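(* The functors $\mathrm{Rep}^{\Gamma_1}_{G,\pi}$ and $\mathrm{PC}^{\Gamma_1}_{G,\pi}$ are represented by the group algebras $\mathcal O[(\mathcal E \otimes M)_{\Delta}]$ and $\mathcal O[H_1(\Gamma_1, M)]$, respectively.
   Context: Let $\mathcal O$ be a commutative ring with $\mathrm{Spec}\,\mathcal O$ connected. Let $G$ be a generalised torus over $\mathcal O$, i.e. a smooth affine $\mathcal O$-group scheme whose neutral component $G^0$ is a torus and whose component group $G/G^0$ is finite étale; assume $G^0$ is split over $\mathcal O$ with character lattice $M$ (a free $\mathbb Z$-module of finite rank) and that $G/G^0$ is a constant group scheme. Let $\Pi: G\to G/G^0$ be the quotient map. Let $\Gamma_1$ be an abstract group and assume there is a representation $\rho_0:\Gamma_1\to G(\mathcal O)$. Let $\Gamma_2$ be the kernel of $\Pi\circ\rho_0$ (a normal subgroup of finite index), $\Delta=\Gamma_1/\Gamma_2$ with projection $\pi:\Gamma_1\to\Delta$; the conjugation action of $G$ on $G^0$ induces an action of $\Delta$ on $M$, and $\Gamma_1$ acts on $M$ through $\Delta$. Let $\mathrm{Rep}^{\Gamma_1}_{G,\pi}$ be the functor on $\mathcal O$-algebras sending $A$ to the set of group homomorphisms $\rho:\Gamma_1\to G(A)$ with $\Pi\circ\rho=\Pi\circ\rho_0$. Let $\mathrm{PC}^{\Gamma_1}_{G,\pi}$ be the functor sending $A$ to the set of $A$-valued (Lafforgue) $G$-pseudocharacters of $\Gamma_1$ whose image under $\Pi$ is the $G/G^0$-pseudocharacter attached to $\Pi\circ\rho_0$.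 Let $I_\Delta\subset\mathbb Z[\Delta]$ be the augmentation ideal and let $\Gamma_2^{\mathrm{ab}}$ be the abelianisation of $\Gamma_2$. The extension $0\to\Gamma_2^{\mathrm{ab}}\to\Gamma_1/[\Gamma_2,\Gamma_2]\to\Delta\to0$ defines a class in $H^2(\Delta,\Gamma_2^{\mathrm{ab}})\cong \mathrm{Ext}^1_{\mathbb Z[\Delta]}(I_\Delta,\Gamma_2^{\mathrm{ab}})$, and $\mathcal E$ denotes the corresponding extension of $\mathbb Z[\Delta]$-modules $0\to\Gamma_2^{\mathrm{ab}}\to\mathcal E\to I_\Delta\to0$. $(\mathcal E\otimes M)_\Delta$ denotes coinvariants for the diagonal $\Delta$-action, and $H_1(\Gamma_1,M)$ is group homology. *)

theory Defs
  imports "HOL-Algebra.Algebra" "HOL-Analysis.Abstract_Topology_2"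
begin

section \<open>Commutative algebras over a fixed base ring\<close>

text \<open>
  All test algebras have their underlying set in one type \<open>'u\<close>, which plays the role of a universe.
  Nothing is assumed about \<open>'u\<close> except, in the theorem, that it is infinite. As \<open>'u\<close> is a type
  variable, statements about all algebras in \<open>'u\<close> hold in every universe. An infinite universe is
  closed, up to isomorphism, under finite tensor products, quotients and finitely generated algebras.

  Homomorphisms are extensional on the carrier of their source, so that they are equal as soon as
  they agree there.
\<close>

definition Alg :: "('k, 'x) ring_scheme \<Rightarrow> ('k, 'u) module set" where
  "Alg R = {A. algebra R A}"

definition alg_hom ::
  "('k, 'x) ring_scheme \<Rightarrow> ('k, 'a, 'y) module_scheme \<Rightarrow> ('k, 'b, 'z) module_scheme \<Rightarrow> ('a \<Rightarrow> 'b) set"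
where
  "alg_hom R A B = {h \<in> ring_hom A B \<inter> extensional (carrier A).
     \<forall>r \<in> carrier R. \<forall>a \<in> carrier A. h (r \<odot>\<^bsub>A\<^esub> a) = r \<odot>\<^bsub>B\<^esub> h a}"

definition base_alg :: "('u, 'x) ring_scheme \<Rightarrow> ('u, 'u) module" where
  "base_alg R = \<lparr>carrier = carrier R, monoid.mult = monoid.mult R, one = one R,
     ring.zero = ring.zero R, ring.add = ring.add R, smult = monoid.mult R\<rparr>"

definition structure_map :: "('k, 'x) ring_scheme \<Rightarrow> ('k, 'a, 'y) module_scheme \<Rightarrow> 'k \<Rightarrow> 'a" where
  "structure_map R A = (\<lambda>r \<in> carrier R. r \<odot>\<^bsub>A\<^esub> \<one>\<^bsub>A\<^esub>)"

definition alg_along :: "('u, 'u) module \<Rightarrow> ('u \<Rightarrow> 'u) \<Rightarrow> ('u, 'u) module" where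
  "alg_along B f = B\<lparr>smult := (\<lambda>a b. f a \<otimes>\<^bsub>B\<^esub> b)\<rparr>"

definition quot_alg :: "('k, 'a) module \<Rightarrow> 'a set \<Rightarrow> ('k, 'a set) module" where
  "quot_alg A I = \<lparr>carrier = carrier (A Quot I), monoid.mult = monoid.mult (A Quot I),
     one = one (A Quot I), ring.zero = ring.zero (A Quot I), ring.add = ring.add (A Quot I),
     smult = (\<lambda>r Z. \<Union>x \<in> Z. I +>\<^bsub>A\<^esub> (r \<odot>\<^bsub>A\<^esub> x))\<rparr>"

definition monoid_algebra ::
  "('k, 'x) ring_scheme \<Rightarrow> ('n, 'y) monoid_scheme \<Rightarrow> ('k, 'n \<Rightarrow> 'k) module"
where
  "monoid_algebra R N =
    \<lparr>carrier = {f \<in> carrier N \<rightarrow>\<^sub>E carrier R. finite {z \<in> carrier N. f z \<noteq> \<zero>\<^bsub>R\<^esub>}},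
     monoid.mult = (\<lambda>f g. \<lambda>z \<in> carrier N.
       finsum R (\<lambda>(x, y). f x \<otimes>\<^bsub>R\<^esub> g y)
         {(x, y). x \<in> carrier N \<and> y \<in> carrier N \<and> f x \<noteq> \<zero>\<^bsub>R\<^esub> \<and> g y \<noteq> \<zero>\<^bsub>R\<^esub> \<and> x \<otimes>\<^bsub>N\<^esub> y = z}),
     one = (\<lambda>z \<in> carrier N. if z = \<one>\<^bsub>N\<^esub> then \<one>\<^bsub>R\<^esub> else \<zero>\<^bsub>R\<^esub>),
     ring.zero = (\<lambda>z \<in> carrier N. \<zero>\<^bsub>R\<^esub>),
     ring.add = (\<lambda>f g. \<lambda>z \<in> carrier N. f z \<oplus>\<^bsub>R\<^esub> g z),
     smult = (\<lambda>r f. \<lambda>z \<in> carrier N. r \<otimes>\<^bsub>R\<^esub> f z)\<rparr>"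

text \<open>The polynomial ring in \<open>n\<close> variables: a monomial is a multiset of variables.\<close>

definition poly_alg :: "('k, 'x) ring_scheme \<Rightarrow> nat \<Rightarrow> ('k, nat multiset \<Rightarrow> 'k) module" where
  "poly_alg R n =
     monoid_algebra R \<lparr>carrier = {\<mu>. set_mset \<mu> \<subseteq> {..<n}}, monoid.mult = (+), one = {#}\<rparr>"

definition finitely_presented :: "('k, 'x) ring_scheme \<Rightarrow> ('k, 'u) module \<Rightarrow> bool" where
  "finitely_presented R B \<longleftrightarrow>
     (\<exists>n. \<exists>\<phi> \<in> alg_hom R (poly_alg R n) B. \<phi> ` carrier (poly_alg R n) = carrier B \<and>
       (\<exists>S. finite S \<and> S \<subseteq> carrier (poly_alg R n) \<and>
          a_kernel (poly_alg R n) B \<phi> = Idl\<^bsub>poly_alg R n\<^esub> S))"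

definition square_zero_ideal :: "'u set \<Rightarrow> ('k, 'u) module \<Rightarrow> bool" where
  "square_zero_ideal I T \<longleftrightarrow> ideal I T \<and> (\<forall>x \<in> I. \<forall>y \<in> I. x \<otimes>\<^bsub>T\<^esub> y = \<zero>\<^bsub>T\<^esub>)"

definition infinitesimal_lifts ::
  "('k, 'x) ring_scheme \<Rightarrow> ('k, 'u) module \<Rightarrow> ('k, 'u) module \<Rightarrow> 'u set \<Rightarrow> ('u \<Rightarrow> 'u set) \<Rightarrow> ('u \<Rightarrow> 'u) set"
where
  "infinitesimal_lifts R B T I h =
     {h' \<in> alg_hom R B T. \<forall>b \<in> carrier B. h b = I +>\<^bsub>T\<^esub> h' b}"

definition smooth_alg :: "('k, 'x) ring_scheme \<Rightarrow> ('k, 'u) module \<Rightarrow> bool" where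
  "smooth_alg R B \<longleftrightarrow> B \<in> Alg R \<and> finitely_presented R B \<and>
     (\<forall>T \<in> Alg R. \<forall>I. square_zero_ideal I T \<longrightarrow>
        (\<forall>h \<in> alg_hom R B (quot_alg T I). \<exists>h'. h' \<in> infinitesimal_lifts R B T I h))"

definition etale_alg :: "('k, 'x) ring_scheme \<Rightarrow> ('k, 'u) module \<Rightarrow> bool" where
  "etale_alg R B \<longleftrightarrow> B \<in> Alg R \<and> finitely_presented R B \<and>
     (\<forall>T \<in> Alg R. \<forall>I. square_zero_ideal I T \<longrightarrow>
        (\<forall>h \<in> alg_hom R B (quot_alg T I). \<exists>!h'. h' \<in> infinitesimal_lifts R B T I h))"


section \<open>Spectra\<close>

definition spec :: "('a, 'x) ring_scheme \<Rightarrow> 'a set set" where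
  "spec A = {P. primeideal P A}"

definition zariski :: "('a, 'x) ring_scheme \<Rightarrow> 'a set topology" where
  "zariski A = topology_generated_by {{P \<in> spec A. a \<notin> P} | a. a \<in> carrier A}"

definition spec_map :: "('a, 'x) ring_scheme \<Rightarrow> ('a \<Rightarrow> 'b) \<Rightarrow> 'b set \<Rightarrow> 'a set" where
  "spec_map A f Q = {a \<in> carrier A. f a \<in> Q}"

definition connected_spec :: "('a, 'x) ring_scheme \<Rightarrow> bool" where
  "connected_spec A \<longleftrightarrow> spec A \<noteq> {} \<and> connected_space (zariski A)"


section \<open>Group functors and affine group schemes\<close>

record ('u, 'g) group_functor =
  pts :: "('u, 'u) module \<Rightarrow> 'g monoid"
  transport :: "('u, 'u) module \<Rightarrow> ('u, 'u) module \<Rightarrow> ('u \<Rightarrow> 'u) \<Rightarrow> 'g \<Rightarrow> 'g"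

definition is_group_functor :: "'u ring \<Rightarrow> ('u, 'g) group_functor \<Rightarrow> bool" where
  "is_group_functor R Z \<longleftrightarrow>
     (\<forall>A \<in> Alg R. group (pts Z A)) \<and>
     (\<forall>A \<in> Alg R. \<forall>B \<in> Alg R. \<forall>f \<in> alg_hom R A B. transport Z A B f \<in> hom (pts Z A) (pts Z B)) \<and>
     (\<forall>A \<in> Alg R. \<forall>g \<in> carrier (pts Z A). transport Z A A (\<lambda>a \<in> carrier A. a) g = g) \<and>
     (\<forall>A \<in> Alg R. \<forall>B \<in> Alg R. \<forall>D \<in> Alg R. \<forall>f \<in> alg_hom R A B. \<forall>f' \<in> alg_hom R B D.
        \<forall>g \<in> carrier (pts Z A).
        transport Z A D (compose (carrier A) f' f) g = transport Z B D f' (transport Z A B f g))"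

definition group_functor_hom ::
  "'u ring \<Rightarrow> ('u, 'g) group_functor \<Rightarrow> ('u, 'h) group_functor \<Rightarrow> (('u, 'u) module \<Rightarrow> 'g \<Rightarrow> 'h) \<Rightarrow> bool"
where
  "group_functor_hom R Z Y \<eta> \<longleftrightarrow>
     (\<forall>A \<in> Alg R. \<eta> A \<in> hom (pts Z A) (pts Y A)) \<and>
     (\<forall>A \<in> Alg R. \<forall>B \<in> Alg R. \<forall>f \<in> alg_hom R A B. \<forall>g \<in> carrier (pts Z A).
        \<eta> B (transport Z A B f g) = transport Y A B f (\<eta> A g))"

definition group_functor_iso ::
  "'u ring \<Rightarrow> ('u, 'g) group_functor \<Rightarrow> ('u, 'h) group_functor \<Rightarrow> (('u, 'u) module \<Rightarrow> 'g \<Rightarrow> 'h) \<Rightarrow> bool"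
where
  "group_functor_iso R Z Y \<eta> \<longleftrightarrow> group_functor_hom R Z Y \<eta> \<and>
     (\<forall>A \<in> Alg R. bij_betw (\<eta> A) (carrier (pts Z A)) (carrier (pts Y A)))"

text \<open>
  The affine group scheme \<open>Spec H\<close>, given by its functor of points: a group law on each set of
  algebra homomorphisms from \<open>H\<close> to \<open>A\<close>, natural in \<open>A\<close>.
\<close>

definition affine_group_scheme ::
  "'u ring \<Rightarrow> ('u, 'u) module \<Rightarrow> ('u, 'u \<Rightarrow> 'u) group_functor \<Rightarrow> bool"
where
  "affine_group_scheme R H G \<longleftrightarrow> H \<in> Alg R \<and> is_group_functor R G \<and>
     (\<forall>A \<in> Alg R. carrier (pts G A) = alg_hom R H A) \<and>
     (\<forall>A \<in> Alg R. \<forall>B \<in> Alg R. \<forall>f \<in> alg_hom R A B. \<forall>g \<in> alg_hom R H A.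
        transport G A B f g = compose (carrier H) f g)"

text \<open>
  The neutral component in the sense of SGA 3, Exp. VI B: an \<open>A\<close>-point belongs to it iff, over each
  point \<open>s\<close> of the base, it maps the fibre of \<open>Spec A\<close> into the connected component of the neutral
  element of the fibre of \<open>G\<close>. The fibre of \<open>Spec H\<close> over \<open>s\<close> is homeomorphic to the subspace of
  primes of \<open>H\<close> that contract to \<open>s\<close>, and the neutral element of that fibre is the image of \<open>s\<close>
  under the unit section.
\<close>

definition fibre :: "'u ring \<Rightarrow> ('u, 'u) module \<Rightarrow> 'u set \<Rightarrow> 'u set topology" where
  "fibre R H s = subtopology (zariski H) {P \<in> spec H. spec_map R (structure_map R H) P = s}"

definition neutral_component ::
  "'u ring \<Rightarrow> ('u, 'u) module \<Rightarrow> ('u, 'u \<Rightarrow> 'u) group_functor \<Rightarrow> ('u, 'u \<Rightarrow> 'u) group_functor"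
where
  "neutral_component R H G =
    \<lparr>pts = (\<lambda>A. (pts G A)\<lparr>carrier := {g \<in> carrier (pts G A). \<forall>Q \<in> spec A.
        let s = spec_map R (structure_map R A) Q in
        spec_map H g Q \<in>
          connected_component_of_set (fibre R H s) (spec_map H \<one>\<^bsub>pts G (base_alg R)\<^esub> s)}\<rparr>),
     transport = transport G\<rparr>"

text \<open>The diagonalisable group with character group \<open>M\<close>; for \<open>M\<close> free of finite rank, the split torus.\<close>

definition diag_group :: "('m, 'y) monoid_scheme \<Rightarrow> ('u, 'm \<Rightarrow> 'u) group_functor" where
  "diag_group M =
    \<lparr>pts = (\<lambda>A. \<lparr>carrier = hom M (units_of A) \<inter> extensional (carrier M),
                 monoid.mult = (\<lambda>t t'. \<lambda>m \<in> carrier M. t m \<otimes>\<^bsub>A\<^esub> t' m),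
                 one = (\<lambda>m \<in> carrier M. \<one>\<^bsub>A\<^esub>)\<rparr>),
     transport = (\<lambda>A B f t. compose (carrier M) f t)\<rparr>"

definition lattice_group :: "('m, 'y) monoid_scheme \<Rightarrow> bool" where
  "lattice_group M \<longleftrightarrow> comm_group M \<and> (\<exists>n::nat. M \<cong> free_Abelian_group {..<n})"

text \<open>The constant group scheme: its \<open>A\<close>-points are the locally constant functions on \<open>Spec A\<close>.\<close>

definition constant_group :: "('c, 'y) monoid_scheme \<Rightarrow> ('u, 'u set \<Rightarrow> 'c) group_functor" where
  "constant_group C =
    \<lparr>pts = (\<lambda>A. \<lparr>carrier = {x \<in> spec A \<rightarrow>\<^sub>E carrier C.
                    continuous_map (zariski A) (discrete_topology (carrier C)) x},
                 monoid.mult = (\<lambda>x y. \<lambda>Q \<in> spec A. x Q \<otimes>\<^bsub>C\<^esub> y Q),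
                 one = (\<lambda>Q \<in> spec A. \<one>\<^bsub>C\<^esub>)\<rparr>),
     transport = (\<lambda>A B f x. \<lambda>Q \<in> spec B. x (spec_map A f Q))\<rparr>"

definition etale_cover ::
  "'u ring \<Rightarrow> ('u, 'u) module \<Rightarrow> ('u, 'u) module \<Rightarrow> ('u \<Rightarrow> 'u) \<Rightarrow> bool"
where
  "etale_cover R A B f \<longleftrightarrow> B \<in> Alg R \<and> f \<in> alg_hom R A B \<and> etale_alg A (alg_along B f) \<and>
     spec_map A f ` spec B = spec A"

text \<open>
  \<open>\<pi> : Z \<rightarrow> Y\<close> exhibits the sheaf \<open>Y\<close> as the quotient of \<open>Z\<close> by the normal subgroup functor \<open>K\<close>:
  it is an epimorphism of etale sheaves with kernel \<open>K\<close>.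
\<close>

definition quotient_map_by ::
  "'u ring \<Rightarrow> ('u, 'g) group_functor \<Rightarrow> ('u, 'g) group_functor \<Rightarrow> ('u, 'h) group_functor
     \<Rightarrow> (('u, 'u) module \<Rightarrow> 'g \<Rightarrow> 'h) \<Rightarrow> bool"
where
  "quotient_map_by R Z K Y \<pi> \<longleftrightarrow> group_functor_hom R Z Y \<pi> \<and>
     (\<forall>A \<in> Alg R. kernel (pts Z A) (pts Y A) (\<pi> A) = carrier (pts K A)) \<and>
     (\<forall>A \<in> Alg R. \<forall>y \<in> carrier (pts Y A). \<exists>B f. etale_cover R A B f \<and>
        (\<exists>g \<in> carrier (pts Z B). \<pi> B g = transport Y A B f y))"


section \<open>Pseudocharacters\<close>

abbreviation tuples :: "nat \<Rightarrow> ('g, 'y) monoid_scheme \<Rightarrow> (nat \<Rightarrow> 'g) set" where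
  "tuples n G \<equiv> {1..n} \<rightarrow>\<^sub>E carrier G"

text \<open>
  The algebra of regular functions on \<open>Z\<^sup>n\<close>, i.e. of morphisms to the affine line, that are
  invariant under diagonal conjugation by the subgroup functor \<open>K\<close>.
\<close>

definition regular_functions ::
  "'u ring \<Rightarrow> ('u, 'g) group_functor \<Rightarrow> nat \<Rightarrow> (('u, 'u) module \<Rightarrow> (nat \<Rightarrow> 'g) \<Rightarrow> 'u) set"
where
  "regular_functions R Z n =
     {f \<in> \<Pi>\<^sub>E A \<in> Alg R. tuples n (pts Z A) \<rightarrow>\<^sub>E carrier A.
        \<forall>A \<in> Alg R. \<forall>B \<in> Alg R. \<forall>\<phi> \<in> alg_hom R A B. \<forall>g \<in> tuples n (pts Z A).
          f B (\<lambda>i \<in> {1..n}. transport Z A B \<phi> (g i)) = \<phi> (f A g)}"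

definition inv_functions ::
  "'u ring \<Rightarrow> ('u, 'g) group_functor \<Rightarrow> (('u, 'u) module \<Rightarrow> 'g set) \<Rightarrow> nat
     \<Rightarrow> ('u, ('u, 'u) module \<Rightarrow> (nat \<Rightarrow> 'g) \<Rightarrow> 'u) module"
where
  "inv_functions R Z K n =
    \<lparr>carrier = {f \<in> regular_functions R Z n.
       \<forall>A \<in> Alg R. \<forall>g \<in> tuples n (pts Z A). \<forall>t \<in> K A.
         f A (\<lambda>i \<in> {1..n}. t \<otimes>\<^bsub>pts Z A\<^esub> g i \<otimes>\<^bsub>pts Z A\<^esub> inv\<^bsub>pts Z A\<^esub> t) = f A g},
     monoid.mult = (\<lambda>f f'. \<lambda>A \<in> Alg R. \<lambda>g \<in> tuples n (pts Z A). f A g \<otimes>\<^bsub>A\<^esub> f' A g),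
     one = (\<lambda>A \<in> Alg R. \<lambda>g \<in> tuples n (pts Z A). \<one>\<^bsub>A\<^esub>),
     ring.zero = (\<lambda>A \<in> Alg R. \<lambda>g \<in> tuples n (pts Z A). \<zero>\<^bsub>A\<^esub>),
     ring.add = (\<lambda>f f'. \<lambda>A \<in> Alg R. \<lambda>g \<in> tuples n (pts Z A). f A g \<oplus>\<^bsub>A\<^esub> f' A g),
     smult = (\<lambda>r f. \<lambda>A \<in> Alg R. \<lambda>g \<in> tuples n (pts Z A). r \<odot>\<^bsub>A\<^esub> f A g)\<rparr>"

definition map_alg ::
  "'s set \<Rightarrow> ('k, 'a) module \<Rightarrow> ('k, 's \<Rightarrow> 'a) module"
where
  "map_alg S A =
    \<lparr>carrier = S \<rightarrow>\<^sub>E carrier A,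
     monoid.mult = (\<lambda>u v. \<lambda>s \<in> S. u s \<otimes>\<^bsub>A\<^esub> v s),
     one = (\<lambda>s \<in> S. \<one>\<^bsub>A\<^esub>),
     ring.zero = (\<lambda>s \<in> S. \<zero>\<^bsub>A\<^esub>),
     ring.add = (\<lambda>u v. \<lambda>s \<in> S. u s \<oplus>\<^bsub>A\<^esub> v s),
     smult = (\<lambda>r u. \<lambda>s \<in> S. r \<odot>\<^bsub>A\<^esub> u s)\<rparr>"

text \<open>\<open>f\<^sup>\<zeta> (g\<^sub>1, \<dots>, g\<^sub>n) = f (g\<^bsub>\<zeta>(1)\<^esub>, \<dots>, g\<^bsub>\<zeta>(m)\<^esub>)\<close>\<close>

definition reindex_function ::
  "'u ring \<Rightarrow> ('u, 'g) group_functor \<Rightarrow> nat \<Rightarrow> nat \<Rightarrow> (nat \<Rightarrow> nat)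
     \<Rightarrow> (('u, 'u) module \<Rightarrow> (nat \<Rightarrow> 'g) \<Rightarrow> 'u) \<Rightarrow> (('u, 'u) module \<Rightarrow> (nat \<Rightarrow> 'g) \<Rightarrow> 'u)"
where
  "reindex_function R Z m n \<zeta> f =
     (\<lambda>A \<in> Alg R. \<lambda>g \<in> tuples n (pts Z A). f A (\<lambda>i \<in> {1..m}. g (\<zeta> i)))"

definition merge_last :: "('g, 'y) monoid_scheme \<Rightarrow> nat \<Rightarrow> (nat \<Rightarrow> 'g) \<Rightarrow> (nat \<Rightarrow> 'g)" where
  "merge_last G n g = (\<lambda>i \<in> {1..n}. if i = n then g n \<otimes>\<^bsub>G\<^esub> g (Suc n) else g i)"

definition merge_function ::
  "'u ring \<Rightarrow> ('u, 'g) group_functor \<Rightarrow> nat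
     \<Rightarrow> (('u, 'u) module \<Rightarrow> (nat \<Rightarrow> 'g) \<Rightarrow> 'u) \<Rightarrow> (('u, 'u) module \<Rightarrow> (nat \<Rightarrow> 'g) \<Rightarrow> 'u)"
where
  "merge_function R Z n f =
     (\<lambda>A \<in> Alg R. \<lambda>g \<in> tuples (Suc n) (pts Z A). f A (merge_last (pts Z A) n g))"

text \<open>
  Lafforgue's pseudocharacters of \<open>\<Gamma>\<close> with values in \<open>Z\<close> over \<open>A\<close>, where \<open>K\<close> is the neutral
  component of \<open>Z\<close>.
\<close>

definition pseudocharacters ::
  "'u ring \<Rightarrow> ('u, 'g) group_functor \<Rightarrow> (('u, 'u) module \<Rightarrow> 'g set) \<Rightarrow> ('p, 'y) monoid_scheme
     \<Rightarrow> ('u, 'u) module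
     \<Rightarrow> (nat \<Rightarrow> (('u, 'u) module \<Rightarrow> (nat \<Rightarrow> 'g) \<Rightarrow> 'u) \<Rightarrow> (nat \<Rightarrow> 'p) \<Rightarrow> 'u) set"
where
  "pseudocharacters R Z K \<Gamma> A =
     {\<Theta> \<in> \<Pi>\<^sub>E n \<in> {1..}. alg_hom R (inv_functions R Z K n) (map_alg (tuples n \<Gamma>) A).
        (\<forall>m \<ge> 1. \<forall>n \<ge> 1. \<forall>\<zeta> \<in> {1..m} \<rightarrow> {1..n}. \<forall>f \<in> carrier (inv_functions R Z K m).
           \<forall>\<gamma> \<in> tuples n \<Gamma>.
           \<Theta> n (reindex_function R Z m n \<zeta> f) \<gamma> = \<Theta> m f (\<lambda>i \<in> {1..m}. \<gamma> (\<zeta> i))) \<and>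
        (\<forall>n \<ge> 1. \<forall>f \<in> carrier (inv_functions R Z K n). \<forall>\<gamma> \<in> tuples (Suc n) \<Gamma>.
           \<Theta> (Suc n) (merge_function R Z n f) \<gamma> = \<Theta> n f (merge_last \<Gamma> n \<gamma>))}"

definition attached_pseudocharacter ::
  "'u ring \<Rightarrow> ('u, 'g) group_functor \<Rightarrow> (('u, 'u) module \<Rightarrow> 'g set) \<Rightarrow> ('p, 'y) monoid_scheme
     \<Rightarrow> ('u, 'u) module \<Rightarrow> ('p \<Rightarrow> 'g)
     \<Rightarrow> (nat \<Rightarrow> (('u, 'u) module \<Rightarrow> (nat \<Rightarrow> 'g) \<Rightarrow> 'u) \<Rightarrow> (nat \<Rightarrow> 'p) \<Rightarrow> 'u)"
where
  "attached_pseudocharacter R Z K \<Gamma> A \<rho> =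
     (\<lambda>n \<in> {1..}. \<lambda>f \<in> carrier (inv_functions R Z K n). \<lambda>\<gamma> \<in> tuples n \<Gamma>.
        f A (\<lambda>i \<in> {1..n}. \<rho> (\<gamma> i)))"

definition pull_function ::
  "'u ring \<Rightarrow> ('u, 'g) group_functor \<Rightarrow> nat \<Rightarrow> (('u, 'u) module \<Rightarrow> 'g \<Rightarrow> 'h)
     \<Rightarrow> (('u, 'u) module \<Rightarrow> (nat \<Rightarrow> 'h) \<Rightarrow> 'u) \<Rightarrow> (('u, 'u) module \<Rightarrow> (nat \<Rightarrow> 'g) \<Rightarrow> 'u)"
where
  "pull_function R Z n \<eta> f =
     (\<lambda>A \<in> Alg R. \<lambda>g \<in> tuples n (pts Z A). f A (\<lambda>i \<in> {1..n}. \<eta> A (g i)))"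

definition push_pseudocharacter ::
  "'u ring \<Rightarrow> ('u, 'g) group_functor \<Rightarrow> ('u, 'h) group_functor \<Rightarrow> (('u, 'u) module \<Rightarrow> 'h set)
     \<Rightarrow> (('u, 'u) module \<Rightarrow> 'g \<Rightarrow> 'h)
     \<Rightarrow> (nat \<Rightarrow> (('u, 'u) module \<Rightarrow> (nat \<Rightarrow> 'g) \<Rightarrow> 'u) \<Rightarrow> (nat \<Rightarrow> 'p) \<Rightarrow> 'u)
     \<Rightarrow> (nat \<Rightarrow> (('u, 'u) module \<Rightarrow> (nat \<Rightarrow> 'h) \<Rightarrow> 'u) \<Rightarrow> (nat \<Rightarrow> 'p) \<Rightarrow> 'u)"
where
  "push_pseudocharacter R Z Y L \<eta> \<Theta> =
     (\<lambda>n \<in> {1..}. \<lambda>f \<in> carrier (inv_functions R Y L n). \<Theta> n (pull_function R Z n \<eta> f))"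


section \<open>The two functors and representability\<close>

definition reduced_rep ::
  "'u ring \<Rightarrow> ('u, 'h) group_functor \<Rightarrow> (('u, 'u) module \<Rightarrow> 'g \<Rightarrow> 'h) \<Rightarrow> ('p \<Rightarrow> 'g)
     \<Rightarrow> ('u, 'u) module \<Rightarrow> 'p \<Rightarrow> 'h"
where
  "reduced_rep R Y \<pi> \<rho>\<^sub>0 A \<gamma> =
     transport Y (base_alg R) A (structure_map R A) (\<pi> (base_alg R) (\<rho>\<^sub>0 \<gamma>))"

definition Rep ::
  "'u ring \<Rightarrow> ('u, 'g) group_functor \<Rightarrow> ('u, 'h) group_functor \<Rightarrow> (('u, 'u) module \<Rightarrow> 'g \<Rightarrow> 'h)
     \<Rightarrow> ('p, 'y) monoid_scheme \<Rightarrow> ('p \<Rightarrow> 'g) \<Rightarrow> ('u, 'u) module \<Rightarrow> ('p \<Rightarrow> 'g) set"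
where
  "Rep R G Y \<pi> \<Gamma> \<rho>\<^sub>0 A =
     {\<rho> \<in> hom \<Gamma> (pts G A) \<inter> extensional (carrier \<Gamma>).
        \<forall>\<gamma> \<in> carrier \<Gamma>. \<pi> A (\<rho> \<gamma>) = reduced_rep R Y \<pi> \<rho>\<^sub>0 A \<gamma>}"

definition Rep_map ::
  "('u, 'g) group_functor \<Rightarrow> ('p, 'y) monoid_scheme
     \<Rightarrow> ('u, 'u) module \<Rightarrow> ('u, 'u) module \<Rightarrow> ('u \<Rightarrow> 'u) \<Rightarrow> ('p \<Rightarrow> 'g) \<Rightarrow> ('p \<Rightarrow> 'g)"
where
  "Rep_map G \<Gamma> A B \<phi> \<rho> = (\<lambda>\<gamma> \<in> carrier \<Gamma>. transport G A B \<phi> (\<rho> \<gamma>))"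

text \<open>The target \<open>Y\<close> is an etale group scheme, so its neutral component is trivial.\<close>

definition PC ::
  "'u ring \<Rightarrow> ('u, 'g) group_functor \<Rightarrow> ('u, 'g) group_functor \<Rightarrow> ('u, 'h) group_functor
     \<Rightarrow> (('u, 'u) module \<Rightarrow> 'g \<Rightarrow> 'h) \<Rightarrow> ('p, 'y) monoid_scheme \<Rightarrow> ('p \<Rightarrow> 'g) \<Rightarrow> ('u, 'u) module
     \<Rightarrow> (nat \<Rightarrow> (('u, 'u) module \<Rightarrow> (nat \<Rightarrow> 'g) \<Rightarrow> 'u) \<Rightarrow> (nat \<Rightarrow> 'p) \<Rightarrow> 'u) set"
where
  "PC R G G\<^sub>0 Y \<pi> \<Gamma> \<rho>\<^sub>0 A =
     {\<Theta> \<in> pseudocharacters R G (\<lambda>B. carrier (pts G\<^sub>0 B)) \<Gamma> A.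
        push_pseudocharacter R G Y (\<lambda>B. {\<one>\<^bsub>pts Y B\<^esub>}) \<pi> \<Theta> =
        attached_pseudocharacter R Y (\<lambda>B. {\<one>\<^bsub>pts Y B\<^esub>}) \<Gamma> A (reduced_rep R Y \<pi> \<rho>\<^sub>0 A)}"

definition PC_map ::
  "'u ring \<Rightarrow> ('u, 'g) group_functor \<Rightarrow> ('u, 'g) group_functor \<Rightarrow> ('p, 'y) monoid_scheme
     \<Rightarrow> ('u, 'u) module \<Rightarrow> ('u, 'u) module \<Rightarrow> ('u \<Rightarrow> 'u)
     \<Rightarrow> (nat \<Rightarrow> (('u, 'u) module \<Rightarrow> (nat \<Rightarrow> 'g) \<Rightarrow> 'u) \<Rightarrow> (nat \<Rightarrow> 'p) \<Rightarrow> 'u)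
     \<Rightarrow> (nat \<Rightarrow> (('u, 'u) module \<Rightarrow> (nat \<Rightarrow> 'g) \<Rightarrow> 'u) \<Rightarrow> (nat \<Rightarrow> 'p) \<Rightarrow> 'u)"
where
  "PC_map R G G\<^sub>0 \<Gamma> A B \<phi> \<Theta> =
     (\<lambda>n \<in> {1..}. \<lambda>f \<in> carrier (inv_functions R G (\<lambda>D. carrier (pts G\<^sub>0 D)) n).
        \<lambda>\<gamma> \<in> tuples n \<Gamma>. \<phi> (\<Theta> n f \<gamma>))"

text \<open>
  The set-valued functor \<open>(F, Fmap)\<close> on algebras is naturally isomorphic to the functor of algebra
  homomorphisms out of \<open>S\<close>. The algebra \<open>S\<close> may live in a type other than \<open>'u\<close>.
\<close>

definition represented_by ::
  "'u ring \<Rightarrow> (('u, 'u) module \<Rightarrow> 'f set)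
     \<Rightarrow> (('u, 'u) module \<Rightarrow> ('u, 'u) module \<Rightarrow> ('u \<Rightarrow> 'u) \<Rightarrow> 'f \<Rightarrow> 'f) \<Rightarrow> ('u, 's) module \<Rightarrow> bool"
where
  "represented_by R F Fmap S \<longleftrightarrow> S \<in> Alg R \<and>
     (\<exists>\<Phi>. (\<forall>A \<in> Alg R. bij_betw (\<Phi> A) (alg_hom R S A) (F A)) \<and>
          (\<forall>A \<in> Alg R. \<forall>B \<in> Alg R. \<forall>\<phi> \<in> alg_hom R A B. \<forall>h \<in> alg_hom R S A.
             \<Phi> B (compose (carrier S) \<phi> h) = Fmap A B \<phi> (\<Phi> A h)))"


section \<open>Modules over groups\<close>

text \<open>Underlying abelian groups of modules are written multiplicatively.\<close>

definition group_module ::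
  "('d, 'x) monoid_scheme \<Rightarrow> ('e, 'y) monoid_scheme \<Rightarrow> ('d \<Rightarrow> 'e \<Rightarrow> 'e) \<Rightarrow> bool"
where
  "group_module D E a \<longleftrightarrow> comm_group E \<and> (\<forall>d \<in> carrier D. a d \<in> hom E E) \<and>
     (\<forall>x \<in> carrier E. a \<one>\<^bsub>D\<^esub> x = x) \<and>
     (\<forall>c \<in> carrier D. \<forall>d \<in> carrier D. \<forall>x \<in> carrier E. a (c \<otimes>\<^bsub>D\<^esub> d) x = a c (a d x))"

definition tensor_relations ::
  "('e, 'x) monoid_scheme \<Rightarrow> ('m, 'y) monoid_scheme \<Rightarrow> ('e \<times> 'm \<Rightarrow>\<^sub>0 int) set"
where
  "tensor_relations E M =
     generate (free_Abelian_group (carrier E \<times> carrier M))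
       ({frag_of (x \<otimes>\<^bsub>E\<^esub> y, m) - frag_of (x, m) - frag_of (y, m) | x y m.
           x \<in> carrier E \<and> y \<in> carrier E \<and> m \<in> carrier M} \<union>
        {frag_of (x, m \<otimes>\<^bsub>M\<^esub> n) - frag_of (x, m) - frag_of (x, n) | x m n.
           x \<in> carrier E \<and> m \<in> carrier M \<and> n \<in> carrier M})"

definition tensor ::
  "('e, 'x) monoid_scheme \<Rightarrow> ('m, 'y) monoid_scheme \<Rightarrow> ('e \<times> 'm \<Rightarrow>\<^sub>0 int) set monoid"
where
  "tensor E M = free_Abelian_group (carrier E \<times> carrier M) Mod tensor_relations E M"

text \<open>The union runs over representatives of one coset and consists of equal cosets.\<close>

definition tensor_action ::
  "('e, 'x) monoid_scheme \<Rightarrow> ('m, 'y) monoid_scheme \<Rightarrow> ('d \<Rightarrow> 'e \<Rightarrow> 'e) \<Rightarrow> ('d \<Rightarrow> 'm \<Rightarrow> 'm)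
     \<Rightarrow> 'd \<Rightarrow> ('e \<times> 'm \<Rightarrow>\<^sub>0 int) set \<Rightarrow> ('e \<times> 'm \<Rightarrow>\<^sub>0 int) set"
where
  "tensor_action E M a b d T =
     (\<Union>t \<in> T. tensor_relations E M #>\<^bsub>free_Abelian_group (carrier E \<times> carrier M)\<^esub>
                frag_extend (\<lambda>(x, m). frag_of (a d x, b d m)) t)"

definition coinvariants ::
  "('d, 'x) monoid_scheme \<Rightarrow> ('e, 'y) monoid_scheme \<Rightarrow> ('d \<Rightarrow> 'e \<Rightarrow> 'e) \<Rightarrow> 'e set monoid"
where
  "coinvariants D E a =
     E Mod generate E {a d x \<otimes>\<^bsub>E\<^esub> inv\<^bsub>E\<^esub> x | d x. d \<in> carrier D \<and> x \<in> carrier E}"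

definition augmentation_ideal :: "('d, 'x) monoid_scheme \<Rightarrow> ('d \<Rightarrow>\<^sub>0 int) monoid" where
  "augmentation_ideal D = (free_Abelian_group (carrier D))
     \<lparr>carrier := {x \<in> carrier (free_Abelian_group (carrier D)).
        (\<Sum>d \<in> Poly_Mapping.keys x. Poly_Mapping.lookup x d) = 0}\<rparr>"

definition group_ring_action ::
  "('d, 'x) monoid_scheme \<Rightarrow> 'd \<Rightarrow> ('d \<Rightarrow>\<^sub>0 int) \<Rightarrow> ('d \<Rightarrow>\<^sub>0 int)"
where
  "group_ring_action D d = frag_extend (\<lambda>c. frag_of (d \<otimes>\<^bsub>D\<^esub> c))"

text \<open>
  \<open>H\<^sub>1\<close> is computed with the inhomogeneous bar complex; \<open>chain1 G M g m\<close> is the chain \<open>m \<otimes> [g]\<close>.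
\<close>

definition chain1 :: "('g, 'x) monoid_scheme \<Rightarrow> ('m, 'y) monoid_scheme \<Rightarrow> 'g \<Rightarrow> 'm \<Rightarrow> 'g \<Rightarrow> 'm" where
  "chain1 G M g m = (\<lambda>k \<in> carrier G. if k = g then m else \<one>\<^bsub>M\<^esub>)"

definition chains1 :: "('g, 'x) monoid_scheme \<Rightarrow> ('m, 'y) monoid_scheme \<Rightarrow> ('g \<Rightarrow> 'm) monoid" where
  "chains1 G M = sum_group (carrier G) (\<lambda>_. M)"

definition chains2 ::
  "('g, 'x) monoid_scheme \<Rightarrow> ('m, 'y) monoid_scheme \<Rightarrow> ('g \<times> 'g \<Rightarrow> 'm) monoid"
where
  "chains2 G M = sum_group (carrier G \<times> carrier G) (\<lambda>_. M)"

text \<open>\<open>\<partial>(m \<otimes> [g]) = g\<^sup>-\<^sup>1m - m\<close>\<close>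

definition boundary1 ::
  "('g, 'x) monoid_scheme \<Rightarrow> ('m, 'y) monoid_scheme \<Rightarrow> ('g \<Rightarrow> 'm \<Rightarrow> 'm) \<Rightarrow> ('g \<Rightarrow> 'm) \<Rightarrow> 'm"
where
  "boundary1 G M b c =
     gfinprod M (\<lambda>g. b (inv\<^bsub>G\<^esub> g) (c g) \<otimes>\<^bsub>M\<^esub> inv\<^bsub>M\<^esub> (c g)) (carrier G)"

text \<open>\<open>\<partial>(m \<otimes> [g|h]) = g\<^sup>-\<^sup>1m \<otimes> [h] - m \<otimes> [gh] + m \<otimes> [g]\<close>\<close>

definition boundary2 ::
  "('g, 'x) monoid_scheme \<Rightarrow> ('m, 'y) monoid_scheme \<Rightarrow> ('g \<Rightarrow> 'm \<Rightarrow> 'm) \<Rightarrow> ('g \<times> 'g \<Rightarrow> 'm) \<Rightarrow> 'g \<Rightarrow> 'm"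
where
  "boundary2 G M b c =
     gfinprod (chains1 G M)
       (\<lambda>(g, h). chain1 G M h (b (inv\<^bsub>G\<^esub> g) (c (g, h)))
          \<otimes>\<^bsub>chains1 G M\<^esub> inv\<^bsub>chains1 G M\<^esub> (chain1 G M (g \<otimes>\<^bsub>G\<^esub> h) (c (g, h)))
          \<otimes>\<^bsub>chains1 G M\<^esub> chain1 G M g (c (g, h)))
       (carrier G \<times> carrier G)"

definition homology1 ::
  "('g, 'x) monoid_scheme \<Rightarrow> ('m, 'y) monoid_scheme \<Rightarrow> ('g \<Rightarrow> 'm \<Rightarrow> 'm) \<Rightarrow> ('g \<Rightarrow> 'm) set monoid"
where
  "homology1 G M b =
     (chains1 G M)\<lparr>carrier := kernel (chains1 G M) M (boundary1 G M b)\<rparr>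
       Mod (boundary2 G M b ` carrier (chains2 G M))"


section \<open>The action on characters\<close>

text \<open>
  For \<open>g\<close> in \<open>G(R)\<close> and a character \<open>m\<close> of the neutral component, \<open>(g m)(t) = m(g\<^sup>-\<^sup>1 t g)\<close>. Here
  \<open>\<chi> A t m\<close> is the value of the character \<open>m\<close> at the \<open>A\<close>-point \<open>t\<close>.
\<close>

definition character_action ::
  "'u ring \<Rightarrow> ('u, 'g) group_functor \<Rightarrow> ('u, 'g) group_functor \<Rightarrow> ('m, 'y) monoid_scheme
     \<Rightarrow> (('u, 'u) module \<Rightarrow> 'g \<Rightarrow> 'm \<Rightarrow> 'u) \<Rightarrow> 'g \<Rightarrow> 'm \<Rightarrow> 'm"
where
  "character_action R G G\<^sub>0 M \<chi> g m = (THE m'. m' \<in> carrier M \<and>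
     (\<forall>A \<in> Alg R. \<forall>t \<in> carrier (pts G\<^sub>0 A).
        let g\<^sub>A = transport G (base_alg R) A (structure_map R A) g in
        \<chi> A t m' = \<chi> A (inv\<^bsub>pts G A\<^esub> g\<^sub>A \<otimes>\<^bsub>pts G A\<^esub> t \<otimes>\<^bsub>pts G A\<^esub> g\<^sub>A) m))"

text \<open>The action of a quotient group of \<open>\<Gamma>\<close>, whose elements are cosets, through representatives.\<close>

definition coset_action :: "('p \<Rightarrow> 'm \<Rightarrow> 'm) \<Rightarrow> 'p set \<Rightarrow> 'm \<Rightarrow> 'm" where
  "coset_action b d = b (SOME \<gamma>. \<gamma> \<in> d)"


section \<open>The module extension attached to a group extension\<close>

definition abelianisation :: "('p, 'x) monoid_scheme \<Rightarrow> 'p set \<Rightarrow> 'p set monoid" where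
  "abelianisation \<Gamma> N = (\<Gamma>\<lparr>carrier := N\<rparr>) Mod (derived \<Gamma> N)"

definition conjugation_action :: "('p, 'x) monoid_scheme \<Rightarrow> 'p set \<Rightarrow> 'p set \<Rightarrow> 'p set" where
  "conjugation_action \<Gamma> = coset_action (\<lambda>\<gamma> Z. (\<lambda>x. \<gamma> \<otimes>\<^bsub>\<Gamma>\<^esub> x \<otimes>\<^bsub>\<Gamma>\<^esub> inv\<^bsub>\<Gamma>\<^esub> \<gamma>) ` Z)"

definition module_extension ::
  "('d, 'x) monoid_scheme \<Rightarrow> ('n, 'y) monoid_scheme \<Rightarrow> ('d \<Rightarrow> 'n \<Rightarrow> 'n) \<Rightarrow> ('e, 'z) monoid_scheme
     \<Rightarrow> ('d \<Rightarrow> 'e \<Rightarrow> 'e) \<Rightarrow> ('q, 'w) monoid_scheme \<Rightarrow> ('d \<Rightarrow> 'q \<Rightarrow> 'q) \<Rightarrow> ('n \<Rightarrow> 'e) \<Rightarrow> ('e \<Rightarrow> 'q) \<Rightarrow> bool"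
where
  "module_extension D N a\<^sub>N E a\<^sub>E Q a\<^sub>Q \<iota> p \<longleftrightarrow> group_module D E a\<^sub>E \<and>
     \<iota> \<in> mon N E \<and> p \<in> epi E Q \<and> kernel E Q p = \<iota> ` carrier N \<and>
     (\<forall>d \<in> carrier D. \<forall>x \<in> carrier N. \<iota> (a\<^sub>N d x) = a\<^sub>E d (\<iota> x)) \<and>
     (\<forall>d \<in> carrier D. \<forall>x \<in> carrier E. p (a\<^sub>E d x) = a\<^sub>Q d (p x))"

definition cohomologous2 ::
  "('d, 'x) monoid_scheme \<Rightarrow> ('n, 'y) monoid_scheme \<Rightarrow> ('d \<Rightarrow> 'n \<Rightarrow> 'n)
     \<Rightarrow> ('d \<Rightarrow> 'd \<Rightarrow> 'n) \<Rightarrow> ('d \<Rightarrow> 'd \<Rightarrow> 'n) \<Rightarrow> bool"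
where
  "cohomologous2 D N a z z' \<longleftrightarrow> (\<exists>u \<in> carrier D \<rightarrow> carrier N.
     \<forall>c \<in> carrier D. \<forall>d \<in> carrier D.
       z c d = z' c d \<otimes>\<^bsub>N\<^esub> (u c \<otimes>\<^bsub>N\<^esub> a c (u d) \<otimes>\<^bsub>N\<^esub> inv\<^bsub>N\<^esub> u (c \<otimes>\<^bsub>D\<^esub> d)))"

text \<open>
  \<open>z\<close> is a factor set \<open>z(c, d) = s(c) s(d) s(cd)\<^sup>-\<^sup>1\<close> of the group extension
  \<open>N\<^sup>a\<^sup>b \<rightarrow> \<Gamma>/[N, N] \<rightarrow> \<Gamma>/N\<close>, for a set-theoretic section \<open>s\<close>. A coset of \<open>[N, N]\<close> lies over the
  coset of \<open>N\<close> that contains it.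
\<close>

definition group_extension_cocycle ::
  "('p, 'x) monoid_scheme \<Rightarrow> 'p set \<Rightarrow> ('p set \<Rightarrow> 'p set \<Rightarrow> 'p set) \<Rightarrow> bool"
where
  "group_extension_cocycle \<Gamma> N z \<longleftrightarrow>
     (let D = \<Gamma> Mod N; Q = \<Gamma> Mod (derived \<Gamma> N) in
      \<exists>s \<in> carrier D \<rightarrow> carrier Q. (\<forall>d \<in> carrier D. s d \<subseteq> d) \<and>
        (\<forall>c \<in> carrier D. \<forall>d \<in> carrier D.
           z c d = s c \<otimes>\<^bsub>Q\<^esub> s d \<otimes>\<^bsub>Q\<^esub> inv\<^bsub>Q\<^esub> s (c \<otimes>\<^bsub>D\<^esub> d)))"

text \<open>
  The isomorphism of \<open>Ext\<^sup>1(I\<^sub>D, N)\<close> with \<open>H\<^sup>2(D, N)\<close>: if \<open>e(d)\<close> lifts \<open>[d] - [1]\<close> to the extension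
  \<open>E\<close> of \<open>I\<^sub>D\<close> by \<open>N\<close>, the class of \<open>E\<close> goes to that of \<open>z(c, d) = e(c) + c e(d) - e(cd)\<close>.
\<close>

definition module_extension_cocycle ::
  "('d, 'x) monoid_scheme \<Rightarrow> ('n, 'y) monoid_scheme \<Rightarrow> ('e, 'z) monoid_scheme \<Rightarrow> ('d \<Rightarrow> 'e \<Rightarrow> 'e)
     \<Rightarrow> ('n \<Rightarrow> 'e) \<Rightarrow> ('e \<Rightarrow> ('d \<Rightarrow>\<^sub>0 int)) \<Rightarrow> ('d \<Rightarrow> 'd \<Rightarrow> 'n) \<Rightarrow> bool"
where
  "module_extension_cocycle D N E a\<^sub>E \<iota> p z \<longleftrightarrow>
     (\<exists>e \<in> carrier D \<rightarrow> carrier E. (\<forall>d \<in> carrier D. p (e d) = frag_of d - frag_of \<one>\<^bsub>D\<^esub>) \<and>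
        (\<forall>c \<in> carrier D. \<forall>d \<in> carrier D. z c d \<in> carrier N \<and>
           \<iota> (z c d) = e c \<otimes>\<^bsub>E\<^esub> a\<^sub>E c (e d) \<otimes>\<^bsub>E\<^esub> inv\<^bsub>E\<^esub> e (c \<otimes>\<^bsub>D\<^esub> d)))"

definition corresponding_extension ::
  "('p, 'x) monoid_scheme \<Rightarrow> 'p set \<Rightarrow> ('e, 'z) monoid_scheme \<Rightarrow> ('p set \<Rightarrow> 'e \<Rightarrow> 'e)
     \<Rightarrow> ('p set \<Rightarrow> 'e) \<Rightarrow> ('e \<Rightarrow> ('p set \<Rightarrow>\<^sub>0 int)) \<Rightarrow> bool"
where
  "corresponding_extension \<Gamma> N E a\<^sub>E \<iota> p \<longleftrightarrow>
     (let D = \<Gamma> Mod N; A = abelianisation \<Gamma> N in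
      module_extension D A (conjugation_action \<Gamma>) E a\<^sub>E
        (augmentation_ideal D) (group_ring_action D) \<iota> p \<and>
      (\<exists>z z'. group_extension_cocycle \<Gamma> N z \<and> module_extension_cocycle D A E a\<^sub>E \<iota> p z' \<and>
         cohomologous2 D A (conjugation_action \<Gamma>) z z'))"

end

theory Submission
  imports Defs
begin

text \<open>
  Both functors are compared with the functor of characters of an abelian group, which is represented
  by the group algebra.

  Over \<open>A\<close>, a representation with the prescribed reduction is \<open>\<rho> = c \<cdot> \<rho>\<^sub>0\<close> for a unique cocycle \<open>c\<close> of
  \<open>\<Gamma>\<close> with values in the torus \<open>Hom(M, A\<^sup>\<times>)\<close>. The extension \<open>E\<close> carries the universal crossed
  homomorphism \<open>\<Gamma> \<rightarrow> E\<close>, so cocycles are the equivariant maps \<open>E \<rightarrow> Hom(M, A\<^sup>\<times>)\<close>, which are the characters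
  of \<open>(E \<otimes> M)\<^sub>\<Delta>\<close>.

  The translate of \<open>T\<^sup>n\<close> by \<open>(\<rho>\<^sub>0 w\<^sub>1, \<dots>, \<rho>\<^sub>0 w\<^sub>n)\<close> is a component of \<open>G\<^sup>n\<close> on which a regular function is a
  Laurent polynomial with exponents \<open>\<mu> \<in> M\<^sup>n\<close>. Conjugation by \<open>T\<close> multiplies the monomial \<open>\<mu>\<close> by a
  character that is trivial exactly if the 1-chain \<open>\<Sum> \<mu>\<^sub>i \<otimes> [w\<^sub>i]\<close> is a cycle. A pseudocharacter with the
  prescribed reduction takes the value 1 on the indicator function of this component, so it amounts to
  a character of the cycles at every \<open>w\<close>. Compatibility with reindexing glues these to a character of all
  1-cycles, and compatibility with multiplication in \<open>\<Gamma>\<close> says that it kills the boundaries.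
\<close>

section \<open>Monoid algebras and characters\<close>

text \<open>Two obstacles shape the argument. The spectrum of a test algebra \<open>A\<close> need
  not be connected, so an \<open>A\<close>-point of \<open>G^n\<close> can lie in different
  components at different primes; a function supported on one component is therefore built by
  cutting \<open>A\<close> with the idempotent of a clopen subset of its spectrum. And test algebras
  are confined to one universe, so a regular function is seen to be a Laurent polynomial only after
  the group algebra of \<open>M^n\<close> has been copied into that universe; countability of
  \<open>M\<close> and infiniteness of the universe enter here. Connectedness of the base enters
  chiefly through the action on characters: over a connected base a multiplicative function on a
  torus is a single character, so conjugation by a point of \<open>G\<close> over the base carries
  characters to characters. Finally, \<open>E\<close> is given only through its cohomology class;
  the universal crossed homomorphism is obtained by correcting lifts until the two factor sets agree
  exactly.\<close>

definition monomial :: "('k, 'x) ring_scheme \<Rightarrow> ('n, 'y) monoid_scheme \<Rightarrow> 'n \<Rightarrow> 'n \<Rightarrow> 'k" where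
  "monomial R N z = (\<lambda>y \<in> carrier N. if y = z then \<one>\<^bsub>R\<^esub> else \<zero>\<^bsub>R\<^esub>)"

text \<open>Here \<open>h\<close> is an arbitrary function, not a character: further on it is a
  function on exponents that is multiplicative only on a subset, and the value depends on
  \<open>h\<close> only through the support of \<open>F\<close>.\<close>

definition lin_ext ::
  "('k, 'x) ring_scheme \<Rightarrow> ('n, 'y) monoid_scheme \<Rightarrow> ('k, 'a, 'z) module_scheme \<Rightarrow> ('n \<Rightarrow> 'a) \<Rightarrow> ('n \<Rightarrow> 'k) \<Rightarrow> 'a"
where
  "lin_ext R N A h F = finsum A (\<lambda>z. F z \<odot>\<^bsub>A\<^esub> h z) {z \<in> carrier N. F z \<noteq> \<zero>\<^bsub>R\<^esub>}"

locale monoid_alg = R: cring R + N: comm_monoid N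
  for R :: "('k, 'x) ring_scheme" (structure) and N :: "('n, 'y) monoid_scheme"
begin

abbreviation P where "P \<equiv> monoid_algebra R N"
abbreviation supp where "supp F \<equiv> {z \<in> carrier N. F z \<noteq> \<zero>}"

lemma carrier_P: "F \<in> carrier P \<longleftrightarrow> F \<in> carrier N \<rightarrow>\<^sub>E carrier R \<and> finite (supp F)"
  by (simp add: monoid_algebra_def)

lemma P_coeff [simp]: "F \<in> carrier P \<Longrightarrow> z \<in> carrier N \<Longrightarrow> F z \<in> carrier R"
  by (auto simp: carrier_P)

lemma P_finite_supp: "F \<in> carrier P \<Longrightarrow> finite (supp F)"
  by (simp add: carrier_P)

lemma P_eqI:
  assumes "F \<in> carrier P" "G \<in> carrier P" "\<And>z. z \<in> carrier N \<Longrightarrow> F z = G z"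
  shows "F = G"
  using assms by (auto simp: carrier_P intro: PiE_ext)

lemma zero_P [simp]: "z \<in> carrier N \<Longrightarrow> \<zero>\<^bsub>P\<^esub> z = \<zero>"
  by (simp add: monoid_algebra_def)

lemma add_P [simp]: "z \<in> carrier N \<Longrightarrow> (F \<oplus>\<^bsub>P\<^esub> G) z = F z \<oplus> G z"
  by (simp add: monoid_algebra_def)

lemma smult_P [simp]: "z \<in> carrier N \<Longrightarrow> (r \<odot>\<^bsub>P\<^esub> F) z = r \<otimes> F z"
  by (simp add: monoid_algebra_def)

lemma one_P: "\<one>\<^bsub>P\<^esub> = monomial R N \<one>\<^bsub>N\<^esub>"
  by (simp add: monoid_algebra_def monomial_def)

lemma monomial_apply [simp]:
  "y \<in> carrier N \<Longrightarrow> monomial R N z y = (if y = z then \<one> else \<zero>)"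
  by (simp add: monomial_def)

lemma zero_closed_P [simp]: "\<zero>\<^bsub>P\<^esub> \<in> carrier P"
  by (simp add: monoid_algebra_def)

lemma add_closed_P [simp]:
  assumes "F \<in> carrier P" "G \<in> carrier P"
  shows "F \<oplus>\<^bsub>P\<^esub> G \<in> carrier P"
proof -
  have "supp (F \<oplus>\<^bsub>P\<^esub> G) \<subseteq> supp F \<union> supp G"
    by auto
  then have "finite (supp (F \<oplus>\<^bsub>P\<^esub> G))"
    using assms by (auto intro: finite_subset[OF _ finite_UnI[OF P_finite_supp P_finite_supp]])
  moreover have "F \<oplus>\<^bsub>P\<^esub> G \<in> carrier N \<rightarrow>\<^sub>E carrier R"
    using assms by (auto simp: monoid_algebra_def)
  ultimately show ?thesis
    by (simp add: carrier_P)
qed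

lemma smult_closed_P [simp]:
  assumes "r \<in> carrier R" "F \<in> carrier P"
  shows "r \<odot>\<^bsub>P\<^esub> F \<in> carrier P"
proof -
  have "supp (r \<odot>\<^bsub>P\<^esub> F) \<subseteq> supp F"
    using assms by auto
  then have "finite (supp (r \<odot>\<^bsub>P\<^esub> F))"
    using assms by (auto intro: finite_subset[OF _ P_finite_supp])
  moreover have "r \<odot>\<^bsub>P\<^esub> F \<in> carrier N \<rightarrow>\<^sub>E carrier R"
    using assms by (auto simp: monoid_algebra_def)
  ultimately show ?thesis
    by (simp add: carrier_P)
qed

lemma monomial_closed [simp]:
  assumes "z \<in> carrier N"
  shows "monomial R N z \<in> carrier P"
proof -
  have "finite (supp (monomial R N z))"
    by (rule finite_subset[of _ "{z}"]) (auto split: if_splits)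
  then show ?thesis
    by (auto simp: carrier_P) (auto simp: monomial_def)
qed

lemma abelian_group_P: "abelian_group P"
proof (rule abelian_groupI)
  fix F assume F: "F \<in> carrier P"
  have "(\<ominus> \<one>) \<odot>\<^bsub>P\<^esub> F \<oplus>\<^bsub>P\<^esub> F = \<zero>\<^bsub>P\<^esub>"
    by (rule P_eqI) (use F in \<open>auto simp: R.l_minus R.l_neg\<close>)
  then show "\<exists>y \<in> carrier P. y \<oplus>\<^bsub>P\<^esub> F = \<zero>\<^bsub>P\<^esub>"
    using F by (intro bexI[of _ "(\<ominus> \<one>) \<odot>\<^bsub>P\<^esub> F"]) auto
qed (auto intro!: P_eqI simp: R.a_ac)

lemma module_P: "module R P"
  by (rule moduleI) (auto intro!: P_eqI abelian_group_P R.is_cring simp: R.l_distr R.r_distr R.m_assoc)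

abbreviation conv where
  "conv F G z q \<equiv> if fst q \<otimes>\<^bsub>N\<^esub> snd q = z then F (fst q) \<otimes> G (snd q) else \<zero>"

text \<open>The product is defined by a sum over pairs that depends on the supports and on
  \<open>z\<close>. Extending the sum by zero terms to a fixed rectangle that contains both supports
  gives an index set common to several factors, after which bilinearity is checked term by
  term.\<close>

lemma mult_P_apply:
  assumes "F \<in> carrier P" "G \<in> carrier P" "finite S" "finite T" "S \<subseteq> carrier N" "T \<subseteq> carrier N"
    and "supp F \<subseteq> S" "supp G \<subseteq> T" and z: "z \<in> carrier N"
  shows "(F \<otimes>\<^bsub>P\<^esub> G) z =
    finsum R (conv F G z) (S \<times> T)"
proof -
  have "(F \<otimes>\<^bsub>P\<^esub> G) z = finsum R (\<lambda>(x, y). F x \<otimes> G y)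
         {(x, y). x \<in> carrier N \<and> y \<in> carrier N \<and> F x \<noteq> \<zero> \<and> G y \<noteq> \<zero> \<and> x \<otimes>\<^bsub>N\<^esub> y = z}"
    using z by (simp add: monoid_algebra_def)
  also have "\<dots> = finsum R (conv F G z) (S \<times> T)"
  proof (rule R.add.finprod_mono_neutral_cong_left)
    show "(conv F G z) \<in> S \<times> T \<rightarrow> carrier R"
    proof
      fix q assume "q \<in> S \<times> T"
      then have "fst q \<in> carrier N" "snd q \<in> carrier N"
        using assms(5,6) by auto
      then show "(conv F G z q) \<in> carrier R"
        using assms(1,2) by simp
    qed
  next
    fix q assume q: "q \<in> S \<times> T -
      {(x, y). x \<in> carrier N \<and> y \<in> carrier N \<and> F x \<noteq> \<zero> \<and> G y \<noteq> \<zero> \<and> x \<otimes>\<^bsub>N\<^esub> y = z}"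
    then have "fst q \<in> carrier N" "snd q \<in> carrier N"
      using assms(5,6) by auto
    then show "(conv F G z q) = \<zero>"
      using q assms(1,2) by (cases q) auto
  qed (use assms(3,4,7,8) in auto)
  finally show ?thesis .
qed

lemma mult_closed_P [simp]:
  assumes F: "F \<in> carrier P" and G: "G \<in> carrier P"
  shows "F \<otimes>\<^bsub>P\<^esub> G \<in> carrier P"
proof -
  have "supp (F \<otimes>\<^bsub>P\<^esub> G) \<subseteq> (\<lambda>(x, y). x \<otimes>\<^bsub>N\<^esub> y) ` (supp F \<times> supp G)"
  proof
    fix z assume z: "z \<in> supp (F \<otimes>\<^bsub>P\<^esub> G)"
    show "z \<in> (\<lambda>(x, y). x \<otimes>\<^bsub>N\<^esub> y) ` (supp F \<times> supp G)"
    proof (rule ccontr)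
      assume no: "z \<notin> (\<lambda>(x, y). x \<otimes>\<^bsub>N\<^esub> y) ` (supp F \<times> supp G)"
      have "(F \<otimes>\<^bsub>P\<^esub> G) z = \<zero>"
        by (subst mult_P_apply[where S = "supp F" and T = "supp G"])
          (use F G z no in \<open>auto simp: P_finite_supp intro!: R.add.finprod_one_eqI\<close>)
      with z show False by simp
    qed
  qed
  moreover have "finite ((\<lambda>(x, y). x \<otimes>\<^bsub>N\<^esub> y) ` (supp F \<times> supp G))"
    using F G by (simp add: P_finite_supp)
  ultimately have "finite (supp (F \<otimes>\<^bsub>P\<^esub> G))"
    by (meson finite_subset)
  moreover have "(F \<otimes>\<^bsub>P\<^esub> G) z \<in> carrier R" if "z \<in> carrier N" for z
    by (subst mult_P_apply[where S = "supp F" and T = "supp G"])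
      (use F G that in \<open>auto simp: P_finite_supp intro!: R.finsum_closed\<close>)
  moreover have "F \<otimes>\<^bsub>P\<^esub> G \<in> extensional (carrier N)"
    by (simp add: monoid_algebra_def)
  ultimately show ?thesis
    by (auto simp: carrier_P PiE_def)
qed

lemma conv_closed:
  assumes "F \<in> carrier P" "G \<in> carrier P" "S \<subseteq> carrier N" "T \<subseteq> carrier N"
  shows "(conv F G z) \<in> S \<times> T \<rightarrow> carrier R"
proof
  fix q assume "q \<in> S \<times> T"
  then have "fst q \<in> carrier N" "snd q \<in> carrier N"
    using assms(3,4) by auto
  then show "(conv F G z q) \<in> carrier R"
    using assms(1,2) by simp
qed

lemma l_distr_P:
  assumes F: "F \<in> carrier P" and F': "F' \<in> carrier P" and G: "G \<in> carrier P"
  shows "(F \<oplus>\<^bsub>P\<^esub> F') \<otimes>\<^bsub>P\<^esub> G = F \<otimes>\<^bsub>P\<^esub> G \<oplus>\<^bsub>P\<^esub> F' \<otimes>\<^bsub>P\<^esub> G"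
proof (rule P_eqI)
  fix z assume z: "z \<in> carrier N"
  define S where "S = supp F \<union> supp F'"
  have S: "finite S" "S \<subseteq> carrier N" "supp F \<subseteq> S" "supp F' \<subseteq> S" "supp (F \<oplus>\<^bsub>P\<^esub> F') \<subseteq> S"
    using F F' by (auto simp: S_def P_finite_supp)
  note * = mult_P_apply[where S = S and T = "supp G", OF _ G S(1) P_finite_supp[OF G] S(2) _ _ _ z]
  note Pi = conv_closed[OF F G S(2), of "supp G" z] conv_closed[OF F' G S(2), of "supp G" z]
  have "((F \<oplus>\<^bsub>P\<^esub> F') \<otimes>\<^bsub>P\<^esub> G) z = finsum R (\<lambda>q. (conv (F \<oplus>\<^bsub>P\<^esub> F') G z q)) (S \<times> supp G)"
    using * F F' S by simp
  also have "\<dots> = finsum R (\<lambda>q. (conv F G z q) \<oplus> (conv F' G z q)) (S \<times> supp G)"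
  proof (rule R.finsum_cong'[OF refl])
    fix q assume "q \<in> (S \<times> supp G)"
    then have "fst q \<in> carrier N" "snd q \<in> carrier N"
      using S(2) by auto
    then show "(conv (F \<oplus>\<^bsub>P\<^esub> F') G z q) = (conv F G z q) \<oplus> (conv F' G z q)"
      using F F' G by (simp add: R.l_distr)
  qed (use Pi in \<open>auto simp: Pi_iff\<close>)
  also have "\<dots> = (F \<otimes>\<^bsub>P\<^esub> G) z \<oplus> (F' \<otimes>\<^bsub>P\<^esub> G) z"
    using * F F' S Pi by (simp add: R.finsum_addf)
  finally show "((F \<oplus>\<^bsub>P\<^esub> F') \<otimes>\<^bsub>P\<^esub> G) z = (F \<otimes>\<^bsub>P\<^esub> G \<oplus>\<^bsub>P\<^esub> F' \<otimes>\<^bsub>P\<^esub> G) z"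
    using z by simp
qed (use assms in auto)

lemma r_distr_P:
  assumes F: "F \<in> carrier P" and F': "F' \<in> carrier P" and G: "G \<in> carrier P"
  shows "G \<otimes>\<^bsub>P\<^esub> (F \<oplus>\<^bsub>P\<^esub> F') = G \<otimes>\<^bsub>P\<^esub> F \<oplus>\<^bsub>P\<^esub> G \<otimes>\<^bsub>P\<^esub> F'"
proof (rule P_eqI)
  fix z assume z: "z \<in> carrier N"
  define S where "S = supp F \<union> supp F'"
  have S: "finite S" "S \<subseteq> carrier N" "supp F \<subseteq> S" "supp F' \<subseteq> S" "supp (F \<oplus>\<^bsub>P\<^esub> F') \<subseteq> S"
    using F F' by (auto simp: S_def P_finite_supp)
  note * = mult_P_apply[where S = "supp G" and T = S, OF G _ P_finite_supp[OF G] S(1) _ S(2) _ _ z]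
  note Pi = conv_closed[OF G F _ S(2), of "supp G" z] conv_closed[OF G F' _ S(2), of "supp G" z]
  have "(G \<otimes>\<^bsub>P\<^esub> (F \<oplus>\<^bsub>P\<^esub> F')) z = finsum R (\<lambda>q. (conv G (F \<oplus>\<^bsub>P\<^esub> F') z q)) (supp G \<times> S)"
    using * F F' S by simp
  also have "\<dots> = finsum R (\<lambda>q. (conv G F z q) \<oplus> (conv G F' z q)) (supp G \<times> S)"
  proof (rule R.finsum_cong'[OF refl])
    fix q assume "q \<in> (supp G \<times> S)"
    then have "fst q \<in> carrier N" "snd q \<in> carrier N"
      using S(2) by auto
    then show "(conv G (F \<oplus>\<^bsub>P\<^esub> F') z q) = (conv G F z q) \<oplus> (conv G F' z q)"
      using F F' G by (simp add: R.r_distr)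
  qed (use Pi in \<open>auto simp: Pi_iff\<close>)
  also have "\<dots> = (G \<otimes>\<^bsub>P\<^esub> F) z \<oplus> (G \<otimes>\<^bsub>P\<^esub> F') z"
    using * F F' S Pi by (simp add: R.finsum_addf)
  finally show "(G \<otimes>\<^bsub>P\<^esub> (F \<oplus>\<^bsub>P\<^esub> F')) z = (G \<otimes>\<^bsub>P\<^esub> F \<oplus>\<^bsub>P\<^esub> G \<otimes>\<^bsub>P\<^esub> F') z"
    using z by simp
qed (use assms in auto)

lemma smult_assoc2_P:
  assumes F: "F \<in> carrier P" and G: "G \<in> carrier P" and r: "r \<in> carrier R"
  shows "(r \<odot>\<^bsub>P\<^esub> F) \<otimes>\<^bsub>P\<^esub> G = r \<odot>\<^bsub>P\<^esub> (F \<otimes>\<^bsub>P\<^esub> G)"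
proof (rule P_eqI)
  fix z assume z: "z \<in> carrier N"
  have S: "supp (r \<odot>\<^bsub>P\<^esub> F) \<subseteq> supp F"
    using F G r by auto
  note * = mult_P_apply[where S = "supp F" and T = "supp G", OF _ _ P_finite_supp[OF F] P_finite_supp[OF G] _ _ _ _ z]
  note Pi = conv_closed[OF F G, of "supp F" "supp G" z]
  have "((r \<odot>\<^bsub>P\<^esub> F) \<otimes>\<^bsub>P\<^esub> G) z = finsum R (conv (r \<odot>\<^bsub>P\<^esub> F) G z) (supp F \<times> supp G)"
    using * F G S r by simp
  also have "\<dots> = finsum R (\<lambda>q. r \<otimes> (conv F G z q)) (supp F \<times> supp G)"
    by (rule R.finsum_cong'[OF refl]) (use F G r Pi in \<open>auto simp: Pi_iff R.m_assoc R.m_lcomm\<close>)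
  also have "\<dots> = r \<otimes> (F \<otimes>\<^bsub>P\<^esub> G) z"
    using * F G S r Pi by (simp add: R.finsum_rdistr P_finite_supp)
  finally show "((r \<odot>\<^bsub>P\<^esub> F) \<otimes>\<^bsub>P\<^esub> G) z = (r \<odot>\<^bsub>P\<^esub> (F \<otimes>\<^bsub>P\<^esub> G)) z"
    using z by simp
qed (use assms in auto)

lemma smult_assoc3_P:
  assumes F: "F \<in> carrier P" and G: "G \<in> carrier P" and r: "r \<in> carrier R"
  shows "F \<otimes>\<^bsub>P\<^esub> (r \<odot>\<^bsub>P\<^esub> G) = r \<odot>\<^bsub>P\<^esub> (F \<otimes>\<^bsub>P\<^esub> G)"
proof (rule P_eqI)
  fix z assume z: "z \<in> carrier N"
  have S: "supp (r \<odot>\<^bsub>P\<^esub> G) \<subseteq> supp G"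
    using F G r by auto
  note * = mult_P_apply[where S = "supp F" and T = "supp G", OF _ _ P_finite_supp[OF F] P_finite_supp[OF G] _ _ _ _ z]
  note Pi = conv_closed[OF F G, of "supp F" "supp G" z]
  have "(F \<otimes>\<^bsub>P\<^esub> (r \<odot>\<^bsub>P\<^esub> G)) z = finsum R (conv F (r \<odot>\<^bsub>P\<^esub> G) z) (supp F \<times> supp G)"
    using * F G S r by simp
  also have "\<dots> = finsum R (\<lambda>q. r \<otimes> (conv F G z q)) (supp F \<times> supp G)"
    by (rule R.finsum_cong'[OF refl]) (use F G r Pi in \<open>auto simp: Pi_iff R.m_assoc R.m_lcomm\<close>)
  also have "\<dots> = r \<otimes> (F \<otimes>\<^bsub>P\<^esub> G) z"
    using * F G S r Pi by (simp add: R.finsum_rdistr P_finite_supp)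
  finally show "(F \<otimes>\<^bsub>P\<^esub> (r \<odot>\<^bsub>P\<^esub> G)) z = (r \<odot>\<^bsub>P\<^esub> (F \<otimes>\<^bsub>P\<^esub> G)) z"
    using z by simp
qed (use assms in auto)

lemma monomial_mult:
  assumes x: "x \<in> carrier N" and y: "y \<in> carrier N"
  shows "monomial R N x \<otimes>\<^bsub>P\<^esub> monomial R N y = monomial R N (x \<otimes>\<^bsub>N\<^esub> y)"
proof (rule P_eqI)
  fix z assume z: "z \<in> carrier N"
  show "(monomial R N x \<otimes>\<^bsub>P\<^esub> monomial R N y) z = monomial R N (x \<otimes>\<^bsub>N\<^esub> y) z"
    by (subst mult_P_apply[where S = "{x}" and T = "{y}"]) (use x y z in \<open>auto split: if_splits\<close>)
qed (use assms in auto)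

text \<open>Keeping the support inside \<open>K\<close> allows induction for assertions that only
  hold for elements supported in \<open>K\<close>, such as multiplicativity of a linear extension
  whose function is multiplicative only there. One monomial of the support is removed at a
  time.\<close>

lemma P_induct_on [consumes 3, case_names zero step]:
  assumes "F \<in> carrier P" "supp F \<subseteq> K" "K \<subseteq> carrier N"
    and zero: "Q \<zero>\<^bsub>P\<^esub>"
    and step: "\<And>F r z. \<lbrakk>F \<in> carrier P; supp F \<subseteq> K; Q F; r \<in> carrier R; z \<in> K\<rbrakk>
      \<Longrightarrow> Q (F \<oplus>\<^bsub>P\<^esub> r \<odot>\<^bsub>P\<^esub> monomial R N z)"
  shows "Q F"
proof -
  have "\<forall>F \<in> carrier P. supp F \<subseteq> S \<longrightarrow> S \<subseteq> K \<longrightarrow> Q F" if "finite S" for S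
    using that
  proof (induction S)
    case empty
    then show ?case
      using zero P_eqI[OF _ zero_closed_P] by fastforce
  next
    case (insert z S)
    show ?case
    proof (intro ballI impI)
      fix F assume F: "F \<in> carrier P" and sub: "supp F \<subseteq> insert z S" and K: "insert z S \<subseteq> K"
      then have z: "z \<in> carrier N"
        using assms(3) by auto
      define F' where "F' = F(z := \<zero>)"
      have s: "supp F' \<subseteq> supp F" "supp F' \<subseteq> S"
        using sub by (auto simp: F'_def)
      have F': "F' \<in> carrier P"
      proof -
        have "F' \<in> carrier N \<rightarrow>\<^sub>E carrier R"
          using F z unfolding F'_def carrier_P by (auto simp: PiE_iff extensional_def)
        then show ?thesis
          using finite_subset[OF s(1) P_finite_supp[OF F]] by (simp only: carrier_P)
      qed
      have "Q F'"
        using insert.IH F' s K by auto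
      then have "Q (F' \<oplus>\<^bsub>P\<^esub> F z \<odot>\<^bsub>P\<^esub> monomial R N z)"
        using step[OF F' _ \<open>Q F'\<close>, of "F z" z] F z K s(2) by auto
      moreover have "F = F' \<oplus>\<^bsub>P\<^esub> F z \<odot>\<^bsub>P\<^esub> monomial R N z"
        by (rule P_eqI) (use F F' z in \<open>auto simp: F'_def\<close>)
      ultimately show "Q F" by simp
    qed
  qed
  from this[OF P_finite_supp[OF assms(1)]] show ?thesis
    using assms(1-3) by auto
qed

lemma P_induct [consumes 1, case_names zero step]:
  assumes "F \<in> carrier P"
    and "Q \<zero>\<^bsub>P\<^esub>"
    and "\<And>F r z. \<lbrakk>F \<in> carrier P; Q F; r \<in> carrier R; z \<in> carrier N\<rbrakk>
      \<Longrightarrow> Q (F \<oplus>\<^bsub>P\<^esub> r \<odot>\<^bsub>P\<^esub> monomial R N z)"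
  shows "Q F"
  using P_induct_on[OF assms(1) _ subset_refl, of Q] assms(2,3) by auto

lemma zero_mult_P:
  assumes "F \<in> carrier P"
  shows "\<zero>\<^bsub>P\<^esub> \<otimes>\<^bsub>P\<^esub> F = \<zero>\<^bsub>P\<^esub>" "F \<otimes>\<^bsub>P\<^esub> \<zero>\<^bsub>P\<^esub> = \<zero>\<^bsub>P\<^esub>"
proof -
  interpret M: module R P by (rule module_P)
  have "(\<zero> \<odot>\<^bsub>P\<^esub> \<zero>\<^bsub>P\<^esub>) \<otimes>\<^bsub>P\<^esub> F = \<zero> \<odot>\<^bsub>P\<^esub> (\<zero>\<^bsub>P\<^esub> \<otimes>\<^bsub>P\<^esub> F)"
    using assms by (intro smult_assoc2_P) auto
  then show "\<zero>\<^bsub>P\<^esub> \<otimes>\<^bsub>P\<^esub> F = \<zero>\<^bsub>P\<^esub>"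
    using assms by simp
  have "F \<otimes>\<^bsub>P\<^esub> (\<zero> \<odot>\<^bsub>P\<^esub> \<zero>\<^bsub>P\<^esub>) = \<zero> \<odot>\<^bsub>P\<^esub> (F \<otimes>\<^bsub>P\<^esub> \<zero>\<^bsub>P\<^esub>)"
    using assms by (intro smult_assoc3_P) auto
  then show "F \<otimes>\<^bsub>P\<^esub> \<zero>\<^bsub>P\<^esub> = \<zero>\<^bsub>P\<^esub>"
    using assms by simp
qed

lemmas bilinear_P = l_distr_P r_distr_P smult_assoc2_P smult_assoc3_P zero_mult_P

text \<open>Both sides are linear in each argument, so the claim reduces one argument at a time to
  monomials, where it is associativity in \<open>N\<close>.\<close>

lemma m_assoc_P:
  assumes F: "F \<in> carrier P" and G: "G \<in> carrier P" and H: "H \<in> carrier P"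
  shows "(F \<otimes>\<^bsub>P\<^esub> G) \<otimes>\<^bsub>P\<^esub> H = F \<otimes>\<^bsub>P\<^esub> (G \<otimes>\<^bsub>P\<^esub> H)"
proof -
  interpret M: module R P by (rule module_P)
  have 1: "(monomial R N x \<otimes>\<^bsub>P\<^esub> monomial R N y) \<otimes>\<^bsub>P\<^esub> H = monomial R N x \<otimes>\<^bsub>P\<^esub> (monomial R N y \<otimes>\<^bsub>P\<^esub> H)"
    if "x \<in> carrier N" "y \<in> carrier N" for x y
    using H
  proof (induction H rule: P_induct)
    case (step F r z)
    then show ?case
      using that by (simp add: bilinear_P) (simp add: monomial_mult N.m_assoc)
  qed (use that in \<open>simp add: bilinear_P\<close>)
  have 2: "(monomial R N x \<otimes>\<^bsub>P\<^esub> G) \<otimes>\<^bsub>P\<^esub> H = monomial R N x \<otimes>\<^bsub>P\<^esub> (G \<otimes>\<^bsub>P\<^esub> H)"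
    if "x \<in> carrier N" for x
    using G by (induction G rule: P_induct) (use that H in \<open>simp_all add: bilinear_P 1\<close>)
  show ?thesis
    using F by (induction F rule: P_induct) (use G H in \<open>simp_all add: bilinear_P 2\<close>)
qed

lemma m_comm_P:
  assumes F: "F \<in> carrier P" and G: "G \<in> carrier P"
  shows "F \<otimes>\<^bsub>P\<^esub> G = G \<otimes>\<^bsub>P\<^esub> F"
proof -
  have 1: "monomial R N x \<otimes>\<^bsub>P\<^esub> G = G \<otimes>\<^bsub>P\<^esub> monomial R N x" if "x \<in> carrier N" for x
    using G by (induction G rule: P_induct) (use that in \<open>simp_all add: bilinear_P monomial_mult N.m_comm\<close>)
  show ?thesis
    using F by (induction F rule: P_induct) (use G in \<open>simp_all add: bilinear_P 1\<close>)
qed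

lemma l_one_P:
  assumes F: "F \<in> carrier P"
  shows "\<one>\<^bsub>P\<^esub> \<otimes>\<^bsub>P\<^esub> F = F"
  using F by (induction F rule: P_induct) (simp_all add: one_P bilinear_P monomial_mult)

lemma cring_P: "cring P"
proof (rule cringI)
  show "Group.comm_monoid P"
    by (rule comm_monoidI) (simp_all add: m_assoc_P l_one_P, simp add: one_P, rule m_comm_P)
qed (auto simp: abelian_group_P l_distr_P)

lemma algebra_P: "algebra R P"
proof -
  interpret M: module R P by (rule module_P)
  show ?thesis
    by (rule algebraI)
      (auto simp: R.is_cring cring_P M.smult_l_distr M.smult_r_distr M.smult_assoc1 smult_assoc2_P)
qed

end

section \<open>Homomorphisms of algebras and characters with values in units\<close>

abbreviation characters :: "('n, 'y) monoid_scheme \<Rightarrow> ('a, 'z) ring_scheme \<Rightarrow> ('n \<Rightarrow> 'a) set" where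
  "characters N A \<equiv> hom N (units_of A) \<inter> extensional (carrier N)"

lemma alg_hom_closed: "\<phi> \<in> alg_hom R A B \<Longrightarrow> a \<in> carrier A \<Longrightarrow> \<phi> a \<in> carrier B"
  by (auto simp: alg_hom_def ring_hom_def)

lemma alg_hom_simps:
  assumes "\<phi> \<in> alg_hom R A B"
  shows "\<lbrakk>a \<in> carrier A; b \<in> carrier A\<rbrakk> \<Longrightarrow> \<phi> (a \<otimes>\<^bsub>A\<^esub> b) = \<phi> a \<otimes>\<^bsub>B\<^esub> \<phi> b"
    and "\<lbrakk>a \<in> carrier A; b \<in> carrier A\<rbrakk> \<Longrightarrow> \<phi> (a \<oplus>\<^bsub>A\<^esub> b) = \<phi> a \<oplus>\<^bsub>B\<^esub> \<phi> b"
    and "\<phi> \<one>\<^bsub>A\<^esub> = \<one>\<^bsub>B\<^esub>"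
    and "\<lbrakk>r \<in> carrier R; a \<in> carrier A\<rbrakk> \<Longrightarrow> \<phi> (r \<odot>\<^bsub>A\<^esub> a) = r \<odot>\<^bsub>B\<^esub> \<phi> a"
    and "\<phi> \<in> extensional (carrier A)"
  using assms by (auto simp: alg_hom_def ring_hom_def)

lemma alg_hom_zero:
  assumes "\<phi> \<in> alg_hom R A B" "ring A" "ring B"
  shows "\<phi> \<zero>\<^bsub>A\<^esub> = \<zero>\<^bsub>B\<^esub>"
  using assms by (intro ring_hom_zero) (auto simp: alg_hom_def)

lemma alg_hom_Units:
  assumes "\<phi> \<in> alg_hom R A B" "a \<in> Units A"
  shows "\<phi> a \<in> Units B"
proof -
  obtain b where b: "b \<in> carrier A" "b \<otimes>\<^bsub>A\<^esub> a = \<one>\<^bsub>A\<^esub>" "a \<otimes>\<^bsub>A\<^esub> b = \<one>\<^bsub>A\<^esub>" "a \<in> carrier A"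
    using assms(2) by (auto simp: Units_def)
  then have "\<phi> b \<otimes>\<^bsub>B\<^esub> \<phi> a = \<one>\<^bsub>B\<^esub>" "\<phi> a \<otimes>\<^bsub>B\<^esub> \<phi> b = \<one>\<^bsub>B\<^esub>"
    using alg_hom_simps(1,3)[OF assms(1)] by metis+
  then show ?thesis
    using b alg_hom_closed[OF assms(1)] by (auto simp: Units_def)
qed

lemma alg_hom_compose:
  assumes f: "f \<in> alg_hom R A B" and g: "g \<in> alg_hom R B D" and A: "algebra R A"
  shows "compose (carrier A) g f \<in> alg_hom R A D"
proof -
  interpret A: algebra R A by (rule A)
  have "compose (carrier A) g f \<in> ring_hom A D"
    by (rule ring_hom_memI)
      (simp_all add: compose_def alg_hom_closed[OF f] alg_hom_closed[OF g] alg_hom_simps[OF f] alg_hom_simps[OF g])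
  then show ?thesis
    by (simp add: alg_hom_def) (simp add: compose_def alg_hom_closed[OF f] alg_hom_simps[OF f] alg_hom_simps[OF g])
qed

lemma characters_closed:
  assumes "h \<in> characters N A" "z \<in> carrier N"
  shows "h z \<in> Units A" "h z \<in> carrier A"
  using assms by (auto simp: hom_def units_of_def Units_def)

lemma characters_mult:
  assumes "h \<in> characters N A" "x \<in> carrier N" "y \<in> carrier N"
  shows "h (x \<otimes>\<^bsub>N\<^esub> y) = h x \<otimes>\<^bsub>A\<^esub> h y"
  using assms by (auto simp: hom_def units_of_def)

lemma characters_one:
  assumes "h \<in> characters N A" "group N" "monoid A"
  shows "h \<one>\<^bsub>N\<^esub> = \<one>\<^bsub>A\<^esub>"
  using assms hom_one[of h N "units_of A"] by (auto simp: monoid.units_group units_of_one)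

lemma charactersI:
  assumes "\<And>x. x \<in> carrier N \<Longrightarrow> h x \<in> Units A"
    and "\<And>x y. x \<in> carrier N \<Longrightarrow> y \<in> carrier N \<Longrightarrow> h (x \<otimes>\<^bsub>N\<^esub> y) = h x \<otimes>\<^bsub>A\<^esub> h y"
    and "h \<in> extensional (carrier N)"
  shows "h \<in> characters N A"
  using assms by (auto simp: hom_def units_of_def)

lemma characters_compose:
  assumes \<phi>: "\<phi> \<in> alg_hom R A B" and h: "h \<in> characters N A" and N: "group N"
  shows "compose (carrier N) \<phi> h \<in> characters N B"
proof (rule charactersI)
  fix x y assume "x \<in> carrier N" "y \<in> carrier N"
  then show "compose (carrier N) \<phi> h (x \<otimes>\<^bsub>N\<^esub> y) = compose (carrier N) \<phi> h x \<otimes>\<^bsub>B\<^esub> compose (carrier N) \<phi> h y"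
    using N by (simp add: compose_def characters_mult[OF h] characters_closed[OF h] alg_hom_simps[OF \<phi>] group.is_monoid monoid.m_closed)
qed (use alg_hom_Units[OF \<phi>] characters_closed[OF h] in \<open>auto simp: compose_def\<close>)

locale monoid_alg_target = monoid_alg R N + A: algebra R A
  for R :: "('k, 'x) ring_scheme" and N :: "('n, 'y) monoid_scheme" and A :: "('k, 'a, 'z) module_scheme"
begin

lemma lin_ext_superset:
  assumes F: "F \<in> carrier P" and h: "h \<in> carrier N \<rightarrow> carrier A"
    and S: "finite S" "S \<subseteq> carrier N" "supp F \<subseteq> S"
  shows "lin_ext R N A h F = finsum A (\<lambda>z. F z \<odot>\<^bsub>A\<^esub> h z) S"
  unfolding lin_ext_def
proof (rule A.add.finprod_mono_neutral_cong_left)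
  fix z assume "z \<in> S - supp F"
  then have "F z = \<zero>\<^bsub>R\<^esub>" "z \<in> carrier N"
    using S(2) by auto
  then show "F z \<odot>\<^bsub>A\<^esub> h z = \<zero>\<^bsub>A\<^esub>"
    using funcset_mem[OF h] by simp
next
  show "(\<lambda>z. F z \<odot>\<^bsub>A\<^esub> h z) \<in> S \<rightarrow> carrier A"
  proof
    fix z assume "z \<in> S"
    then have "z \<in> carrier N"
      using S(2) by auto
    then show "F z \<odot>\<^bsub>A\<^esub> h z \<in> carrier A"
      using F funcset_mem[OF h] by simp
  qed
qed (use S in auto)

lemma lin_ext_closed [simp]:
  assumes F: "F \<in> carrier P" and h: "h \<in> carrier N \<rightarrow> carrier A"
  shows "lin_ext R N A h F \<in> carrier A"
  unfolding lin_ext_def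
  by (rule A.finsum_closed) (use F funcset_mem[OF h] in simp)

lemma lin_ext_zero [simp]: "lin_ext R N A h \<zero>\<^bsub>P\<^esub> = \<zero>\<^bsub>A\<^esub>"
proof -
  have "supp \<zero>\<^bsub>P\<^esub> = {}"
    by simp
  then show ?thesis
    unfolding lin_ext_def by (simp only: A.finsum_empty)
qed

lemma lin_ext_add:
  assumes F: "F \<in> carrier P" and G: "G \<in> carrier P" and h: "h \<in> carrier N \<rightarrow> carrier A"
  shows "lin_ext R N A h (F \<oplus>\<^bsub>P\<^esub> G) = lin_ext R N A h F \<oplus>\<^bsub>A\<^esub> lin_ext R N A h G"
proof -
  define S where "S = supp F \<union> supp G"
  have S: "finite S" "S \<subseteq> carrier N" "supp F \<subseteq> S" "supp G \<subseteq> S" "supp (F \<oplus>\<^bsub>P\<^esub> G) \<subseteq> S"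
    using F G by (auto simp: S_def P_finite_supp)
  note * = lin_ext_superset[OF _ h S(1,2)]
  have c: "z \<in> carrier N" "h z \<in> carrier A" if "z \<in> S" for z
    using that S(2) h by auto
  have "lin_ext R N A h (F \<oplus>\<^bsub>P\<^esub> G) = finsum A (\<lambda>z. F z \<odot>\<^bsub>A\<^esub> h z \<oplus>\<^bsub>A\<^esub> G z \<odot>\<^bsub>A\<^esub> h z) S"
    unfolding *[OF add_closed_P[OF F G] S(5)]
    by (rule A.finsum_cong'[OF refl]) (use F G c in \<open>simp_all add: A.smult_l_distr\<close>)
  also have "\<dots> = lin_ext R N A h F \<oplus>\<^bsub>A\<^esub> lin_ext R N A h G"
    unfolding *[OF F S(3)] *[OF G S(4)]
    by (rule A.finsum_addf) (use F G c in simp_all)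
  finally show ?thesis .
qed

lemma lin_ext_monomial:
  assumes z: "z \<in> carrier N" and h: "h \<in> carrier N \<rightarrow> carrier A"
  shows "lin_ext R N A h (monomial R N z) = h z"
proof -
  have "lin_ext R N A h (monomial R N z) = finsum A (\<lambda>y. monomial R N z y \<odot>\<^bsub>A\<^esub> h y) {z}"
    by (rule lin_ext_superset) (use z h in \<open>auto split: if_splits\<close>)
  also have "\<dots> = h z"
    using z funcset_mem[OF h] by simp
  finally show ?thesis .
qed

lemma lin_ext_smult:
  assumes F: "F \<in> carrier P" and r: "r \<in> carrier R" and h: "h \<in> carrier N \<rightarrow> carrier A"
  shows "lin_ext R N A h (r \<odot>\<^bsub>P\<^esub> F) = r \<odot>\<^bsub>A\<^esub> lin_ext R N A h F"
proof -
  have S: "supp (r \<odot>\<^bsub>P\<^esub> F) \<subseteq> supp F"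
    using F r by auto
  have "lin_ext R N A h (r \<odot>\<^bsub>P\<^esub> F) = finsum A (\<lambda>z. (r \<odot>\<^bsub>P\<^esub> F) z \<odot>\<^bsub>A\<^esub> h z) (supp F)"
    by (rule lin_ext_superset) (use F r h S P_finite_supp[OF F] in simp_all)
  also have "\<dots> = finsum A (\<lambda>z. r \<odot>\<^bsub>A\<^esub> (F z \<odot>\<^bsub>A\<^esub> h z)) (supp F)"
    by (rule A.finsum_cong'[OF refl]) (use F r funcset_mem[OF h] in \<open>simp_all add: A.smult_assoc1\<close>)
  also have "\<dots> = r \<odot>\<^bsub>A\<^esub> lin_ext R N A h F"
    unfolding lin_ext_def
    by (rule A.finsum_smult_ldistr[symmetric]) (use F r funcset_mem[OF h] P_finite_supp[OF F] in simp_all)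
  finally show ?thesis .
qed

lemma linear_eq_lin_ext:
  assumes add: "\<And>F G. F \<in> carrier P \<Longrightarrow> G \<in> carrier P \<Longrightarrow> \<phi> (F \<oplus>\<^bsub>P\<^esub> G) = \<phi> F \<oplus>\<^bsub>A\<^esub> \<phi> G"
    and smult: "\<And>r F. r \<in> carrier R \<Longrightarrow> F \<in> carrier P \<Longrightarrow> \<phi> (r \<odot>\<^bsub>P\<^esub> F) = r \<odot>\<^bsub>A\<^esub> \<phi> F"
    and monomial: "\<And>z. z \<in> carrier N \<Longrightarrow> \<phi> (monomial R N z) = h z"
    and h: "h \<in> carrier N \<rightarrow> carrier A" and F: "F \<in> carrier P"
  shows "\<phi> F = lin_ext R N A h F"
  using F
proof (induction rule: P_induct)
  case zero
  interpret MP: module R P by (rule module_P)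
  have m: "h \<one>\<^bsub>N\<^esub> \<in> carrier A"
    using h by auto
  \<comment> \<open>Values of \<open>\<phi>\<close> are not assumed to lie in \<open>A\<close>, so
    additivity alone does not give this; zero is written as 0 times a monomial, whose value does lie
    in \<open>A\<close>.\<close>
  have "\<phi> \<zero>\<^bsub>P\<^esub> = \<phi> (\<zero>\<^bsub>R\<^esub> \<odot>\<^bsub>P\<^esub> monomial R N \<one>\<^bsub>N\<^esub>)"
    by simp
  also have "\<dots> = \<zero>\<^bsub>A\<^esub>"
    using m by (simp only: smult R.zero_closed monomial_closed N.one_closed monomial A.smult_l_null)
  finally show ?case
    by simp
next
  case (step F r z)
  then show ?case
    using h by (simp add: add smult monomial lin_ext_add lin_ext_smult lin_ext_monomial)
qed

text \<open>Expanding both factors into monomials of \<open>K\<close> uses multiplicativity of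
  \<open>h\<close> only for two elements of \<open>K\<close>. This serves for functions on exponents
  that are characters on the cycles and arbitrary elsewhere.\<close>

lemma lin_ext_mult:
  assumes K: "K \<subseteq> carrier N" and h: "h \<in> carrier N \<rightarrow> carrier A"
    and mult: "\<And>x y. x \<in> K \<Longrightarrow> y \<in> K \<Longrightarrow> h (x \<otimes>\<^bsub>N\<^esub> y) = h x \<otimes>\<^bsub>A\<^esub> h y"
    and F: "F \<in> carrier P" "supp F \<subseteq> K" and G: "G \<in> carrier P" "supp G \<subseteq> K"
  shows "lin_ext R N A h (F \<otimes>\<^bsub>P\<^esub> G) = lin_ext R N A h F \<otimes>\<^bsub>A\<^esub> lin_ext R N A h G"
proof -
  have hc: "h x \<in> carrier A" if "x \<in> carrier N" for x
    using h that by auto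
  have assoc3: "x \<otimes>\<^bsub>A\<^esub> (r \<odot>\<^bsub>A\<^esub> y) = r \<odot>\<^bsub>A\<^esub> (x \<otimes>\<^bsub>A\<^esub> y)"
    if "x \<in> carrier A" "y \<in> carrier A" "r \<in> carrier R" for x y r
    using that A.smult_assoc2[of r y x] by (simp add: A.m_comm)
  note lin = lin_ext_add lin_ext_smult lin_ext_monomial lin_ext_zero
  note simps = lin bilinear_P h hc
  have 1: "lin_ext R N A h (monomial R N x \<otimes>\<^bsub>P\<^esub> G) = h x \<otimes>\<^bsub>A\<^esub> lin_ext R N A h G" if x: "x \<in> K" for x
    using G K
  proof (induction rule: P_induct_on)
    case zero
    then show ?case
      using x K by (auto simp: simps)
  next
    case (step F r z)
    then have "z \<in> carrier N" "x \<in> carrier N"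
      using x K by auto
    with step x show ?case
      by (simp add: simps monomial_mult mult A.r_distr assoc3)
  qed
  show ?thesis
    using F K
  proof (induction rule: P_induct_on)
    case zero
    then show ?case
      using G(1) by (simp add: simps)
  next
    case (step F r z)
    then have "z \<in> carrier N"
      using K by auto
    with step G(1) show ?case
      by (simp add: simps 1 A.l_distr A.smult_assoc2)
  qed
qed

lemma lin_ext_alg_hom:
  assumes h: "h \<in> carrier N \<rightarrow> carrier A" and one: "h \<one>\<^bsub>N\<^esub> = \<one>\<^bsub>A\<^esub>"
    and mult: "\<And>x y. x \<in> carrier N \<Longrightarrow> y \<in> carrier N \<Longrightarrow> h (x \<otimes>\<^bsub>N\<^esub> y) = h x \<otimes>\<^bsub>A\<^esub> h y"
  shows "(\<lambda>F \<in> carrier P. lin_ext R N A h F) \<in> alg_hom R P A"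
proof -
  interpret CP: cring P by (rule cring_P)
  have "lin_ext R N A h (F \<otimes>\<^bsub>P\<^esub> G) = lin_ext R N A h F \<otimes>\<^bsub>A\<^esub> lin_ext R N A h G"
    if "F \<in> carrier P" "G \<in> carrier P" for F G
    by (rule lin_ext_mult[OF subset_refl h mult]) (use that in auto)
  then have "(\<lambda>F \<in> carrier P. lin_ext R N A h F) \<in> ring_hom P A"
    by (intro ring_hom_memI) (simp_all add: h lin_ext_add one_P lin_ext_monomial one)
  then show ?thesis
    by (simp add: alg_hom_def h lin_ext_smult)
qed

lemma alg_hom_eq_lin_ext:
  assumes \<phi>: "\<phi> \<in> alg_hom R P A" and F: "F \<in> carrier P"
    and h: "\<And>z. z \<in> carrier N \<Longrightarrow> \<phi> (monomial R N z) = h z"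
  shows "\<phi> F = lin_ext R N A h F"
proof (rule linear_eq_lin_ext)
  have c: "\<phi> \<in> carrier P \<rightarrow> carrier A"
    using \<phi> by (auto simp: alg_hom_def ring_hom_def)
  show "h \<in> carrier N \<rightarrow> carrier A"
    using funcset_mem[OF c] h[symmetric] by simp
qed (simp_all add: alg_hom_simps[OF \<phi>] F h)

end

locale group_alg_target = monoid_alg_target R N A + N: comm_group N
  for R :: "('k, 'x) ring_scheme" and N :: "('n, 'y) monoid_scheme" and A :: "('k, 'a, 'z) module_scheme"
begin

lemma lin_ext_characters:
  assumes "h \<in> characters N A"
  shows "(\<lambda>F \<in> carrier P. lin_ext R N A h F) \<in> alg_hom R P A"
  using assms
  by (intro lin_ext_alg_hom)
    (auto simp: characters_closed characters_mult characters_one N.is_group A.is_monoid)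

lemma alg_hom_characters:
  assumes \<phi>: "\<phi> \<in> alg_hom R P A"
  shows "(\<lambda>z \<in> carrier N. \<phi> (monomial R N z)) \<in> characters N A"
proof (rule charactersI)
  have u: "monomial R N x \<in> Units P" if "x \<in> carrier N" for x
    using that monomial_mult[of "inv\<^bsub>N\<^esub> x" x] monomial_mult[of x "inv\<^bsub>N\<^esub> x"]
    by (auto simp: Units_def one_P intro!: bexI[of _ "monomial R N (inv\<^bsub>N\<^esub> x)"])
  then show "(\<lambda>z \<in> carrier N. \<phi> (monomial R N z)) x \<in> Units A" if "x \<in> carrier N" for x
    using that alg_hom_Units[OF \<phi>] by auto
  fix x y assume "x \<in> carrier N" "y \<in> carrier N"
  then show "(\<lambda>z \<in> carrier N. \<phi> (monomial R N z)) (x \<otimes>\<^bsub>N\<^esub> y) =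
    (\<lambda>z \<in> carrier N. \<phi> (monomial R N z)) x \<otimes>\<^bsub>A\<^esub> (\<lambda>z \<in> carrier N. \<phi> (monomial R N z)) y"
    using alg_hom_simps(1)[OF \<phi>] by (simp flip: monomial_mult)
qed auto

lemma alg_hom_eqI:
  assumes \<phi>: "\<phi> \<in> alg_hom R P A" and \<psi>: "\<psi> \<in> alg_hom R P A"
    and "\<And>z. z \<in> carrier N \<Longrightarrow> \<phi> (monomial R N z) = \<psi> (monomial R N z)"
  shows "\<phi> = \<psi>"
proof (rule extensionalityI)
  fix F assume "F \<in> carrier P"
  then show "\<phi> F = \<psi> F"
    using alg_hom_eq_lin_ext[OF \<phi>, of F "\<lambda>z. \<psi> (monomial R N z)"]
      alg_hom_eq_lin_ext[OF \<psi>, of F "\<lambda>z. \<psi> (monomial R N z)"] assms(3) by simp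
qed (use alg_hom_simps(5)[OF \<phi>] alg_hom_simps(5)[OF \<psi>] in auto)

end

section \<open>Functoriality of monoid algebras in the monoid\<close>

locale monoid_alg_map = monoid_alg R N + N': monoid_alg R N'
  for R :: "('k, 'x) ring_scheme" and N :: "('n, 'y) monoid_scheme" and N' :: "('n1, 'y1) monoid_scheme" +
  fixes j assumes j: "j \<in> carrier N \<rightarrow> carrier N'"
begin

definition push where "push F = lin_ext R N (monoid_algebra R N') (\<lambda>z. monomial R N' (j z)) F"

lemma jm: "(\<lambda>z. monomial R N' (j z)) \<in> carrier N \<rightarrow> carrier (monoid_algebra R N')"
  using funcset_mem[OF j] by (intro funcsetI N'.monomial_closed)

sublocale target: monoid_alg_target R N "monoid_algebra R N'"
  by (intro monoid_alg_target.intro monoid_alg_axioms N'.algebra_P)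

lemma push_closed: "F \<in> carrier P \<Longrightarrow> push F \<in> carrier (monoid_algebra R N')"
  by (simp add: push_def target.lin_ext_closed jm)

text \<open>For a homomorphism \<open>j\<close>, \<open>push\<close> is the comorphism of the map
  that \<open>j\<close> induces from characters of \<open>N'\<close> to characters of
  \<open>N\<close>. Both sides are linear in \<open>F\<close> and agree on monomials.\<close>

lemma lin_ext_push:
  assumes A: "algebra R A" and h: "h \<in> carrier N' \<rightarrow> carrier A" and F: "F \<in> carrier P"
  shows "lin_ext R N' A h (push F) = lin_ext R N A (\<lambda>z. h (j z)) F"
proof -
  interpret A: monoid_alg_target R N A
    by (intro monoid_alg_target.intro monoid_alg_axioms A)
  interpret A': monoid_alg_target R N' A
    by (intro monoid_alg_target.intro N'.monoid_alg_axioms A)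
  show ?thesis
  proof (rule A.linear_eq_lin_ext[where \<phi> = "\<lambda>F. lin_ext R N' A h (push F)"])
    show "(\<lambda>z. h (j z)) \<in> carrier N \<rightarrow> carrier A"
      using h j by auto
    show "lin_ext R N' A h (push (monomial R N z)) = h (j z)" if "z \<in> carrier N" for z
      using that funcset_mem[OF j] unfolding push_def
      by (simp add: target.lin_ext_monomial[OF _ jm] A'.lin_ext_monomial[OF _ h])
  qed (use F h jm push_closed in \<open>simp_all add: push_def target.lin_ext_add target.lin_ext_smult
      A'.lin_ext_add A'.lin_ext_smult\<close>)
qed

text \<open>Reading off coefficients of \<open>push F\<close> is how identities between functions on
  diagonalisable groups become statements about exponents; injectivity keeps distinct monomials from
  colliding.\<close>

lemma push_coeff_inj:
  assumes inj: "inj_on j (carrier N)" and F: "F \<in> carrier P" and z: "z \<in> carrier N"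
  shows "push F (j z) = F z"
  using F
proof (induction rule: P_induct)
  case zero
  show ?case
    using z funcset_mem[OF j] by (simp add: push_def)
next
  case (step F r y)
  then have "push (F \<oplus>\<^bsub>P\<^esub> r \<odot>\<^bsub>P\<^esub> monomial R N y) =
    push F \<oplus>\<^bsub>monoid_algebra R N'\<^esub> r \<odot>\<^bsub>monoid_algebra R N'\<^esub> monomial R N' (j y)"
    using jm by (simp add: push_def target.lin_ext_add target.lin_ext_smult target.lin_ext_monomial)
  moreover have "j z \<in> carrier N'" "j z = j y \<longleftrightarrow> z = y"
    using inj z j step by (auto simp: inj_on_eq_iff)
  ultimately show ?case
    using step z by simp
qed

lemma push_coeff_outside:
  assumes y: "y \<in> carrier N'" "y \<notin> j ` carrier N" and F: "F \<in> carrier P"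
  shows "push F y = \<zero>\<^bsub>R\<^esub>"
  using F
proof (induction rule: P_induct)
  case zero
  show ?case
    using y by (simp add: push_def)
next
  case (step F r z)
  then have "push (F \<oplus>\<^bsub>P\<^esub> r \<odot>\<^bsub>P\<^esub> monomial R N z) =
    push F \<oplus>\<^bsub>monoid_algebra R N'\<^esub> r \<odot>\<^bsub>monoid_algebra R N'\<^esub> monomial R N' (j z)"
    using jm by (simp add: push_def target.lin_ext_add target.lin_ext_smult target.lin_ext_monomial)
  moreover have "y \<noteq> j z"
    using y step by auto
  ultimately show ?case
    using step y by simp
qed

end

section \<open>Test algebras in an infinite universe\<close>

text \<open>Transport of structure along an injection of the carrier alone. This is what moves a
  group algebra into the universe of test algebras.\<close>

lemma transport_algebra:
  fixes A :: "('k, 'a) module" and f :: "'a \<Rightarrow> 'b"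
  assumes A: "algebra R A" and inj: "inj_on f (carrier A)"
  obtains U :: "('k, 'b) module" and j k
  where "algebra R U" "j \<in> alg_hom R A U" "k \<in> alg_hom R U A"
    "\<And>a. a \<in> carrier A \<Longrightarrow> k (j a) = a" "\<And>u. u \<in> carrier U \<Longrightarrow> j (k u) = u"
proof -
  interpret A: algebra R A by (rule A)
  define g where "g = inv_into (carrier A) f"
  have gf [simp]: "g (f a) = a" if "a \<in> carrier A" for a
    using that inj by (simp add: g_def)
  define U :: "('k, 'b) module" where
    "U = \<lparr>carrier = f ` carrier A, monoid.mult = (\<lambda>x y. f (g x \<otimes>\<^bsub>A\<^esub> g y)), one = f \<one>\<^bsub>A\<^esub>,
      ring.zero = f \<zero>\<^bsub>A\<^esub>, ring.add = (\<lambda>x y. f (g x \<oplus>\<^bsub>A\<^esub> g y)), smult = (\<lambda>r x. f (r \<odot>\<^bsub>A\<^esub> g x))\<rparr>"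
  have neg: "\<exists>y \<in> carrier U. y \<oplus>\<^bsub>U\<^esub> x = \<zero>\<^bsub>U\<^esub>" if "x \<in> carrier U" for x
    using that by (intro bexI[of _ "f (\<ominus>\<^bsub>A\<^esub> g x)"]) (auto simp: U_def A.l_neg)
  have ag: "abelian_group U"
    by (rule abelian_groupI) (auto intro: neg, auto simp: U_def A.a_ac)
  have cm: "Group.comm_monoid U"
    by (rule comm_monoidI) (auto simp: U_def A.m_ac)
  have "cring U"
    by (rule cringI[OF ag cm]) (auto simp: U_def A.l_distr)
  then have U: "algebra R U"
    by (rule algebraI[OF A.R_cring])
      (auto simp: U_def A.smult_l_distr A.smult_r_distr A.smult_assoc1 A.smult_assoc2)
  show ?thesis
  proof (rule that[OF U, of "restrict f (carrier A)" "restrict g (f ` carrier A)"])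
    show "restrict f (carrier A) \<in> alg_hom R A U"
      by (auto simp: alg_hom_def U_def intro!: ring_hom_memI)
    show "restrict g (f ` carrier A) \<in> alg_hom R U A"
      by (auto simp: alg_hom_def U_def intro!: ring_hom_memI) (metis gf A.m_closed A.a_closed)+
  qed (auto simp: U_def)
qed

text \<open>Once \<open>N\<close> is enumerated, an element is determined by the graph of its
  restriction to the support, a finite subset of \<open>nat \<times> 'k\<close>; and an infinite set
  has no more finite subsets than elements. It is the type \<open>'k\<close> that is infinite; the
  ring itself may be finite.\<close>

lemma (in monoid_alg) inj_into_coefficients:
  assumes inf: "infinite (UNIV :: 'k set)" and count: "countable (carrier N)"
  shows "\<exists>f :: ('n \<Rightarrow> 'k) \<Rightarrow> 'k. inj_on f (carrier P)"
proof -
  define e where "e = to_nat_on (carrier N)"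
  have e: "inj_on e (carrier N)"
    unfolding e_def using count by (rule inj_on_to_nat_on)
  define c where "c F = (\<lambda>z. (e z, F z)) ` supp F" for F :: "'n \<Rightarrow> 'k"
  have "inj_on c (carrier P)"
  proof (rule inj_onI)
    fix F G assume F: "F \<in> carrier P" and G: "G \<in> carrier P" and eq: "c F = c G"
    have *: "G z = F z" if "z \<in> supp F" "c F = c G" for z and F G
    proof -
      have "(e z, F z) \<in> c G"
        using that by (auto simp: c_def)
      then show ?thesis
        using e that by (auto simp: c_def dest: inj_onD)
    qed
    show "F = G"
      by (rule P_eqI[OF F G]) (use *[OF _ eq] *[OF _ eq[symmetric]] in force)
  qed
  moreover have "c ` carrier P \<subseteq> Fpow (UNIV :: (nat \<times> 'k) set)"
    using P_finite_supp by (auto simp: Fpow_def c_def)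
  ultimately have "carrier P \<lesssim> Fpow (UNIV :: (nat \<times> 'k) set)"
    unfolding lepoll_def by blast
  also have "\<dots> \<approx> (UNIV :: (nat \<times> 'k) set)"
    by (rule eqpoll_Fpow) (use inf in \<open>simp add: finite_prod\<close>)
  also have "\<dots> \<lesssim> (UNIV :: 'k set)"
  proof -
    have "(UNIV :: nat set) \<times> (UNIV :: 'k set) \<lesssim> (UNIV :: 'k set) \<times> (UNIV :: 'k set)"
      using inf by (intro times_lepoll_mono) (auto simp: infinite_le_lepoll)
    also have "\<dots> \<approx> (UNIV :: 'k set)"
      unfolding eqpoll_iff_card_of_ordIso by (rule card_of_Times_same_infinite[OF inf])
    finally show ?thesis
      by simp
  qed
  finally show ?thesis
    unfolding lepoll_def by blast
qed

section \<open>The Yoneda argument for characters inside one universe\<close>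

locale universe =
  fixes R :: "'u ring"
  assumes R_cring: "cring R" and inf: "infinite (UNIV :: 'u set)"
begin

lemma AlgD: "A \<in> Alg R \<Longrightarrow> algebra R A"
  by (simp add: Alg_def)

text \<open>
  As \<open>'u\<close> is infinite, the group algebra of a countable group has a copy with carrier in \<open>'u\<close>. This
  makes the Yoneda argument available although only test algebras in \<open>'u\<close> are considered.
\<close>

lemma universal_character:
  fixes N :: "('n, 'y) monoid_scheme"
  assumes N: "comm_group N" "countable (carrier N)"
  shows "\<exists>U :: ('u, 'u) module. U \<in> Alg R \<and> (\<exists>u \<in> characters N U. \<exists>k \<in> alg_hom R U (monoid_algebra R N).
    (\<forall>z \<in> carrier N. k (u z) = monomial R N z) \<and>
    (\<forall>F \<in> carrier (monoid_algebra R N). k (lin_ext R N U u F) = F))"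
proof -
  interpret N: comm_group N by (rule N)
  interpret monoid_alg R N
    by (intro monoid_alg.intro R_cring N.comm_monoid_axioms)
  obtain f :: "('n \<Rightarrow> 'u) \<Rightarrow> 'u" where f: "inj_on f (carrier P)"
    using inj_into_coefficients[OF inf N(2)] by blast
  obtain U :: "('u, 'u) module" and j k where U: "algebra R U" and j: "j \<in> alg_hom R P U"
    and k: "k \<in> alg_hom R U P" and kj: "\<And>a. a \<in> carrier P \<Longrightarrow> k (j a) = a"
    by (rule transport_algebra[OF algebra_P f]) blast
  interpret group_alg_target R N U
    by (intro group_alg_target.intro monoid_alg_target.intro monoid_alg_axioms U N.comm_group_axioms)
  define u where "u = (\<lambda>z \<in> carrier N. j (monomial R N z))"
  have "u \<in> characters N U"
    unfolding u_def by (rule alg_hom_characters[OF j])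
  moreover have "k (lin_ext R N U u F) = F" if "F \<in> carrier P" for F
    using alg_hom_eq_lin_ext[OF j that, of u] kj[OF that] by (simp add: u_def)
  moreover have "k (u z) = monomial R N z" if "z \<in> carrier N" for z
    using that by (simp add: u_def kj)
  ultimately show ?thesis
    using k U unfolding Alg_def by blast
qed

text \<open>Yoneda: \<open>F\<close> is the value of \<open>f\<close> at the universal character,
  read in the group algebra. Every character \<open>h\<close> is the image of the universal one
  under \<open>l\<close> composed with \<open>k\<close>, and naturality carries the value
  along.\<close>

lemma natural_function_expansion:
  fixes N :: "('n, 'y) monoid_scheme"
  assumes N: "comm_group N" "countable (carrier N)"
    and f: "\<And>(A :: ('u, 'u) module) h. A \<in> Alg R \<Longrightarrow> h \<in> characters N A \<Longrightarrow> f A h \<in> carrier A"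
    and natural: "\<And>A B \<phi> h. \<lbrakk>A \<in> Alg R; B \<in> Alg R; \<phi> \<in> alg_hom R A B; h \<in> characters N A\<rbrakk>
      \<Longrightarrow> f B (compose (carrier N) \<phi> h) = \<phi> (f A h)"
  shows "\<exists>F \<in> carrier (monoid_algebra R N). \<forall>A \<in> Alg R. \<forall>h \<in> characters N A. f A h = lin_ext R N A h F"
proof -
  interpret N: comm_group N by (rule N)
  obtain U :: "('u, 'u) module" and u and k :: "'u \<Rightarrow> 'n \<Rightarrow> 'u" where U: "U \<in> Alg R" and u: "u \<in> characters N U"
    and k: "k \<in> alg_hom R U (monoid_algebra R N)" and ku: "\<forall>z \<in> carrier N. k (u z) = monomial R N z"
    using universal_character[OF N] by blast
  show ?thesis
  proof (intro bexI ballI)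
    show "k (f U u) \<in> carrier (monoid_algebra R N)"
      using f[OF U u] alg_hom_closed[OF k] by blast
    fix A :: "('u, 'u) module" and h assume A: "A \<in> Alg R" and h: "h \<in> characters N A"
    interpret group_alg_target R N A
      by (intro group_alg_target.intro monoid_alg_target.intro monoid_alg.intro AlgD[OF A]
          N.comm_group_axioms N.comm_monoid_axioms R_cring)
    define l where "l = (\<lambda>F \<in> carrier P. lin_ext R N A h F)"
    have l: "l \<in> alg_hom R P A"
      unfolding l_def by (rule lin_ext_characters[OF h])
    have comp: "compose (carrier U) l k \<in> alg_hom R U A"
      by (rule alg_hom_compose[OF k l AlgD[OF U]])
    have "compose (carrier N) (compose (carrier U) l k) u = h"
    proof (rule extensionalityI)
      fix z assume z: "z \<in> carrier N"
      have "h \<in> carrier N \<rightarrow> carrier A"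
        using characters_closed[OF h] by auto
      then show "compose (carrier N) (compose (carrier U) l k) u z = h z"
        using z characters_closed[OF u z] by (simp add: compose_def ku l_def lin_ext_monomial)
    qed (use h in auto)
    then have "f A h = compose (carrier U) l k (f U u)"
      using natural[OF U A comp u] by simp
    then show "f A h = lin_ext R N A h (k (f U u))"
      using f[OF U u] alg_hom_closed[OF k] by (simp add: compose_def l_def)
  qed
qed

text \<open>The universal character alone separates elements of the group algebra, because
  \<open>k\<close> undoes its linear extension.\<close>

lemma expansion_unique:
  fixes N :: "('n, 'y) monoid_scheme"
  assumes N: "comm_group N" "countable (carrier N)"
    and F: "F \<in> carrier (monoid_algebra R N)" and G: "G \<in> carrier (monoid_algebra R N)"
    and eq: "\<And>(A :: ('u, 'u) module) h. A \<in> Alg R \<Longrightarrow> h \<in> characters N A \<Longrightarrow> lin_ext R N A h F = lin_ext R N A h G"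
  shows "F = G"
proof -
  obtain U :: "('u, 'u) module" and u k where U: "U \<in> Alg R" and u: "u \<in> characters N U"
    and k: "\<forall>F \<in> carrier (monoid_algebra R N). k (lin_ext R N U u F) = F"
    using universal_character[OF N] by blast
  have "F = k (lin_ext R N U u F)"
    using k F by metis
  also have "\<dots> = k (lin_ext R N U u G)"
    unfolding eq[OF U u] ..
  also have "\<dots> = G"
    using k G by metis
  finally show ?thesis .
qed

end

section \<open>Idempotents and clopen subsets of the spectrum\<close>

text \<open>Krull: by Zorn there is an ideal maximal among those that contain \<open>I\<close> and
  avoid \<open>S\<close>, and maximality makes it prime. If neither \<open>a\<close> nor
  \<open>b\<close> lies in it, adjoining either one produces an element of \<open>S\<close>; the
  product of these two elements would lie in the ideal as soon as \<open>a \<otimes> b\<close>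
  does.\<close>

lemma (in cring) prime_avoiding:
  assumes I: "ideal I R" and S: "S \<subseteq> carrier R" "\<one> \<in> S" "\<And>x y. x \<in> S \<Longrightarrow> y \<in> S \<Longrightarrow> x \<otimes> y \<in> S"
    and disj: "I \<inter> S = {}"
  shows "\<exists>Q. primeideal Q R \<and> I \<subseteq> Q \<and> Q \<inter> S = {}"
proof -
  define \<A> where "\<A> = {J. ideal J R \<and> I \<subseteq> J \<and> J \<inter> S = {}}"
  have "\<exists>Q \<in> \<A>. \<forall>Y \<in> \<A>. Q \<subseteq> Y \<longrightarrow> Y = Q"
  proof (rule subset_Zorn_nonempty)
    show "\<A> \<noteq> {}"
      using I disj by (auto simp: \<A>_def)
    fix C assume C: "C \<noteq> {}" "subset.chain \<A> C"
    then have "subset.chain {I. ideal I R} C" "C \<subseteq> \<A>"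
      by (auto simp: pred_on.chain_def \<A>_def)
    then show "\<Union>C \<in> \<A>"
      using C(1) chain_Union_is_ideal[of C] by (auto simp: \<A>_def)
  qed
  then obtain Q where QA: "Q \<in> \<A>" and max': "\<forall>Y \<in> \<A>. Q \<subseteq> Y \<longrightarrow> Y = Q" ..
  have Q: "ideal Q R" "I \<subseteq> Q" "Q \<inter> S = {}"
    using QA by (simp_all add: \<A>_def)
  have max: "Y = Q" if "ideal Y R" "Q \<subseteq> Y" "Y \<inter> S = {}" for Y
  proof -
    have "Y \<in> \<A>"
      unfolding \<A>_def using that Q(2) by auto
    then show ?thesis
      using max' that(2) by auto
  qed
  interpret Q: ideal Q R by (rule Q)
  have meets: "\<exists>q \<in> Q. \<exists>r \<in> carrier R. q \<oplus> r \<otimes> a \<in> S" if a: "a \<in> carrier R" "a \<notin> Q" for a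
  proof -
    have id: "ideal (Q <+>\<^bsub>R\<^esub> PIdl a) R"
      by (rule add_ideals[OF Q(1) cgenideal_ideal[OF a(1)]])
    have aP: "a \<in> PIdl a"
      by (rule cgenideal_self[OF a(1)])
    have zP: "\<zero> \<in> PIdl a"
      using ideal.axioms(1)[OF cgenideal_ideal[OF a(1)]] by (simp add: additive_subgroup.zero_closed)
    have "Q \<subseteq> Q <+>\<^bsub>R\<^esub> PIdl a"
    proof
      fix q assume q: "q \<in> Q"
      then have "q = q \<oplus> \<zero>"
        using Q.a_subset by auto
      then show "q \<in> Q <+>\<^bsub>R\<^esub> PIdl a"
        using q zP unfolding set_add_def' by blast
    qed
    moreover have "a \<in> Q <+>\<^bsub>R\<^esub> PIdl a"
    proof -
      have "a = \<zero> \<oplus> a"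
        using a(1) by simp
      then show ?thesis
        using aP Q.zero_closed unfolding set_add_def' by blast
    qed
    ultimately have "(Q <+>\<^bsub>R\<^esub> PIdl a) \<inter> S \<noteq> {}"
      using max[OF id] a(2) by metis
    then obtain q b where qb: "q \<in> Q" "b \<in> PIdl a" "q \<oplus> b \<in> S"
      unfolding set_add_def' by blast
    then obtain r where "r \<in> carrier R" "b = r \<otimes> a"
      unfolding cgenideal_def by blast
    then show ?thesis
      using qb by metis
  qed
  have "primeideal Q R"
  proof (rule primeidealI[OF Q(1) is_cring])
    show "carrier R \<noteq> Q"
      using Q(3) S by auto
    fix a b assume ab: "a \<in> carrier R" "b \<in> carrier R" "a \<otimes> b \<in> Q"
    show "a \<in> Q \<or> b \<in> Q"
    proof (rule ccontr)
      assume "\<not> (a \<in> Q \<or> b \<in> Q)"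
      then obtain q r q' r' where q: "q \<in> Q" "r \<in> carrier R" "q \<oplus> r \<otimes> a \<in> S"
        "q' \<in> Q" "r' \<in> carrier R" "q' \<oplus> r' \<otimes> b \<in> S"
        using meets[OF ab(1)] meets[OF ab(2)] by metis
      then have c: "q \<in> carrier R" "q' \<in> carrier R"
        using Q.a_subset by auto
      have "(q \<oplus> r \<otimes> a) \<otimes> (q' \<oplus> r' \<otimes> b) =
        q \<otimes> (q' \<oplus> r' \<otimes> b) \<oplus> ((r \<otimes> a) \<otimes> q' \<oplus> (r \<otimes> r') \<otimes> (a \<otimes> b))"
        using c q ab by (simp add: l_distr r_distr m_ac a_ac)
      also have "\<dots> \<in> Q"
        using Q.I_r_closed[OF q(1), of "q' \<oplus> r' \<otimes> b"] Q.I_l_closed[OF q(4), of "r \<otimes> a"]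
          Q.I_l_closed[OF ab(3), of "r \<otimes> r'"] q(2,5) ab c by (simp add: Q.a_closed)
      finally show False
        using S(3)[OF q(3) q(6)] Q(3) by auto
    qed
  qed
  then show ?thesis
    using Q by blast
qed

text \<open>If no power of \<open>a\<close> vanishes, the zero ideal avoids the powers of
  \<open>a\<close>, and so does some prime.\<close>

lemma (in cring) in_all_primes_nilpotent:
  assumes a: "a \<in> carrier R" and prime: "\<And>Q. Q \<in> spec R \<Longrightarrow> a \<in> Q"
  shows "\<exists>n :: nat. a [^] n = \<zero>"
proof (rule ccontr)
  assume no: "\<nexists>n :: nat. a [^] n = \<zero>"
  have "\<exists>Q. primeideal Q R \<and> {\<zero>} \<subseteq> Q \<and> Q \<inter> range (\<lambda>n :: nat. a [^] n) = {}"
  proof (rule prime_avoiding[OF zeroideal])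
    show "\<one> \<in> range (\<lambda>n :: nat. a [^] n)"
      by (rule range_eqI[of _ _ 0]) simp
    show "x \<otimes> y \<in> range (\<lambda>n :: nat. a [^] n)"
      if "x \<in> range (\<lambda>n :: nat. a [^] n)" "y \<in> range (\<lambda>n :: nat. a [^] n)" for x y
      using that a by (auto simp: nat_pow_mult)
  qed (use a no in auto)
  then obtain Q where Q: "Q \<in> spec R" "Q \<inter> range (\<lambda>n :: nat. a [^] n) = {}"
    by (auto simp: spec_def)
  moreover have "a = a [^] (1 :: nat)"
    using a by simp
  ultimately show False
    using prime[OF Q(1)] by blast
qed

lemma (in cring) idempotent_in_all_primes:
  assumes e: "e \<in> carrier R" "e \<otimes> e = e" and prime: "\<And>Q. Q \<in> spec R \<Longrightarrow> e \<in> Q"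
  shows "e = \<zero>"
proof -
  obtain n :: nat where n: "e [^] n = \<zero>"
    using in_all_primes_nilpotent[OF e(1) prime] by blast
  have pow: "e [^] Suc m = e" for m :: nat
    using e by (induction m) auto
  have "e [^] Suc n = \<zero>"
    using n e by simp
  then show ?thesis
    using pow by simp
qed

lemma (in cring) ideal_proper_prime:
  assumes I: "ideal I R" and "\<one> \<notin> I"
  shows "\<exists>Q \<in> spec R. I \<subseteq> Q"
  using prime_avoiding[OF I, of "{\<one>}"] assms(2) by (auto simp: spec_def)

lemma (in cring) comaximal:
  assumes I: "ideal I R" and J: "ideal J R" and no: "\<And>Q. Q \<in> spec R \<Longrightarrow> I \<subseteq> Q \<Longrightarrow> J \<subseteq> Q \<Longrightarrow> False"
  obtains x y where "x \<in> I" "y \<in> J" "x \<oplus> y = \<one>"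
proof -
  interpret I: ideal I R by (rule I)
  interpret J: ideal J R by (rule J)
  have l: "x \<in> I <+>\<^bsub>R\<^esub> J" if "x \<in> I" for x
  proof -
    have "x = x \<oplus> \<zero>"
      using that I.a_subset by auto
    then show ?thesis
      using that J.zero_closed unfolding set_add_def' by blast
  qed
  have r: "x \<in> I <+>\<^bsub>R\<^esub> J" if "x \<in> J" for x
  proof -
    have "x = \<zero> \<oplus> x"
      using that J.a_subset by auto
    then show ?thesis
      using that I.zero_closed unfolding set_add_def' by blast
  qed
  have "\<one> \<in> I <+>\<^bsub>R\<^esub> J"
  proof (rule ccontr)
    assume "\<one> \<notin> I <+>\<^bsub>R\<^esub> J"
    then obtain Q where "Q \<in> spec R" "I <+>\<^bsub>R\<^esub> J \<subseteq> Q"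
      using ideal_proper_prime[OF add_ideals[OF I J]] by blast
    then show False
      using no[of Q] l r by auto
  qed
  then obtain x y where "x \<in> I" "y \<in> J" "x \<oplus> y = \<one>"
    unfolding set_add_def' by (metis (no_types, lifting) UN_E singletonD)
  then show ?thesis
    by (rule that)
qed

lemma (in cring) spec_mem:
  assumes "Q \<in> spec R" "a \<in> carrier R" "b \<in> carrier R"
  shows "a \<otimes> b \<in> Q \<longleftrightarrow> a \<in> Q \<or> b \<in> Q" "\<one> \<notin> Q" "\<zero> \<in> Q" "a \<in> Q \<Longrightarrow> b \<in> Q \<Longrightarrow> a \<oplus> b \<in> Q"
    "a [^] Suc n \<in> Q \<longleftrightarrow> a \<in> Q"
proof -
  interpret Q: primeideal Q R
    using assms by (simp add: spec_def)
  show 1: "a \<otimes> b \<in> Q \<longleftrightarrow> a \<in> Q \<or> b \<in> Q"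
    using assms Q.I_prime Q.I_l_closed Q.I_r_closed by blast
  show "\<one> \<notin> Q"
    using Q.I_notcarr Q.one_imp_carrier by auto
  show "a [^] Suc n \<in> Q \<longleftrightarrow> a \<in> Q"
  proof (induction n)
    case (Suc n)
    then show ?case
      using assms Q.I_prime[of "a [^] Suc n" a] Q.I_l_closed[of a "a [^] Suc n"] by auto
  qed (use assms in simp)
qed (use assms in \<open>auto simp: spec_def primeideal_def ideal_def additive_subgroup.zero_closed additive_subgroup.a_closed\<close>)

section \<open>The Zariski topology and the idempotents of clopen sets\<close>

lemma (in cring) topspace_zariski: "topspace (zariski R) = spec R"
proof -
  have "spec R \<subseteq> \<Union>{{P \<in> spec R. a \<notin> P} | a. a \<in> carrier R}"
    using spec_mem(2)[OF _ one_closed one_closed] by blast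
  then show ?thesis
    by (auto simp: zariski_def)
qed

text \<open>The generating sets \<open>D(a)\<close> are closed under intersection, as
  \<open>D(a) \<inter> D(b) = D(ab)\<close>, hence they form a basis and not merely a
  subbasis.\<close>

lemma (in cring) zariski_basic:
  assumes "openin (zariski R) U" "Q \<in> U"
  shows "\<exists>a \<in> carrier R. a \<notin> Q \<and> {Q \<in> spec R. a \<notin> Q} \<subseteq> U"
proof -
  have "generate_topology_on {{P \<in> spec R. a \<notin> P} | a. a \<in> carrier R} U"
    using assms(1) unfolding zariski_def by (rule openin_topology_generated_by)
  \<comment> \<open>Membership of \<open>Q\<close> in the spectrum is carried along in the
    induction, because the case of an intersection uses that \<open>Q\<close> is prime.\<close>
  then have "\<forall>Q \<in> U. \<exists>a \<in> carrier R. a \<notin> Q \<and> {Q \<in> spec R. a \<notin> Q} \<subseteq> U \<and> Q \<in> spec R"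
  proof (induction rule: generate_topology_on.induct)
    case Empty
    show ?case
      by simp
  next
    case (Int U V)
    show ?case
    proof
      fix Q assume "Q \<in> U \<inter> V"
      then have UV: "Q \<in> U" "Q \<in> V"
        by auto
      from bspec[OF Int.IH(1) UV(1)] obtain a where
        a: "a \<in> carrier R" "a \<notin> Q" "{Q \<in> spec R. a \<notin> Q} \<subseteq> U" "Q \<in> spec R"
        by (elim bexE conjE)
      from bspec[OF Int.IH(2) UV(2)] obtain b where
        b: "b \<in> carrier R" "b \<notin> Q" "{Q \<in> spec R. b \<notin> Q} \<subseteq> V"
        by (elim bexE conjE)
      note ab = a(4,1,2,3) b
      have "a \<otimes> b \<notin> Q"
        using spec_mem(1)[OF ab(1,2,5)] ab by simp
      moreover have "{Q \<in> spec R. a \<otimes> b \<notin> Q} \<subseteq> U \<inter> V"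
      proof
        fix Q assume "Q \<in> {Q \<in> spec R. a \<otimes> b \<notin> Q}"
        then have "Q \<in> {Q \<in> spec R. a \<notin> Q}" "Q \<in> {Q \<in> spec R. b \<notin> Q}"
          using spec_mem(1)[OF _ ab(2,5)] by auto
        then show "Q \<in> U \<inter> V"
          using ab(4,7) by auto
      qed
      ultimately show "\<exists>a \<in> carrier R. a \<notin> Q \<and> {Q \<in> spec R. a \<notin> Q} \<subseteq> U \<inter> V \<and> Q \<in> spec R"
        using ab by (intro bexI[of _ "a \<otimes> b"]) auto
    qed
  next
    case (UN K)
    show ?case
    proof
      fix Q assume "Q \<in> \<Union>K"
      then obtain k where k: "k \<in> K" "Q \<in> k"
        by auto
      from bspec[OF UN.IH[OF k(1)] k(2)] obtain a where
        "a \<in> carrier R" "a \<notin> Q" "{Q \<in> spec R. a \<notin> Q} \<subseteq> k" "Q \<in> spec R"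
        by (elim bexE conjE)
      then show "\<exists>a \<in> carrier R. a \<notin> Q \<and> {Q \<in> spec R. a \<notin> Q} \<subseteq> \<Union>K \<and> Q \<in> spec R"
        using k(1) by (intro bexI[of _ a]) auto
    qed
  next
    case (Basis s)
    then obtain a where "s = {P \<in> spec R. a \<notin> P}" "a \<in> carrier R"
      by auto
    then show ?case
      by (intro ballI bexI[of _ a]) auto
  qed
  then show ?thesis
    using assms(2) by meson
qed

lemma (in cring) zariski_open_basic: "a \<in> carrier R \<Longrightarrow> openin (zariski R) {Q \<in> spec R. a \<notin> Q}"
  unfolding zariski_def by (rule topology_generated_by_Basis) auto

text \<open>Meaningful for clopen \<open>U\<close>, where exactly one idempotent avoids precisely
  the primes in \<open>U\<close>.\<close>

definition idem_of :: "('a, 'x) ring_scheme \<Rightarrow> 'a set set \<Rightarrow> 'a" where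
  "idem_of A U = (THE e. e \<in> carrier A \<and> e \<otimes>\<^bsub>A\<^esub> e = e \<and> (\<forall>Q \<in> spec A. e \<notin> Q \<longleftrightarrow> Q \<in> U))"

lemma (in cring) ideal_Inter_spec:
  assumes "V \<subseteq> spec R"
  shows "ideal {a \<in> carrier R. \<forall>Q \<in> V. a \<in> Q} R"
proof -
  have "{a \<in> carrier R. \<forall>Q \<in> V. a \<in> Q} = \<Inter>(insert (carrier R) V)"
    by auto
  moreover have "ideal (\<Inter>(insert (carrier R) V)) R"
    by (rule i_Intersect) (use assms oneideal in \<open>auto simp: spec_def primeideal_def\<close>)
  ultimately show ?thesis
    by simp
qed

lemma (in cring) one_minus_idempotent:
  assumes "e \<in> carrier R" "e \<otimes> e = e"
  shows "e \<otimes> (\<one> \<ominus> e) = \<zero>" "(\<one> \<ominus> e) \<otimes> (\<one> \<ominus> e) = \<one> \<ominus> e"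
proof -
  show 0: "e \<otimes> (\<one> \<ominus> e) = \<zero>"
    using assms by (simp add: minus_eq r_distr r_minus r_neg)
  have "(\<one> \<ominus> e) \<otimes> (\<one> \<ominus> e) = (\<one> \<ominus> e) \<ominus> e \<otimes> (\<one> \<ominus> e)"
    using assms by (simp add: minus_eq l_distr l_minus)
  then show "(\<one> \<ominus> e) \<otimes> (\<one> \<ominus> e) = \<one> \<ominus> e"
    using assms 0 by (simp add: minus_eq)
qed

lemma (in cring) idempotent_spec:
  assumes e: "e \<in> carrier R" "e \<otimes> e = e" and Q: "Q \<in> spec R"
  shows "\<one> \<ominus> e \<in> Q \<longleftrightarrow> e \<notin> Q"
proof -
  have "(\<one> \<ominus> e) \<oplus> e = \<one>"
    using e by (simp add: minus_eq a_assoc l_neg)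
  then have "\<not> (\<one> \<ominus> e \<in> Q \<and> e \<in> Q)"
    using spec_mem(2,4)[OF Q, of "\<one> \<ominus> e" e] e by auto
  moreover have "e \<in> Q \<or> \<one> \<ominus> e \<in> Q"
    using spec_mem(1,3)[OF Q, of e "\<one> \<ominus> e"] e one_minus_idempotent[OF e] by auto
  ultimately show ?thesis
    by blast
qed

text \<open>An idempotent that lies in every prime is zero. Applied to \<open>e (1 - e')\<close> and
  to \<open>e' (1 - e)\<close> this gives \<open>e = e e' = e'\<close>.\<close>

lemma (in cring) idempotent_eqI:
  assumes e: "e \<in> carrier R" "e \<otimes> e = e" and e': "e' \<in> carrier R" "e' \<otimes> e' = e'"
    and eq: "\<And>Q. Q \<in> spec R \<Longrightarrow> e \<in> Q \<longleftrightarrow> e' \<in> Q"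
  shows "e = e'"
proof -
  have *: "e \<otimes> (\<one> \<ominus> e') = \<zero>"
    if e: "e \<in> carrier R" "e \<otimes> e = e" and e': "e' \<in> carrier R" "e' \<otimes> e' = e'"
      and eq: "\<And>Q. Q \<in> spec R \<Longrightarrow> e \<in> Q \<longleftrightarrow> e' \<in> Q" for e e'
  proof (rule idempotent_in_all_primes)
    show "(e \<otimes> (\<one> \<ominus> e')) \<otimes> (e \<otimes> (\<one> \<ominus> e')) = e \<otimes> (\<one> \<ominus> e')"
    proof -
      have "(e \<otimes> (\<one> \<ominus> e')) \<otimes> (e \<otimes> (\<one> \<ominus> e')) = (e \<otimes> e) \<otimes> ((\<one> \<ominus> e') \<otimes> (\<one> \<ominus> e'))"
        using e(1) e'(1) by (simp add: m_ac)
      then show ?thesis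
        using e(2) one_minus_idempotent(2)[OF e'] by simp
    qed
    show "e \<otimes> (\<one> \<ominus> e') \<in> Q" if Q: "Q \<in> spec R" for Q
      using spec_mem(1)[OF Q, of e "\<one> \<ominus> e'"] idempotent_spec[OF e' Q] eq[OF Q] e(1) e'(1) by auto
  qed (use e e' in auto)
  have **: "a = a \<otimes> b" if "a \<otimes> (\<one> \<ominus> b) = \<zero>" "a \<in> carrier R" "b \<in> carrier R" for a b
  proof -
    have "a \<ominus> a \<otimes> b = \<zero>"
      using that by (simp add: minus_eq r_distr r_minus)
    then show ?thesis
      using that(2,3) by simp
  qed
  have "e = e \<otimes> e'"
    by (rule **[OF *[OF e e' eq] e(1) e'(1)])
  also have "\<dots> = e' \<otimes> e"
    using e(1) e'(1) by (rule m_comm)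
  also have "\<dots> = e'"
    by (rule **[OF *[OF e' e eq[symmetric]] e'(1) e(1), symmetric])
  finally show ?thesis .
qed

text \<open>The elements vanishing outside \<open>U\<close> and those vanishing on \<open>U\<close>
  form comaximal ideals, so \<open>1 = x + y\<close> with \<open>x y\<close> in every prime, hence
  nilpotent. Raising \<open>x\<close> and \<open>y\<close> to a power makes the product zero and
  keeps them comaximal; a decomposition \<open>1 = x' + y'\<close> with \<open>x' y' = 0\<close>
  makes \<open>x'\<close> idempotent.\<close>

lemma (in cring) clopen_idempotent:
  assumes U: "openin (zariski R) U" "openin (zariski R) (spec R - U)"
  shows "\<exists>!e. e \<in> carrier R \<and> e \<otimes> e = e \<and> (\<forall>Q \<in> spec R. e \<notin> Q \<longleftrightarrow> Q \<in> U)"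
proof (rule ex_ex1I)
  have sub: "U \<subseteq> spec R"
    using openin_subset[OF U(1)] by (simp add: topspace_zariski)
  define I where "I = {a \<in> carrier R. \<forall>Q \<in> spec R - U. a \<in> Q}"
  define J where "J = {a \<in> carrier R. \<forall>Q \<in> U. a \<in> Q}"
  have id: "ideal I R" "ideal J R"
    unfolding I_def J_def using sub by (auto intro!: ideal_Inter_spec)
  obtain x y where xy: "x \<in> I" "y \<in> J" "x \<oplus> y = \<one>"
  proof (rule comaximal[OF id])
    fix Q assume Q: "Q \<in> spec R" "I \<subseteq> Q" "J \<subseteq> Q"
    show False
    proof (cases "Q \<in> U")
      case True
      then show ?thesis
        using zariski_basic[OF U(1) True] Q by (auto simp: I_def)
    next
      case False
      then have "Q \<in> spec R - U"
        using Q by auto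
      then show ?thesis
        using zariski_basic[OF U(2)] Q sub by (force simp: J_def)
    qed
  qed
  have c: "x \<in> carrier R" "y \<in> carrier R"
    using xy by (auto simp: I_def J_def)
  have "x \<otimes> y \<in> Q" if "Q \<in> spec R" for Q
    using that xy spec_mem(1)[OF that] c by (auto simp: I_def J_def)
  then obtain n :: nat where n: "(x \<otimes> y) [^] n = \<zero>"
    using in_all_primes_nilpotent c by (meson m_closed)
  \<comment> \<open>The exponent \<open>Suc n\<close> is positive even if \<open>n\<close> is 0, so
    that a prime contains the power exactly if it contains the element.\<close>
  have pc: "x [^] Suc n \<in> carrier R" "y [^] Suc n \<in> carrier R"
    using c by auto
  obtain x' y' where xy': "x' \<in> PIdl (x [^] Suc n)" "y' \<in> PIdl (y [^] Suc n)" "x' \<oplus> y' = \<one>"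
  proof (rule comaximal[OF cgenideal_ideal[OF pc(1)] cgenideal_ideal[OF pc(2)]])
    fix Q assume Q: "Q \<in> spec R" "PIdl (x [^] Suc n) \<subseteq> Q" "PIdl (y [^] Suc n) \<subseteq> Q"
    then have "x \<in> Q" "y \<in> Q"
      using cgenideal_self pc spec_mem(5)[OF Q(1)] c by (meson in_mono)+
    then show False
      using spec_mem(2,4)[OF Q(1) c] xy(3) by simp
  qed
  obtain r s where rs: "r \<in> carrier R" "s \<in> carrier R" "x' = r \<otimes> x [^] Suc n" "y' = s \<otimes> y [^] Suc n"
    using xy'(1,2) unfolding cgenideal_def by blast
  have c': "x' \<in> carrier R" "y' \<in> carrier R"
    using rs pc by auto
  have "x' \<otimes> y' = (r \<otimes> s) \<otimes> (x [^] Suc n \<otimes> y [^] Suc n)"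
    using rs pc by (simp add: m_ac del: nat_pow_Suc)
  also have "x [^] Suc n \<otimes> y [^] Suc n = (x \<otimes> y) [^] Suc n"
    using c by (simp only: nat_pow_distrib)
  also have "\<dots> = \<zero>"
    using n c by simp
  finally have 0: "x' \<otimes> y' = \<zero>"
    using rs by simp
  have "x' = x' \<otimes> (x' \<oplus> y')"
    using xy'(3) c' by simp
  also have "\<dots> = x' \<otimes> x'"
    using c' 0 by (simp add: r_distr)
  finally have id: "x' \<otimes> x' = x'"
    by simp
  have "x' \<notin> Q \<longleftrightarrow> Q \<in> U" if Q: "Q \<in> spec R" for Q
  proof
    assume "x' \<notin> Q"
    then have "x \<notin> Q"
      using spec_mem(1)[OF Q rs(1) pc(1)] spec_mem(5)[OF Q c(1) c(1), of n] rs(3) by simp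
    then show "Q \<in> U"
      using xy(1) Q by (auto simp: I_def)
  next
    assume "Q \<in> U"
    then have "y \<in> Q"
      using xy(2) by (auto simp: J_def)
    then have "y' \<in> Q"
      using spec_mem(1)[OF Q rs(2) pc(2)] spec_mem(5)[OF Q c(2) c(2), of n] rs(4) by simp
    then show "x' \<notin> Q"
      using spec_mem(2,4)[OF Q c'] xy'(3) by auto
  qed
  then show "\<exists>e. e \<in> carrier R \<and> e \<otimes> e = e \<and> (\<forall>Q \<in> spec R. e \<notin> Q \<longleftrightarrow> Q \<in> U)"
    using c' id by blast
next
  fix e e' assume e: "e \<in> carrier R \<and> e \<otimes> e = e \<and> (\<forall>Q \<in> spec R. e \<notin> Q \<longleftrightarrow> Q \<in> U)"
    and e': "e' \<in> carrier R \<and> e' \<otimes> e' = e' \<and> (\<forall>Q \<in> spec R. e' \<notin> Q \<longleftrightarrow> Q \<in> U)"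
  show "e = e'"
  proof (rule idempotent_eqI)
    fix Q assume Q: "Q \<in> spec R"
    have "e \<notin> Q \<longleftrightarrow> Q \<in> U" "e' \<notin> Q \<longleftrightarrow> Q \<in> U"
      using e e' Q by simp_all
    then show "e \<in> Q \<longleftrightarrow> e' \<in> Q"
      by metis
  qed (use e e' in simp_all)
qed

lemma (in cring) idem_of:
  assumes U: "openin (zariski R) U" "openin (zariski R) (spec R - U)"
  shows "idem_of R U \<in> carrier R" "idem_of R U \<otimes> idem_of R U = idem_of R U"
    "Q \<in> spec R \<Longrightarrow> idem_of R U \<notin> Q \<longleftrightarrow> Q \<in> U"
  using theI'[OF clopen_idempotent[OF U]] unfolding idem_of_def by simp_all

lemma (in cring) idem_of_eqI:
  assumes U: "openin (zariski R) U" "openin (zariski R) (spec R - U)"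
    and e: "e \<in> carrier R" "e \<otimes> e = e" "\<And>Q. Q \<in> spec R \<Longrightarrow> e \<notin> Q \<longleftrightarrow> Q \<in> U"
  shows "idem_of R U = e"
proof (rule idempotent_eqI)
  fix Q assume "Q \<in> spec R"
  then show "idem_of R U \<in> Q \<longleftrightarrow> e \<in> Q"
    using idem_of(3)[OF U, of Q] e(3)[of Q] by metis
qed (use idem_of(1,2)[OF U] e(1,2) in simp_all)

text \<open>The loci where \<open>e\<close> and \<open>1 - e\<close> do not vanish are open and
  disjoint and cover the spectrum.\<close>

lemma (in cring) connected_idempotent:
  assumes conn: "connected_spec R" and e: "e \<in> carrier R" "e \<otimes> e = e"
  shows "e = \<zero> \<or> e = \<one>"
proof -
  have e': "\<one> \<ominus> e \<in> carrier R"
    using e by simp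
  have "{Q \<in> spec R. e \<notin> Q} = {} \<or> {Q \<in> spec R. \<one> \<ominus> e \<notin> Q} = {}"
  proof (rule ccontr)
    assume "\<not> ?thesis"
    moreover have "topspace (zariski R) \<subseteq> {Q \<in> spec R. e \<notin> Q} \<union> {Q \<in> spec R. \<one> \<ominus> e \<notin> Q}"
      "{Q \<in> spec R. e \<notin> Q} \<inter> {Q \<in> spec R. \<one> \<ominus> e \<notin> Q} = {}"
      using idempotent_spec[OF e] by (auto simp: topspace_zariski)
    ultimately show False
      using conn zariski_open_basic[OF e(1)] zariski_open_basic[OF e']
      unfolding connected_spec_def connected_space_def by blast
  qed
  then show ?thesis
  proof
    assume "{Q \<in> spec R. e \<notin> Q} = {}"
    then show ?thesis
      using idempotent_in_all_primes[OF e] by auto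
  next
    assume "{Q \<in> spec R. \<one> \<ominus> e \<notin> Q} = {}"
    then have "\<one> \<ominus> e = \<zero>"
      using idempotent_in_all_primes[OF e' one_minus_idempotent(2)[OF e]] by auto
    then show ?thesis
      using e by simp
  qed
qed

lemma (in cring) connected_nontrivial:
  assumes "connected_spec R"
  shows "\<one> \<noteq> \<zero>"
proof -
  obtain Q where Q: "Q \<in> spec R"
    using assms by (auto simp: connected_spec_def)
  show ?thesis
    using spec_mem(2,3)[OF Q zero_closed zero_closed] by metis
qed

lemma spec_map_spec:
  assumes A: "algebra R A" and B: "algebra R B" and f: "f \<in> alg_hom R A B" and Q: "Q \<in> spec B"
  shows "spec_map A f Q \<in> spec A"
proof -
  interpret A: algebra R A by (rule A)
  interpret B: algebra R B by (rule B)
  interpret Q: primeideal Q B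
    using Q by (simp add: spec_def)
  interpret f: ring_hom_cring A B f
    using f by (intro ring_hom_cring.intro ring_hom_cring_axioms.intro A.M_cring B.M_cring) (simp add: alg_hom_def)
  have c: "f a \<in> carrier B" if "a \<in> carrier A" for a
    using that by simp
  have "ideal (spec_map A f Q) A"
  proof (rule idealI[OF A.ring_axioms])
    show "subgroup (spec_map A f Q) (add_monoid A)"
    proof (rule group.subgroupI[OF A.a_group])
      show "spec_map A f Q \<noteq> {}"
        using Q.zero_closed unfolding spec_map_def by (metis (mono_tags, lifting) A.zero_closed empty_iff f.hom_zero mem_Collect_eq)
    next
      fix a assume "a \<in> spec_map A f Q"
      then show "inv\<^bsub>add_monoid A\<^esub> a \<in> spec_map A f Q"
        using Q.a_inv_closed[of "f a"] by (simp add: spec_map_def a_inv_def[symmetric])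
    next
      fix a b assume "a \<in> spec_map A f Q" "b \<in> spec_map A f Q"
      then show "a \<otimes>\<^bsub>add_monoid A\<^esub> b \<in> spec_map A f Q"
        using Q.a_closed[of "f a" "f b"] by (simp add: spec_map_def)
    qed (simp add: spec_map_def)
  qed (simp_all add: spec_map_def Q.I_l_closed Q.I_r_closed)
  then have "primeideal (spec_map A f Q) A"
  proof (rule primeidealI[OF _ A.M_cring])
    have "\<one>\<^bsub>A\<^esub> \<notin> spec_map A f Q"
      using Q.I_notcarr Q.one_imp_carrier by (auto simp: spec_map_def)
    then show "carrier A \<noteq> spec_map A f Q"
      using A.one_closed by metis
    show "a \<in> spec_map A f Q \<or> b \<in> spec_map A f Q"
      if "a \<in> carrier A" "b \<in> carrier A" "a \<otimes>\<^bsub>A\<^esub> b \<in> spec_map A f Q" for a b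
      using that Q.I_prime[of "f a" "f b"] by (simp add: spec_map_def)
  qed
  then show ?thesis
    by (simp add: spec_def)
qed

text \<open>The factor \<open>eA\<close> of \<open>A\<close> cut out by an idempotent \<open>e\<close>; its unit element is \<open>e\<close>.\<close>

definition corner :: "('k, 'a) module \<Rightarrow> 'a \<Rightarrow> ('k, 'a) module" where
  "corner A e = A\<lparr>carrier := {a \<in> carrier A. e \<otimes>\<^bsub>A\<^esub> a = a}, one := e\<rparr>"

definition corner_map :: "('k, 'a) module \<Rightarrow> 'a \<Rightarrow> 'a \<Rightarrow> 'a" where
  "corner_map A e = (\<lambda>a \<in> carrier A. e \<otimes>\<^bsub>A\<^esub> a)"

lemma corner_simps [simp]:
  "a \<in> carrier (corner A e) \<longleftrightarrow> a \<in> carrier A \<and> e \<otimes>\<^bsub>A\<^esub> a = a"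
  "\<one>\<^bsub>corner A e\<^esub> = e" "a \<otimes>\<^bsub>corner A e\<^esub> b = a \<otimes>\<^bsub>A\<^esub> b" "a \<oplus>\<^bsub>corner A e\<^esub> b = a \<oplus>\<^bsub>A\<^esub> b"
  "\<zero>\<^bsub>corner A e\<^esub> = \<zero>\<^bsub>A\<^esub>" "r \<odot>\<^bsub>corner A e\<^esub> a = r \<odot>\<^bsub>A\<^esub> a"
  by (simp_all add: corner_def)

lemma algebra_smult_assoc3:
  assumes "algebra R A" "r \<in> carrier R" "x \<in> carrier A" "y \<in> carrier A"
  shows "x \<otimes>\<^bsub>A\<^esub> (r \<odot>\<^bsub>A\<^esub> y) = r \<odot>\<^bsub>A\<^esub> (x \<otimes>\<^bsub>A\<^esub> y)"
proof -
  interpret A: algebra R A by (rule assms(1))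
  show ?thesis
    using A.smult_assoc2[OF assms(2,4,3)] assms(2-4) by (simp add: A.m_comm)
qed

lemma corner_algebra:
  assumes A: "algebra R A" and e: "e \<in> carrier A" "e \<otimes>\<^bsub>A\<^esub> e = e"
  shows "algebra R (corner A e)"
proof -
  interpret A: algebra R A by (rule A)
  have neg: "\<exists>y \<in> carrier (corner A e). y \<oplus>\<^bsub>corner A e\<^esub> x = \<zero>\<^bsub>corner A e\<^esub>" if "x \<in> carrier (corner A e)" for x
    using that e by (intro bexI[of _ "\<ominus>\<^bsub>A\<^esub> x"]) (simp_all add: A.l_neg A.r_minus)
  have ag: "abelian_group (corner A e)"
    by (rule abelian_groupI, rule_tac [6] neg) (use e in \<open>simp_all add: A.r_distr A.a_ac\<close>)
  have mc: "e \<otimes>\<^bsub>A\<^esub> (a \<otimes>\<^bsub>A\<^esub> b) = a \<otimes>\<^bsub>A\<^esub> b" if "a \<in> carrier A" "e \<otimes>\<^bsub>A\<^esub> a = a" "b \<in> carrier A" for a b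
    using that e by (simp add: A.m_assoc[symmetric])
  have cm: "Group.comm_monoid (corner A e)"
    by (rule comm_monoidI) (use e in \<open>simp_all add: mc\<close>, simp_all add: A.m_ac)
  have cr: "cring (corner A e)"
    by (rule cringI[OF ag cm]) (simp add: A.l_distr)
  show ?thesis
    by (rule algebraI[OF A.R_cring cr])
      (use e in \<open>simp_all add: A.smult_l_distr A.smult_r_distr A.smult_assoc1 A.smult_assoc2 algebra_smult_assoc3[OF A]\<close>)
qed

lemma corner_map_hom:
  assumes A: "algebra R A" and e: "e \<in> carrier A" "e \<otimes>\<^bsub>A\<^esub> e = e"
  shows "corner_map A e \<in> alg_hom R A (corner A e)"
proof -
  interpret A: algebra R A by (rule A)
  have sq: "e \<otimes>\<^bsub>A\<^esub> (e \<otimes>\<^bsub>A\<^esub> a) = e \<otimes>\<^bsub>A\<^esub> a" if "a \<in> carrier A" for a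
    using that e by (simp add: A.m_assoc[symmetric])
  have mm: "e \<otimes>\<^bsub>A\<^esub> (a \<otimes>\<^bsub>A\<^esub> b) = (e \<otimes>\<^bsub>A\<^esub> a) \<otimes>\<^bsub>A\<^esub> (e \<otimes>\<^bsub>A\<^esub> b)" if "a \<in> carrier A" "b \<in> carrier A" for a b
  proof -
    have "(e \<otimes>\<^bsub>A\<^esub> a) \<otimes>\<^bsub>A\<^esub> (e \<otimes>\<^bsub>A\<^esub> b) = (e \<otimes>\<^bsub>A\<^esub> e) \<otimes>\<^bsub>A\<^esub> (a \<otimes>\<^bsub>A\<^esub> b)"
      using that e(1) by (simp add: A.m_ac)
    then show ?thesis
      using e(2) by simp
  qed
  have "corner_map A e \<in> ring_hom A (corner A e)"
    by (rule ring_hom_memI) (use e in \<open>simp_all add: corner_map_def A.r_distr sq mm[symmetric]\<close>)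
  then show ?thesis
    using e by (simp add: alg_hom_def) (simp add: corner_map_def algebra_smult_assoc3[OF A])
qed

text \<open>The idempotent is carried along by \<open>\<phi>\<close>, so \<open>\<phi>\<close>
  induces a map of the factors. The second claim is the commuting square that lets values computed
  over a factor be compared after base change.\<close>

lemma corner_restrict_hom:
  assumes A: "algebra R A" and B: "algebra R B" and \<phi>: "\<phi> \<in> alg_hom R A B"
    and e: "e \<in> carrier A" "e \<otimes>\<^bsub>A\<^esub> e = e"
  shows "restrict \<phi> (carrier (corner A e)) \<in> alg_hom R (corner A e) (corner B (\<phi> e))"
    and "compose (carrier A) (restrict \<phi> (carrier (corner A e))) (corner_map A e) =
      compose (carrier A) (corner_map B (\<phi> e)) \<phi>"
proof -
  interpret A: algebra R A by (rule A)
  interpret B: algebra R B by (rule B)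
  interpret cA: algebra R "corner A e" by (rule corner_algebra[OF A e])
  note \<phi>c = alg_hom_closed[OF \<phi>] and \<phi>s = alg_hom_simps[OF \<phi>]
  have sq: "e \<otimes>\<^bsub>A\<^esub> (e \<otimes>\<^bsub>A\<^esub> a) = e \<otimes>\<^bsub>A\<^esub> a" if "a \<in> carrier A" for a
    using that e by (simp add: A.m_assoc[symmetric])
  have cl: "\<phi> e \<otimes>\<^bsub>B\<^esub> \<phi> a = \<phi> a" if "a \<in> carrier A" "e \<otimes>\<^bsub>A\<^esub> a = a" for a
    using \<phi>s(1)[OF e(1) that(1)] that(2) by simp
  have "restrict \<phi> (carrier (corner A e)) \<in> ring_hom (corner A e) (corner B (\<phi> e))"
    by (rule ring_hom_memI)
      (use cA.m_closed cA.a_closed cA.one_closed e \<phi>c \<phi>s(1,2) cl in simp_all)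
  then show "restrict \<phi> (carrier (corner A e)) \<in> alg_hom R (corner A e) (corner B (\<phi> e))"
    using cA.smult_closed \<phi>s(4) by (simp add: alg_hom_def)
  show "compose (carrier A) (restrict \<phi> (carrier (corner A e))) (corner_map A e) =
      compose (carrier A) (corner_map B (\<phi> e)) \<phi>"
    unfolding compose_def by (rule restrict_ext) (use e \<phi>c \<phi>s(1) sq in \<open>simp add: corner_map_def\<close>)
qed

context universe
begin

lemma base_alg_algebra: "algebra R (base_alg R)"
proof -
  interpret R: cring R by (rule R_cring)
  have sel: "carrier (base_alg R) = carrier R" "monoid.mult (base_alg R) = monoid.mult R" "one (base_alg R) = one R"
    "ring.zero (base_alg R) = ring.zero R" "ring.add (base_alg R) = ring.add R" "smult (base_alg R) = monoid.mult R"
    by (simp_all add: base_alg_def)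
  have neg: "\<exists>y \<in> carrier (base_alg R). y \<oplus>\<^bsub>base_alg R\<^esub> x = \<zero>\<^bsub>base_alg R\<^esub>" if "x \<in> carrier (base_alg R)" for x
    using that by (intro bexI[of _ "\<ominus>\<^bsub>R\<^esub> x"]) (simp_all add: sel R.l_neg)
  have ag: "abelian_group (base_alg R)"
    by (rule abelian_groupI, rule_tac [6] neg) (simp_all add: sel R.a_ac)
  have cm: "Group.comm_monoid (base_alg R)"
    by (rule comm_monoidI) (simp_all add: sel R.m_ac)
  have "cring (base_alg R)"
    by (rule cringI[OF ag cm]) (simp add: sel R.l_distr)
  then show ?thesis
    by (rule algebraI[OF R_cring]) (simp_all add: sel R.l_distr R.r_distr R.m_assoc)
qed

lemma base_alg_Alg [simp]: "base_alg R \<in> Alg R"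
  by (simp add: Alg_def base_alg_algebra)

lemma carrier_base_alg [simp]: "carrier (base_alg R) = carrier R"
  by (simp add: base_alg_def)

lemma structure_map_hom:
  assumes A: "A \<in> Alg R"
  shows "structure_map R A \<in> alg_hom R (base_alg R) A"
proof -
  interpret A: algebra R A by (rule AlgD[OF A])
  interpret R: cring R by (rule R_cring)
  have "structure_map R A \<in> ring_hom (base_alg R) A"
    by (rule ring_hom_memI)
      (simp_all add: structure_map_def base_alg_def A.smult_l_distr A.smult_assoc1 A.smult_assoc2)
  then show ?thesis
    by (simp add: alg_hom_def) (simp add: structure_map_def base_alg_def A.smult_assoc1)
qed

lemma structure_map_compose:
  assumes A: "A \<in> Alg R" and \<phi>: "\<phi> \<in> alg_hom R A B"
  shows "compose (carrier R) \<phi> (structure_map R A) = structure_map R B"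
proof -
  interpret A: algebra R A by (rule AlgD[OF A])
  show ?thesis
    unfolding compose_def structure_map_def by (rule restrict_ext) (simp add: alg_hom_simps[OF \<phi>])
qed

lemma corner_Alg: "A \<in> Alg R \<Longrightarrow> e \<in> carrier A \<Longrightarrow> e \<otimes>\<^bsub>A\<^esub> e = e \<Longrightarrow> corner A e \<in> Alg R"
  by (simp add: Alg_def corner_algebra)

end

section \<open>Extensions of a constant group by a split torus\<close>

text \<open>\<open>T\<close> enters as the kernel of \<open>\<pi>\<close> on
  \<open>A\<close>-points, with group law and transport restricted from \<open>G\<close>, and
  \<open>\<chi>\<close> identifies it with the split torus. The type of points is left
  abstract.\<close>

locale split_extension = universe R for R :: "'u ring" +
  fixes G T :: "('u, 'g) group_functor" and C :: "'c monoid" and M :: "'m monoid"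
    and \<pi> :: "('u, 'u) module \<Rightarrow> 'g \<Rightarrow> 'u set \<Rightarrow> 'c"
    and \<chi> :: "('u, 'u) module \<Rightarrow> 'g \<Rightarrow> 'm \<Rightarrow> 'u"
    and \<Gamma> :: "'p monoid" (structure) and \<rho>\<^sub>0 :: "'p \<Rightarrow> 'g"
  assumes conn: "connected_spec R"
    and G: "is_group_functor R G"
    and T_mult: "\<And>A. monoid.mult (pts T A) = monoid.mult (pts G A)"
    and T_transport: "transport T = transport G"
    and M: "lattice_group M" and iso: "group_functor_iso R T (diag_group M) \<chi>"
    and C: "group C" and \<pi>: "group_functor_hom R G (constant_group C) \<pi>"
    and ker: "\<And>A. A \<in> Alg R \<Longrightarrow> kernel (pts G A) (pts (constant_group C) A) (\<pi> A) = carrier (pts T A)"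
    and \<Gamma>: "group \<Gamma>" and \<rho>\<^sub>0: "\<rho>\<^sub>0 \<in> hom \<Gamma> (pts G (base_alg R))"
begin

sublocale C: group C by (rule C)
sublocale \<Gamma>: group \<Gamma> by (rule \<Gamma>)
sublocale R: cring R by (rule R_cring)
sublocale M: comm_group M using M by (simp add: lattice_group_def)

text \<open>Elements of the free group are finite graphs in \<open>nat \<times> int\<close>.
  Countability of \<open>M\<close> is what allows the group algebras of \<open>M\<close> and of its
  powers to be copied into the universe.\<close>

lemma countable_M: "countable (carrier M)"
proof -
  obtain n :: nat where "M \<cong> free_Abelian_group {..<n}"
    using M by (auto simp: lattice_group_def)
  then have eq: "carrier M \<approx> carrier (free_Abelian_group {..<n})"
    by (rule iso_imp_eqpoll_carrier)
  have "inj (\<lambda>x :: nat \<Rightarrow>\<^sub>0 int. (\<lambda>i. (i, Poly_Mapping.lookup x i)) ` Poly_Mapping.keys x)"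
  proof (rule injI)
    fix x y :: "nat \<Rightarrow>\<^sub>0 int"
    assume eq: "(\<lambda>i. (i, Poly_Mapping.lookup x i)) ` Poly_Mapping.keys x =
      (\<lambda>i. (i, Poly_Mapping.lookup y i)) ` Poly_Mapping.keys y"
    show "x = y"
    proof (rule poly_mapping_eqI)
      fix i
      have *: "Poly_Mapping.lookup v i = Poly_Mapping.lookup w i"
        if "(\<lambda>i. (i, Poly_Mapping.lookup v i)) ` Poly_Mapping.keys v =
          (\<lambda>i. (i, Poly_Mapping.lookup w i)) ` Poly_Mapping.keys w" "i \<in> Poly_Mapping.keys v" for v w :: "nat \<Rightarrow>\<^sub>0 int"
      proof -
        have "(i, Poly_Mapping.lookup v i) \<in> (\<lambda>i. (i, Poly_Mapping.lookup w i)) ` Poly_Mapping.keys w"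
          using that by blast
        then show ?thesis
          by blast
      qed
      show "Poly_Mapping.lookup x i = Poly_Mapping.lookup y i"
        using *[OF eq] *[OF eq[symmetric]] by (metis in_keys_iff)
    qed
  qed
  moreover have "countable (Collect finite :: (nat \<times> int) set set)"
    by (rule countable_Collect_finite)
  moreover have "range (\<lambda>x :: nat \<Rightarrow>\<^sub>0 int. (\<lambda>i. (i, Poly_Mapping.lookup x i)) ` Poly_Mapping.keys x)
    \<subseteq> Collect finite"
    by auto
  ultimately have "countable (UNIV :: (nat \<Rightarrow>\<^sub>0 int) set)"
    by (meson countable_image_inj_on countable_subset)
  then have "countable (carrier (free_Abelian_group {..<n}))"
    by (rule countable_subset[OF subset_UNIV])
  then show ?thesis
    using eq countable_eqpoll eqpoll_sym by blast
qed

abbreviation Gp where "Gp A \<equiv> pts G A"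
abbreviation Tp where "Tp A \<equiv> carrier (pts T A)"
abbreviation tr where "tr \<equiv> transport G"

lemma group_G: "A \<in> Alg R \<Longrightarrow> group (Gp A)"
  using G by (simp add: is_group_functor_def)

lemma tr_hom: "\<lbrakk>A \<in> Alg R; B \<in> Alg R; \<phi> \<in> alg_hom R A B\<rbrakk> \<Longrightarrow> tr A B \<phi> \<in> hom (Gp A) (Gp B)"
  using G by (simp add: is_group_functor_def)

lemma tr_closed: "\<lbrakk>A \<in> Alg R; B \<in> Alg R; \<phi> \<in> alg_hom R A B; g \<in> carrier (Gp A)\<rbrakk> \<Longrightarrow> tr A B \<phi> g \<in> carrier (Gp B)"
  using hom_carrier[OF tr_hom] by blast

lemma tr_mult: "\<lbrakk>A \<in> Alg R; B \<in> Alg R; \<phi> \<in> alg_hom R A B; g \<in> carrier (Gp A); h \<in> carrier (Gp A)\<rbrakk>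
  \<Longrightarrow> tr A B \<phi> (g \<otimes>\<^bsub>Gp A\<^esub> h) = tr A B \<phi> g \<otimes>\<^bsub>Gp B\<^esub> tr A B \<phi> h"
  using hom_mult[OF tr_hom] by blast

lemma tr_inv:
  assumes "A \<in> Alg R" "B \<in> Alg R" "\<phi> \<in> alg_hom R A B" "g \<in> carrier (Gp A)"
  shows "tr A B \<phi> (inv\<^bsub>Gp A\<^esub> g) = inv\<^bsub>Gp B\<^esub> tr A B \<phi> g"
  using group_hom.hom_inv[OF group_hom.intro[OF group_G[OF assms(1)] group_G[OF assms(2)]]]
    tr_hom[OF assms(1-3)] assms(4) by (simp add: group_hom_axioms_def)

lemma tr_compose: "\<lbrakk>A \<in> Alg R; B \<in> Alg R; D \<in> Alg R; f \<in> alg_hom R A B; f' \<in> alg_hom R B D; g \<in> carrier (Gp A)\<rbrakk>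
  \<Longrightarrow> tr A D (compose (carrier A) f' f) g = tr B D f' (tr A B f g)"
  using G by (simp add: is_group_functor_def)

text \<open>Base change of the reference representation to \<open>A\<close>; \<open>r A w\<close>
  serves as base point of the component of \<open>w\<close>.\<close>

definition r where "r A w = tr (base_alg R) A (structure_map R A) (\<rho>\<^sub>0 w)"

lemma \<rho>\<^sub>0_closed: "w \<in> carrier \<Gamma> \<Longrightarrow> \<rho>\<^sub>0 w \<in> carrier (Gp (base_alg R))"
  using hom_carrier[OF \<rho>\<^sub>0] by blast

lemma r_closed: "A \<in> Alg R \<Longrightarrow> w \<in> carrier \<Gamma> \<Longrightarrow> r A w \<in> carrier (Gp A)"
  unfolding r_def by (rule tr_closed[OF _ _ structure_map_hom \<rho>\<^sub>0_closed]) auto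

lemma r_mult: "A \<in> Alg R \<Longrightarrow> w \<in> carrier \<Gamma> \<Longrightarrow> \<delta> \<in> carrier \<Gamma> \<Longrightarrow> r A (w \<otimes> \<delta>) = r A w \<otimes>\<^bsub>Gp A\<^esub> r A \<delta>"
  unfolding r_def by (simp add: hom_mult[OF \<rho>\<^sub>0] tr_mult structure_map_hom \<rho>\<^sub>0_closed)

lemma r_hom: "A \<in> Alg R \<Longrightarrow> r A \<in> hom \<Gamma> (Gp A)"
  by (rule homI) (simp_all add: r_closed r_mult)

lemma r_inv: "A \<in> Alg R \<Longrightarrow> w \<in> carrier \<Gamma> \<Longrightarrow> r A (inv w) = inv\<^bsub>Gp A\<^esub> r A w"
  using group_hom.hom_inv[OF group_hom.intro[OF \<Gamma> group_G]] r_hom by (simp add: group_hom_axioms_def)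

lemma tr_r:
  assumes "A \<in> Alg R" "B \<in> Alg R" "\<phi> \<in> alg_hom R A B" "w \<in> carrier \<Gamma>"
  shows "tr A B \<phi> (r A w) = r B w"
  unfolding r_def
  using tr_compose[OF base_alg_Alg assms(1,2) structure_map_hom[OF assms(1)] assms(3) \<rho>\<^sub>0_closed[OF assms(4)]]
  by (simp add: structure_map_compose[OF assms(1,3)])

lemma \<pi>_closed: "\<lbrakk>A \<in> Alg R; g \<in> carrier (Gp A)\<rbrakk> \<Longrightarrow> \<pi> A g \<in> carrier (pts (constant_group C) A)"
  using \<pi> unfolding group_functor_hom_def by (metis (no_types, lifting) hom_carrier image_subset_iff)

lemma \<pi>_pt: "\<lbrakk>A \<in> Alg R; g \<in> carrier (Gp A); Q \<in> spec A\<rbrakk> \<Longrightarrow> \<pi> A g Q \<in> carrier C"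
  using \<pi>_closed[of A g] by (auto simp: constant_group_def PiE_iff)

lemma \<pi>_ext: "\<lbrakk>A \<in> Alg R; g \<in> carrier (Gp A)\<rbrakk> \<Longrightarrow> \<pi> A g \<in> extensional (spec A)"
  using \<pi>_closed[of A g] by (simp add: constant_group_def PiE_def)

lemma \<pi>_mult: "\<lbrakk>A \<in> Alg R; g \<in> carrier (Gp A); h \<in> carrier (Gp A); Q \<in> spec A\<rbrakk>
  \<Longrightarrow> \<pi> A (g \<otimes>\<^bsub>Gp A\<^esub> h) Q = \<pi> A g Q \<otimes>\<^bsub>C\<^esub> \<pi> A h Q"
  using \<pi> hom_mult[of "\<pi> A" "Gp A" "pts (constant_group C) A" g h]
  by (simp add: group_functor_hom_def constant_group_def)

lemma \<pi>_one: "\<lbrakk>A \<in> Alg R; Q \<in> spec A\<rbrakk> \<Longrightarrow> \<pi> A \<one>\<^bsub>Gp A\<^esub> Q = \<one>\<^bsub>C\<^esub>"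
proof -
  assume A: "A \<in> Alg R" and Q: "Q \<in> spec A"
  interpret Gp: group "Gp A" by (rule group_G[OF A])
  show ?thesis
    using \<pi>_mult[OF A Gp.one_closed Gp.one_closed Q] \<pi>_pt[OF A Gp.one_closed Q] by simp
qed

lemma \<pi>_inv: "\<lbrakk>A \<in> Alg R; g \<in> carrier (Gp A); Q \<in> spec A\<rbrakk> \<Longrightarrow> \<pi> A (inv\<^bsub>Gp A\<^esub> g) Q = inv\<^bsub>C\<^esub> \<pi> A g Q"
proof -
  assume A: "A \<in> Alg R" and g: "g \<in> carrier (Gp A)" and Q: "Q \<in> spec A"
  interpret Gp: group "Gp A" by (rule group_G[OF A])
  have "\<pi> A (inv\<^bsub>Gp A\<^esub> g) Q \<otimes>\<^bsub>C\<^esub> \<pi> A g Q = \<one>\<^bsub>C\<^esub>"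
    using \<pi>_mult[OF A Gp.inv_closed[OF g] g Q] \<pi>_one[OF A Q] Gp.l_inv[OF g] by simp
  then show ?thesis
    using C.inv_equality \<pi>_pt[OF A g Q] \<pi>_pt[OF A Gp.inv_closed[OF g] Q] by simp
qed

lemma \<pi>_tr: "\<lbrakk>A \<in> Alg R; B \<in> Alg R; \<phi> \<in> alg_hom R A B; g \<in> carrier (Gp A); Q \<in> spec B\<rbrakk>
  \<Longrightarrow> \<pi> B (tr A B \<phi> g) Q = \<pi> A g (spec_map A \<phi> Q)"
  using \<pi> by (simp add: group_functor_hom_def constant_group_def)

lemma T_iff: "A \<in> Alg R \<Longrightarrow> g \<in> Tp A \<longleftrightarrow> g \<in> carrier (Gp A) \<and> (\<forall>Q \<in> spec A. \<pi> A g Q = \<one>\<^bsub>C\<^esub>)"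
proof -
  assume A: "A \<in> Alg R"
  have "g \<in> Tp A \<longleftrightarrow> g \<in> carrier (Gp A) \<and> \<pi> A g = (\<lambda>Q \<in> spec A. \<one>\<^bsub>C\<^esub>)"
    unfolding ker[OF A, symmetric] by (simp add: kernel_def constant_group_def)
  moreover have "\<pi> A g = (\<lambda>Q \<in> spec A. \<one>\<^bsub>C\<^esub>) \<longleftrightarrow> (\<forall>Q \<in> spec A. \<pi> A g Q = \<one>\<^bsub>C\<^esub>)" if "g \<in> carrier (Gp A)"
  proof
    assume "\<forall>Q \<in> spec A. \<pi> A g Q = \<one>\<^bsub>C\<^esub>"
    then show "\<pi> A g = (\<lambda>Q \<in> spec A. \<one>\<^bsub>C\<^esub>)"
      by (intro extensionalityI[OF \<pi>_ext[OF A that]]) auto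
  qed auto
  ultimately show ?thesis
    by blast
qed

lemma T_G: "A \<in> Alg R \<Longrightarrow> t \<in> Tp A \<Longrightarrow> t \<in> carrier (Gp A)"
  by (simp add: T_iff)

lemma T_subgroup: "A \<in> Alg R \<Longrightarrow> subgroup (Tp A) (Gp A)"
proof -
  assume A: "A \<in> Alg R"
  interpret Gp: group "Gp A" by (rule group_G[OF A])
  show ?thesis
  proof (rule Gp.subgroupI)
    have "\<one>\<^bsub>Gp A\<^esub> \<in> Tp A"
      by (simp add: T_iff[OF A] \<pi>_one[OF A])
    then show "Tp A \<noteq> {}"
      by blast
  qed (use A in \<open>auto simp: T_iff[OF A] \<pi>_mult[OF A] \<pi>_inv[OF A]\<close>)
qed

lemma T_one: "A \<in> Alg R \<Longrightarrow> \<one>\<^bsub>Gp A\<^esub> \<in> Tp A"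
  by (rule subgroup.one_closed[OF T_subgroup])

lemma T_closed: "A \<in> Alg R \<Longrightarrow> s \<in> Tp A \<Longrightarrow> t \<in> Tp A \<Longrightarrow> s \<otimes>\<^bsub>Gp A\<^esub> t \<in> Tp A"
  by (rule subgroup.m_closed[OF T_subgroup])

lemma T_inv: "A \<in> Alg R \<Longrightarrow> t \<in> Tp A \<Longrightarrow> inv\<^bsub>Gp A\<^esub> t \<in> Tp A"
  by (rule subgroup.m_inv_closed[OF T_subgroup])

lemma T_conj:
  assumes A: "A \<in> Alg R" and g: "g \<in> carrier (Gp A)" and t: "t \<in> Tp A"
  shows "g \<otimes>\<^bsub>Gp A\<^esub> t \<otimes>\<^bsub>Gp A\<^esub> inv\<^bsub>Gp A\<^esub> g \<in> Tp A" "inv\<^bsub>Gp A\<^esub> g \<otimes>\<^bsub>Gp A\<^esub> t \<otimes>\<^bsub>Gp A\<^esub> g \<in> Tp A"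
proof -
  interpret Gp: group "Gp A" by (rule group_G[OF A])
  have t': "t \<in> carrier (Gp A)" "\<forall>Q \<in> spec A. \<pi> A t Q = \<one>\<^bsub>C\<^esub>"
    using t by (simp_all add: T_iff[OF A])
  show "g \<otimes>\<^bsub>Gp A\<^esub> t \<otimes>\<^bsub>Gp A\<^esub> inv\<^bsub>Gp A\<^esub> g \<in> Tp A"
    "inv\<^bsub>Gp A\<^esub> g \<otimes>\<^bsub>Gp A\<^esub> t \<otimes>\<^bsub>Gp A\<^esub> g \<in> Tp A"
    using t' g \<pi>_pt[OF A g] by (simp_all add: T_iff[OF A] \<pi>_mult[OF A] \<pi>_inv[OF A])
qed

lemma same_\<pi>:
  assumes A: "A \<in> Alg R" and g: "g \<in> carrier (Gp A)" and h: "h \<in> carrier (Gp A)"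
    and eq: "\<And>Q. Q \<in> spec A \<Longrightarrow> \<pi> A g Q = \<pi> A h Q"
  shows "g \<otimes>\<^bsub>Gp A\<^esub> inv\<^bsub>Gp A\<^esub> h \<in> Tp A"
proof -
  interpret Gp: group "Gp A" by (rule group_G[OF A])
  show ?thesis
    using g h \<pi>_pt[OF A h] by (simp add: T_iff[OF A] \<pi>_mult[OF A] \<pi>_inv[OF A] eq)
qed

lemma T_tr:
  assumes "A \<in> Alg R" "B \<in> Alg R" "\<phi> \<in> alg_hom R A B" "t \<in> Tp A"
  shows "tr A B \<phi> t \<in> Tp B"
  using assms spec_map_spec[OF AlgD[OF assms(1)] AlgD[OF assms(2)] assms(3)]
  by (simp add: T_iff[OF assms(1)] T_iff[OF assms(2)] tr_closed \<pi>_tr)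

lemma \<chi>_char: "A \<in> Alg R \<Longrightarrow> t \<in> Tp A \<Longrightarrow> \<chi> A t \<in> characters M A"
  using iso unfolding group_functor_iso_def
  by (metis (no_types, lifting) bij_betw_apply diag_group_def group_functor.select_convs(1) partial_object.select_convs(1))

lemma \<chi>_inj: "A \<in> Alg R \<Longrightarrow> inj_on (\<chi> A) (Tp A)"
  using iso unfolding group_functor_iso_def bij_betw_def by blast

lemma \<chi>_surj: "A \<in> Alg R \<Longrightarrow> \<chi> A ` Tp A = characters M A"
  using iso unfolding group_functor_iso_def bij_betw_def by (simp add: diag_group_def)

lemma \<chi>_mult: "\<lbrakk>A \<in> Alg R; s \<in> Tp A; t \<in> Tp A; m \<in> carrier M\<rbrakk> \<Longrightarrow> \<chi> A (s \<otimes>\<^bsub>Gp A\<^esub> t) m = \<chi> A s m \<otimes>\<^bsub>A\<^esub> \<chi> A t m"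
  using iso hom_mult[of "\<chi> A" "pts T A" "pts (diag_group M) A" s t]
  unfolding group_functor_iso_def group_functor_hom_def by (simp add: T_mult diag_group_def)

lemma \<chi>_tr: "\<lbrakk>A \<in> Alg R; B \<in> Alg R; \<phi> \<in> alg_hom R A B; t \<in> Tp A\<rbrakk> \<Longrightarrow> \<chi> B (tr A B \<phi> t) = compose (carrier M) \<phi> (\<chi> A t)"
  using iso unfolding group_functor_iso_def group_functor_hom_def by (simp add: T_transport diag_group_def)

definition \<tau> where "\<tau> A h = inv_into (Tp A) (\<chi> A) h"

lemma \<tau>_closed: "A \<in> Alg R \<Longrightarrow> h \<in> characters M A \<Longrightarrow> \<tau> A h \<in> Tp A"
  unfolding \<tau>_def by (rule inv_into_into) (simp add: \<chi>_surj)

lemma \<chi>_\<tau>: "A \<in> Alg R \<Longrightarrow> h \<in> characters M A \<Longrightarrow> \<chi> A (\<tau> A h) = h"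
  unfolding \<tau>_def by (rule f_inv_into_f) (simp add: \<chi>_surj)

lemma \<tau>_\<chi>: "A \<in> Alg R \<Longrightarrow> t \<in> Tp A \<Longrightarrow> \<tau> A (\<chi> A t) = t"
  unfolding \<tau>_def by (rule inv_into_f_f[OF \<chi>_inj])

lemma T_eqI:
  assumes A: "A \<in> Alg R" and s: "s \<in> Tp A" and t: "t \<in> Tp A"
    and eq: "\<And>m. m \<in> carrier M \<Longrightarrow> \<chi> A s m = \<chi> A t m"
  shows "s = t"
proof (rule inj_onD[OF \<chi>_inj[OF A] _ s t])
  show "\<chi> A s = \<chi> A t"
    by (rule extensionalityI[of _ "carrier M"]) (use \<chi>_char[OF A s] \<chi>_char[OF A t] eq in auto)
qed

lemma \<chi>_closed: "\<lbrakk>A \<in> Alg R; t \<in> Tp A; m \<in> carrier M\<rbrakk> \<Longrightarrow> \<chi> A t m \<in> carrier A"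
  by (rule characters_closed(2)[OF \<chi>_char])

lemma \<chi>_Unit: "\<lbrakk>A \<in> Alg R; t \<in> Tp A; m \<in> carrier M\<rbrakk> \<Longrightarrow> \<chi> A t m \<in> Units A"
  by (rule characters_closed(1)[OF \<chi>_char])

lemma \<chi>_M_mult: "\<lbrakk>A \<in> Alg R; t \<in> Tp A; m \<in> carrier M; n \<in> carrier M\<rbrakk> \<Longrightarrow> \<chi> A t (m \<otimes>\<^bsub>M\<^esub> n) = \<chi> A t m \<otimes>\<^bsub>A\<^esub> \<chi> A t n"
  by (rule characters_mult[OF \<chi>_char])

lemma monoid_A: "A \<in> Alg R \<Longrightarrow> monoid A"
  by (simp add: Alg_def algebra_def cring_def ring_def)

lemma \<chi>_M_one: "\<lbrakk>A \<in> Alg R; t \<in> Tp A\<rbrakk> \<Longrightarrow> \<chi> A t \<one>\<^bsub>M\<^esub> = \<one>\<^bsub>A\<^esub>"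
  by (rule characters_one[OF \<chi>_char M.is_group monoid_A])

text \<open>Commutativity of the torus is read off through the characters, which separate its
  points.\<close>

lemma T_comm:
  assumes A: "A \<in> Alg R" and s: "s \<in> Tp A" and t: "t \<in> Tp A"
  shows "s \<otimes>\<^bsub>Gp A\<^esub> t = t \<otimes>\<^bsub>Gp A\<^esub> s"
proof (rule T_eqI[OF A T_closed[OF A s t] T_closed[OF A t s]])
  interpret A: algebra R A by (rule AlgD[OF A])
  show "\<chi> A (s \<otimes>\<^bsub>Gp A\<^esub> t) m = \<chi> A (t \<otimes>\<^bsub>Gp A\<^esub> s) m" if m: "m \<in> carrier M" for m
    using \<chi>_mult[OF A s t m] \<chi>_mult[OF A t s m] \<chi>_closed[OF A s m] \<chi>_closed[OF A t m] by (simp add: A.m_comm)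
qed

lemma \<chi>_one: "\<lbrakk>A \<in> Alg R; m \<in> carrier M\<rbrakk> \<Longrightarrow> \<chi> A \<one>\<^bsub>Gp A\<^esub> m = \<one>\<^bsub>A\<^esub>"
proof -
  assume A: "A \<in> Alg R" and m: "m \<in> carrier M"
  interpret A: algebra R A by (rule AlgD[OF A])
  interpret Gp: group "Gp A" by (rule group_G[OF A])
  have "\<chi> A \<one>\<^bsub>Gp A\<^esub> m \<otimes>\<^bsub>A\<^esub> \<chi> A \<one>\<^bsub>Gp A\<^esub> m = \<chi> A \<one>\<^bsub>Gp A\<^esub> m \<otimes>\<^bsub>A\<^esub> \<one>\<^bsub>A\<^esub>"
    using \<chi>_mult[OF A T_one[OF A] T_one[OF A] m] \<chi>_closed[OF A T_one[OF A] m] by simp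
  then show ?thesis
    using A.Units_l_cancel[OF \<chi>_Unit[OF A T_one[OF A] m] \<chi>_closed[OF A T_one[OF A] m] A.one_closed] by metis
qed

lemma \<tau>_tr:
  assumes A: "A \<in> Alg R" and B: "B \<in> Alg R" and \<phi>: "\<phi> \<in> alg_hom R A B" and h: "h \<in> characters M A"
  shows "tr A B \<phi> (\<tau> A h) = \<tau> B (compose (carrier M) \<phi> h)"
  using \<tau>_\<chi>[OF B T_tr[OF A B \<phi> \<tau>_closed[OF A h]]] \<chi>_tr[OF A B \<phi> \<tau>_closed[OF A h]] \<chi>_\<tau>[OF A h] by simp

end

section \<open>Multiplicative functions on diagonalisable groups\<close>

lemma (in monoid_alg_target) lin_ext_cong:
  assumes F: "F \<in> carrier P" and h': "h' \<in> carrier N \<rightarrow> carrier A"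
    and eq: "\<And>z. z \<in> carrier N \<Longrightarrow> h z = h' z"
  shows "lin_ext R N A h F = lin_ext R N A h' F"
  unfolding lin_ext_def
  by (rule A.finsum_cong'[OF refl]) (use F funcset_mem[OF h'] eq in simp_all)

context monoid_alg_map
begin

lemma push_zero: "push \<zero>\<^bsub>P\<^esub> = \<zero>\<^bsub>monoid_algebra R N'\<^esub>"
  by (simp add: push_def)

lemma push_step:
  assumes "F \<in> carrier P" "a \<in> carrier R" "y \<in> carrier N"
  shows "push (F \<oplus>\<^bsub>P\<^esub> a \<odot>\<^bsub>P\<^esub> monomial R N y) =
    push F \<oplus>\<^bsub>monoid_algebra R N'\<^esub> a \<odot>\<^bsub>monoid_algebra R N'\<^esub> monomial R N' (j y)"
  using assms jm by (simp add: push_def target.lin_ext_add target.lin_ext_smult target.lin_ext_monomial)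

end

lemma comm_group_DirProd:
  assumes "comm_group N" "comm_group N'"
  shows "comm_group (N \<times>\<times> N')"
proof -
  interpret N: comm_group N by (rule assms)
  interpret N': comm_group N' by (rule assms)
  interpret NN: group "N \<times>\<times> N'" by (rule DirProd_group) (rule N.is_group N'.is_group)+
  show ?thesis
    by (rule NN.group_comm_groupI) (auto simp: DirProd_def N.m_comm N'.m_comm)
qed

context universe
begin

text \<open>The group algebra of \<open>N \<times> N\<close> is the tensor square of that of
  \<open>N\<close>; the two pushes are the maps \<open>F \<mapsto> F \<otimes> 1\<close> and
  \<open>K \<mapsto> 1 \<otimes> K\<close>.\<close>

lemma push_mult_coeff:
  assumes N: "comm_group N"
    and F: "F \<in> carrier (monoid_algebra R N)" and K: "K \<in> carrier (monoid_algebra R N)"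
    and \<mu>: "\<mu> \<in> carrier N" and \<nu>: "\<nu> \<in> carrier N"
  shows "(monoid_alg_map.push R N (N \<times>\<times> N) (\<lambda>x. (x, \<one>\<^bsub>N\<^esub>)) F \<otimes>\<^bsub>monoid_algebra R (N \<times>\<times> N)\<^esub>
     monoid_alg_map.push R N (N \<times>\<times> N) (\<lambda>x. (\<one>\<^bsub>N\<^esub>, x)) K) (\<mu>, \<nu>) = F \<mu> \<otimes>\<^bsub>R\<^esub> K \<nu>"
proof -
  interpret N: comm_group N by (rule N)
  interpret R: cring R by (rule R_cring)
  interpret N2: comm_group "N \<times>\<times> N" by (rule comm_group_DirProd[OF N N])
  interpret A1: monoid_alg R N by (intro monoid_alg.intro R_cring N.comm_monoid_axioms)
  interpret A2: monoid_alg R "N \<times>\<times> N" by (intro monoid_alg.intro R_cring N2.comm_monoid_axioms)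
  interpret I1: monoid_alg_map R N "N \<times>\<times> N" "\<lambda>x. (x, \<one>\<^bsub>N\<^esub>)"
    by (intro monoid_alg_map.intro monoid_alg_map_axioms.intro A1.monoid_alg_axioms A2.monoid_alg_axioms) (simp add: DirProd_def)
  interpret I2: monoid_alg_map R N "N \<times>\<times> N" "\<lambda>x. (\<one>\<^bsub>N\<^esub>, x)"
    by (intro monoid_alg_map.intro monoid_alg_map_axioms.intro A1.monoid_alg_axioms A2.monoid_alg_axioms) (simp add: DirProd_def)
  have \<mu>\<nu>: "(\<mu>, \<nu>) \<in> carrier (N \<times>\<times> N)"
    using \<mu> \<nu> by (simp add: DirProd_def)
  have c: "(x, \<one>\<^bsub>N\<^esub>) \<in> carrier (N \<times>\<times> N)" "(\<one>\<^bsub>N\<^esub>, x) \<in> carrier (N \<times>\<times> N)" if "x \<in> carrier N" for x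
    using that by (simp_all add: DirProd_def)
  have mm: "monomial R (N \<times>\<times> N) (x, \<one>\<^bsub>N\<^esub>) \<otimes>\<^bsub>A2.P\<^esub> monomial R (N \<times>\<times> N) (\<one>\<^bsub>N\<^esub>, y) = monomial R (N \<times>\<times> N) (x, y)"
    if "x \<in> carrier N" "y \<in> carrier N" for x y
    using A2.monomial_mult[OF c(1)[OF that(1)] c(2)[OF that(2)]] that by simp
  have 1: "(monomial R (N \<times>\<times> N) (x, \<one>\<^bsub>N\<^esub>) \<otimes>\<^bsub>A2.P\<^esub> I2.push K) (\<mu>, \<nu>) = (if \<mu> = x then K \<nu> else \<zero>\<^bsub>R\<^esub>)"
    if x: "x \<in> carrier N" for x
    using K
  proof (induction rule: A1.P_induct)
    case zero
    show ?case
      using \<mu>\<nu> \<nu> c(1)[OF x] by (simp add: I2.push_zero A2.zero_mult_P)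
  next
    case (step F r z)
    have pc: "I2.push F \<in> carrier A2.P"
      by (rule I2.push_closed[OF step(1)])
    have "monomial R (N \<times>\<times> N) (x, \<one>\<^bsub>N\<^esub>) \<otimes>\<^bsub>A2.P\<^esub> I2.push (F \<oplus>\<^bsub>A1.P\<^esub> r \<odot>\<^bsub>A1.P\<^esub> monomial R N z) =
      monomial R (N \<times>\<times> N) (x, \<one>\<^bsub>N\<^esub>) \<otimes>\<^bsub>A2.P\<^esub> I2.push F \<oplus>\<^bsub>A2.P\<^esub> r \<odot>\<^bsub>A2.P\<^esub> monomial R (N \<times>\<times> N) (x, z)"
      unfolding I2.push_step[OF step(1-3)] using step pc c(1)[OF x] c(2)[OF step(3)] x
      by (simp add: A2.bilinear_P mm)
    then show ?case
      using step \<mu>\<nu> \<nu> by simp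
  qed
  show ?thesis
    using F
  proof (induction rule: A1.P_induct)
    case zero
    show ?case
      using \<mu>\<nu> \<mu> \<nu> K by (simp add: I1.push_zero A2.zero_mult_P I2.push_closed)
  next
    case (step F r z)
    have pc: "I1.push F \<in> carrier A2.P" "I2.push K \<in> carrier A2.P"
      by (rule I1.push_closed[OF step(1)], rule I2.push_closed[OF K])
    have "I1.push (F \<oplus>\<^bsub>A1.P\<^esub> r \<odot>\<^bsub>A1.P\<^esub> monomial R N z) \<otimes>\<^bsub>A2.P\<^esub> I2.push K =
      I1.push F \<otimes>\<^bsub>A2.P\<^esub> I2.push K \<oplus>\<^bsub>A2.P\<^esub> r \<odot>\<^bsub>A2.P\<^esub> (monomial R (N \<times>\<times> N) (z, \<one>\<^bsub>N\<^esub>) \<otimes>\<^bsub>A2.P\<^esub> I2.push K)"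
      unfolding I1.push_step[OF step(1-3)] using step pc c(1)[OF step(3)]
      by (simp add: A2.bilinear_P)
    then show ?case
      using step \<mu>\<nu> \<mu> A1.P_coeff[OF K \<nu>] A1.P_coeff[OF step(1) \<mu>] by (simp add: 1 R.l_distr)
  qed
qed

text \<open>
  A multiplicative function on a diagonalisable group is a sum of characters whose coefficients are
  orthogonal idempotents; over a connected base only one of them survives.
\<close>

lemma multiplicative_function_character:
  fixes N :: "('n, 'y) monoid_scheme"
  assumes conn: "connected_spec R" and N: "comm_group N" "countable (carrier N)"
    and f: "\<And>(A :: ('u, 'u) module) h. A \<in> Alg R \<Longrightarrow> h \<in> characters N A \<Longrightarrow> f A h \<in> carrier A"
    and natural: "\<And>A B \<phi> h. \<lbrakk>A \<in> Alg R; B \<in> Alg R; \<phi> \<in> alg_hom R A B; h \<in> characters N A\<rbrakk>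
      \<Longrightarrow> f B (compose (carrier N) \<phi> h) = \<phi> (f A h)"
    and mult: "\<And>A h h'. \<lbrakk>A \<in> Alg R; h \<in> characters N A; h' \<in> characters N A\<rbrakk>
      \<Longrightarrow> f A (\<lambda>z \<in> carrier N. h z \<otimes>\<^bsub>A\<^esub> h' z) = f A h \<otimes>\<^bsub>A\<^esub> f A h'"
    and one: "f (base_alg R) (\<lambda>z \<in> carrier N. \<one>\<^bsub>R\<^esub>) = \<one>\<^bsub>R\<^esub>"
  shows "\<exists>m \<in> carrier N. \<forall>A \<in> Alg R. \<forall>h \<in> characters N A. f A h = h m"
proof -
  interpret N: comm_group N by (rule N)
  interpret R: cring R by (rule R_cring)
  have N2: "comm_group (N \<times>\<times> N)" "countable (carrier (N \<times>\<times> N))"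
    by (rule comm_group_DirProd[OF N(1) N(1)]) (simp add: DirProd_def N(2))
  interpret N2: comm_group "N \<times>\<times> N" by (rule N2)
  interpret A1: monoid_alg R N by (intro monoid_alg.intro R_cring N.comm_monoid_axioms)
  interpret A2: monoid_alg R "N \<times>\<times> N" by (intro monoid_alg.intro R_cring N2.comm_monoid_axioms)
  interpret I1: monoid_alg_map R N "N \<times>\<times> N" "\<lambda>x. (x, \<one>\<^bsub>N\<^esub>)"
    by (intro monoid_alg_map.intro monoid_alg_map_axioms.intro A1.monoid_alg_axioms A2.monoid_alg_axioms) (simp add: DirProd_def)
  interpret I2: monoid_alg_map R N "N \<times>\<times> N" "\<lambda>x. (\<one>\<^bsub>N\<^esub>, x)"
    by (intro monoid_alg_map.intro monoid_alg_map_axioms.intro A1.monoid_alg_axioms A2.monoid_alg_axioms) (simp add: DirProd_def)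
  interpret D: monoid_alg_map R N "N \<times>\<times> N" "\<lambda>x. (x, x)"
    by (intro monoid_alg_map.intro monoid_alg_map_axioms.intro A1.monoid_alg_axioms A2.monoid_alg_axioms) (simp add: DirProd_def)
  obtain F where F: "F \<in> carrier A1.P" and fF: "\<forall>A \<in> Alg R. \<forall>h \<in> characters N A. f A h = lin_ext R N A h F"
    using natural_function_expansion[OF N f natural] by blast
  \<comment> \<open>The Laurent polynomial of a multiplicative function is group-like: the diagonal
    sends it to \<open>F \<otimes> F\<close>. It suffices to evaluate at a character of
    \<open>N \<times> N\<close>, which is a pair of characters \<open>h1\<close>, \<open>h2\<close>
    of \<open>N\<close> whose pointwise product is the restriction \<open>hd\<close> to the
    diagonal.\<close>
  have "D.push F = I1.push F \<otimes>\<^bsub>A2.P\<^esub> I2.push F"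
  proof (rule expansion_unique[OF N2 D.push_closed[OF F] A2.mult_closed_P[OF I1.push_closed[OF F] I2.push_closed[OF F]]])
    fix A :: "('u, 'u) module" and h
    assume A: "A \<in> Alg R" and h: "h \<in> characters (N \<times>\<times> N) A"
    interpret A: algebra R A by (rule AlgD[OF A])
    interpret T1: monoid_alg_target R N A
      by (intro monoid_alg_target.intro A1.monoid_alg_axioms AlgD[OF A])
    interpret T2: monoid_alg_target R "N \<times>\<times> N" A
      by (intro monoid_alg_target.intro A2.monoid_alg_axioms AlgD[OF A])
    have c: "(x, y) \<in> carrier (N \<times>\<times> N)" if "x \<in> carrier N" "y \<in> carrier N" for x y
      using that by (simp add: DirProd_def)
    have hPi: "h \<in> carrier (N \<times>\<times> N) \<rightarrow> carrier A"
      by (rule funcsetI) (rule characters_closed(2)[OF h])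
    have hm: "h (x \<otimes>\<^bsub>N\<^esub> x', y \<otimes>\<^bsub>N\<^esub> y') = h (x, y) \<otimes>\<^bsub>A\<^esub> h (x', y')"
      if "x \<in> carrier N" "y \<in> carrier N" "x' \<in> carrier N" "y' \<in> carrier N" for x y x' y'
      using characters_mult[OF h c[OF that(1,2)] c[OF that(3,4)]] by simp
    define h1 h2 where "h1 = (\<lambda>z \<in> carrier N. h (z, \<one>\<^bsub>N\<^esub>))" and "h2 = (\<lambda>z \<in> carrier N. h (\<one>\<^bsub>N\<^esub>, z))"
    have h1: "h1 \<in> characters N A"
      by (rule charactersI)
        (use characters_closed(1)[OF h c] hm[of _ "\<one>\<^bsub>N\<^esub>" _ "\<one>\<^bsub>N\<^esub>"] in \<open>simp_all add: h1_def\<close>)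
    have h2: "h2 \<in> characters N A"
      by (rule charactersI)
        (use characters_closed(1)[OF h c] hm[of "\<one>\<^bsub>N\<^esub>" _ "\<one>\<^bsub>N\<^esub>"] in \<open>simp_all add: h2_def\<close>)
    define hd where "hd = (\<lambda>z \<in> carrier N. h1 z \<otimes>\<^bsub>A\<^esub> h2 z)"
    have hd_eq: "hd z = h (z, z)" if "z \<in> carrier N" for z
      using hm[of z "\<one>\<^bsub>N\<^esub>" "\<one>\<^bsub>N\<^esub>" z] that by (simp add: hd_def h1_def h2_def)
    have hd: "hd \<in> characters N A"
    proof (rule charactersI)
      show "hd x \<in> Units A" if "x \<in> carrier N" for x
        using hd_eq[OF that] characters_closed(1)[OF h c[OF that that]] by simp
      show "hd (x \<otimes>\<^bsub>N\<^esub> y) = hd x \<otimes>\<^bsub>A\<^esub> hd y" if "x \<in> carrier N" "y \<in> carrier N" for x y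
        using hd_eq that hm[OF that(1,1,2,2)] by simp
    qed (simp add: hd_def)
    have p: "h1 \<in> carrier N \<rightarrow> carrier A" "h2 \<in> carrier N \<rightarrow> carrier A" "hd \<in> carrier N \<rightarrow> carrier A"
      using characters_closed(2)[OF h1] characters_closed(2)[OF h2] characters_closed(2)[OF hd] by blast+
    have "lin_ext R (N \<times>\<times> N) A h (D.push F) = lin_ext R N A (\<lambda>z. h (z, z)) F"
      by (rule D.lin_ext_push[OF AlgD[OF A] hPi F])
    also have "\<dots> = lin_ext R N A hd F"
      by (rule T1.lin_ext_cong[OF F p(3)]) (simp add: hd_eq)
    also have "\<dots> = f A hd"
      using fF A hd by simp
    also have "\<dots> = f A h1 \<otimes>\<^bsub>A\<^esub> f A h2"
      unfolding hd_def by (rule mult[OF A h1 h2])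
    also have "\<dots> = lin_ext R N A h1 F \<otimes>\<^bsub>A\<^esub> lin_ext R N A h2 F"
      using fF A h1 h2 by simp
    also have "lin_ext R N A h1 F = lin_ext R (N \<times>\<times> N) A h (I1.push F)"
      unfolding I1.lin_ext_push[OF AlgD[OF A] hPi F]
      by (rule T1.lin_ext_cong[OF F p(1), symmetric]) (simp add: h1_def)
    also have "lin_ext R N A h2 F = lin_ext R (N \<times>\<times> N) A h (I2.push F)"
      unfolding I2.lin_ext_push[OF AlgD[OF A] hPi F]
      by (rule T1.lin_ext_cong[OF F p(2), symmetric]) (simp add: h2_def)
    also have "lin_ext R (N \<times>\<times> N) A h (I1.push F) \<otimes>\<^bsub>A\<^esub> lin_ext R (N \<times>\<times> N) A h (I2.push F) =
      lin_ext R (N \<times>\<times> N) A h (I1.push F \<otimes>\<^bsub>A2.P\<^esub> I2.push F)"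
      by (rule T2.lin_ext_mult[OF subset_refl hPi characters_mult[OF h], symmetric])
        (use I1.push_closed[OF F] I2.push_closed[OF F] in blast)+
    finally show "lin_ext R (N \<times>\<times> N) A h (D.push F) = lin_ext R (N \<times>\<times> N) A h (I1.push F \<otimes>\<^bsub>A2.P\<^esub> I2.push F)" .
  qed
  then have coeff: "D.push F (\<mu>, \<nu>) = F \<mu> \<otimes>\<^bsub>R\<^esub> F \<nu>" if "\<mu> \<in> carrier N" "\<nu> \<in> carrier N" for \<mu> \<nu>
    using push_mult_coeff[OF N(1) F F that] by simp
  \<comment> \<open>Comparing coefficients on and off the diagonal shows that the coefficients of
    \<open>F\<close> are orthogonal idempotents.\<close>
  have idem: "F \<mu> \<otimes>\<^bsub>R\<^esub> F \<mu> = F \<mu>" if "\<mu> \<in> carrier N" for \<mu>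
    using coeff[OF that that] D.push_coeff_inj[OF _ F that] by (simp add: inj_on_def)
  have orth: "F \<mu> \<otimes>\<^bsub>R\<^esub> F \<nu> = \<zero>\<^bsub>R\<^esub>" if "\<mu> \<in> carrier N" "\<nu> \<in> carrier N" "\<mu> \<noteq> \<nu>" for \<mu> \<nu>
    using coeff[OF that(1,2)] D.push_coeff_outside[of "(\<mu>, \<nu>)" F] F that by (auto simp: DirProd_def)
  interpret B: algebra R "base_alg R" by (rule base_alg_algebra)
  interpret TB: monoid_alg_target R N "base_alg R"
    by (intro monoid_alg_target.intro A1.monoid_alg_axioms base_alg_algebra)
  have one_char: "(\<lambda>z \<in> carrier N. \<one>\<^bsub>R\<^esub>) \<in> characters N (base_alg R)"
  proof -
    have o: "\<one>\<^bsub>R\<^esub> = \<one>\<^bsub>base_alg R\<^esub>"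
      by (simp add: base_alg_def)
    show ?thesis
      unfolding o by (rule charactersI) (simp_all add: B.l_one[OF B.one_closed])
  qed
  \<comment> \<open>The value 1 at the trivial character excludes \<open>F = 0\<close>. A nonzero
    idempotent of a connected ring is 1, and orthogonality then kills all other
    coefficients.\<close>
  have "\<exists>\<mu> \<in> carrier N. F \<mu> \<noteq> \<zero>\<^bsub>R\<^esub>"
  proof (rule ccontr)
    assume "\<not> ?thesis"
    then have "F = \<zero>\<^bsub>A1.P\<^esub>"
      by (intro A1.P_eqI[OF F A1.zero_closed_P]) simp
    then have "f (base_alg R) (\<lambda>z \<in> carrier N. \<one>\<^bsub>R\<^esub>) = \<zero>\<^bsub>base_alg R\<^esub>"
      using fF one_char by simp
    then show False
      using one R.connected_nontrivial[OF conn] by (simp add: base_alg_def)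
  qed
  then obtain \<mu> where \<mu>: "\<mu> \<in> carrier N" "F \<mu> \<noteq> \<zero>\<^bsub>R\<^esub>"
    by blast
  then have F1: "F \<mu> = \<one>\<^bsub>R\<^esub>"
    using R.connected_idempotent[OF conn A1.P_coeff[OF F \<mu>(1)] idem[OF \<mu>(1)]] by simp
  have "F = monomial R N \<mu>"
  proof (rule A1.P_eqI[OF F A1.monomial_closed[OF \<mu>(1)]])
    fix \<nu> assume \<nu>: "\<nu> \<in> carrier N"
    show "F \<nu> = monomial R N \<mu> \<nu>"
      using orth[OF \<mu>(1) \<nu>] F1 A1.P_coeff[OF F \<nu>] \<nu> by auto
  qed
  moreover have "lin_ext R N A h (monomial R N \<mu>) = h \<mu>" if "A \<in> Alg R" "h \<in> characters N A" for A :: "('u, 'u) module" and h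
  proof -
    interpret monoid_alg_target R N A
      by (intro monoid_alg_target.intro A1.monoid_alg_axioms AlgD[OF that(1)])
    show ?thesis
      by (rule lin_ext_monomial[OF \<mu>(1)]) (use characters_closed(2)[OF that(2)] in blast)
  qed
  ultimately show ?thesis
    using fF \<mu>(1) by (intro bexI[of _ \<mu>]) auto
qed

end

section \<open>The action of the group on the characters of the torus\<close>

context split_extension
begin

text \<open>Conjugation is written as \<open>r^-1 t r\<close>, matching the convention
  \<open>(w m)(t) = m(w^-1 t w)\<close> for the action on characters; the left action of
  \<open>w\<close> on the torus is therefore \<open>cj A (inv w)\<close>.\<close>

definition cj where "cj A w t = inv\<^bsub>Gp A\<^esub> r A w \<otimes>\<^bsub>Gp A\<^esub> t \<otimes>\<^bsub>Gp A\<^esub> r A w"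

definition act where "act w = character_action R G T M \<chi> (\<rho>\<^sub>0 w)"

lemma cj_closed: "A \<in> Alg R \<Longrightarrow> w \<in> carrier \<Gamma> \<Longrightarrow> t \<in> Tp A \<Longrightarrow> cj A w t \<in> Tp A"
  unfolding cj_def by (rule T_conj(2)[OF _ r_closed])

lemma cj_mult:
  assumes A: "A \<in> Alg R" and w: "w \<in> carrier \<Gamma>" and s: "s \<in> Tp A" and t: "t \<in> Tp A"
  shows "cj A w (s \<otimes>\<^bsub>Gp A\<^esub> t) = cj A w s \<otimes>\<^bsub>Gp A\<^esub> cj A w t"
proof -
  interpret Gp: group "Gp A" by (rule group_G[OF A])
  have [simp]: "s \<in> carrier (Gp A)" "t \<in> carrier (Gp A)" "r A w \<in> carrier (Gp A)"
    by (rule T_G[OF A s], rule T_G[OF A t], rule r_closed[OF A w])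
  have "r A w \<otimes>\<^bsub>Gp A\<^esub> (inv\<^bsub>Gp A\<^esub> r A w \<otimes>\<^bsub>Gp A\<^esub> (t \<otimes>\<^bsub>Gp A\<^esub> r A w)) = t \<otimes>\<^bsub>Gp A\<^esub> r A w"
    by (simp flip: Gp.m_assoc)
  then show ?thesis
    by (simp add: cj_def Gp.m_assoc)
qed

lemma cj_one: "A \<in> Alg R \<Longrightarrow> w \<in> carrier \<Gamma> \<Longrightarrow> cj A w \<one>\<^bsub>Gp A\<^esub> = \<one>\<^bsub>Gp A\<^esub>"
proof -
  assume A: "A \<in> Alg R" and w: "w \<in> carrier \<Gamma>"
  interpret Gp: group "Gp A" by (rule group_G[OF A])
  show ?thesis
    using r_closed[OF A w] by (simp add: cj_def)
qed

lemma cj_tr: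
  assumes A: "A \<in> Alg R" and B: "B \<in> Alg R" and \<phi>: "\<phi> \<in> alg_hom R A B" and w: "w \<in> carrier \<Gamma>" and t: "t \<in> Tp A"
  shows "tr A B \<phi> (cj A w t) = cj B w (tr A B \<phi> t)"
proof -
  interpret Gp: group "Gp A" by (rule group_G[OF A])
  show ?thesis
    using r_closed[OF A w] T_G[OF A t] by (simp add: cj_def tr_mult[OF A B \<phi>] tr_inv[OF A B \<phi>] tr_r[OF A B \<phi> w])
qed

text \<open>Points of the torus exhaust the characters of \<open>M\<close>, so agreement at all
  points makes the two monomials equal in the group algebra; over a nonzero ring distinct elements
  give distinct monomials.\<close>

lemma character_eqI:
  assumes m: "m \<in> carrier M" and m': "m' \<in> carrier M"
    and eq: "\<And>A t. A \<in> Alg R \<Longrightarrow> t \<in> Tp A \<Longrightarrow> \<chi> A t m = \<chi> A t m'"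
  shows "m = m'"
proof -
  interpret A1: monoid_alg R M by (intro monoid_alg.intro R_cring M.comm_monoid_axioms)
  have "monomial R M m = monomial R M m'"
  proof (rule expansion_unique[OF M.comm_group_axioms countable_M A1.monomial_closed[OF m] A1.monomial_closed[OF m']])
    fix A :: "('u, 'u) module" and h assume A: "A \<in> Alg R" and h: "h \<in> characters M A"
    interpret monoid_alg_target R M A
      by (intro monoid_alg_target.intro A1.monoid_alg_axioms AlgD[OF A])
    have "h \<in> carrier M \<rightarrow> carrier A"
      using characters_closed(2)[OF h] by blast
    then show "lin_ext R M A h (monomial R M m) = lin_ext R M A h (monomial R M m')"
      using eq[OF A \<tau>_closed[OF A h]] \<chi>_\<tau>[OF A h] by (simp add: lin_ext_monomial m m')
  qed
  then have "monomial R M m m = monomial R M m' m"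
    by simp
  then show ?thesis
    using m R.connected_nontrivial[OF conn] by (simp split: if_splits)
qed

text \<open>The function \<open>t \<mapsto> m(w^-1 t w)\<close> on the torus is multiplicative and
  natural, hence a character over the connected base. Through \<open>\<tau>\<close> it is regarded
  as a function of characters of \<open>M\<close>.\<close>

lemma act_ex:
  assumes w: "w \<in> carrier \<Gamma>" and m: "m \<in> carrier M"
  shows "\<exists>m' \<in> carrier M. \<forall>A \<in> Alg R. \<forall>t \<in> Tp A. \<chi> A t m' = \<chi> A (cj A w t) m"
proof -
  define f where "f A h = \<chi> A (cj A w (\<tau> A h)) m" for A h
  have "\<exists>m' \<in> carrier M. \<forall>A \<in> Alg R. \<forall>h \<in> characters M A. f A h = h m'"
  proof (rule multiplicative_function_character[OF conn M.comm_group_axioms countable_M])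
    fix A :: "('u, 'u) module" and h assume A: "A \<in> Alg R" and h: "h \<in> characters M A"
    show "f A h \<in> carrier A"
      unfolding f_def by (rule \<chi>_closed[OF A cj_closed[OF A w \<tau>_closed[OF A h]] m])
    show "f B (compose (carrier M) \<phi> h) = \<phi> (f A h)" if B: "B \<in> Alg R" and \<phi>: "\<phi> \<in> alg_hom R A B" for B \<phi>
      unfolding f_def \<tau>_tr[OF A B \<phi> h, symmetric] cj_tr[OF A B \<phi> w \<tau>_closed[OF A h], symmetric]
        \<chi>_tr[OF A B \<phi> cj_closed[OF A w \<tau>_closed[OF A h]]] by (simp add: compose_def m)
    fix h' assume h': "h' \<in> characters M A"
    define k where "k = (\<lambda>z \<in> carrier M. h z \<otimes>\<^bsub>A\<^esub> h' z)"
    note \<tau>c = \<tau>_closed[OF A h] \<tau>_closed[OF A h']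
    have "\<chi> A (\<tau> A h \<otimes>\<^bsub>Gp A\<^esub> \<tau> A h') = k"
    proof (rule extensionalityI[of _ "carrier M"])
      show "\<chi> A (\<tau> A h \<otimes>\<^bsub>Gp A\<^esub> \<tau> A h') z = k z" if "z \<in> carrier M" for z
        using \<chi>_mult[OF A \<tau>c that] \<chi>_\<tau>[OF A h] \<chi>_\<tau>[OF A h'] that by (simp add: k_def)
    qed (use \<chi>_char[OF A T_closed[OF A \<tau>c]] in \<open>auto simp: k_def\<close>)
    then have "\<tau> A k = \<tau> A h \<otimes>\<^bsub>Gp A\<^esub> \<tau> A h'"
      using \<tau>_\<chi>[OF A T_closed[OF A \<tau>c]] by simp
    then show "f A (\<lambda>z \<in> carrier M. h z \<otimes>\<^bsub>A\<^esub> h' z) = f A h \<otimes>\<^bsub>A\<^esub> f A h'"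
      unfolding f_def k_def[symmetric]
      by (simp add: cj_mult[OF A w \<tau>c] \<chi>_mult[OF A cj_closed[OF A w \<tau>c(1)] cj_closed[OF A w \<tau>c(2)] m])
  next
    have "\<chi> (base_alg R) \<one>\<^bsub>Gp (base_alg R)\<^esub> = (\<lambda>z \<in> carrier M. \<one>\<^bsub>R\<^esub>)"
    proof (rule extensionalityI[of _ "carrier M"])
      show "\<chi> (base_alg R) \<one>\<^bsub>Gp (base_alg R)\<^esub> z = (\<lambda>z \<in> carrier M. \<one>\<^bsub>R\<^esub>) z" if "z \<in> carrier M" for z
        using \<chi>_one[OF base_alg_Alg that] that by (simp add: base_alg_def)
    qed (use \<chi>_char[OF base_alg_Alg T_one[OF base_alg_Alg]] in auto)
    then have "\<tau> (base_alg R) (\<lambda>z \<in> carrier M. \<one>\<^bsub>R\<^esub>) = \<one>\<^bsub>Gp (base_alg R)\<^esub>"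
      using \<tau>_\<chi>[OF base_alg_Alg T_one[OF base_alg_Alg]] by simp
    then show "f (base_alg R) (\<lambda>z \<in> carrier M. \<one>\<^bsub>R\<^esub>) = \<one>\<^bsub>R\<^esub>"
      unfolding f_def using cj_one[OF base_alg_Alg w] \<chi>_one[OF base_alg_Alg m] by (simp add: base_alg_def)
  qed
  then obtain m' where m': "m' \<in> carrier M" and eq: "\<forall>A \<in> Alg R. \<forall>h \<in> characters M A. f A h = h m'"
    by blast
  have "\<chi> A t m' = \<chi> A (cj A w t) m" if A: "A \<in> Alg R" and t: "t \<in> Tp A" for A t
    using bspec[OF bspec[OF eq A] \<chi>_char[OF A t]] by (simp add: f_def \<tau>_\<chi>[OF A t])
  then show ?thesis
    using m' by blast
qed

text \<open>Existence and uniqueness, so that the definite description in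
  \<open>character_action\<close> denotes.\<close>

lemma act_spec:
  assumes w: "w \<in> carrier \<Gamma>" and m: "m \<in> carrier M"
  shows "act w m \<in> carrier M \<and> (\<forall>A \<in> Alg R. \<forall>t \<in> Tp A. \<chi> A t (act w m) = \<chi> A (cj A w t) m)"
proof -
  have u: "\<exists>!m'. m' \<in> carrier M \<and> (\<forall>A \<in> Alg R. \<forall>t \<in> Tp A. \<chi> A t m' = \<chi> A (cj A w t) m)"
  proof (rule ex_ex1I)
    show "\<exists>m'. m' \<in> carrier M \<and> (\<forall>A \<in> Alg R. \<forall>t \<in> Tp A. \<chi> A t m' = \<chi> A (cj A w t) m)"
      using act_ex[OF w m] by blast
    fix x y assume "x \<in> carrier M \<and> (\<forall>A \<in> Alg R. \<forall>t \<in> Tp A. \<chi> A t x = \<chi> A (cj A w t) m)"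
      "y \<in> carrier M \<and> (\<forall>A \<in> Alg R. \<forall>t \<in> Tp A. \<chi> A t y = \<chi> A (cj A w t) m)"
    then show "x = y"
      by (intro character_eqI) simp_all
  qed
  have eq: "act w m = (THE m'. m' \<in> carrier M \<and> (\<forall>A \<in> Alg R. \<forall>t \<in> Tp A. \<chi> A t m' = \<chi> A (cj A w t) m))"
    by (simp add: act_def character_action_def cj_def r_def Let_def)
  show ?thesis
    unfolding eq by (rule theI'[OF u])
qed

lemma act_closed: "w \<in> carrier \<Gamma> \<Longrightarrow> m \<in> carrier M \<Longrightarrow> act w m \<in> carrier M"
  using act_spec by blast

lemma \<chi>_act: "\<lbrakk>w \<in> carrier \<Gamma>; m \<in> carrier M; A \<in> Alg R; t \<in> Tp A\<rbrakk> \<Longrightarrow> \<chi> A t (act w m) = \<chi> A (cj A w t) m"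
  using act_spec by blast

lemma act_mult:
  assumes w: "w \<in> carrier \<Gamma>" and m: "m \<in> carrier M" and n: "n \<in> carrier M"
  shows "act w (m \<otimes>\<^bsub>M\<^esub> n) = act w m \<otimes>\<^bsub>M\<^esub> act w n"
  using act_closed[OF w] m n
  by (intro character_eqI) (simp_all add: \<chi>_act[OF w] \<chi>_M_mult cj_closed[OF _ w])

lemma act_hom: "w \<in> carrier \<Gamma> \<Longrightarrow> act w \<in> hom M M"
  by (rule homI) (simp_all add: act_closed act_mult)

lemma act_compose:
  assumes w: "w \<in> carrier \<Gamma>" and \<delta>: "\<delta> \<in> carrier \<Gamma>" and m: "m \<in> carrier M"
  shows "act (w \<otimes> \<delta>) m = act w (act \<delta> m)"
proof (rule character_eqI)
  fix A t assume A: "A \<in> Alg R" and t: "t \<in> Tp A"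
  interpret Gp: group "Gp A" by (rule group_G[OF A])
  have "cj A (w \<otimes> \<delta>) t = cj A \<delta> (cj A w t)"
    using r_closed[OF A w] r_closed[OF A \<delta>] T_G[OF A t]
    by (simp add: cj_def r_mult[OF A w \<delta>] Gp.inv_mult_group Gp.m_assoc)
  then show "\<chi> A t (act (w \<otimes> \<delta>) m) = \<chi> A t (act w (act \<delta> m))"
    using \<chi>_act[OF _ m A t] \<chi>_act[OF w act_closed[OF \<delta> m] A t] \<chi>_act[OF \<delta> m A cj_closed[OF A w t]] w \<delta> by simp
qed (use w \<delta> m in \<open>simp_all add: act_closed\<close>)

text \<open>The torus is commutative, so elements that \<open>\<rho>\<^sub>0\<close> sends into it
  act trivially; the action thus factors through \<Delta>.\<close>

lemma act_T:
  assumes w: "w \<in> carrier \<Gamma>" and T: "\<rho>\<^sub>0 w \<in> Tp (base_alg R)" and m: "m \<in> carrier M"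
  shows "act w m = m"
proof (rule character_eqI)
  fix A t assume A: "A \<in> Alg R" and t: "t \<in> Tp A"
  interpret Gp: group "Gp A" by (rule group_G[OF A])
  have rT: "r A w \<in> Tp A"
    unfolding r_def by (rule T_tr[OF base_alg_Alg A structure_map_hom[OF A] T])
  have "cj A w t = t"
    using T_comm[OF A T_inv[OF A rT] t] T_G[OF A rT] T_G[OF A t] by (simp add: cj_def Gp.m_assoc)
  then show "\<chi> A t (act w m) = \<chi> A t m"
    using \<chi>_act[OF w m A t] by simp
qed (use w m in \<open>simp_all add: act_closed\<close>)

lemma act_one: "m \<in> carrier M \<Longrightarrow> act \<one> m = m"
proof (rule act_T)
  interpret Gp: group "Gp (base_alg R)" by (rule group_G[OF base_alg_Alg])
  show "\<rho>\<^sub>0 \<one> \<in> Tp (base_alg R)"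
    using hom_one[OF \<rho>\<^sub>0 \<Gamma> Gp.is_group] T_one[OF base_alg_Alg] by simp
qed auto

lemma act_inv_act: "\<lbrakk>w \<in> carrier \<Gamma>; m \<in> carrier M\<rbrakk> \<Longrightarrow> act (inv w) (act w m) = m"
  using act_compose[of "inv w" w m] by (simp add: act_one)

lemma act_act_inv: "\<lbrakk>w \<in> carrier \<Gamma>; m \<in> carrier M\<rbrakk> \<Longrightarrow> act w (act (inv w) m) = m"
  using act_compose[of w "inv w" m] by (simp add: act_one)

lemma conj_r:
  assumes A: "A \<in> Alg R" and w: "w \<in> carrier \<Gamma>" and t: "t \<in> Tp A"
  shows "r A w \<otimes>\<^bsub>Gp A\<^esub> t = cj A (inv w) t \<otimes>\<^bsub>Gp A\<^esub> r A w"
proof -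
  interpret Gp: group "Gp A" by (rule group_G[OF A])
  show ?thesis
    using r_closed[OF A w] T_G[OF A t] by (simp add: cj_def r_inv[OF A w] Gp.m_assoc)
qed

end

abbreviation coeff_sum :: "('z \<Rightarrow>\<^sub>0 int) \<Rightarrow> int" where
  "coeff_sum x \<equiv> \<Sum>d \<in> Poly_Mapping.keys x. Poly_Mapping.lookup x d"

lemma coeff_sum_diff:
  fixes x y :: "'z \<Rightarrow>\<^sub>0 int"
  shows "(coeff_sum (x - y)) =
    (coeff_sum x) - (coeff_sum y)"
proof -
  define S where "S = Poly_Mapping.keys x \<union> Poly_Mapping.keys y"
  have S: "finite S"
    by (simp add: S_def)
  have *: "(coeff_sum v) = (\<Sum>d \<in> S. Poly_Mapping.lookup v d)"
    if "Poly_Mapping.keys v \<subseteq> S" for v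
    by (rule sum.mono_neutral_left[OF S that]) (simp add: in_keys_iff)
  have "Poly_Mapping.keys (x - y) \<subseteq> S"
    unfolding S_def by (rule keys_diff)
  then show ?thesis
    using *[of x] *[of y] *[of "x - y"] by (simp add: S_def lookup_minus sum_subtractf)
qed

lemma hom_free_unique:
  assumes H: "group H" and f: "f \<in> hom (free_Abelian_group S) H" and g: "g \<in> hom (free_Abelian_group S) H"
    and eq: "\<And>a. a \<in> S \<Longrightarrow> f (frag_of a) = g (frag_of a)" and x: "x \<in> carrier (free_Abelian_group S)"
  shows "f x = g x"
proof -
  interpret f: group_hom "free_Abelian_group S" H f
    by (intro group_hom.intro H group_free_Abelian_group group_hom_axioms.intro f)
  interpret g: group_hom "free_Abelian_group S" H g
    by (intro group_hom.intro H group_free_Abelian_group group_hom_axioms.intro g)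
  have "Poly_Mapping.keys x \<subseteq> S"
    using x by simp
  then show ?thesis
  proof (induction rule: free_Abelian_group_induct[consumes 1, case_names 1 2 3])
    case 1
    then show ?case
      using f.hom_one g.hom_one by simp
  next
    case (2 x y)
    have c: "x \<in> carrier (free_Abelian_group S)" "y \<in> carrier (free_Abelian_group S)"
      using 2 by simp_all
    show ?case
      using f.hom_mult[OF c(1) group.inv_closed[OF group_free_Abelian_group c(2)]] f.hom_inv[OF c(2)]
        g.hom_mult[OF c(1) group.inv_closed[OF group_free_Abelian_group c(2)]] g.hom_inv[OF c(2)] 2 by simp
  qed (rule eq)
qed

section \<open>The universal crossed homomorphism\<close>

locale crossed_extension = \<Gamma>: group \<Gamma> + N: normal N \<Gamma>
  for \<Gamma> :: "'p monoid" (structure) and N :: "'p set" +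
  fixes E :: "'e monoid" and a\<^sub>E :: "'p set \<Rightarrow> 'e \<Rightarrow> 'e" and \<iota> :: "'p set \<Rightarrow> 'e" and p :: "'e \<Rightarrow> 'p set \<Rightarrow>\<^sub>0 int"
  assumes ext: "corresponding_extension \<Gamma> N E a\<^sub>E \<iota> p"
begin

abbreviation D where "D \<equiv> \<Gamma> Mod N"
abbreviation K where "K \<equiv> derived \<Gamma> N"
abbreviation Q where "Q \<equiv> \<Gamma> Mod K"
abbreviation A where "A \<equiv> abelianisation \<Gamma> N"
abbreviation cl where "cl w \<equiv> N #> w"
abbreviation q where "q w \<equiv> K #> w"

sublocale K: normal K \<Gamma> by (rule \<Gamma>.derived_is_normal[OF N.normal_axioms])
sublocale Q: group Q by (rule K.factorgroup_is_group)
sublocale D: group D by (rule N.factorgroup_is_group)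

lemma mod_ext: "module_extension D A (conjugation_action \<Gamma>) E a\<^sub>E (augmentation_ideal D) (group_ring_action D) \<iota> p"
  using ext by (simp add: corresponding_extension_def Let_def)

sublocale E: comm_group E
  using mod_ext by (simp add: module_extension_def group_module_def)

lemma aE_hom: "d \<in> carrier D \<Longrightarrow> a\<^sub>E d \<in> hom E E"
  using mod_ext by (simp add: module_extension_def group_module_def)

lemma aE_closed: "d \<in> carrier D \<Longrightarrow> x \<in> carrier E \<Longrightarrow> a\<^sub>E d x \<in> carrier E"
  using hom_carrier[OF aE_hom] by blast

lemma aE_mult: "\<lbrakk>d \<in> carrier D; x \<in> carrier E; y \<in> carrier E\<rbrakk> \<Longrightarrow> a\<^sub>E d (x \<otimes>\<^bsub>E\<^esub> y) = a\<^sub>E d x \<otimes>\<^bsub>E\<^esub> a\<^sub>E d y"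
  using hom_mult[OF aE_hom] by blast

lemma aE_one: "x \<in> carrier E \<Longrightarrow> a\<^sub>E \<one>\<^bsub>D\<^esub> x = x"
  using mod_ext by (simp add: module_extension_def group_module_def)

lemma N_group: "group (\<Gamma>\<lparr>carrier := N\<rparr>)"
  by (rule \<Gamma>.subgroup_imp_group[OF N.is_subgroup])

lemma A_eq: "A = (\<Gamma>\<lparr>carrier := N\<rparr>) Mod (derived (\<Gamma>\<lparr>carrier := N\<rparr>) (carrier (\<Gamma>\<lparr>carrier := N\<rparr>)))"
  using \<Gamma>.derived_consistent[OF subset_refl N.is_subgroup] by (simp add: abelianisation_def)

sublocale A: comm_group A
  unfolding A_eq by (rule group.derived_quot_is_comm_group[OF N_group])

lemma A_carrier: "carrier A = q ` N"
  by (simp add: abelianisation_def carrier_FactGroup r_coset_def)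

lemma A_mult: "x \<otimes>\<^bsub>A\<^esub> y = x \<otimes>\<^bsub>Q\<^esub> y"
  by (simp add: abelianisation_def set_mult_def)

lemma A_one: "\<one>\<^bsub>A\<^esub> = \<one>\<^bsub>Q\<^esub>"
  by (simp add: abelianisation_def)

lemma q_closed: "w \<in> carrier \<Gamma> \<Longrightarrow> q w \<in> carrier Q"
  by (simp add: carrier_FactGroup)

lemma cl_closed: "w \<in> carrier \<Gamma> \<Longrightarrow> cl w \<in> carrier D"
  by (simp add: carrier_FactGroup)

lemma A_Q: "x \<in> carrier A \<Longrightarrow> x \<in> carrier Q"
  using A_carrier q_closed N.subset by auto

lemma q_A: "n \<in> N \<Longrightarrow> q n \<in> carrier A"
  by (simp add: A_carrier)

lemma q_mult: "w \<in> carrier \<Gamma> \<Longrightarrow> \<delta> \<in> carrier \<Gamma> \<Longrightarrow> q (w \<otimes> \<delta>) = q w \<otimes>\<^bsub>Q\<^esub> q \<delta>"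
  using K.rcos_sum by simp

lemma cl_mult: "w \<in> carrier \<Gamma> \<Longrightarrow> \<delta> \<in> carrier \<Gamma> \<Longrightarrow> cl (w \<otimes> \<delta>) = cl w \<otimes>\<^bsub>D\<^esub> cl \<delta>"
  using N.rcos_sum by simp

lemma q_inv: "w \<in> carrier \<Gamma> \<Longrightarrow> q (inv w) = inv\<^bsub>Q\<^esub> q w"
  using group_hom.hom_inv[OF group_hom.intro[OF \<Gamma>.is_group Q.is_group]] K.r_coset_hom_Mod by (simp add: group_hom_axioms_def)

lemma cl_N: "n \<in> N \<Longrightarrow> cl n = \<one>\<^bsub>D\<^esub>"
  using N.rcos_const[OF \<Gamma>.is_group] by simp

lemma A_conj:
  assumes w: "w \<in> carrier \<Gamma>" and x: "x \<in> carrier A"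
  shows "q w \<otimes>\<^bsub>Q\<^esub> x \<otimes>\<^bsub>Q\<^esub> inv\<^bsub>Q\<^esub> q w \<in> carrier A"
proof -
  obtain n where n: "n \<in> N" "x = q n"
    using x A_carrier by auto
  have nc: "n \<in> carrier \<Gamma>"
    using n N.subset by auto
  have "q w \<otimes>\<^bsub>Q\<^esub> x \<otimes>\<^bsub>Q\<^esub> inv\<^bsub>Q\<^esub> q w = q (w \<otimes> n \<otimes> inv w)"
    using q_mult[of "w \<otimes> n" "inv w"] q_mult[OF w nc] q_inv[OF w] w nc n(2) by simp
  then show ?thesis
    using q_A[OF N.inv_op_closed2[OF w n(1)]] by simp
qed

text \<open>\<open>conjugation_action\<close> picks some element of the coset of \<open>w\<close>.
  It differs from \<open>w\<close> by an element \<open>n\<close> of \<open>N\<close>, and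
  conjugation by \<open>n\<close> is trivial on the commutative group \<open>A\<close>.\<close>

lemma conj_act:
  assumes w: "w \<in> carrier \<Gamma>" and x: "x \<in> carrier A"
  shows "conjugation_action \<Gamma> (cl w) x = q w \<otimes>\<^bsub>Q\<^esub> x \<otimes>\<^bsub>Q\<^esub> inv\<^bsub>Q\<^esub> q w"
proof -
  define g where "g = (SOME g. g \<in> cl w)"
  have "g \<in> cl w"
    unfolding g_def by (rule someI[of _ w]) (rule \<Gamma>.rcos_self[OF w N.is_subgroup])
  then obtain n where n: "n \<in> N" "g = n \<otimes> w"
    by (auto simp: r_coset_def)
  have nc: "n \<in> carrier \<Gamma>"
    using n N.subset by auto
  have g: "g \<in> carrier \<Gamma>"
    using n nc w by simp
  obtain y where y: "y \<in> N" "x = q y"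
    using x A_carrier by auto
  have yc: "y \<in> carrier \<Gamma>"
    using y N.subset by auto
  have KG: "k \<in> carrier \<Gamma>" if "k \<in> K" for k
    using that K.subset by auto
  \<comment> \<open>Conjugating elementwise maps a coset of \<open>K\<close> onto a coset of
    \<open>K\<close>, since \<open>K\<close> is normal in all of \<Gamma>.\<close>
  have "(\<lambda>x. g \<otimes> x \<otimes> inv g) ` (q y) = q (g \<otimes> y \<otimes> inv g)"
  proof (intro equalityI subsetI)
    fix y' assume "y' \<in> (\<lambda>x. g \<otimes> x \<otimes> inv g) ` (q y)"
    then obtain k where k: "k \<in> K" "y' = g \<otimes> (k \<otimes> y) \<otimes> inv g"
      by (auto simp: r_coset_def)
    have "y' = (g \<otimes> k \<otimes> inv g) \<otimes> (g \<otimes> y \<otimes> inv g)"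
      using k(2) KG[OF k(1)] g yc by (simp add: \<Gamma>.m_assoc \<Gamma>.inv_solve_left)
    then show "y' \<in> q (g \<otimes> y \<otimes> inv g)"
      using K.inv_op_closed2[OF g k(1)] unfolding r_coset_def by blast
  next
    fix y' assume "y' \<in> q (g \<otimes> y \<otimes> inv g)"
    then obtain k where k: "k \<in> K" "y' = k \<otimes> (g \<otimes> y \<otimes> inv g)"
      by (auto simp: r_coset_def)
    have "y' = g \<otimes> ((inv g \<otimes> k \<otimes> g) \<otimes> y) \<otimes> inv g"
      using k(2) KG[OF k(1)] g yc by (simp add: \<Gamma>.m_assoc[symmetric])
    moreover have "(inv g \<otimes> k \<otimes> g) \<otimes> y \<in> q y"
      using K.inv_op_closed1[OF g k(1)] unfolding r_coset_def by blast
    ultimately show "y' \<in> (\<lambda>x. g \<otimes> x \<otimes> inv g) ` (q y)"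
      by blast
  qed
  then have "conjugation_action \<Gamma> (cl w) x = q (g \<otimes> y \<otimes> inv g)"
    by (simp add: conjugation_action_def coset_action_def g_def[symmetric] y(2))
  also have "\<dots> = q g \<otimes>\<^bsub>Q\<^esub> x \<otimes>\<^bsub>Q\<^esub> inv\<^bsub>Q\<^esub> q g"
    using q_mult[of "g \<otimes> y" "inv g"] q_mult[OF g yc] q_inv[OF g] g yc y(2) by simp
  also have "\<dots> = q n \<otimes>\<^bsub>Q\<^esub> (q w \<otimes>\<^bsub>Q\<^esub> x \<otimes>\<^bsub>Q\<^esub> inv\<^bsub>Q\<^esub> q w) \<otimes>\<^bsub>Q\<^esub> inv\<^bsub>Q\<^esub> q n"
    unfolding n(2) q_mult[OF nc w] using q_closed[OF nc] q_closed[OF w] A_Q[OF x]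
    by (simp only: Q.inv_mult_group Q.m_assoc Q.m_closed Q.inv_closed)
  also have "q n \<otimes>\<^bsub>Q\<^esub> (q w \<otimes>\<^bsub>Q\<^esub> x \<otimes>\<^bsub>Q\<^esub> inv\<^bsub>Q\<^esub> q w) = (q w \<otimes>\<^bsub>Q\<^esub> x \<otimes>\<^bsub>Q\<^esub> inv\<^bsub>Q\<^esub> q w) \<otimes>\<^bsub>Q\<^esub> q n"
    using A.m_comm[OF q_A[OF n(1)] A_conj[OF w x]] by (simp only: A_mult)
  also have "\<dots> \<otimes>\<^bsub>Q\<^esub> inv\<^bsub>Q\<^esub> q n = q w \<otimes>\<^bsub>Q\<^esub> x \<otimes>\<^bsub>Q\<^esub> inv\<^bsub>Q\<^esub> q w"
    using q_closed[OF nc] A_Q[OF A_conj[OF w x]] by (simp only: Q.m_assoc Q.r_inv Q.r_one Q.inv_closed)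
  finally show ?thesis .
qed

lemma \<iota>_hom: "\<iota> \<in> hom A E" and \<iota>_inj: "inj_on \<iota> (carrier A)"
  using mod_ext by (simp_all add: module_extension_def mon_def)

sublocale \<iota>: group_hom A E \<iota>
  by (intro group_hom.intro A.is_group E.is_group group_hom_axioms.intro \<iota>_hom)

lemma p_hom: "p \<in> hom E (free_Abelian_group (carrier D))"
  using mod_ext by (auto simp: module_extension_def epi_def hom_def augmentation_ideal_def)

sublocale p: group_hom E "free_Abelian_group (carrier D)" p
  by (intro group_hom.intro E.is_group group_free_Abelian_group group_hom_axioms.intro p_hom)

lemma p_aug: "x \<in> carrier E \<Longrightarrow> (coeff_sum (p x)) = 0"
  using mod_ext by (auto simp: module_extension_def epi_def hom_def augmentation_ideal_def)

lemma p_ker: "x \<in> carrier E \<Longrightarrow> p x = 0 \<longleftrightarrow> x \<in> \<iota> ` carrier A"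
  using mod_ext by (auto simp: module_extension_def kernel_def augmentation_ideal_def)

lemma \<iota>_equiv: "\<lbrakk>d \<in> carrier D; x \<in> carrier A\<rbrakk> \<Longrightarrow> \<iota> (conjugation_action \<Gamma> d x) = a\<^sub>E d (\<iota> x)"
  using mod_ext by (simp add: module_extension_def)

abbreviation fset where "fset s c d \<equiv> s c \<otimes>\<^bsub>Q\<^esub> s d \<otimes>\<^bsub>Q\<^esub> inv\<^bsub>Q\<^esub> s (c \<otimes>\<^bsub>D\<^esub> d)"

text \<open>
  A section \<open>s\<close> of \<open>\<Gamma>/[N, N] \<rightarrow> \<Gamma>/N\<close> and lifts \<open>e d\<close> of \<open>[d] - [1]\<close> to \<open>E\<close> whose factor sets are equal,
  not merely cohomologous.
\<close>

definition adapted where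
  "adapted s e \<longleftrightarrow> s \<in> carrier D \<rightarrow> carrier Q \<and> (\<forall>d \<in> carrier D. s d \<subseteq> d) \<and> e \<in> carrier D \<rightarrow> carrier E \<and>
    (\<forall>d \<in> carrier D. p (e d) = frag_of d - frag_of \<one>\<^bsub>D\<^esub>) \<and>
    (\<forall>c \<in> carrier D. \<forall>d \<in> carrier D.
       fset s c d \<in> carrier A \<and>
       e c \<otimes>\<^bsub>E\<^esub> a\<^sub>E c (e d) = \<iota> (fset s c d) \<otimes>\<^bsub>E\<^esub> e (c \<otimes>\<^bsub>D\<^esub> d))"

lemma conj_act_closed: "\<lbrakk>d \<in> carrier D; x \<in> carrier A\<rbrakk> \<Longrightarrow> conjugation_action \<Gamma> d x \<in> carrier A"
  using conj_act A_conj by (auto simp: carrier_FactGroup)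

text \<open>The two factor sets differ by the coboundary of a cochain \<open>u\<close> with values
  in \<open>A\<close>. Adding \<open>\<iota> (u d)\<close> to the lift \<open>e d\<close> changes
  its factor set by that coboundary and leaves \<open>p (e d)\<close> alone.\<close>

lemma adapted_ex: "\<exists>s e. adapted s e"
proof -
  obtain z z' where z: "group_extension_cocycle \<Gamma> N z" and z': "module_extension_cocycle D A E a\<^sub>E \<iota> p z'"
    and co: "cohomologous2 D A (conjugation_action \<Gamma>) z z'"
    using ext unfolding corresponding_extension_def Let_def by blast
  obtain s where s: "s \<in> carrier D \<rightarrow> carrier Q" "\<forall>d \<in> carrier D. s d \<subseteq> d"
    "\<forall>c \<in> carrier D. \<forall>d \<in> carrier D. z c d = fset s c d"
    using z unfolding group_extension_cocycle_def Let_def by blast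
  obtain e where e: "e \<in> carrier D \<rightarrow> carrier E" "\<forall>d \<in> carrier D. p (e d) = frag_of d - frag_of \<one>\<^bsub>D\<^esub>"
    "\<forall>c \<in> carrier D. \<forall>d \<in> carrier D. z' c d \<in> carrier A \<and>
       \<iota> (z' c d) = e c \<otimes>\<^bsub>E\<^esub> a\<^sub>E c (e d) \<otimes>\<^bsub>E\<^esub> inv\<^bsub>E\<^esub> e (c \<otimes>\<^bsub>D\<^esub> d)"
    using z' unfolding module_extension_cocycle_def by blast
  obtain u where u: "u \<in> carrier D \<rightarrow> carrier A" "\<forall>c \<in> carrier D. \<forall>d \<in> carrier D.
       z c d = z' c d \<otimes>\<^bsub>A\<^esub> (u c \<otimes>\<^bsub>A\<^esub> conjugation_action \<Gamma> c (u d) \<otimes>\<^bsub>A\<^esub> inv\<^bsub>A\<^esub> u (c \<otimes>\<^bsub>D\<^esub> d))"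
    using co unfolding cohomologous2_def by blast
  have uA: "u d \<in> carrier A" and eE: "e d \<in> carrier E" if "d \<in> carrier D" for d
    using u(1) e(1) that by auto
  define e' where "e' d = e d \<otimes>\<^bsub>E\<^esub> \<iota> (u d)" for d
  have pe: "p (e' d) = frag_of d - frag_of \<one>\<^bsub>D\<^esub>" if "d \<in> carrier D" for d
    using p_ker[of "\<iota> (u d)"] uA[OF that] eE[OF that] bspec[OF e(2) that] by (simp add: e'_def)
  have "z c d \<in> carrier A \<and> e' c \<otimes>\<^bsub>E\<^esub> a\<^sub>E c (e' d) = \<iota> (z c d) \<otimes>\<^bsub>E\<^esub> e' (c \<otimes>\<^bsub>D\<^esub> d)"
    if c: "c \<in> carrier D" and d: "d \<in> carrier D" for c d
  proof -
    have cd: "c \<otimes>\<^bsub>D\<^esub> d \<in> carrier D"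
      by (rule D.m_closed[OF c d])
    have z'A: "z' c d \<in> carrier A" and z'e: "\<iota> (z' c d) = e c \<otimes>\<^bsub>E\<^esub> a\<^sub>E c (e d) \<otimes>\<^bsub>E\<^esub> inv\<^bsub>E\<^esub> e (c \<otimes>\<^bsub>D\<^esub> d)"
      using e(3) c d by auto
    have zu: "z c d = z' c d \<otimes>\<^bsub>A\<^esub> (u c \<otimes>\<^bsub>A\<^esub> conjugation_action \<Gamma> c (u d) \<otimes>\<^bsub>A\<^esub> inv\<^bsub>A\<^esub> u (c \<otimes>\<^bsub>D\<^esub> d))"
      using u(2) c d by auto
    note cl = uA[OF c] uA[OF d] uA[OF cd] eE[OF c] eE[OF d] eE[OF cd] conj_act_closed[OF c uA[OF d]]
      z'A aE_closed[OF c eE[OF d]] aE_closed[OF c \<iota>.hom_closed[OF uA[OF d]]]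
    have zA: "z c d \<in> carrier A"
      unfolding zu using cl by (intro A.m_closed A.inv_closed)
    have ec: "e c \<otimes>\<^bsub>E\<^esub> a\<^sub>E c (e d) = \<iota> (z' c d) \<otimes>\<^bsub>E\<^esub> e (c \<otimes>\<^bsub>D\<^esub> d)"
      unfolding z'e using cl by (simp add: E.m_assoc)
    have uc: "\<iota> (u c) \<otimes>\<^bsub>E\<^esub> a\<^sub>E c (\<iota> (u d)) =
      \<iota> (u c \<otimes>\<^bsub>A\<^esub> conjugation_action \<Gamma> c (u d) \<otimes>\<^bsub>A\<^esub> inv\<^bsub>A\<^esub> u (c \<otimes>\<^bsub>D\<^esub> d)) \<otimes>\<^bsub>E\<^esub> \<iota> (u (c \<otimes>\<^bsub>D\<^esub> d))"
      using cl \<iota>_equiv[OF c uA[OF d]] by (simp add: E.m_assoc)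
    have "e' c \<otimes>\<^bsub>E\<^esub> a\<^sub>E c (e' d) = (e c \<otimes>\<^bsub>E\<^esub> a\<^sub>E c (e d)) \<otimes>\<^bsub>E\<^esub> (\<iota> (u c) \<otimes>\<^bsub>E\<^esub> a\<^sub>E c (\<iota> (u d)))"
      unfolding e'_def using cl aE_mult[OF c eE[OF d] \<iota>.hom_closed[OF uA[OF d]]] by (simp add: E.m_ac)
    also have "\<dots> = \<iota> (z c d) \<otimes>\<^bsub>E\<^esub> e' (c \<otimes>\<^bsub>D\<^esub> d)"
      unfolding ec uc zu e'_def using cl by (simp add: E.m_ac)
    finally show ?thesis
      using zA by blast
  qed
  then have "adapted s e'"
    unfolding adapted_def using s pe eE uA by (auto simp: e'_def Pi_iff)
  then show ?thesis
    by blast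
qed

definition se where "se = (SOME se. adapted (fst se) (snd se))"
definition s where "s = fst se"
definition e where "e = snd se"

lemma adapted_se: "adapted s e"
proof -
  obtain s' e' where "adapted s' e'"
    using adapted_ex by blast
  then have "adapted (fst (s', e')) (snd (s', e'))"
    by simp
  then show ?thesis
    unfolding s_def e_def se_def by (rule someI)
qed

lemma s_closed: "d \<in> carrier D \<Longrightarrow> s d \<in> carrier Q" and s_sub: "d \<in> carrier D \<Longrightarrow> s d \<subseteq> d"
  and e_closed: "d \<in> carrier D \<Longrightarrow> e d \<in> carrier E"
  and p_e: "d \<in> carrier D \<Longrightarrow> p (e d) = frag_of d - frag_of \<one>\<^bsub>D\<^esub>"
  and sse: "\<lbrakk>c \<in> carrier D; d \<in> carrier D\<rbrakk> \<Longrightarrow>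
    fset s c d \<in> carrier A \<and>
    e c \<otimes>\<^bsub>E\<^esub> a\<^sub>E c (e d) = \<iota> (fset s c d) \<otimes>\<^bsub>E\<^esub> e (c \<otimes>\<^bsub>D\<^esub> d)"
  using adapted_se unfolding adapted_def by (blast dest: funcset_mem)+

text \<open>An element of \<Gamma> that represents both the coset \<open>s d\<close> of
  \<open>K\<close> and the coset \<open>d\<close> of \<open>N\<close>.\<close>

definition \<sigma> where "\<sigma> d = (SOME g. g \<in> s d)"

lemma \<sigma>:
  assumes d: "d \<in> carrier D"
  shows "\<sigma> d \<in> carrier \<Gamma>" "cl (\<sigma> d) = d" "q (\<sigma> d) = s d"
proof -
  obtain g where g: "g \<in> carrier \<Gamma>" "s d = q g"
    using s_closed[OF d] by (auto simp: carrier_FactGroup)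
  have "g \<in> s d"
    unfolding g(2) by (rule \<Gamma>.rcos_self[OF g(1) K.is_subgroup])
  then have \<sigma>s: "\<sigma> d \<in> s d"
    unfolding \<sigma>_def by (rule someI)
  then show c: "\<sigma> d \<in> carrier \<Gamma>"
    using g(2) K.rcosets_carrier[OF \<Gamma>.is_group] s_closed[OF d] by (auto simp: FactGroup_def)
  show "q (\<sigma> d) = s d"
    using \<Gamma>.repr_independence[OF _ g(1) K.is_subgroup, of "\<sigma> d"] \<sigma>s g(2) by simp
  obtain h where h: "h \<in> carrier \<Gamma>" "d = cl h"
    using d by (auto simp: carrier_FactGroup)
  show "cl (\<sigma> d) = d"
    using \<Gamma>.repr_independence[OF _ h(1) N.is_subgroup, of "\<sigma> d"] \<sigma>s s_sub[OF d] h(2) by auto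
qed

definition \<nu> where "\<nu> w = q w \<otimes>\<^bsub>Q\<^esub> inv\<^bsub>Q\<^esub> s (cl w)"

text \<open>Modulo \<open>[N, N]\<close> each \<open>w\<close> is the element \<open>\<nu> w\<close>
  of \<open>A\<close> times the value of the section, and \<open>\<delta>\<close> replaces the
  section by the lift \<open>e\<close>. With it \<open>E\<close> is the middle term of Crowell's
  exact sequence, the augmentation ideal of \<Gamma> with scalars extended to the group ring of
  \<open>D\<close>, and \<open>\<delta> w\<close> corresponds to \<open>w - 1\<close>.\<close>

definition \<delta> where "\<delta> w = \<iota> (\<nu> w) \<otimes>\<^bsub>E\<^esub> e (cl w)"

lemma diff_\<sigma>:
  assumes w: "w \<in> carrier \<Gamma>"
  shows "w \<otimes> inv \<sigma> (cl w) \<in> N" "\<nu> w = q (w \<otimes> inv \<sigma> (cl w))" "\<nu> w \<in> carrier A"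
proof -
  note \<sigma>' = \<sigma>[OF cl_closed[OF w]]
  have "w \<in> cl (\<sigma> (cl w))"
    unfolding \<sigma>'(2) by (rule \<Gamma>.rcos_self[OF w N.is_subgroup])
  then show n: "w \<otimes> inv \<sigma> (cl w) \<in> N"
    by (rule N.rcos_module_imp[OF \<Gamma>.is_group \<sigma>'(1)])
  show \<nu>: "\<nu> w = q (w \<otimes> inv \<sigma> (cl w))"
    using q_mult[OF w, of "inv \<sigma> (cl w)"] q_inv[OF \<sigma>'(1)] \<sigma>' by (simp add: \<nu>_def)
  show "\<nu> w \<in> carrier A"
    unfolding \<nu> by (rule q_A[OF n])
qed

lemma \<delta>_closed: "w \<in> carrier \<Gamma> \<Longrightarrow> \<delta> w \<in> carrier E"
  unfolding \<delta>_def by (intro E.m_closed \<iota>.hom_closed diff_\<sigma> e_closed cl_closed)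

text \<open>The factor set of \<open>s\<close> appears when \<open>\<nu> (w w')\<close> is expressed
  by \<open>\<nu> w\<close> and the conjugate of \<open>\<nu> w'\<close>; the factor set of
  \<open>e\<close> appears in \<open>e c + c e(d)\<close>. For adapted data the two are the same
  element \<open>z\<close>, so the terms match exactly.\<close>

lemma \<delta>_crossed:
  assumes w: "w \<in> carrier \<Gamma>" and w': "w' \<in> carrier \<Gamma>"
  shows "\<delta> (w \<otimes> w') = \<delta> w \<otimes>\<^bsub>E\<^esub> a\<^sub>E (cl w) (\<delta> w')"
proof -
  define c d where "c = cl w" and "d = cl w'"
  have c: "c \<in> carrier D" and d: "d \<in> carrier D"
    by (simp_all only: c_def d_def cl_closed[OF w] cl_closed[OF w'])
  have cd: "cl (w \<otimes> w') = c \<otimes>\<^bsub>D\<^esub> d"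
    unfolding c_def d_def by (rule cl_mult[OF w w'])
  have cdD: "c \<otimes>\<^bsub>D\<^esub> d \<in> carrier D"
    by (rule D.m_closed[OF c d])
  define z where "z = fset s c d"
  have z: "z \<in> carrier A" "e c \<otimes>\<^bsub>E\<^esub> a\<^sub>E c (e d) = \<iota> z \<otimes>\<^bsub>E\<^esub> e (c \<otimes>\<^bsub>D\<^esub> d)"
    using sse[OF c d] unfolding z_def by blast+
  note \<nu>A = diff_\<sigma>(3)[OF w] diff_\<sigma>(3)[OF w']
  have ca: "conjugation_action \<Gamma> c (\<nu> w') = s c \<otimes>\<^bsub>Q\<^esub> \<nu> w' \<otimes>\<^bsub>Q\<^esub> inv\<^bsub>Q\<^esub> s c"
    using conj_act[OF \<sigma>(1)[OF c] \<nu>A(2)] \<sigma>[OF c] by simp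
  have \<nu>_mult: "\<nu> (w \<otimes> w') = \<nu> w \<otimes>\<^bsub>Q\<^esub> (s c \<otimes>\<^bsub>Q\<^esub> \<nu> w' \<otimes>\<^bsub>Q\<^esub> inv\<^bsub>Q\<^esub> s c) \<otimes>\<^bsub>Q\<^esub> z"
  proof -
    have [simp]: "q w \<in> carrier Q" "q w' \<in> carrier Q" "s c \<in> carrier Q" "s d \<in> carrier Q" "s (c \<otimes>\<^bsub>D\<^esub> d) \<in> carrier Q"
      by (rule q_closed[OF w], rule q_closed[OF w'], rule s_closed[OF c], rule s_closed[OF d], rule s_closed[OF cdD])
    have cancel: "inv\<^bsub>Q\<^esub> x \<otimes>\<^bsub>Q\<^esub> (x \<otimes>\<^bsub>Q\<^esub> y) = y" if "x \<in> carrier Q" "y \<in> carrier Q" for x y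
      using that by (simp only: Q.m_assoc[symmetric] Q.inv_closed Q.l_inv Q.l_one)
    show ?thesis
      unfolding \<nu>_def cd q_mult[OF w w'] c_def[symmetric] d_def[symmetric] z_def
      by (simp only: Q.m_assoc Q.m_closed Q.inv_closed cancel \<open>q w \<in> carrier Q\<close> \<open>q w' \<in> carrier Q\<close>
          \<open>s c \<in> carrier Q\<close> \<open>s d \<in> carrier Q\<close> \<open>s (c \<otimes>\<^bsub>D\<^esub> d) \<in> carrier Q\<close>)
  qed
  have "\<nu> (w \<otimes> w') = \<nu> w \<otimes>\<^bsub>A\<^esub> conjugation_action \<Gamma> c (\<nu> w') \<otimes>\<^bsub>A\<^esub> z"
    unfolding A_mult ca by (rule \<nu>_mult)
  then have "\<iota> (\<nu> (w \<otimes> w')) = \<iota> (\<nu> w) \<otimes>\<^bsub>E\<^esub> a\<^sub>E c (\<iota> (\<nu> w')) \<otimes>\<^bsub>E\<^esub> \<iota> z"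
    using \<iota>_equiv[OF c \<nu>A(2)] conj_act_closed[OF c \<nu>A(2)] \<nu>A z(1)
    by (simp only: \<iota>.hom_mult A.m_closed)
  then have "\<delta> (w \<otimes> w') = \<iota> (\<nu> w) \<otimes>\<^bsub>E\<^esub> a\<^sub>E c (\<iota> (\<nu> w')) \<otimes>\<^bsub>E\<^esub> \<iota> z \<otimes>\<^bsub>E\<^esub> e (c \<otimes>\<^bsub>D\<^esub> d)"
    by (simp add: \<delta>_def cd)
  also have "\<dots> = \<iota> (\<nu> w) \<otimes>\<^bsub>E\<^esub> a\<^sub>E c (\<iota> (\<nu> w')) \<otimes>\<^bsub>E\<^esub> (e c \<otimes>\<^bsub>E\<^esub> a\<^sub>E c (e d))"
    unfolding z(2) using \<nu>A z(1) aE_closed[OF c] e_closed[OF cdD] by (simp add: E.m_assoc)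
  also have "\<dots> = \<delta> w \<otimes>\<^bsub>E\<^esub> a\<^sub>E c (\<delta> w')"
    unfolding \<delta>_def c_def[symmetric] d_def[symmetric]
    using \<nu>A aE_closed[OF c] e_closed[OF c] e_closed[OF d] by (simp add: aE_mult[OF c] E.m_ac)
  finally show ?thesis
    unfolding c_def .
qed

text \<open>The section is not normalised. At the pair \<open>(1, 1)\<close> its factor set is
  \<open>s 1\<close> itself, and equality of the factor sets forces \<open>e 1\<close> to be the
  image of \<open>s 1\<close>.\<close>

lemma s_one: "s \<one>\<^bsub>D\<^esub> \<in> carrier A" "e \<one>\<^bsub>D\<^esub> = \<iota> (s \<one>\<^bsub>D\<^esub>)"
proof -
  have sc: "s \<one>\<^bsub>D\<^esub> \<in> carrier Q"
    by (rule s_closed[OF D.one_closed])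
  have 1: "s \<one>\<^bsub>D\<^esub> \<otimes>\<^bsub>Q\<^esub> s \<one>\<^bsub>D\<^esub> \<otimes>\<^bsub>Q\<^esub> inv\<^bsub>Q\<^esub> s \<one>\<^bsub>D\<^esub> = s \<one>\<^bsub>D\<^esub>"
    using sc by (simp only: Q.m_assoc Q.r_inv Q.r_one Q.inv_closed)
  note * = sse[OF D.one_closed D.one_closed, unfolded D.r_one[OF D.one_closed] aE_one[OF e_closed[OF D.one_closed]], unfolded 1]
  show "s \<one>\<^bsub>D\<^esub> \<in> carrier A"
    using * by blast
  then show "e \<one>\<^bsub>D\<^esub> = \<iota> (s \<one>\<^bsub>D\<^esub>)"
    using * e_closed[OF D.one_closed] \<iota>.hom_closed by (metis E.r_cancel)
qed

text \<open>The unnormalised value \<open>s 1\<close> in \<open>\<nu>\<close> cancels against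
  \<open>e 1\<close>, so on \<open>N\<close> the crossed homomorphism is the projection to the
  abelianisation.\<close>

lemma \<delta>_N: "n \<in> N \<Longrightarrow> \<delta> n = \<iota> (q n)"
proof -
  assume n: "n \<in> N"
  have qn: "q n \<in> carrier A"
    by (rule q_A[OF n])
  have nc: "n \<in> carrier \<Gamma>"
    using n N.subset by auto
  have "\<delta> n = \<iota> (\<nu> n \<otimes>\<^bsub>A\<^esub> s \<one>\<^bsub>D\<^esub>)"
    unfolding \<delta>_def cl_N[OF n] s_one(2) using diff_\<sigma>(3)[OF nc] s_one(1) by (simp only: \<iota>.hom_mult)
  also have "\<nu> n \<otimes>\<^bsub>A\<^esub> s \<one>\<^bsub>D\<^esub> = q n"
    unfolding \<nu>_def cl_N[OF n] A_mult using q_closed[OF nc] s_closed[OF D.one_closed]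
    by (simp only: Q.m_assoc Q.l_inv Q.r_one Q.inv_closed)
  finally show ?thesis .
qed

lemma \<delta>_\<sigma>: "d \<in> carrier D \<Longrightarrow> \<delta> (\<sigma> d) = e d"
proof -
  assume d: "d \<in> carrier D"
  have "\<nu> (\<sigma> d) = \<one>\<^bsub>A\<^esub>"
    unfolding \<nu>_def \<sigma>(2)[OF d] \<sigma>(3)[OF d] A_one by (rule Q.r_inv[OF s_closed[OF d]])
  then show ?thesis
    unfolding \<delta>_def \<sigma>(2)[OF d] using e_closed[OF d] by (simp only: \<iota>.hom_one E.l_one)
qed

text \<open>The map \<open>[d] \<mapsto> e d\<close> satisfies
  \<open>p (h y) = y - \<epsilon>(y) [1]\<close>, with \<open>\<epsilon>\<close> the sum of
  coefficients. On the augmentation ideal it is a section of \<open>p\<close>, so \<open>E\<close>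
  splits additively, although in general not as a module.\<close>

lemma free_lift:
  obtains h where "h \<in> hom (free_Abelian_group (carrier D)) E" "\<And>d. d \<in> carrier D \<Longrightarrow> h (frag_of d) = e d"
    "\<And>x. x \<in> carrier E \<Longrightarrow> p (h (p x)) = p x"
proof -
  obtain h where h: "h \<in> hom (free_Abelian_group (carrier D)) E" and he: "\<And>d. d \<in> carrier D \<Longrightarrow> h (frag_of d) = e d"
    using E.free_Abelian_group_universal[of e "carrier D"] e_closed by blast
  interpret h: group_hom "free_Abelian_group (carrier D)" E h
    by (intro group_hom.intro E.is_group group_free_Abelian_group group_hom_axioms.intro h)
  have "p (h y) = y - frag_cmul (coeff_sum y) (frag_of \<one>\<^bsub>D\<^esub>)"
    if "Poly_Mapping.keys y \<subseteq> carrier D" for y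
    using that
  proof (induction rule: free_Abelian_group_induct[consumes 1, case_names 1 2 3])
    case 1
    then show ?case
      using h.hom_one p.hom_one by simp
  next
    case (2 x y)
    have c: "x \<in> carrier (free_Abelian_group (carrier D))" "y \<in> carrier (free_Abelian_group (carrier D))"
      using 2 by simp_all
    have "h (x - y) = h x \<otimes>\<^bsub>E\<^esub> inv\<^bsub>E\<^esub> h y"
      using h.hom_mult[OF c(1) group.inv_closed[OF group_free_Abelian_group c(2)]] h.hom_inv[OF c(2)] 2 by simp
    then have "p (h (x - y)) = p (h x) - p (h y)"
      using p.hom_mult[of "h x" "inv\<^bsub>E\<^esub> h y"] h.hom_closed[OF c(1)] h.hom_closed[OF c(2)] p.hom_inv[of "h y"]
        p.hom_closed[of "h y"] by simp
    then show ?case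
      using 2 unfolding coeff_sum_diff by (simp add: frag_cmul_diff_distrib)
  next
    case (3 a)
    then show ?case
      by (simp add: he p_e)
  qed
  then have "p (h (p x)) = p x" if "x \<in> carrier E" for x
    using p.hom_closed[OF that] p_aug[OF that] by simp
  then show ?thesis
    using that h he by blast
qed

lemma decompose:
  assumes x: "x \<in> carrier E" and h: "h \<in> hom (free_Abelian_group (carrier D)) E"
    and ph: "p (h (p x)) = p x"
  shows "\<exists>y \<in> carrier A. x \<otimes>\<^bsub>E\<^esub> inv\<^bsub>E\<^esub> h (p x) = \<iota> y"
proof -
  have hc: "h (p x) \<in> carrier E"
    using hom_carrier[OF h] p.hom_closed[OF x] by blast
  then have "p (x \<otimes>\<^bsub>E\<^esub> inv\<^bsub>E\<^esub> h (p x)) = 0"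
    using x p.hom_closed[OF hc] by (simp add: ph)
  then show ?thesis
    using p_ker[of "x \<otimes>\<^bsub>E\<^esub> inv\<^bsub>E\<^esub> h (p x)"] x hc by auto
qed

text \<open>By the additive splitting, \<open>E\<close> is generated as an abelian group by the
  image of \<open>A\<close> and the lifts \<open>e d\<close>. Both consist of values of
  \<open>\<delta>\<close>, at elements of \<open>N\<close> and at the representatives
  \<open>\<sigma> d\<close>.\<close>

lemma \<delta>_generates:
  assumes H: "group H" and f: "f \<in> hom E H" and g: "g \<in> hom E H"
    and eq: "\<And>w. w \<in> carrier \<Gamma> \<Longrightarrow> f (\<delta> w) = g (\<delta> w)" and x: "x \<in> carrier E"
  shows "f x = g x"
proof -
  obtain h where h: "h \<in> hom (free_Abelian_group (carrier D)) E" and he: "\<And>d. d \<in> carrier D \<Longrightarrow> h (frag_of d) = e d"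
    and ph: "\<And>x. x \<in> carrier E \<Longrightarrow> p (h (p x)) = p x"
    by (rule free_lift) blast
  obtain y where y: "y \<in> carrier A" "x \<otimes>\<^bsub>E\<^esub> inv\<^bsub>E\<^esub> h (p x) = \<iota> y"
    using decompose[OF x h ph[OF x]] by blast
  obtain n where n: "n \<in> N" "y = q n"
    using y(1) A_carrier by auto
  have nc: "n \<in> carrier \<Gamma>"
    using n N.subset by auto
  have "f (h z) = g (h z)" if "z \<in> carrier (free_Abelian_group (carrier D))" for z
  proof -
    have "(f \<circ> h) z = (g \<circ> h) z"
    proof (rule hom_free_unique[OF H hom_compose[OF h f] hom_compose[OF h g] _ that])
      show "(f \<circ> h) (frag_of d) = (g \<circ> h) (frag_of d)" if "d \<in> carrier D" for d
        using eq[OF \<sigma>(1)[OF that]] he[OF that] \<delta>_\<sigma>[OF that] by simp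
    qed
    then show ?thesis
      by simp
  qed
  then have 1: "f (h (p x)) = g (h (p x))"
    using p.hom_closed[OF x] by blast
  have 2: "f (\<iota> y) = g (\<iota> y)"
    using eq[OF nc] \<delta>_N[OF n(1)] n(2) by simp
  have hc: "h (p x) \<in> carrier E"
    using hom_carrier[OF h] p.hom_closed[OF x] by blast
  have "x = \<iota> y \<otimes>\<^bsub>E\<^esub> h (p x)"
    unfolding y(2)[symmetric] using x hc by (simp add: E.m_assoc)
  then show ?thesis
    using 1 2 hom_mult[OF f \<iota>.hom_closed[OF y(1)] hc] hom_mult[OF g \<iota>.hom_closed[OF y(1)] hc] by metis
qed

text \<open>The homomorphism is defined on the two summands of the additive splitting: on the kernel
  of \<open>p\<close> by what \<open>c\<close> induces on the abelianisation of \<open>N\<close>, on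
  the other summand by \<open>[d] \<mapsto> c (\<sigma> d)\<close>. Equivariance is a separate
  matter and can be tested on the values of \<open>\<delta>\<close>, as these generate.\<close>

lemma \<delta>_universal:
  fixes B :: "'b monoid"
  assumes B: "comm_group B" and c: "\<And>w. w \<in> carrier \<Gamma> \<Longrightarrow> c w \<in> carrier B"
    and crossed: "\<And>w w'. w \<in> carrier \<Gamma> \<Longrightarrow> w' \<in> carrier \<Gamma> \<Longrightarrow> c (w \<otimes> w') = c w \<otimes>\<^bsub>B\<^esub> b w (c w')"
    and triv: "\<And>n x. n \<in> N \<Longrightarrow> x \<in> carrier B \<Longrightarrow> b n x = x"
  shows "\<exists>\<phi> \<in> hom E B. \<forall>w \<in> carrier \<Gamma>. \<phi> (\<delta> w) = c w"
proof -
  interpret B: comm_group B by (rule B)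
  have NG: "n \<in> carrier \<Gamma>" if "n \<in> N" for n
    using that N.subset by auto
  have cN: "c (n \<otimes> w) = c n \<otimes>\<^bsub>B\<^esub> c w" if "n \<in> N" "w \<in> carrier \<Gamma>" for n w
    using crossed[OF NG[OF that(1)] that(2)] triv[OF that(1) c[OF that(2)]] by simp
  interpret c: group_hom "\<Gamma>\<lparr>carrier := N\<rparr>" B c
    by (intro group_hom.intro N_group B.is_group group_hom_axioms.intro homI) (simp_all add: c NG cN)
  have "c ` N \<subseteq> carrier B"
    using c[OF NG] by blast
  \<comment> \<open>As \<open>N\<close> acts trivially on \<open>B\<close>, the map \<open>c\<close>
    is a homomorphism on \<open>N\<close>; its target is commutative, so it kills
    commutators.\<close>
  then have "c ` K = {\<one>\<^bsub>B\<^esub>}"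
    using c.derived_img[of N] B.derived_eq_singleton[of "c ` N"]
      \<Gamma>.derived_consistent[OF subset_refl N.is_subgroup] by simp
  then have ker: "derived (\<Gamma>\<lparr>carrier := N\<rparr>) N \<subseteq> kernel (\<Gamma>\<lparr>carrier := N\<rparr>) B c"
    using \<Gamma>.derived_consistent[OF subset_refl N.is_subgroup] \<Gamma>.derived_incl[OF subset_refl N.is_subgroup]
    by (auto simp: kernel_def)
  obtain k where k: "k \<in> hom A B" and kq: "\<And>n. n \<in> N \<Longrightarrow> k (q n) = c n"
  proof (rule c.FactGroup_universal_kernel[OF _ ker])
    show "derived (\<Gamma>\<lparr>carrier := N\<rparr>) N \<lhd> \<Gamma>\<lparr>carrier := N\<rparr>"
      using group.derived_self_is_normal[OF N_group] by simp
    fix g assume "g \<in> hom (\<Gamma>\<lparr>carrier := N\<rparr> Mod derived (\<Gamma>\<lparr>carrier := N\<rparr>) N) B"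
      and "\<And>x. x \<in> carrier (\<Gamma>\<lparr>carrier := N\<rparr>) \<Longrightarrow> g (derived (\<Gamma>\<lparr>carrier := N\<rparr>) N #>\<^bsub>\<Gamma>\<lparr>carrier := N\<rparr>\<^esub> x) = c x"
    then show thesis
      using that[of g] \<Gamma>.derived_consistent[OF subset_refl N.is_subgroup]
      by (simp add: abelianisation_def r_coset_def)
  qed
  interpret k: group_hom A B k
    by (intro group_hom.intro A.is_group B.is_group group_hom_axioms.intro k)
  obtain h where h: "h \<in> hom (free_Abelian_group (carrier D)) E" and he: "\<And>d. d \<in> carrier D \<Longrightarrow> h (frag_of d) = e d"
    and ph: "\<And>x. x \<in> carrier E \<Longrightarrow> p (h (p x)) = p x"
    by (rule free_lift) blast
  obtain h' where h': "h' \<in> hom (free_Abelian_group (carrier D)) B" and he': "\<And>d. d \<in> carrier D \<Longrightarrow> h' (frag_of d) = c (\<sigma> d)"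
    using B.free_Abelian_group_universal[of "\<lambda>d. c (\<sigma> d)" "carrier D"] c \<sigma>(1) by blast
  interpret h: group_hom "free_Abelian_group (carrier D)" E h
    by (intro group_hom.intro E.is_group group_free_Abelian_group group_hom_axioms.intro h)
  interpret h': group_hom "free_Abelian_group (carrier D)" B h'
    by (intro group_hom.intro B.is_group group_free_Abelian_group group_hom_axioms.intro h')
  \<comment> \<open>The component of \<open>x\<close> in \<open>A\<close> with respect to the
    splitting \<open>h\<close>.\<close>
  define y where "y x = the_inv_into (carrier A) \<iota> (x \<otimes>\<^bsub>E\<^esub> inv\<^bsub>E\<^esub> h (p x))" for x
  have y: "y x \<in> carrier A" "\<iota> (y x) = x \<otimes>\<^bsub>E\<^esub> inv\<^bsub>E\<^esub> h (p x)" if "x \<in> carrier E" for x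
    using decompose[OF that h ph[OF that]] the_inv_into_into[OF \<iota>_inj] f_the_inv_into_f[OF \<iota>_inj]
    unfolding y_def by (metis image_eqI subset_refl)+
  have hp: "h (p x) \<in> carrier E" if "x \<in> carrier E" for x
    by (rule h.hom_closed[OF p.hom_closed[OF that]])
  have hp': "h' (p x) \<in> carrier B" if "x \<in> carrier E" for x
    by (rule h'.hom_closed[OF p.hom_closed[OF that]])
  have y_mult: "y (x \<otimes>\<^bsub>E\<^esub> x') = y x \<otimes>\<^bsub>A\<^esub> y x'" if x: "x \<in> carrier E" "x' \<in> carrier E" for x x'
  proof (rule inj_onD[OF \<iota>_inj])
    have "h (p (x \<otimes>\<^bsub>E\<^esub> x')) = h (p x) \<otimes>\<^bsub>E\<^esub> h (p x')"
      using p.hom_mult[OF x] h.hom_mult[OF p.hom_closed[OF x(1)] p.hom_closed[OF x(2)]] by simp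
    then show "\<iota> (y (x \<otimes>\<^bsub>E\<^esub> x')) = \<iota> (y x \<otimes>\<^bsub>A\<^esub> y x')"
      using x hp[OF x(1)] hp[OF x(2)] y[OF x(1)] y[OF x(2)] y(2)[OF E.m_closed[OF x]]
      by (simp add: E.inv_mult E.m_ac)
  qed (use y that in simp_all)
  define \<phi> where "\<phi> x = h' (p x) \<otimes>\<^bsub>B\<^esub> k (y x)" for x
  have "\<phi> \<in> hom E B"
  proof (rule homI)
    show "\<phi> x \<in> carrier B" if "x \<in> carrier E" for x
      unfolding \<phi>_def by (intro B.m_closed hp'[OF that] k.hom_closed y(1)[OF that])
    fix x x' assume x: "x \<in> carrier E" "x' \<in> carrier E"
    have "h' (p (x \<otimes>\<^bsub>E\<^esub> x')) = h' (p x) \<otimes>\<^bsub>B\<^esub> h' (p x')"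
      using p.hom_mult[OF x] h'.hom_mult[OF p.hom_closed[OF x(1)] p.hom_closed[OF x(2)]] by simp
    then show "\<phi> (x \<otimes>\<^bsub>E\<^esub> x') = \<phi> x \<otimes>\<^bsub>B\<^esub> \<phi> x'"
      unfolding \<phi>_def y_mult[OF x] using hp'[OF x(1)] hp'[OF x(2)] y(1)[OF x(1)] y(1)[OF x(2)]
      by (simp add: B.m_ac)
  qed
  moreover have "\<phi> (\<delta> w) = c w" if w: "w \<in> carrier \<Gamma>" for w
  proof -
    define d where "d = cl w"
    have d: "d \<in> carrier D"
      unfolding d_def by (rule cl_closed[OF w])
    have fc: "frag_of d \<in> carrier (free_Abelian_group (carrier D))"
      "frag_of \<one>\<^bsub>D\<^esub> \<in> carrier (free_Abelian_group (carrier D))"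
      using d D.one_closed by simp_all
    have ef: "frag_of d - frag_of \<one>\<^bsub>D\<^esub> = frag_of d \<otimes>\<^bsub>free_Abelian_group (carrier D)\<^esub>
      inv\<^bsub>free_Abelian_group (carrier D)\<^esub> frag_of \<one>\<^bsub>D\<^esub>"
      using D.one_closed by simp
    have pd: "p (\<delta> w) = frag_of d - frag_of \<one>\<^bsub>D\<^esub>"
      unfolding \<delta>_def d_def[symmetric]
      using p.hom_mult[OF \<iota>.hom_closed[OF diff_\<sigma>(3)[OF w]] e_closed[OF d]] p_e[OF d]
        p_ker[OF \<iota>.hom_closed[OF diff_\<sigma>(3)[OF w]]] diff_\<sigma>(3)[OF w] by simp
    have hd: "h (p (\<delta> w)) = e d \<otimes>\<^bsub>E\<^esub> inv\<^bsub>E\<^esub> e \<one>\<^bsub>D\<^esub>"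
      unfolding pd ef using h.hom_mult[OF fc(1) group.inv_closed[OF group_free_Abelian_group fc(2)]] h.hom_inv[OF fc(2)]
        he[OF d] he[OF D.one_closed] by metis
    have hd': "h' (p (\<delta> w)) = c (\<sigma> d) \<otimes>\<^bsub>B\<^esub> inv\<^bsub>B\<^esub> c (\<sigma> \<one>\<^bsub>D\<^esub>)"
      unfolding pd ef using h'.hom_mult[OF fc(1) group.inv_closed[OF group_free_Abelian_group fc(2)]] h'.hom_inv[OF fc(2)]
        he'[OF d] he'[OF D.one_closed] by metis
    have cancelB: "(x \<otimes>\<^bsub>B\<^esub> inv\<^bsub>B\<^esub> y) \<otimes>\<^bsub>B\<^esub> (z \<otimes>\<^bsub>B\<^esub> y) = z \<otimes>\<^bsub>B\<^esub> x"
      if "x \<in> carrier B" "y \<in> carrier B" "z \<in> carrier B" for x y z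
    proof -
      have "(x \<otimes>\<^bsub>B\<^esub> inv\<^bsub>B\<^esub> y) \<otimes>\<^bsub>B\<^esub> (z \<otimes>\<^bsub>B\<^esub> y) = (z \<otimes>\<^bsub>B\<^esub> y) \<otimes>\<^bsub>B\<^esub> (inv\<^bsub>B\<^esub> y \<otimes>\<^bsub>B\<^esub> x)"
        using that B.m_comm[of "x \<otimes>\<^bsub>B\<^esub> inv\<^bsub>B\<^esub> y" "z \<otimes>\<^bsub>B\<^esub> y"] B.m_comm[of x "inv\<^bsub>B\<^esub> y"] by simp
      moreover have "z \<otimes>\<^bsub>B\<^esub> y \<otimes>\<^bsub>B\<^esub> inv\<^bsub>B\<^esub> y = z"
        using that by (simp add: B.m_assoc)
      ultimately show ?thesis
        using that B.m_assoc[of "z \<otimes>\<^bsub>B\<^esub> y" "inv\<^bsub>B\<^esub> y" x] by simp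
    qed
    have cancel: "(x \<otimes>\<^bsub>E\<^esub> y) \<otimes>\<^bsub>E\<^esub> inv\<^bsub>E\<^esub> (y \<otimes>\<^bsub>E\<^esub> inv\<^bsub>E\<^esub> z) = x \<otimes>\<^bsub>E\<^esub> z"
      if "x \<in> carrier E" "y \<in> carrier E" "z \<in> carrier E" for x y z
    proof -
      have "inv\<^bsub>E\<^esub> (y \<otimes>\<^bsub>E\<^esub> inv\<^bsub>E\<^esub> z) = z \<otimes>\<^bsub>E\<^esub> inv\<^bsub>E\<^esub> y"
        using that by (simp add: E.inv_mult_group)
      moreover have "(x \<otimes>\<^bsub>E\<^esub> y) \<otimes>\<^bsub>E\<^esub> (z \<otimes>\<^bsub>E\<^esub> inv\<^bsub>E\<^esub> y) = (x \<otimes>\<^bsub>E\<^esub> z) \<otimes>\<^bsub>E\<^esub> (y \<otimes>\<^bsub>E\<^esub> inv\<^bsub>E\<^esub> y)"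
        using that by (simp add: E.m_ac del: E.r_inv)
      ultimately show ?thesis
        using that by simp
    qed
    \<comment> \<open>Since \<open>p (\<delta> w)\<close> is \<open>[d] - [1]\<close>, subtracting
      its lift leaves \<open>e 1\<close> behind. This is the origin of the extra term
      \<open>s 1\<close>, which cancels in the end against the value of \<open>c\<close> at
      \<open>\<sigma> 1\<close>.\<close>
    have "y (\<delta> w) = \<nu> w \<otimes>\<^bsub>A\<^esub> s \<one>\<^bsub>D\<^esub>"
    proof (rule inj_onD[OF \<iota>_inj])
      show "\<iota> (y (\<delta> w)) = \<iota> (\<nu> w \<otimes>\<^bsub>A\<^esub> s \<one>\<^bsub>D\<^esub>)"
        unfolding y(2)[OF \<delta>_closed[OF w]] hd \<iota>.hom_mult[OF diff_\<sigma>(3)[OF w] s_one(1)] s_one(2)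
        unfolding \<delta>_def d_def[symmetric]
        by (rule cancel[OF \<iota>.hom_closed[OF diff_\<sigma>(3)[OF w]] e_closed[OF d] \<iota>.hom_closed[OF s_one(1)]])
    qed (use y(1)[OF \<delta>_closed[OF w]] diff_\<sigma>(3)[OF w] s_one(1) in \<open>simp_all only: A.m_closed\<close>)
    moreover have "k (\<nu> w) = c (w \<otimes> inv \<sigma> d)"
      using diff_\<sigma>[OF w] kq by (simp add: d_def)
    moreover have "k (s \<one>\<^bsub>D\<^esub>) = c (\<sigma> \<one>\<^bsub>D\<^esub>)"
    proof -
      have "cl (\<sigma> \<one>\<^bsub>D\<^esub>) = N"
        using \<sigma>(2)[OF D.one_closed] by simp
      then have "\<sigma> \<one>\<^bsub>D\<^esub> \<in> N"
        by (rule \<Gamma>.coset_join1[OF _ \<sigma>(1)[OF D.one_closed] N.is_subgroup])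
      then show ?thesis
        using kq \<sigma>(3)[OF D.one_closed] by metis
    qed
    ultimately have "\<phi> (\<delta> w) = (c (\<sigma> d) \<otimes>\<^bsub>B\<^esub> inv\<^bsub>B\<^esub> c (\<sigma> \<one>\<^bsub>D\<^esub>)) \<otimes>\<^bsub>B\<^esub>
      (c (w \<otimes> inv \<sigma> d) \<otimes>\<^bsub>B\<^esub> c (\<sigma> \<one>\<^bsub>D\<^esub>))"
      unfolding \<phi>_def hd' using k.hom_mult[OF diff_\<sigma>(3)[OF w] s_one(1)] by simp
    also have "\<dots> = c (w \<otimes> inv \<sigma> d) \<otimes>\<^bsub>B\<^esub> c (\<sigma> d)"
      by (rule cancelB) (use c \<sigma>(1)[OF d] \<sigma>(1)[OF D.one_closed] w in simp_all)
    also have "\<dots> = c (w \<otimes> inv \<sigma> d \<otimes> \<sigma> d)"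
      by (rule cN[symmetric]) (use diff_\<sigma>(1)[OF w] \<sigma>(1)[OF d] in \<open>simp_all add: d_def\<close>)
    also have "w \<otimes> inv \<sigma> d \<otimes> \<sigma> d = w"
      using w \<sigma>(1)[OF d] by (simp add: \<Gamma>.m_assoc)
    finally show ?thesis .
  qed
  ultimately show ?thesis
    by blast
qed

end

lemma (in group) rcoset_eqI:
  assumes J: "subgroup J G" and x: "x \<in> carrier G" and y: "y \<in> carrier G" and "y \<otimes> inv x \<in> J"
  shows "J #> y = J #> x"
proof -
  have "y = (y \<otimes> inv x) \<otimes> x"
    using x y by (simp add: m_assoc)
  then have "y \<in> J #> x"
    using assms(4) unfolding r_coset_def by blast
  then show ?thesis
    using repr_independence[OF _ x J] by simp
qed

section \<open>Coinvariants of a tensor product\<close>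

locale coinvariant_tensor = \<Delta>: group \<Delta> + E: comm_group E + M: comm_group M
  for \<Delta> :: "'d monoid" and E :: "'e monoid" and M :: "'m monoid" +
  fixes a :: "'d \<Rightarrow> 'e \<Rightarrow> 'e" and b :: "'d \<Rightarrow> 'm \<Rightarrow> 'm"
  assumes a: "\<And>d. d \<in> carrier \<Delta> \<Longrightarrow> a d \<in> hom E E" and b: "\<And>d. d \<in> carrier \<Delta> \<Longrightarrow> b d \<in> hom M M"
begin

abbreviation F where "F \<equiv> free_Abelian_group (carrier E \<times> carrier M)"
abbreviation T where "T \<equiv> tensor_relations E M"
abbreviation Y where "Y \<equiv> tensor E M"
abbreviation W where "W \<equiv> coinvariants \<Delta> Y (tensor_action E M a b)"

definition gens where
  "gens = {frag_of (x \<otimes>\<^bsub>E\<^esub> y, m) - frag_of (x, m) - frag_of (y, m) | x y m.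
           x \<in> carrier E \<and> y \<in> carrier E \<and> m \<in> carrier M} \<union>
        {frag_of (x, m \<otimes>\<^bsub>M\<^esub> n) - frag_of (x, m) - frag_of (x, n) | x m n.
           x \<in> carrier E \<and> m \<in> carrier M \<and> n \<in> carrier M}"

sublocale F: comm_group F by (rule abelian_free_Abelian_group)

lemma T_eq: "T = generate F gens"
  by (simp add: tensor_relations_def gens_def)

lemma frag3: "x \<in> S \<Longrightarrow> y \<in> S \<Longrightarrow> z \<in> S \<Longrightarrow> Poly_Mapping.keys (frag_of x - frag_of y - frag_of z) \<subseteq> S"
  using keys_diff[of "frag_of x - frag_of y" "frag_of z"] keys_diff[of "frag_of x" "frag_of y"] by auto

lemma gens_sub: "gens \<subseteq> carrier F"
proof
  fix u assume "u \<in> gens"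
  then consider x y m where "x \<in> carrier E" "y \<in> carrier E" "m \<in> carrier M"
      "u = frag_of (x \<otimes>\<^bsub>E\<^esub> y, m) - frag_of (x, m) - frag_of (y, m)"
    | x m n where "x \<in> carrier E" "m \<in> carrier M" "n \<in> carrier M"
      "u = frag_of (x, m \<otimes>\<^bsub>M\<^esub> n) - frag_of (x, m) - frag_of (x, n)"
    unfolding gens_def by blast
  then show "u \<in> carrier F"
    unfolding carrier_free_Abelian_group_iff by cases (simp_all only: frag3 mem_Times_iff fst_conv snd_conv E.m_closed M.m_closed simp_thms)
qed

lemma T_sub: "subgroup T F"
  unfolding T_eq by (rule F.generate_is_subgroup[OF gens_sub])

sublocale Y: comm_group Y
  unfolding tensor_def by (rule F.abelian_FactGroup[OF T_sub])

definition tens where "tens x m = T #>\<^bsub>F\<^esub> frag_of (x, m)"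

lemma quot_hom: "(\<lambda>t. T #>\<^bsub>F\<^esub> t) \<in> hom F Y"
  unfolding tensor_def by (rule normal.r_coset_hom_Mod[OF F.subgroup_imp_normal[OF T_sub]])

lemma carrier_Y: "carrier Y = (\<lambda>t. T #>\<^bsub>F\<^esub> t) ` carrier F"
  unfolding tensor_def by (rule carrier_FactGroup)

lemma tens_closed: "x \<in> carrier E \<Longrightarrow> m \<in> carrier M \<Longrightarrow> tens x m \<in> carrier Y"
  unfolding tens_def carrier_Y by simp

lemma fragc: "x \<in> carrier E \<Longrightarrow> m \<in> carrier M \<Longrightarrow> frag_of (x, m) \<in> carrier F"
  by simp

lemma quot_add:
  assumes u: "u \<in> carrier F" and v: "v \<in> carrier F" and w: "w \<in> carrier F" and T: "u - v - w \<in> T"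
  shows "T #>\<^bsub>F\<^esub> u = (T #>\<^bsub>F\<^esub> v) \<otimes>\<^bsub>Y\<^esub> (T #>\<^bsub>F\<^esub> w)"
proof -
  have vw: "v + w \<in> carrier F"
    using F.m_closed[OF v w] by simp
  have "u \<otimes>\<^bsub>F\<^esub> inv\<^bsub>F\<^esub> (v + w) = u - v - w"
    using vw by simp
  then have "u \<otimes>\<^bsub>F\<^esub> inv\<^bsub>F\<^esub> (v + w) \<in> T"
    using T by (simp only:)
  then have "T #>\<^bsub>F\<^esub> u = T #>\<^bsub>F\<^esub> (v + w)"
    by (rule F.rcoset_eqI[OF T_sub vw u])
  also have "\<dots> = (T #>\<^bsub>F\<^esub> v) \<otimes>\<^bsub>Y\<^esub> (T #>\<^bsub>F\<^esub> w)"
    using hom_mult[OF quot_hom v w] by simp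
  finally show ?thesis .
qed

lemma tens_l: "\<lbrakk>x \<in> carrier E; y \<in> carrier E; m \<in> carrier M\<rbrakk> \<Longrightarrow> tens (x \<otimes>\<^bsub>E\<^esub> y) m = tens x m \<otimes>\<^bsub>Y\<^esub> tens y m"
  unfolding tens_def
proof (rule quot_add)
  assume "x \<in> carrier E" "y \<in> carrier E" "m \<in> carrier M"
  then have "frag_of (x \<otimes>\<^bsub>E\<^esub> y, m) - frag_of (x, m) - frag_of (y, m) \<in> gens"
    unfolding gens_def by blast
  then show "frag_of (x \<otimes>\<^bsub>E\<^esub> y, m) - frag_of (x, m) - frag_of (y, m) \<in> T"
    unfolding T_eq by (rule generate.incl)
qed simp_all

lemma tens_r: "\<lbrakk>x \<in> carrier E; m \<in> carrier M; n \<in> carrier M\<rbrakk> \<Longrightarrow> tens x (m \<otimes>\<^bsub>M\<^esub> n) = tens x m \<otimes>\<^bsub>Y\<^esub> tens x n"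
  unfolding tens_def
proof (rule quot_add)
  assume "x \<in> carrier E" "m \<in> carrier M" "n \<in> carrier M"
  then have "frag_of (x, m \<otimes>\<^bsub>M\<^esub> n) - frag_of (x, m) - frag_of (x, n) \<in> gens"
    unfolding gens_def by blast
  then show "frag_of (x, m \<otimes>\<^bsub>M\<^esub> n) - frag_of (x, m) - frag_of (x, n) \<in> T"
    unfolding T_eq by (rule generate.incl)
qed simp_all

definition fe where "fe d = frag_extend (\<lambda>(x, m). frag_of (a d x, b d m))"

lemma ab_closed: "\<lbrakk>d \<in> carrier \<Delta>; x \<in> carrier E\<rbrakk> \<Longrightarrow> a d x \<in> carrier E" "\<lbrakk>d \<in> carrier \<Delta>; m \<in> carrier M\<rbrakk> \<Longrightarrow> b d m \<in> carrier M"
  using hom_carrier[OF a] hom_carrier[OF b] by blast+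

lemma fe_hom: "d \<in> carrier \<Delta> \<Longrightarrow> fe d \<in> hom F F"
proof (rule homI)
  assume d: "d \<in> carrier \<Delta>"
  fix x assume "x \<in> carrier F"
  then have "Poly_Mapping.keys x \<subseteq> carrier E \<times> carrier M"
    by simp
  then have "(\<Union>z \<in> Poly_Mapping.keys x. Poly_Mapping.keys ((\<lambda>(x, m). frag_of (a d x, b d m)) z)) \<subseteq> carrier E \<times> carrier M"
    using ab_closed[OF d] by auto
  then show "fe d x \<in> carrier F"
    unfolding fe_def carrier_free_Abelian_group_iff by (rule order_trans[OF keys_frag_extend])
qed (simp add: fe_def frag_extend_add)

lemma fe_frag: "fe d (frag_of (x, m)) = frag_of (a d x, b d m)"
  by (simp add: fe_def)

lemma fe_gens:
  assumes d: "d \<in> carrier \<Delta>" and u: "u \<in> gens"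
  shows "fe d u \<in> gens"
proof -
  consider x y m where "x \<in> carrier E" "y \<in> carrier E" "m \<in> carrier M"
      "u = frag_of (x \<otimes>\<^bsub>E\<^esub> y, m) - frag_of (x, m) - frag_of (y, m)"
    | x m n where "x \<in> carrier E" "m \<in> carrier M" "n \<in> carrier M"
      "u = frag_of (x, m \<otimes>\<^bsub>M\<^esub> n) - frag_of (x, m) - frag_of (x, n)"
    using u unfolding gens_def by blast
  then show ?thesis
  proof cases
    case (1 x y m)
    then have "fe d u = frag_of (a d x \<otimes>\<^bsub>E\<^esub> a d y, b d m) - frag_of (a d x, b d m) - frag_of (a d y, b d m)"
      by (simp add: fe_def frag_extend_diff hom_mult[OF a[OF d]])
    then show ?thesis
      using 1 ab_closed[OF d] unfolding gens_def by blast
  next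
    case (2 x m n)
    then have "fe d u = frag_of (a d x, b d m \<otimes>\<^bsub>M\<^esub> b d n) - frag_of (a d x, b d m) - frag_of (a d x, b d n)"
      by (simp add: fe_def frag_extend_diff hom_mult[OF b[OF d]])
    then show ?thesis
      using 2 ab_closed[OF d] unfolding gens_def by blast
  qed
qed

lemma fe_T: "d \<in> carrier \<Delta> \<Longrightarrow> u \<in> T \<Longrightarrow> fe d u \<in> T"
proof -
  assume d: "d \<in> carrier \<Delta>" and u: "u \<in> T"
  interpret fe: group_hom F F "fe d"
    by (intro group_hom.intro F.is_group group_hom_axioms.intro fe_hom[OF d])
  have "fe d ` generate F gens = generate F (fe d ` gens)"
    by (rule fe.generate_img[OF gens_sub, symmetric])
  also have "\<dots> \<subseteq> generate F gens"
    by (rule F.mono_generate) (use fe_gens[OF d] in blast)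
  finally show ?thesis
    using u unfolding T_eq by blast
qed

text \<open>\<open>fe d\<close> maps relations to relations, so the cosets united in
  \<open>tensor_action\<close> coincide and the action is computed on any representative.\<close>

lemma tact:
  assumes d: "d \<in> carrier \<Delta>" and t: "t \<in> carrier F"
  shows "tensor_action E M a b d (T #>\<^bsub>F\<^esub> t) = T #>\<^bsub>F\<^esub> fe d t"
proof -
  have ft: "fe d t \<in> carrier F"
    using hom_carrier[OF fe_hom[OF d]] t by blast
  have *: "T #>\<^bsub>F\<^esub> fe d t' = T #>\<^bsub>F\<^esub> fe d t" if t': "t' \<in> T #>\<^bsub>F\<^esub> t" for t'
  proof -
    obtain u where u: "u \<in> T" "t' = u + t"
      using t' by (auto simp: r_coset_def)
    have uF: "u \<in> carrier F"
      using u T_sub subgroup.subset by blast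
    have "fe d t' = fe d u \<otimes>\<^bsub>F\<^esub> fe d t"
      using hom_mult[OF fe_hom[OF d] uF t] u(2) by simp
    then have "fe d t' \<in> T #>\<^bsub>F\<^esub> fe d t"
      using fe_T[OF d u(1)] unfolding r_coset_def by blast
    then show ?thesis
      using F.repr_independence[OF _ ft T_sub] by simp
  qed
  have "t \<in> T #>\<^bsub>F\<^esub> t"
    by (rule F.rcos_self[OF t T_sub])
  then have "(\<Union>t' \<in> T #>\<^bsub>F\<^esub> t. T #>\<^bsub>F\<^esub> fe d t') = T #>\<^bsub>F\<^esub> fe d t"
    using * by blast
  then show ?thesis
    by (simp add: tensor_action_def fe_def)
qed

definition S where
  "S = {tensor_action E M a b d x \<otimes>\<^bsub>Y\<^esub> inv\<^bsub>Y\<^esub> x | d x. d \<in> carrier \<Delta> \<and> x \<in> carrier Y}"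

lemma tact_closed: "d \<in> carrier \<Delta> \<Longrightarrow> x \<in> carrier Y \<Longrightarrow> tensor_action E M a b d x \<in> carrier Y"
proof -
  assume d: "d \<in> carrier \<Delta>" and x: "x \<in> carrier Y"
  obtain t where t: "t \<in> carrier F" "x = T #>\<^bsub>F\<^esub> t"
    using x unfolding carrier_Y by blast
  have "fe d t \<in> carrier F"
    using hom_carrier[OF fe_hom[OF d]] t(1) by blast
  then show ?thesis
    unfolding t(2) tact[OF d t(1)] carrier_Y by (rule imageI)
qed

lemma S_sub: "S \<subseteq> carrier Y"
  unfolding S_def using tact_closed by auto

lemma J_sub: "subgroup (generate Y S) Y"
  by (rule Y.generate_is_subgroup[OF S_sub])

lemma W_eq: "W = Y Mod generate Y S"
  by (simp add: coinvariants_def S_def)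

sublocale W: comm_group W
  unfolding W_eq by (rule Y.abelian_FactGroup[OF J_sub])

definition wcls where "wcls x m = generate Y S #>\<^bsub>Y\<^esub> tens x m"

lemma quot_hom_W: "(\<lambda>t. generate Y S #>\<^bsub>Y\<^esub> t) \<in> hom Y W"
  unfolding W_eq by (rule normal.r_coset_hom_Mod[OF Y.subgroup_imp_normal[OF J_sub]])

lemma carrier_W: "carrier W = (\<lambda>t. generate Y S #>\<^bsub>Y\<^esub> t) ` carrier Y"
  unfolding W_eq by (rule carrier_FactGroup)

lemma wcls_closed: "x \<in> carrier E \<Longrightarrow> m \<in> carrier M \<Longrightarrow> wcls x m \<in> carrier W"
  unfolding wcls_def carrier_W using tens_closed by blast

lemma wcls_l: "\<lbrakk>x \<in> carrier E; y \<in> carrier E; m \<in> carrier M\<rbrakk> \<Longrightarrow> wcls (x \<otimes>\<^bsub>E\<^esub> y) m = wcls x m \<otimes>\<^bsub>W\<^esub> wcls y m"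
  unfolding wcls_def tens_l by (rule hom_mult[OF quot_hom_W tens_closed tens_closed])

lemma wcls_r: "\<lbrakk>x \<in> carrier E; m \<in> carrier M; n \<in> carrier M\<rbrakk> \<Longrightarrow> wcls x (m \<otimes>\<^bsub>M\<^esub> n) = wcls x m \<otimes>\<^bsub>W\<^esub> wcls x n"
  unfolding wcls_def tens_r by (rule hom_mult[OF quot_hom_W tens_closed tens_closed])

lemma wcls_invariant:
  assumes d: "d \<in> carrier \<Delta>" and x: "x \<in> carrier E" and m: "m \<in> carrier M"
  shows "wcls (a d x) (b d m) = wcls x m"
  unfolding wcls_def
proof (rule Y.rcoset_eqI[OF J_sub tens_closed[OF x m] tens_closed[OF ab_closed(1)[OF d x] ab_closed(2)[OF d m]]])
  have "tens (a d x) (b d m) = tensor_action E M a b d (tens x m)"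
    unfolding tens_def tact[OF d fragc[OF x m]] fe_frag ..
  then have "tens (a d x) (b d m) \<otimes>\<^bsub>Y\<^esub> inv\<^bsub>Y\<^esub> tens x m \<in> S"
    unfolding S_def using d tens_closed[OF x m] by (intro CollectI exI[of _ d] exI[of _ "tens x m"] conjI) simp_all
  then show "tens (a d x) (b d m) \<otimes>\<^bsub>Y\<^esub> inv\<^bsub>Y\<^esub> tens x m \<in> generate Y S"
    by (rule generate.incl)
qed

lemma hom_W_unique:
  assumes H: "group H" and f: "f \<in> hom W H" and g: "g \<in> hom W H"
    and eq: "\<And>x m. x \<in> carrier E \<Longrightarrow> m \<in> carrier M \<Longrightarrow> f (wcls x m) = g (wcls x m)" and w: "w \<in> carrier W"
  shows "f w = g w"
proof -
  obtain t where t: "t \<in> carrier F" "w = generate Y S #>\<^bsub>Y\<^esub> (T #>\<^bsub>F\<^esub> t)"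
    using w unfolding carrier_W carrier_Y by blast
  define k where "k t = generate Y S #>\<^bsub>Y\<^esub> (T #>\<^bsub>F\<^esub> t)" for t
  have k: "k \<in> hom F W"
    using hom_compose[OF quot_hom quot_hom_W] by (simp add: k_def[abs_def] comp_def)
  have "(f \<circ> k) t = (g \<circ> k) t"
  proof (rule hom_free_unique[OF H hom_compose[OF k f] hom_compose[OF k g] _ t(1)])
    fix z assume "z \<in> carrier E \<times> carrier M"
    then show "(f \<circ> k) (frag_of z) = (g \<circ> k) (frag_of z)"
      using eq by (auto simp: k_def wcls_def tens_def)
  qed
  then show ?thesis
    by (simp add: k_def t(2))
qed

text \<open>Universal property of the coinvariants: an invariant bilinear map extends to the free
  group and then passes to the two successive quotients. With the units of a test algebra as target
  this produces characters of \<open>W\<close>.\<close>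

lemma hom_W_ex:
  fixes H :: "'h monoid"
  assumes H: "comm_group H" and \<beta>: "\<And>x m. x \<in> carrier E \<Longrightarrow> m \<in> carrier M \<Longrightarrow> \<beta> x m \<in> carrier H"
    and l: "\<And>x y m. \<lbrakk>x \<in> carrier E; y \<in> carrier E; m \<in> carrier M\<rbrakk> \<Longrightarrow> \<beta> (x \<otimes>\<^bsub>E\<^esub> y) m = \<beta> x m \<otimes>\<^bsub>H\<^esub> \<beta> y m"
    and r: "\<And>x m n. \<lbrakk>x \<in> carrier E; m \<in> carrier M; n \<in> carrier M\<rbrakk> \<Longrightarrow> \<beta> x (m \<otimes>\<^bsub>M\<^esub> n) = \<beta> x m \<otimes>\<^bsub>H\<^esub> \<beta> x n"
    and inv: "\<And>d x m. \<lbrakk>d \<in> carrier \<Delta>; x \<in> carrier E; m \<in> carrier M\<rbrakk> \<Longrightarrow> \<beta> (a d x) (b d m) = \<beta> x m"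
  shows "\<exists>f \<in> hom W H. \<forall>x \<in> carrier E. \<forall>m \<in> carrier M. f (wcls x m) = \<beta> x m"
proof -
  interpret H: comm_group H by (rule H)
  have img: "(\<lambda>z. \<beta> (fst z) (snd z)) ` (carrier E \<times> carrier M) \<subseteq> carrier H"
    using \<beta> by auto
  obtain h where h: "h \<in> hom F H" and hf: "\<And>z. z \<in> carrier E \<times> carrier M \<Longrightarrow> h (frag_of z) = \<beta> (fst z) (snd z)"
    using H.free_Abelian_group_universal[OF img] by blast
  interpret h: group_hom F H h
    by (intro group_hom.intro F.is_group H.is_group group_hom_axioms.intro h)
  have h3: "h (u - v - w) = \<one>\<^bsub>H\<^esub>" if c: "u \<in> carrier F" "v \<in> carrier F" "w \<in> carrier F" and eq: "h u = h v \<otimes>\<^bsub>H\<^esub> h w" for u v w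
  proof -
    have "u - v - w = u \<otimes>\<^bsub>F\<^esub> inv\<^bsub>F\<^esub> (v \<otimes>\<^bsub>F\<^esub> w)"
      using F.m_closed[OF c(2,3)] by simp
    then show ?thesis
      using c eq h.hom_mult[OF c(1) F.inv_closed[OF F.m_closed[OF c(2,3)]]] h.hom_inv[OF F.m_closed[OF c(2,3)]]
        h.hom_mult[OF c(2,3)] h.hom_closed[OF c(2)] h.hom_closed[OF c(3)] by (metis H.m_closed H.r_inv)
  qed
  have "gens \<subseteq> kernel F H h"
  proof
    fix u assume u: "u \<in> gens"
    then consider x y m where "x \<in> carrier E" "y \<in> carrier E" "m \<in> carrier M"
        "u = frag_of (x \<otimes>\<^bsub>E\<^esub> y, m) - frag_of (x, m) - frag_of (y, m)"
      | x m n where "x \<in> carrier E" "m \<in> carrier M" "n \<in> carrier M"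
        "u = frag_of (x, m \<otimes>\<^bsub>M\<^esub> n) - frag_of (x, m) - frag_of (x, n)"
      unfolding gens_def by blast
    then have "h u = \<one>\<^bsub>H\<^esub>"
    proof cases
      case (1 x y m)
      show ?thesis
        unfolding 1(4) by (rule h3) (use 1(1-3) in \<open>simp_all add: hf l\<close>)
    next
      case (2 x m n)
      show ?thesis
        unfolding 2(4) by (rule h3) (use 2(1-3) in \<open>simp_all add: hf r\<close>)
    qed
    then show "u \<in> kernel F H h"
      using u gens_sub unfolding kernel_def by blast
  qed
  then have TK: "T \<subseteq> kernel F H h"
    unfolding T_eq by (rule F.generate_subgroup_incl[OF _ h.subgroup_kernel])
  obtain g where g: "g \<in> hom Y H" and gt: "\<And>t. t \<in> carrier F \<Longrightarrow> g (T #>\<^bsub>F\<^esub> t) = h t"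
    using h.FactGroup_universal_kernel[OF F.subgroup_imp_normal[OF T_sub] TK] unfolding tensor_def by blast
  interpret g: group_hom Y H g
    by (intro group_hom.intro Y.is_group H.is_group group_hom_axioms.intro g)
  have gt_act: "g (tensor_action E M a b d x) = g x" if d: "d \<in> carrier \<Delta>" and x: "x \<in> carrier Y" for d x
  proof -
    obtain t where t: "t \<in> carrier F" "x = T #>\<^bsub>F\<^esub> t"
      using x unfolding carrier_Y by blast
    have "(h \<circ> fe d) t = h t"
    proof (rule hom_free_unique[OF H.is_group hom_compose[OF fe_hom[OF d] h] h _ t(1)])
      fix z assume z: "z \<in> carrier E \<times> carrier M"
      then obtain x m where xm: "z = (x, m)" "x \<in> carrier E" "m \<in> carrier M"
        by blast
      show "(h \<circ> fe d) (frag_of z) = h (frag_of z)"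
        using hf[of "(a d x, b d m)"] hf[OF z] ab_closed(1)[OF d xm(2)] ab_closed(2)[OF d xm(3)] inv[OF d xm(2,3)]
        by (simp add: xm(1) fe_frag)
    qed
    moreover have "fe d t \<in> carrier F"
      using hom_carrier[OF fe_hom[OF d]] t(1) by blast
    ultimately show ?thesis
      unfolding t(2) tact[OF d t(1)] by (simp only: gt t(1) comp_apply)
  qed
  have "S \<subseteq> kernel Y H g"
  proof
    fix u assume u: "u \<in> S"
    then obtain d x where dx: "d \<in> carrier \<Delta>" "x \<in> carrier Y" "u = tensor_action E M a b d x \<otimes>\<^bsub>Y\<^esub> inv\<^bsub>Y\<^esub> x"
      unfolding S_def by blast
    have "g u = \<one>\<^bsub>H\<^esub>"
      unfolding dx(3) using g.hom_mult[OF tact_closed[OF dx(1,2)] Y.inv_closed[OF dx(2)]] gt_act[OF dx(1,2)]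
        g.hom_inv[OF dx(2)] g.hom_closed[OF dx(2)] by (simp only: H.r_inv)
    then show "u \<in> kernel Y H g"
      using u S_sub unfolding kernel_def by blast
  qed
  then have SK: "generate Y S \<subseteq> kernel Y H g"
    by (rule Y.generate_subgroup_incl[OF _ g.subgroup_kernel])
  obtain f where f: "f \<in> hom W H" and fg: "\<And>x. x \<in> carrier Y \<Longrightarrow> f (generate Y S #>\<^bsub>Y\<^esub> x) = g x"
    using g.FactGroup_universal_kernel[OF Y.subgroup_imp_normal[OF J_sub] SK] unfolding W_eq by blast
  have "f (wcls x m) = \<beta> x m" if "x \<in> carrier E" "m \<in> carrier M" for x m
    unfolding wcls_def fg[OF tens_closed[OF that]] unfolding tens_def gt[OF fragc[OF that]]
    using hf[of "(x, m)"] that by simp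
  then show ?thesis
    using f by blast
qed

end

section \<open>Representability by a group algebra\<close>

context group_alg_target
begin

lemma bij_alg_hom_characters:
  "bij_betw (\<lambda>h. \<lambda>z \<in> carrier N. h (monomial R N z)) (alg_hom R P A) (characters N A)"
proof (rule bij_betwI')
  fix h h' assume h: "h \<in> alg_hom R P A" and h': "h' \<in> alg_hom R P A"
  show "((\<lambda>z \<in> carrier N. h (monomial R N z)) = (\<lambda>z \<in> carrier N. h' (monomial R N z))) = (h = h')"
  proof
    assume eq: "(\<lambda>z \<in> carrier N. h (monomial R N z)) = (\<lambda>z \<in> carrier N. h' (monomial R N z))"
    show "h = h'"
      by (rule alg_hom_eqI[OF h h']) (use fun_cong[OF eq] in \<open>metis restrict_apply'\<close>)
  qed simp
next
  fix h assume "h \<in> alg_hom R P A"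
  then show "(\<lambda>z \<in> carrier N. h (monomial R N z)) \<in> characters N A"
    by (rule alg_hom_characters)
next
  fix \<psi> assume \<psi>: "\<psi> \<in> characters N A"
  have "\<psi> = (\<lambda>z \<in> carrier N. (\<lambda>F \<in> carrier P. lin_ext R N A \<psi> F) (monomial R N z))"
  proof (rule extensionalityI)
    fix z assume "z \<in> carrier N"
    moreover have "\<psi> \<in> carrier N \<rightarrow> carrier A"
      using characters_closed(2)[OF \<psi>] by blast
    ultimately show "\<psi> z = (\<lambda>z \<in> carrier N. (\<lambda>F \<in> carrier P. lin_ext R N A \<psi> F) (monomial R N z)) z"
      by (simp add: lin_ext_monomial)
  qed (use \<psi> in auto)
  then show "\<exists>h \<in> alg_hom R P A. \<psi> = (\<lambda>z \<in> carrier N. h (monomial R N z))"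
    using lin_ext_characters[OF \<psi>] by blast
qed

end

text \<open>Algebra maps out of a group algebra are characters of the group, so it remains to match
  a functor naturally with characters. Both halves of the theorem end with this reduction.\<close>

lemma (in universe) represented_by_group_algebra:
  assumes N: "comm_group N"
    and bij: "\<And>A. A \<in> Alg R \<Longrightarrow> bij_betw (\<Psi> A) (characters N A) (V A)"
    and natural: "\<And>A B \<phi> \<psi>. \<lbrakk>A \<in> Alg R; B \<in> Alg R; \<phi> \<in> alg_hom R A B; \<psi> \<in> characters N A\<rbrakk>
      \<Longrightarrow> \<Psi> B (compose (carrier N) \<phi> \<psi>) = Xmap A B \<phi> (\<Psi> A \<psi>)"
  shows "represented_by R V Xmap (monoid_algebra R N)"
proof -
  interpret N: comm_group N by (rule N)
  interpret monoid_alg R N by (intro monoid_alg.intro R_cring N.comm_monoid_axioms)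
  have target: "group_alg_target R N A" if "A \<in> Alg R" for A :: "('u, 'u) module"
    by (intro group_alg_target.intro monoid_alg_target.intro monoid_alg_axioms AlgD[OF that] N)
  define ch where "ch h = (\<lambda>z \<in> carrier N. h (monomial R N z))" for h :: "_ \<Rightarrow> 'u"
  have ch: "bij_betw ch (alg_hom R P A) (characters N A)" if "A \<in> Alg R" for A :: "('u, 'u) module"
    using group_alg_target.bij_alg_hom_characters[OF target[OF that]] by (simp add: ch_def[abs_def])
  have "bij_betw (\<Psi> A \<circ> ch) (alg_hom R P A) (V A)" if "A \<in> Alg R" for A
    by (rule bij_betw_trans[OF ch[OF that] bij[OF that]])
  moreover have "(\<Psi> B \<circ> ch) (compose (carrier P) \<phi> h) = Xmap A B \<phi> ((\<Psi> A \<circ> ch) h)"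
    if A: "A \<in> Alg R" and B: "B \<in> Alg R" and \<phi>: "\<phi> \<in> alg_hom R A B" and h: "h \<in> alg_hom R P A" for A B \<phi> h
  proof -
    have "ch (compose (carrier P) \<phi> h) = compose (carrier N) \<phi> (ch h)"
      unfolding ch_def compose_def by (rule restrict_ext) simp
    moreover have "ch h \<in> characters N A"
      using bij_betw_apply[OF ch[OF A] h] .
    ultimately show ?thesis
      using natural[OF A B \<phi>] by simp
  qed
  ultimately show ?thesis
    unfolding represented_by_def using algebra_P by (auto simp: Alg_def intro!: exI[of _ "\<lambda>A. \<Psi> A \<circ> ch"])
qed

section \<open>The subgroup that maps to the torus\<close>

context split_extension
begin

text \<open>Equal to \<open>\<Gamma>\<^sub>2\<close> of the theorem, because the torus is the kernel
  of \<open>\<pi>\<close>.\<close>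

definition N2 where "N2 = {w \<in> carrier \<Gamma>. \<rho>\<^sub>0 w \<in> Tp (base_alg R)}"

lemma N2_normal: "N2 \<lhd> \<Gamma>"
proof (rule \<Gamma>.normal_invI)
  interpret Gp: group "Gp (base_alg R)" by (rule group_G[OF base_alg_Alg])
  interpret \<rho>: group_hom \<Gamma> "Gp (base_alg R)" \<rho>\<^sub>0
    by (intro group_hom.intro \<Gamma> Gp.is_group group_hom_axioms.intro \<rho>\<^sub>0)
  show "subgroup N2 \<Gamma>"
  proof (rule \<Gamma>.subgroupI)
    have "\<one> \<in> N2"
      by (simp add: N2_def T_one)
    then show "N2 \<noteq> {}"
      by blast
  qed (auto simp: N2_def T_inv T_closed)
  show "x \<otimes> h \<otimes> inv x \<in> N2" if "x \<in> carrier \<Gamma>" "h \<in> N2" for x h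
    using that T_conj(1)[OF base_alg_Alg \<rho>\<^sub>0_closed[OF that(1)], of "\<rho>\<^sub>0 h"] by (simp add: N2_def)
qed

lemma act_N2: "n \<in> N2 \<Longrightarrow> m \<in> carrier M \<Longrightarrow> act n m = m"
  unfolding N2_def by (rule act_T) simp_all

text \<open>\<open>coset_action\<close> evaluates at some element \<open>n w\<close> of the coset,
  and \<open>n\<close> in \<open>N2\<close> acts trivially.\<close>

lemma coset_act:
  assumes w: "w \<in> carrier \<Gamma>" and m: "m \<in> carrier M"
  shows "coset_action act (N2 #> w) m = act w m"
proof -
  have sub: "subgroup N2 \<Gamma>"
    by (rule normal_imp_subgroup[OF N2_normal])
  define g where "g = (SOME g. g \<in> N2 #> w)"
  have "g \<in> N2 #> w"
    unfolding g_def by (rule someI[of _ w]) (rule \<Gamma>.rcos_self[OF w sub])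
  then obtain n where n: "n \<in> N2" "g = n \<otimes> w"
    by (auto simp: r_coset_def)
  have "n \<in> carrier \<Gamma>"
    using n(1) by (simp add: N2_def)
  then show ?thesis
    using act_compose[OF _ w m, of n] act_N2[OF n(1) act_closed[OF w m]] n(2)
    by (simp add: coset_action_def g_def[symmetric])
qed

lemma \<pi>_T_mult:
  assumes A: "A \<in> Alg R" and t: "t \<in> Tp A" and g: "g \<in> carrier (Gp A)"
  shows "\<pi> A (t \<otimes>\<^bsub>Gp A\<^esub> g) = \<pi> A g"
proof (rule extensionalityI)
  interpret Gp: group "Gp A" by (rule group_G[OF A])
  have tG: "t \<in> carrier (Gp A)"
    by (rule T_G[OF A t])
  show "\<pi> A (t \<otimes>\<^bsub>Gp A\<^esub> g) \<in> extensional (spec A)" "\<pi> A g \<in> extensional (spec A)"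
    using \<pi>_ext[OF A Gp.m_closed[OF tG g]] \<pi>_ext[OF A g] .
  show "\<pi> A (t \<otimes>\<^bsub>Gp A\<^esub> g) Q = \<pi> A g Q" if Q: "Q \<in> spec A" for Q
    using \<pi>_mult[OF A tG g Q] t \<pi>_pt[OF A g Q] Q by (simp add: T_iff[OF A])
qed

lemma reduced_rep_eq:
  assumes A: "A \<in> Alg R" and w: "w \<in> carrier \<Gamma>"
  shows "reduced_rep R (constant_group C) \<pi> \<rho>\<^sub>0 A w = \<pi> A (r A w)"
  using \<pi> structure_map_hom[OF A] \<rho>\<^sub>0_closed[OF w] A base_alg_Alg
  unfolding group_functor_hom_def reduced_rep_def r_def by metis

lemma T_comm_group: "A \<in> Alg R \<Longrightarrow> comm_group ((Gp A)\<lparr>carrier := Tp A\<rparr>)"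
proof -
  assume A: "A \<in> Alg R"
  interpret TG: group "(Gp A)\<lparr>carrier := Tp A\<rparr>"
    by (rule group.subgroup_imp_group[OF group_G[OF A] T_subgroup[OF A]])
  show ?thesis
    by (rule TG.group_comm_groupI) (simp add: T_comm[OF A])
qed

lemma cj_inv_eq: "A \<in> Alg R \<Longrightarrow> w \<in> carrier \<Gamma> \<Longrightarrow> cj A (inv w) t = r A w \<otimes>\<^bsub>Gp A\<^esub> t \<otimes>\<^bsub>Gp A\<^esub> inv\<^bsub>Gp A\<^esub> r A w"
  using group.inv_inv[OF group_G] by (simp add: cj_def r_inv r_closed)

lemma cj_N2:
  assumes A: "A \<in> Alg R" and n: "n \<in> N2" and t: "t \<in> Tp A"
  shows "cj A (inv n) t = t"
proof -
  have i: "inv n \<in> N2"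
    by (rule subgroup.m_inv_closed[OF normal_imp_subgroup[OF N2_normal] n])
  then have c: "inv n \<in> carrier \<Gamma>"
    by (simp add: N2_def)
  show ?thesis
    by (rule T_eqI[OF A cj_closed[OF A c t] t]) (use \<chi>_act[OF c _ A t] act_N2[OF i] in simp)
qed

lemma \<tau>_eqI:
  assumes A: "A \<in> Alg R" and h: "h \<in> characters M A" and t: "t \<in> Tp A"
    and "\<And>m. m \<in> carrier M \<Longrightarrow> h m = \<chi> A t m"
  shows "\<tau> A h = t"
  by (rule T_eqI[OF A \<tau>_closed[OF A h] t]) (use \<chi>_\<tau>[OF A h] assms(4) in simp)

end

section \<open>Representations\<close>

locale rep_extension = split_extension R G T C M \<pi> \<chi> \<Gamma> \<rho>\<^sub>0
  for R :: "'u ring" and G T :: "('u, 'g) group_functor" and C :: "'c monoid" and M :: "'m monoid"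
    and \<pi> :: "('u, 'u) module \<Rightarrow> 'g \<Rightarrow> 'u set \<Rightarrow> 'c"
    and \<chi> :: "('u, 'u) module \<Rightarrow> 'g \<Rightarrow> 'm \<Rightarrow> 'u"
    and \<Gamma> :: "'p monoid" (structure) and \<rho>\<^sub>0 :: "'p \<Rightarrow> 'g" +
  fixes E :: "'e monoid" and a\<^sub>E :: "'p set \<Rightarrow> 'e \<Rightarrow> 'e" and \<iota> :: "'p set \<Rightarrow> 'e" and p :: "'e \<Rightarrow> 'p set \<Rightarrow>\<^sub>0 int"
  assumes ext: "corresponding_extension \<Gamma> N2 E a\<^sub>E \<iota> p"
begin

sublocale X: crossed_extension \<Gamma> N2 E a\<^sub>E \<iota> p
  by (intro crossed_extension.intro \<Gamma> N2_normal crossed_extension_axioms.intro ext)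

sublocale Z: coinvariant_tensor "\<Gamma> Mod N2" E M a\<^sub>E "coset_action act"
proof (intro coinvariant_tensor.intro X.D.is_group X.E.comm_group_axioms M.comm_group_axioms coinvariant_tensor_axioms.intro)
  fix d assume d: "d \<in> carrier (\<Gamma> Mod N2)"
  show "a\<^sub>E d \<in> hom E E"
    by (rule X.aE_hom[OF d])
  obtain w where w: "w \<in> carrier \<Gamma>" "d = N2 #> w"
    using d by (auto simp: carrier_FactGroup)
  show "coset_action act d \<in> hom M M"
    unfolding w(2) by (rule homI) (simp_all add: coset_act[OF w(1)] act_closed[OF w(1)] act_mult[OF w(1)])
qed

text \<open>A character of the coinvariants is an equivariant map from \<open>E\<close> to the
  torus; \<open>cc\<close> is the composite of that map with the universal crossed
  homomorphism.\<close>

definition cc where "cc A \<psi> w = \<tau> A (\<lambda>m \<in> carrier M. \<psi> (Z.wcls (X.\<delta> w) m))"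

definition rep where "rep A \<psi> = (\<lambda>w \<in> carrier \<Gamma>. cc A \<psi> w \<otimes>\<^bsub>Gp A\<^esub> r A w)"

lemma cc_char:
  assumes A: "A \<in> Alg R" and \<psi>: "\<psi> \<in> characters Z.W A" and w: "w \<in> carrier \<Gamma>"
  shows "(\<lambda>m \<in> carrier M. \<psi> (Z.wcls (X.\<delta> w) m)) \<in> characters M A"
proof (rule charactersI)
  note \<delta> = X.\<delta>_closed[OF w]
  show "(\<lambda>m \<in> carrier M. \<psi> (Z.wcls (X.\<delta> w) m)) x \<in> Units A" if "x \<in> carrier M" for x
    using characters_closed(1)[OF \<psi> Z.wcls_closed[OF \<delta> that]] that by simp
  show "(\<lambda>m \<in> carrier M. \<psi> (Z.wcls (X.\<delta> w) m)) (x \<otimes>\<^bsub>M\<^esub> y) =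
    (\<lambda>m \<in> carrier M. \<psi> (Z.wcls (X.\<delta> w) m)) x \<otimes>\<^bsub>A\<^esub> (\<lambda>m \<in> carrier M. \<psi> (Z.wcls (X.\<delta> w) m)) y"
    if "x \<in> carrier M" "y \<in> carrier M" for x y
    using characters_mult[OF \<psi> Z.wcls_closed[OF \<delta> that(1)] Z.wcls_closed[OF \<delta> that(2)]] that Z.wcls_r[OF \<delta> that] by simp
qed simp

lemma cc_closed: "\<lbrakk>A \<in> Alg R; \<psi> \<in> characters Z.W A; w \<in> carrier \<Gamma>\<rbrakk> \<Longrightarrow> cc A \<psi> w \<in> Tp A"
  unfolding cc_def by (rule \<tau>_closed[OF _ cc_char])

lemma \<chi>_cc: "\<lbrakk>A \<in> Alg R; \<psi> \<in> characters Z.W A; w \<in> carrier \<Gamma>; m \<in> carrier M\<rbrakk> \<Longrightarrow> \<chi> A (cc A \<psi> w) m = \<psi> (Z.wcls (X.\<delta> w) m)"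
  unfolding cc_def using \<chi>_\<tau>[OF _ cc_char] by simp

text \<open>The relation \<open>d x \<otimes> d m = x \<otimes> m\<close> of the coinvariants,
  applied to \<open>w^-1 m\<close> in place of \<open>m\<close>.\<close>

lemma wcls_act:
  assumes w: "w \<in> carrier \<Gamma>" and x: "x \<in> carrier E" and m: "m \<in> carrier M"
  shows "Z.wcls (a\<^sub>E (N2 #> w) x) m = Z.wcls x (act (inv w) m)"
  using Z.wcls_invariant[OF X.cl_closed[OF w] x act_closed[OF \<Gamma>.inv_closed[OF w] m]]
    coset_act[OF w act_closed[OF \<Gamma>.inv_closed[OF w] m]] act_act_inv[OF w m] by simp

text \<open>Expanding \<open>\<delta> (w w')\<close> gives a second term in which \<open>w\<close>
  acts on \<open>E\<close>. Moved across the tensor it becomes \<open>w^-1\<close> acting on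
  \<open>m\<close>, which on points of the torus is conjugation by \<open>r A w\<close>.\<close>

lemma cc_crossed:
  assumes A: "A \<in> Alg R" and \<psi>: "\<psi> \<in> characters Z.W A" and w: "w \<in> carrier \<Gamma>" and w': "w' \<in> carrier \<Gamma>"
  shows "cc A \<psi> (w \<otimes> w') = cc A \<psi> w \<otimes>\<^bsub>Gp A\<^esub> cj A (inv w) (cc A \<psi> w')"
proof (rule T_eqI[OF A cc_closed[OF A \<psi> \<Gamma>.m_closed[OF w w']] T_closed[OF A cc_closed[OF A \<psi> w] cj_closed[OF A \<Gamma>.inv_closed[OF w] cc_closed[OF A \<psi> w']]]])
  fix m assume m: "m \<in> carrier M"
  note \<delta> = X.\<delta>_closed[OF w] X.\<delta>_closed[OF w'] and i = \<Gamma>.inv_closed[OF w]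
  have a\<delta>: "a\<^sub>E (N2 #> w) (X.\<delta> w') \<in> carrier E"
    by (rule X.aE_closed[OF X.cl_closed[OF w] \<delta>(2)])
  have "\<chi> A (cc A \<psi> (w \<otimes> w')) m = \<psi> (Z.wcls (X.\<delta> w) m \<otimes>\<^bsub>Z.W\<^esub> Z.wcls (X.\<delta> w') (act (inv w) m))"
    unfolding \<chi>_cc[OF A \<psi> \<Gamma>.m_closed[OF w w'] m] X.\<delta>_crossed[OF w w'] Z.wcls_l[OF \<delta>(1) a\<delta> m] wcls_act[OF w \<delta>(2) m] ..
  also have "\<dots> = \<chi> A (cc A \<psi> w) m \<otimes>\<^bsub>A\<^esub> \<chi> A (cc A \<psi> w') (act (inv w) m)"
    unfolding \<chi>_cc[OF A \<psi> w m] \<chi>_cc[OF A \<psi> w' act_closed[OF i m]]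
    by (rule characters_mult[OF \<psi> Z.wcls_closed[OF \<delta>(1) m] Z.wcls_closed[OF \<delta>(2) act_closed[OF i m]]])
  also have "\<dots> = \<chi> A (cc A \<psi> w \<otimes>\<^bsub>Gp A\<^esub> cj A (inv w) (cc A \<psi> w')) m"
    unfolding \<chi>_act[OF i m A cc_closed[OF A \<psi> w']]
    by (rule \<chi>_mult[OF A cc_closed[OF A \<psi> w] cj_closed[OF A i cc_closed[OF A \<psi> w']] m, symmetric])
  finally show "\<chi> A (cc A \<psi> (w \<otimes> w')) m = \<chi> A (cc A \<psi> w \<otimes>\<^bsub>Gp A\<^esub> cj A (inv w) (cc A \<psi> w')) m" .
qed

text \<open>A crossed homomorphism times the reference homomorphism is a homomorphism: the twist is
  exactly the cost of moving \<open>r A w\<close> past the torus part of the second factor.\<close>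

lemma rep_mem:
  assumes A: "A \<in> Alg R" and \<psi>: "\<psi> \<in> characters Z.W A"
  shows "rep A \<psi> \<in> Rep R G (constant_group C) \<pi> \<Gamma> \<rho>\<^sub>0 A"
proof -
  interpret Gp: group "Gp A" by (rule group_G[OF A])
  have c: "cc A \<psi> w \<in> carrier (Gp A)" "r A w \<in> carrier (Gp A)" if "w \<in> carrier \<Gamma>" for w
    using T_G[OF A cc_closed[OF A \<psi> that]] r_closed[OF A that] .
  have "rep A \<psi> \<in> hom \<Gamma> (Gp A)"
  proof (rule homI)
    show "rep A \<psi> w \<in> carrier (Gp A)" if "w \<in> carrier \<Gamma>" for w
      using c[OF that] that by (simp add: rep_def)
    fix w w' assume w: "w \<in> carrier \<Gamma>" and w': "w' \<in> carrier \<Gamma>"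
    define k where "k = cj A (inv w) (cc A \<psi> w')"
    have k: "k \<in> carrier (Gp A)"
      unfolding k_def by (rule T_G[OF A cj_closed[OF A \<Gamma>.inv_closed[OF w] cc_closed[OF A \<psi> w']]])
    have "rep A \<psi> (w \<otimes> w') = cc A \<psi> w \<otimes>\<^bsub>Gp A\<^esub> (k \<otimes>\<^bsub>Gp A\<^esub> r A w) \<otimes>\<^bsub>Gp A\<^esub> r A w'"
      using w w' k c[OF w] c[OF w'] by (simp add: rep_def cc_crossed[OF A \<psi> w w'] r_mult[OF A w w'] k_def[symmetric] Gp.m_assoc)
    also have "k \<otimes>\<^bsub>Gp A\<^esub> r A w = r A w \<otimes>\<^bsub>Gp A\<^esub> cc A \<psi> w'"
      unfolding k_def by (rule conj_r[OF A w cc_closed[OF A \<psi> w'], symmetric])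
    finally show "rep A \<psi> (w \<otimes> w') = rep A \<psi> w \<otimes>\<^bsub>Gp A\<^esub> rep A \<psi> w'"
      using w w' c[OF w] c[OF w'] by (simp add: rep_def Gp.m_assoc)
  qed
  moreover have "\<pi> A (rep A \<psi> w) = reduced_rep R (constant_group C) \<pi> \<rho>\<^sub>0 A w" if "w \<in> carrier \<Gamma>" for w
    using \<pi>_T_mult[OF A cc_closed[OF A \<psi> that] r_closed[OF A that]] that by (simp add: rep_def reduced_rep_eq[OF A])
  ultimately show ?thesis
    by (simp add: Rep_def) (simp add: rep_def)
qed

text \<open>The cocycle is recovered from the representation by cancelling \<open>r A w\<close>. It
  determines \<open>\<psi>\<close> because the values of \<open>\<delta>\<close> generate
  \<open>E\<close> and pure tensors generate the coinvariants.\<close>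

lemma rep_inj:
  assumes A: "A \<in> Alg R" and \<psi>: "\<psi> \<in> characters Z.W A" and \<psi>': "\<psi>' \<in> characters Z.W A" and eq: "rep A \<psi> = rep A \<psi>'"
  shows "\<psi> = \<psi>'"
proof (rule extensionalityI)
  interpret Gp: group "Gp A" by (rule group_G[OF A])
  interpret A: algebra R A by (rule AlgD[OF A])
  have U: "group (units_of A)"
    by (rule A.units_group)
  have cc: "cc A \<psi> w = cc A \<psi>' w" if w: "w \<in> carrier \<Gamma>" for w
  proof -
    have "cc A \<psi> w \<otimes>\<^bsub>Gp A\<^esub> r A w = cc A \<psi>' w \<otimes>\<^bsub>Gp A\<^esub> r A w"
      using fun_cong[OF eq, of w] w by (simp add: rep_def)
    then show ?thesis
      by (rule Gp.r_cancel[OF _ T_G[OF A cc_closed[OF A \<psi> w]] T_G[OF A cc_closed[OF A \<psi>' w]] r_closed[OF A w]])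
  qed
  have h: "(\<lambda>x. \<phi> (Z.wcls x m)) \<in> hom E (units_of A)" if \<phi>: "\<phi> \<in> characters Z.W A" and m: "m \<in> carrier M" for \<phi> m
    by (rule homI) (use characters_closed(1)[OF \<phi> Z.wcls_closed[OF _ m]] characters_mult[OF \<phi> Z.wcls_closed[OF _ m] Z.wcls_closed[OF _ m]]
      Z.wcls_l[OF _ _ m] in \<open>simp_all add: units_of_carrier units_of_mult\<close>)
  fix w assume w: "w \<in> carrier Z.W"
  show "\<psi> w = \<psi>' w"
  proof (rule Z.hom_W_unique[OF U _ _ _ w])
    show "\<psi> \<in> hom Z.W (units_of A)" "\<psi>' \<in> hom Z.W (units_of A)"
      using \<psi> \<psi>' by auto
    fix x m assume x: "x \<in> carrier E" and m: "m \<in> carrier M"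
    show "\<psi> (Z.wcls x m) = \<psi>' (Z.wcls x m)"
    proof (rule X.\<delta>_generates[OF U h[OF \<psi> m] h[OF \<psi>' m] _ x])
      show "\<psi> (Z.wcls (X.\<delta> w) m) = \<psi>' (Z.wcls (X.\<delta> w) m)" if "w \<in> carrier \<Gamma>" for w
        using \<chi>_cc[OF A \<psi> that m] \<chi>_cc[OF A \<psi>' that m] cc[OF that] by simp
    qed
  qed
qed (use \<psi> \<psi>' in auto)

text \<open>The quotient \<open>c\<close> of \<open>\<rho>\<close> by the reference representation
  lies in the torus, since both have the same image under \<open>\<pi>\<close>. It is a crossed
  homomorphism and \<open>N2\<close> acts trivially on the torus, so it factors through
  \<open>E\<close>; pairing with characters gives an invariant bilinear map.\<close>

lemma rep_surj:
  assumes A: "A \<in> Alg R" and \<rho>: "\<rho> \<in> Rep R G (constant_group C) \<pi> \<Gamma> \<rho>\<^sub>0 A"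
  shows "\<exists>\<psi> \<in> characters Z.W A. \<rho> = rep A \<psi>"
proof -
  interpret Gp: group "Gp A" by (rule group_G[OF A])
  interpret A: algebra R A by (rule AlgD[OF A])
  have \<rho>h: "\<rho> \<in> hom \<Gamma> (Gp A)" and \<rho>e: "\<rho> \<in> extensional (carrier \<Gamma>)"
    and \<rho>\<pi>: "\<And>w. w \<in> carrier \<Gamma> \<Longrightarrow> \<pi> A (\<rho> w) = \<pi> A (r A w)"
    using \<rho> by (simp_all add: Rep_def reduced_rep_eq[OF A])
  have \<rho>c: "\<rho> w \<in> carrier (Gp A)" if "w \<in> carrier \<Gamma>" for w
    using hom_carrier[OF \<rho>h] that by blast
  define c where "c w = \<rho> w \<otimes>\<^bsub>Gp A\<^esub> inv\<^bsub>Gp A\<^esub> r A w" for w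
  have cT: "c w \<in> Tp A" if "w \<in> carrier \<Gamma>" for w
    unfolding c_def by (rule same_\<pi>[OF A \<rho>c[OF that] r_closed[OF A that]]) (simp add: \<rho>\<pi>[OF that])
  define B where "B = (Gp A)\<lparr>carrier := Tp A\<rparr>"
  interpret B: comm_group B
    unfolding B_def by (rule T_comm_group[OF A])
  have B_simps: "carrier B = Tp A" "monoid.mult B = monoid.mult (Gp A)"
    by (simp_all add: B_def)
  have crossed: "c (w \<otimes> w') = c w \<otimes>\<^bsub>Gp A\<^esub> cj A (inv w) (c w')"
    if w: "w \<in> carrier \<Gamma>" and w': "w' \<in> carrier \<Gamma>" for w w'
  proof -
    note cl = \<rho>c[OF w] \<rho>c[OF w'] r_closed[OF A w] r_closed[OF A w']
    have cancel: "inv\<^bsub>Gp A\<^esub> r A w \<otimes>\<^bsub>Gp A\<^esub> (r A w \<otimes>\<^bsub>Gp A\<^esub> y) = y" if "y \<in> carrier (Gp A)" for y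
      using that cl by (simp add: Gp.m_assoc[symmetric])
    show ?thesis
      unfolding cj_inv_eq[OF A w] c_def hom_mult[OF \<rho>h w w'] r_mult[OF A w w']
      using cl by (simp add: Gp.m_assoc Gp.inv_mult_group cancel)
  qed
  have "\<exists>\<phi> \<in> hom E B. \<forall>w \<in> carrier \<Gamma>. \<phi> (X.\<delta> w) = c w"
    by (rule X.\<delta>_universal[OF B.comm_group_axioms, where b = "\<lambda>w. cj A (inv w)"])
      (simp_all add: B_simps cT crossed cj_N2[OF A])
  then obtain \<phi> where \<phi>: "\<phi> \<in> hom E B" and \<phi>\<delta>: "\<And>w. w \<in> carrier \<Gamma> \<Longrightarrow> \<phi> (X.\<delta> w) = c w"
    by blast
  have \<phi>T: "\<phi> x \<in> Tp A" if "x \<in> carrier E" for x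
    using hom_carrier[OF \<phi>] that by (auto simp: B_simps)
  have \<phi>m: "\<phi> (x \<otimes>\<^bsub>E\<^esub> y) = \<phi> x \<otimes>\<^bsub>Gp A\<^esub> \<phi> y" if "x \<in> carrier E" "y \<in> carrier E" for x y
    using hom_mult[OF \<phi> that] by (simp add: B_simps)
  have equiv: "\<phi> (a\<^sub>E (N2 #> w) x) = cj A (inv w) (\<phi> x)" if w: "w \<in> carrier \<Gamma>" and x: "x \<in> carrier E" for w x
  proof (rule X.\<delta>_generates[OF B.is_group _ _ _ x])
    note i = \<Gamma>.inv_closed[OF w] and aE = X.aE_closed[OF X.cl_closed[OF w]]
    show "(\<lambda>x. \<phi> (a\<^sub>E (N2 #> w) x)) \<in> hom E B"
      by (rule homI) (simp_all add: B_simps \<phi>T \<phi>m aE X.aE_mult[OF X.cl_closed[OF w]])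
    show "(\<lambda>x. cj A (inv w) (\<phi> x)) \<in> hom E B"
      by (rule homI) (simp_all add: B_simps \<phi>T \<phi>m cj_closed[OF A i] cj_mult[OF A i])
    fix w' assume w': "w' \<in> carrier \<Gamma>"
    \<comment> \<open>Equivariance on the generators \<open>\<delta> w'\<close>: expand
      \<open>\<phi> (\<delta> (w w'))\<close> by the crossed property of \<open>\<delta>\<close> and
      by that of \<open>c\<close>, then cancel \<open>c w\<close>.\<close>
    have "c w \<otimes>\<^bsub>Gp A\<^esub> \<phi> (a\<^sub>E (N2 #> w) (X.\<delta> w')) = \<phi> (X.\<delta> (w \<otimes> w'))"
      unfolding X.\<delta>_crossed[OF w w'] \<phi>m[OF X.\<delta>_closed[OF w] aE[OF X.\<delta>_closed[OF w']]] \<phi>\<delta>[OF w] ..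
    also have "\<dots> = c w \<otimes>\<^bsub>Gp A\<^esub> cj A (inv w) (c w')"
      using \<phi>\<delta>[OF \<Gamma>.m_closed[OF w w']] crossed[OF w w'] by simp
    finally show "\<phi> (a\<^sub>E (N2 #> w) (X.\<delta> w')) = cj A (inv w) (\<phi> (X.\<delta> w'))"
      unfolding \<phi>\<delta>[OF w']
      by (rule Gp.l_cancel[OF _ T_G[OF A \<phi>T[OF aE[OF X.\<delta>_closed[OF w']]]] T_G[OF A cj_closed[OF A i cT[OF w']]] T_G[OF A cT[OF w]]])
  qed
  have "\<exists>f \<in> hom Z.W (units_of A). \<forall>x \<in> carrier E. \<forall>m \<in> carrier M. f (Z.wcls x m) = \<chi> A (\<phi> x) m"
  proof (rule Z.hom_W_ex[OF A.units_comm_group])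
    fix d x m assume d: "d \<in> carrier (\<Gamma> Mod N2)" and x: "x \<in> carrier E" and m: "m \<in> carrier M"
    obtain w where w: "w \<in> carrier \<Gamma>" "d = N2 #> w"
      using d by (auto simp: carrier_FactGroup)
    show "\<chi> A (\<phi> (a\<^sub>E d x)) (coset_action act d m) = \<chi> A (\<phi> x) m"
      unfolding w(2) coset_act[OF w(1) m] equiv[OF w(1) x]
        \<chi>_act[OF \<Gamma>.inv_closed[OF w(1)] act_closed[OF w(1) m] A \<phi>T[OF x], symmetric] act_inv_act[OF w(1) m] ..
  qed (simp_all add: units_of_carrier units_of_mult \<chi>_Unit[OF A \<phi>T] \<phi>m \<chi>_mult[OF A \<phi>T \<phi>T] \<chi>_M_mult[OF A \<phi>T])
  then obtain f where f: "f \<in> hom Z.W (units_of A)" and fw: "\<And>x m. x \<in> carrier E \<Longrightarrow> m \<in> carrier M \<Longrightarrow> f (Z.wcls x m) = \<chi> A (\<phi> x) m"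
    by blast
  define \<psi> where "\<psi> = restrict f (carrier Z.W)"
  have \<psi>: "\<psi> \<in> characters Z.W A"
    using f by (auto simp: \<psi>_def hom_def Pi_iff)
  have "\<rho> = rep A \<psi>"
  proof (rule extensionalityI[OF \<rho>e])
    show "rep A \<psi> \<in> extensional (carrier \<Gamma>)"
      by (simp add: rep_def)
    fix w assume w: "w \<in> carrier \<Gamma>"
    have "cc A \<psi> w = c w"
    proof (rule T_eqI[OF A cc_closed[OF A \<psi> w] cT[OF w]])
      show "\<chi> A (cc A \<psi> w) m = \<chi> A (c w) m" if m: "m \<in> carrier M" for m
        unfolding \<chi>_cc[OF A \<psi> w m] using Z.wcls_closed[OF X.\<delta>_closed[OF w] m] fw[OF X.\<delta>_closed[OF w] m] \<phi>\<delta>[OF w]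
        by (simp add: \<psi>_def)
    qed
    then show "\<rho> w = rep A \<psi> w"
      using w \<rho>c[OF w] r_closed[OF A w] by (simp add: rep_def c_def Gp.m_assoc)
  qed
  then show ?thesis
    using \<psi> by blast
qed

theorem Rep_represented:
  "represented_by R (Rep R G (constant_group C) \<pi> \<Gamma> \<rho>\<^sub>0) (Rep_map G \<Gamma>) (monoid_algebra R Z.W)"
proof (rule represented_by_group_algebra[OF Z.W.comm_group_axioms, where \<Psi> = rep])
  fix A :: "('u, 'u) module" assume A: "A \<in> Alg R"
  show "bij_betw (rep A) (characters Z.W A) (Rep R G (constant_group C) \<pi> \<Gamma> \<rho>\<^sub>0 A)"
    by (rule bij_betwI') (use rep_inj[OF A] rep_mem[OF A] rep_surj[OF A] in blast)+
  fix B :: "('u, 'u) module" and \<phi> \<psi> assume B: "B \<in> Alg R" and \<phi>: "\<phi> \<in> alg_hom R A B" and \<psi>: "\<psi> \<in> characters Z.W A"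
  show "rep B (compose (carrier Z.W) \<phi> \<psi>) = Rep_map G \<Gamma> A B \<phi> (rep A \<psi>)"
    unfolding rep_def Rep_map_def
  proof (rule restrict_ext)
    fix w assume w: "w \<in> carrier \<Gamma>"
    have "compose (carrier M) \<phi> (\<lambda>m \<in> carrier M. \<psi> (Z.wcls (X.\<delta> w) m)) =
      (\<lambda>m \<in> carrier M. compose (carrier Z.W) \<phi> \<psi> (Z.wcls (X.\<delta> w) m))"
      unfolding compose_def by (rule restrict_ext) (simp add: Z.wcls_closed[OF X.\<delta>_closed[OF w]])
    then have "tr A B \<phi> (cc A \<psi> w) = cc B (compose (carrier Z.W) \<phi> \<psi>) w"
      unfolding cc_def \<tau>_tr[OF A B \<phi> cc_char[OF A \<psi> w]] by simp
    then show "cc B (compose (carrier Z.W) \<phi> \<psi>) w \<otimes>\<^bsub>Gp B\<^esub> r B w =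
      tr A B \<phi> ((\<lambda>w \<in> carrier \<Gamma>. cc A \<psi> w \<otimes>\<^bsub>Gp A\<^esub> r A w) w)"
      using w by (simp add: tr_mult[OF A B \<phi> T_G[OF A cc_closed[OF A \<psi> w]] r_closed[OF A w]] tr_r[OF A B \<phi> w])
  qed
qed

end

section \<open>Chains and the first homology group\<close>

lemma hom_finprod:
  assumes "comm_group G" "comm_group H" "h \<in> hom G H" "f \<in> S \<rightarrow> carrier G"
  shows "h (finprod G f S) = finprod H (\<lambda>i. h (f i)) S"
proof -
  interpret G: comm_group G by fact
  interpret H: comm_group H by fact
  have hc: "h x \<in> carrier H" if "x \<in> carrier G" for x
    using hom_carrier[OF assms(3)] that by blast
  show ?thesis
    using assms(4)
  proof (induction S rule: infinite_finite_induct)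
    case (insert x S)
    then have "f x \<in> carrier G" "f \<in> S \<rightarrow> carrier G"
      by auto
    moreover have "(\<lambda>i. h (f i)) \<in> S \<rightarrow> carrier H"
      using insert.prems hc by auto
    ultimately show ?case
      using insert by (simp add: hom_mult[OF assms(3)] hc)
  qed (simp_all add: hom_one[OF assms(3) G.is_group H.is_group])
qed

lemma (in comm_group) finprod_in_subgroup:
  assumes "subgroup K G" "\<And>i. i \<in> S \<Longrightarrow> f i \<in> K"
  shows "finprod G f S \<in> K"
  using assms(2)
proof (induction S rule: infinite_finite_induct)
  case (insert x S)
  then have "f x \<in> carrier G" "f \<in> S \<rightarrow> carrier G"
    using subgroup.subset[OF assms(1)] by auto
  then show ?case
    using insert subgroup.m_closed[OF assms(1)] by simp
qed (simp_all add: subgroup.one_closed[OF assms(1)])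

definition power_group :: "'m monoid \<Rightarrow> nat \<Rightarrow> (nat \<Rightarrow> 'm) monoid" where
  "power_group M n = product_group {1..n} (\<lambda>_. M)"

definition coord :: "'m monoid \<Rightarrow> nat \<Rightarrow> nat \<Rightarrow> 'm \<Rightarrow> nat \<Rightarrow> 'm" where
  "coord M n i m = (\<lambda>j \<in> {1..n}. if j = i then m else \<one>\<^bsub>M\<^esub>)"

text \<open>The homomorphism \<open>M\<^sup>n \<rightarrow> B\<close> with components \<open>L i\<close>.\<close>

definition pext :: "('b, 'z) monoid_scheme \<Rightarrow> nat \<Rightarrow> (nat \<Rightarrow> 'm \<Rightarrow> 'b) \<Rightarrow> (nat \<Rightarrow> 'm) \<Rightarrow> 'b" where
  "pext B n L \<mu> = finprod B (\<lambda>i. L i (\<mu> i)) {1..n}"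

locale power_groups = M: comm_group M for M :: "'m monoid"
begin

abbreviation Mp where "Mp \<equiv> power_group M"

lemma carrier_Mp: "carrier (Mp n) = {1..n} \<rightarrow>\<^sub>E carrier M"
  by (simp add: power_group_def)

lemma Mp_coord: "\<mu> \<in> carrier (Mp n) \<Longrightarrow> i \<in> {1..n} \<Longrightarrow> \<mu> i \<in> carrier M"
  by (auto simp: carrier_Mp)

lemma mult_Mp: "\<mu> \<otimes>\<^bsub>Mp n\<^esub> \<nu> = (\<lambda>i \<in> {1..n}. \<mu> i \<otimes>\<^bsub>M\<^esub> \<nu> i)"
  by (simp add: power_group_def)

lemma comm_group_Mp: "comm_group (Mp n)"
proof -
  interpret group "Mp n"
    unfolding power_group_def by (simp add: M.is_group)
  show ?thesis
  proof (rule group_comm_groupI)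
    fix x y assume "x \<in> carrier (Mp n)" "y \<in> carrier (Mp n)"
    then show "x \<otimes>\<^bsub>Mp n\<^esub> y = y \<otimes>\<^bsub>Mp n\<^esub> x"
      unfolding mult_Mp by (intro restrict_ext) (simp add: Mp_coord M.m_comm)
  qed
qed

lemma countable_Mp: "countable (carrier M) \<Longrightarrow> countable (carrier (Mp n))"
proof -
  assume M: "countable (carrier M)"
  have "inj_on (\<lambda>f. map f [1..<Suc n]) (carrier (Mp n))"
  proof (rule inj_onI)
    fix f g assume fg: "f \<in> carrier (Mp n)" "g \<in> carrier (Mp n)" and eq: "map f [1..<Suc n] = map g [1..<Suc n]"
    show "f = g"
    proof (rule PiE_ext)
      show "f \<in> {1..n} \<rightarrow>\<^sub>E carrier M" "g \<in> {1..n} \<rightarrow>\<^sub>E carrier M"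
        using fg by (simp_all add: carrier_Mp)
      show "f i = g i" if "i \<in> {1..n}" for i
        using eq that by (simp add: map_eq_conv del: upt_Suc)
    qed
  qed
  moreover have "(\<lambda>f. map f [1..<Suc n]) ` carrier (Mp n) \<subseteq> lists (carrier M)"
    using Mp_coord by (auto simp del: upt_Suc)
  ultimately show ?thesis
    by (meson countable_image_inj_on countable_lists countable_subset M)
qed

lemma coord_closed: "m \<in> carrier M \<Longrightarrow> coord M n i m \<in> carrier (Mp n)"
  by (simp add: carrier_Mp coord_def PiE_iff)

lemma coord_mult: "m \<in> carrier M \<Longrightarrow> m' \<in> carrier M \<Longrightarrow> coord M n i (m \<otimes>\<^bsub>M\<^esub> m') = coord M n i m \<otimes>\<^bsub>Mp n\<^esub> coord M n i m'"
  unfolding mult_Mp coord_def by (intro restrict_ext) simp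

lemma coord_hom: "coord M n i \<in> hom M (Mp n)"
  by (rule homI) (simp_all add: coord_closed coord_mult)

lemma eval_hom: "j \<in> {1..n} \<Longrightarrow> (\<lambda>\<mu>. \<mu> j) \<in> hom (Mp n) M"
  by (rule homI) (simp_all add: Mp_coord mult_Mp)

lemma Mp_decompose:
  assumes \<mu>: "\<mu> \<in> carrier (Mp n)"
  shows "\<mu> = finprod (Mp n) (\<lambda>i. coord M n i (\<mu> i)) {1..n}"
proof (rule PiE_ext)
  interpret Mp: comm_group "Mp n" by (rule comm_group_Mp)
  have F: "(\<lambda>i. coord M n i (\<mu> i)) \<in> {1..n} \<rightarrow> carrier (Mp n)"
    by (rule funcsetI) (rule coord_closed[OF Mp_coord[OF \<mu>]])
  show "\<mu> \<in> {1..n} \<rightarrow>\<^sub>E carrier M"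
    using \<mu> by (simp add: carrier_Mp)
  show "finprod (Mp n) (\<lambda>i. coord M n i (\<mu> i)) {1..n} \<in> {1..n} \<rightarrow>\<^sub>E carrier M"
    using Mp.finprod_closed[OF F] by (simp add: carrier_Mp)
  fix j assume j: "j \<in> {1..n}"
  have "finprod (Mp n) (\<lambda>i. coord M n i (\<mu> i)) {1..n} j = finprod M (\<lambda>i. coord M n i (\<mu> i) j) {1..n}"
    by (rule hom_finprod[OF comm_group_Mp M.comm_group_axioms eval_hom[OF j] F])
  also have "\<dots> = finprod M (\<lambda>i. if j = i then \<mu> i else \<one>\<^bsub>M\<^esub>) {1..n}"
    by (rule M.finprod_cong') (use j Mp_coord[OF \<mu>] in \<open>auto simp: coord_def\<close>)
  also have "\<dots> = \<mu> j"
    by (rule M.finprod_singleton[OF j]) (use Mp_coord[OF \<mu>] in auto)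
  finally show "\<mu> j = finprod (Mp n) (\<lambda>i. coord M n i (\<mu> i)) {1..n} j"
    by simp
qed

lemma pext_hom:
  assumes B: "comm_group B" and L: "\<And>i. i \<in> {1..n} \<Longrightarrow> L i \<in> hom M B"
  shows "pext B n L \<in> hom (Mp n) B"
proof (rule homI)
  interpret B: comm_group B by (rule B)
  have c: "L i (\<mu> i) \<in> carrier B" if "\<mu> \<in> carrier (Mp n)" "i \<in> {1..n}" for \<mu> i
    using hom_carrier[OF L[OF that(2)]] Mp_coord[OF that] by blast
  show "pext B n L \<mu> \<in> carrier B" if "\<mu> \<in> carrier (Mp n)" for \<mu>
    unfolding pext_def by (rule B.finprod_closed) (use c[OF that] in blast)
  fix \<mu> \<nu> assume \<mu>: "\<mu> \<in> carrier (Mp n)" and \<nu>: "\<nu> \<in> carrier (Mp n)"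
  have "pext B n L (\<mu> \<otimes>\<^bsub>Mp n\<^esub> \<nu>) = finprod B (\<lambda>i. L i (\<mu> i) \<otimes>\<^bsub>B\<^esub> L i (\<nu> i)) {1..n}"
    unfolding pext_def
    by (rule B.finprod_cong'[OF refl])
      (use c[OF \<mu>] c[OF \<nu>] hom_mult[OF L] Mp_coord[OF \<mu>] Mp_coord[OF \<nu>] in \<open>simp_all add: mult_Mp\<close>)
  also have "\<dots> = pext B n L \<mu> \<otimes>\<^bsub>B\<^esub> pext B n L \<nu>"
    unfolding pext_def by (rule B.finprod_multf) (use c[OF \<mu>] c[OF \<nu>] in blast)+
  finally show "pext B n L (\<mu> \<otimes>\<^bsub>Mp n\<^esub> \<nu>) = pext B n L \<mu> \<otimes>\<^bsub>B\<^esub> pext B n L \<nu>" .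
qed

lemma pext_coord:
  assumes B: "comm_group B" and L: "\<And>i. i \<in> {1..n} \<Longrightarrow> L i \<in> hom M B" and i: "i \<in> {1..n}" and m: "m \<in> carrier M"
  shows "pext B n L (coord M n i m) = L i m"
proof -
  interpret B: comm_group B by (rule B)
  have c: "L j m \<in> carrier B" if "j \<in> {1..n}" for j
    using hom_carrier[OF L[OF that]] m by blast
  have "pext B n L (coord M n i m) = finprod B (\<lambda>j. if i = j then L j m else \<one>\<^bsub>B\<^esub>) {1..n}"
    unfolding pext_def
    by (rule B.finprod_cong') (use c hom_one[OF L M.is_group B.is_group] in \<open>auto simp: coord_def\<close>)
  also have "\<dots> = L i m"
    by (rule B.finprod_singleton[OF i]) (use c in auto)
  finally show ?thesis .
qed

lemma Mp_hom_unique: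
  assumes B: "comm_group B" and f: "f \<in> hom (Mp n) B" and g: "g \<in> hom (Mp n) B"
    and eq: "\<And>i m. i \<in> {1..n} \<Longrightarrow> m \<in> carrier M \<Longrightarrow> f (coord M n i m) = g (coord M n i m)"
    and \<mu>: "\<mu> \<in> carrier (Mp n)"
  shows "f \<mu> = g \<mu>"
proof -
  interpret B: comm_group B by (rule B)
  have F: "(\<lambda>i. coord M n i (\<mu> i)) \<in> {1..n} \<rightarrow> carrier (Mp n)"
    by (rule funcsetI) (rule coord_closed[OF Mp_coord[OF \<mu>]])
  have "f \<mu> = finprod B (\<lambda>i. f (coord M n i (\<mu> i))) {1..n}"
    by (subst Mp_decompose[OF \<mu>]) (rule hom_finprod[OF comm_group_Mp B f F])
  also have "\<dots> = finprod B (\<lambda>i. g (coord M n i (\<mu> i))) {1..n}"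
    by (rule B.finprod_cong'[OF refl]) (use hom_carrier[OF g] coord_closed[OF Mp_coord[OF \<mu>]] eq[OF _ Mp_coord[OF \<mu>]] in auto)
  also have "\<dots> = g \<mu>"
    by (subst (2) Mp_decompose[OF \<mu>]) (rule hom_finprod[OF comm_group_Mp B g F, symmetric])
  finally show ?thesis .
qed

end

section \<open>The bar complex in degrees one and two\<close>

locale chain_groups = power_groups M + \<Gamma>: group \<Gamma> for M :: "'m monoid" and \<Gamma> :: "'p monoid" (structure) +
  fixes b :: "'p \<Rightarrow> 'm \<Rightarrow> 'm"
  assumes b_hom: "\<And>w. w \<in> carrier \<Gamma> \<Longrightarrow> b w \<in> hom M M"
    and b_mult: "\<And>w \<delta> m. w \<in> carrier \<Gamma> \<Longrightarrow> \<delta> \<in> carrier \<Gamma> \<Longrightarrow> m \<in> carrier M \<Longrightarrow> b (w \<otimes> \<delta>) m = b w (b \<delta> m)"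
begin

abbreviation C1 where "C1 \<equiv> chains1 \<Gamma> M"
abbreviation C2 where "C2 \<equiv> chains2 \<Gamma> M"

lemma b_closed: "w \<in> carrier \<Gamma> \<Longrightarrow> m \<in> carrier M \<Longrightarrow> b w m \<in> carrier M"
  using hom_carrier[OF b_hom] by blast

lemma carrier_C1: "carrier C1 = {x \<in> carrier \<Gamma> \<rightarrow>\<^sub>E carrier M. finite {g \<in> carrier \<Gamma>. x g \<noteq> \<one>\<^bsub>M\<^esub>}}"
  unfolding chains1_def by (rule carrier_sum_group) (rule M.is_group)

lemma C1_coeff: "c \<in> carrier C1 \<Longrightarrow> g \<in> carrier \<Gamma> \<Longrightarrow> c g \<in> carrier M"
  by (auto simp: carrier_C1)

lemma mult_C1: "c \<otimes>\<^bsub>C1\<^esub> d = (\<lambda>g \<in> carrier \<Gamma>. c g \<otimes>\<^bsub>M\<^esub> d g)"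
  by (simp add: chains1_def)

lemma comm_group_C1: "comm_group C1"
proof -
  interpret group C1
    unfolding chains1_def by (rule sum_group) (rule M.is_group)
  show ?thesis
  proof (rule group_comm_groupI)
    fix x y assume "x \<in> carrier C1" "y \<in> carrier C1"
    then show "x \<otimes>\<^bsub>C1\<^esub> y = y \<otimes>\<^bsub>C1\<^esub> x"
      unfolding mult_C1 by (intro restrict_ext) (simp add: C1_coeff M.m_comm)
  qed
qed

sublocale C1: comm_group C1 by (rule comm_group_C1)

lemma chain1_closed: "g \<in> carrier \<Gamma> \<Longrightarrow> m \<in> carrier M \<Longrightarrow> chain1 \<Gamma> M g m \<in> carrier C1"
proof -
  assume "g \<in> carrier \<Gamma>" "m \<in> carrier M"
  moreover have "finite {k \<in> carrier \<Gamma>. chain1 \<Gamma> M g m k \<noteq> \<one>\<^bsub>M\<^esub>}"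
    by (rule finite_subset[of _ "{g}"]) (auto simp: chain1_def)
  ultimately show ?thesis
    by (auto simp: carrier_C1) (auto simp: chain1_def)
qed

lemma chain1_mult: "m \<in> carrier M \<Longrightarrow> m' \<in> carrier M \<Longrightarrow> chain1 \<Gamma> M g (m \<otimes>\<^bsub>M\<^esub> m') = chain1 \<Gamma> M g m \<otimes>\<^bsub>C1\<^esub> chain1 \<Gamma> M g m'"
  unfolding mult_C1 chain1_def by (intro restrict_ext) simp

lemma chain1_hom: "g \<in> carrier \<Gamma> \<Longrightarrow> chain1 \<Gamma> M g \<in> hom M C1"
  by (rule homI) (simp_all add: chain1_closed chain1_mult)

lemma C1_eval_hom: "g \<in> carrier \<Gamma> \<Longrightarrow> (\<lambda>c. c g) \<in> hom C1 M"
  by (rule homI) (simp_all add: C1_coeff mult_C1)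

definition d1 where "d1 g m = b (inv g) m \<otimes>\<^bsub>M\<^esub> inv\<^bsub>M\<^esub> m"

lemma d1_hom: "g \<in> carrier \<Gamma> \<Longrightarrow> d1 g \<in> hom M M"
  by (rule homI) (simp_all add: d1_def b_closed hom_mult[OF b_hom] M.inv_mult M.m_ac)

lemma boundary1_eq: "boundary1 \<Gamma> M b = (\<lambda>c. gfinprod M (\<lambda>g. d1 g (c g)) (carrier \<Gamma>))"
  by (simp add: fun_eq_iff boundary1_def d1_def)

lemma boundary1_hom: "boundary1 \<Gamma> M b \<in> hom C1 M"
  unfolding boundary1_eq chains1_def by (rule M.hom_group_sum) (simp_all add: d1_hom M.is_group)

lemma boundary1_chain1:
  assumes g: "g \<in> carrier \<Gamma>" and m: "m \<in> carrier M"
  shows "boundary1 \<Gamma> M b (chain1 \<Gamma> M g m) = d1 g m"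
proof -
  have c: "d1 g m \<in> carrier M"
    using hom_carrier[OF d1_hom[OF g]] m by blast
  have "gfinprod M (\<lambda>k. d1 k (chain1 \<Gamma> M g m k)) (carrier \<Gamma>) = gfinprod M (\<lambda>k. d1 g m) {g}"
  proof (rule M.gfinprod_mono_neutral_cong_right)
    show "d1 k (chain1 \<Gamma> M g m k) = \<one>\<^bsub>M\<^esub>" if "k \<in> carrier \<Gamma> - {g}" for k
      using that hom_one[OF d1_hom M.is_group M.is_group] by (simp add: chain1_def)
    show "(\<lambda>k. d1 k (chain1 \<Gamma> M g m k)) \<in> carrier \<Gamma> \<rightarrow> carrier M"
      using hom_carrier[OF d1_hom] C1_coeff[OF chain1_closed[OF g m]] by blast
  qed (use g in \<open>auto simp: chain1_def\<close>)
  then show ?thesis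
    using c unfolding boundary1_eq by simp
qed

definition d2 where "d2 gh m = chain1 \<Gamma> M (snd gh) (b (inv (fst gh)) m)
  \<otimes>\<^bsub>C1\<^esub> inv\<^bsub>C1\<^esub> (chain1 \<Gamma> M (fst gh \<otimes> snd gh) m) \<otimes>\<^bsub>C1\<^esub> chain1 \<Gamma> M (fst gh) m"

lemma d2_hom: "gh \<in> carrier \<Gamma> \<times> carrier \<Gamma> \<Longrightarrow> d2 gh \<in> hom M C1"
proof (rule homI)
  assume gh: "gh \<in> carrier \<Gamma> \<times> carrier \<Gamma>"
  then have c: "fst gh \<in> carrier \<Gamma>" "snd gh \<in> carrier \<Gamma>" "inv fst gh \<in> carrier \<Gamma>" "fst gh \<otimes> snd gh \<in> carrier \<Gamma>"
    by auto
  show "d2 gh m \<in> carrier C1" if "m \<in> carrier M" for m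
    unfolding d2_def using c that by (intro C1.m_closed C1.inv_closed chain1_closed b_closed)
  fix m m' assume m: "m \<in> carrier M" "m' \<in> carrier M"
  show "d2 gh (m \<otimes>\<^bsub>M\<^esub> m') = d2 gh m \<otimes>\<^bsub>C1\<^esub> d2 gh m'"
    unfolding d2_def using c m
    by (simp add: hom_mult[OF b_hom] chain1_mult b_closed chain1_closed C1.inv_mult C1.m_ac)
qed

lemma boundary2_eq: "boundary2 \<Gamma> M b = (\<lambda>c. gfinprod C1 (\<lambda>gh. d2 gh (c gh)) (carrier \<Gamma> \<times> carrier \<Gamma>))"
  by (simp add: fun_eq_iff boundary2_def d2_def case_prod_unfold)

lemma boundary2_hom: "boundary2 \<Gamma> M b \<in> hom C2 C1"
  unfolding boundary2_eq chains2_def by (rule C1.hom_group_sum) (simp_all add: d2_hom M.is_group)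

abbreviation Z1 where "Z1 \<equiv> kernel C1 M (boundary1 \<Gamma> M b)"
abbreviation B1 where "B1 \<equiv> boundary2 \<Gamma> M b ` carrier C2"

lemma Z1_subgroup: "subgroup Z1 C1"
  by (rule group_hom.subgroup_kernel[OF group_hom.intro[OF C1.is_group M.is_group group_hom_axioms.intro[OF boundary1_hom]]])

lemma group_C2: "group C2"
  unfolding chains2_def by (rule sum_group) (rule M.is_group)

lemma B1_subgroup: "subgroup B1 C1"
  by (rule group_hom.img_is_subgroup[OF group_hom.intro[OF group_C2 C1.is_group group_hom_axioms.intro[OF boundary2_hom]]])

text \<open>Chains have finite support, so a boundary is a finite product of boundaries of
  elementary 2-chains.\<close>

lemma B1_subset:
  assumes K: "subgroup K C1" and gen: "\<And>gh m. gh \<in> carrier \<Gamma> \<times> carrier \<Gamma> \<Longrightarrow> m \<in> carrier M \<Longrightarrow> d2 gh m \<in> K"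
  shows "B1 \<subseteq> K"
proof
  fix x assume "x \<in> B1"
  then obtain c where c: "c \<in> carrier C2" "x = gfinprod C1 (\<lambda>gh. d2 gh (c gh)) (carrier \<Gamma> \<times> carrier \<Gamma>)"
    unfolding boundary2_eq by blast
  have cM: "c gh \<in> carrier M" if "gh \<in> carrier \<Gamma> \<times> carrier \<Gamma>" for gh
    using c(1) that unfolding chains2_def by (auto simp: carrier_sum_group[OF M.is_group])
  have "finprod C1 (\<lambda>gh. d2 gh (c gh)) {gh \<in> carrier \<Gamma> \<times> carrier \<Gamma>. d2 gh (c gh) \<noteq> \<one>\<^bsub>C1\<^esub>} \<in> K"
    by (rule C1.finprod_in_subgroup[OF K]) (use gen[OF _ cM] in blast)
  \<comment> \<open>\<open>gfinprod\<close> is the product over the indices with nontrivial term if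
    these are finite in number, and 1 otherwise; in either case the result lies in
    \<open>K\<close>.\<close>
  then show "x \<in> K"
    unfolding c(2) gfinprod_def using subgroup.one_closed[OF K]
    by (cases "finite {gh \<in> carrier \<Gamma> \<times> carrier \<Gamma>. d2 gh (c gh) \<noteq> \<one>\<^bsub>C1\<^esub>}") (simp_all only: if_True if_False)
qed

text \<open>The composite of two boundary maps vanishes; after expansion the terms cancel by
  \<open>(gh)^-1 m = h^-1 (g^-1 m)\<close>.\<close>

lemma d2_Z1:
  assumes gh: "gh \<in> carrier \<Gamma> \<times> carrier \<Gamma>" and m: "m \<in> carrier M"
  shows "d2 gh m \<in> Z1"
proof -
  interpret \<partial>: group_hom C1 M "boundary1 \<Gamma> M b"
    by (intro group_hom.intro C1.is_group M.is_group group_hom_axioms.intro boundary1_hom)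
  define g h where "g = fst gh" and "h = snd gh"
  have c: "g \<in> carrier \<Gamma>" "h \<in> carrier \<Gamma>" "inv g \<in> carrier \<Gamma>" "inv h \<in> carrier \<Gamma>" "g \<otimes> h \<in> carrier \<Gamma>"
    using gh by (auto simp: g_def h_def)
  have b2: "b (inv (g \<otimes> h)) m = b (inv h) (b (inv g) m)"
    using c m by (simp add: \<Gamma>.inv_mult_group b_mult)
  define x y where "x = b (inv g) m" and "y = b (inv h) x"
  have xy: "x \<in> carrier M" "y \<in> carrier M"
    unfolding x_def y_def using c m by (simp_all add: b_closed)
  have "boundary1 \<Gamma> M b (d2 gh m) = (y \<otimes>\<^bsub>M\<^esub> inv\<^bsub>M\<^esub> x) \<otimes>\<^bsub>M\<^esub> inv\<^bsub>M\<^esub> (y \<otimes>\<^bsub>M\<^esub> inv\<^bsub>M\<^esub> m) \<otimes>\<^bsub>M\<^esub> (x \<otimes>\<^bsub>M\<^esub> inv\<^bsub>M\<^esub> m)"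
    unfolding d2_def g_def[symmetric] h_def[symmetric] x_def[symmetric]
    using c m xy b2 by (simp add: chain1_closed boundary1_chain1 d1_def x_def[symmetric] y_def[symmetric])
  also have "\<dots> = (y \<otimes>\<^bsub>M\<^esub> inv\<^bsub>M\<^esub> m) \<otimes>\<^bsub>M\<^esub> inv\<^bsub>M\<^esub> (y \<otimes>\<^bsub>M\<^esub> inv\<^bsub>M\<^esub> m)"
  proof -
    have "(y \<otimes>\<^bsub>M\<^esub> inv\<^bsub>M\<^esub> x) \<otimes>\<^bsub>M\<^esub> (x \<otimes>\<^bsub>M\<^esub> inv\<^bsub>M\<^esub> m) = y \<otimes>\<^bsub>M\<^esub> (inv\<^bsub>M\<^esub> x \<otimes>\<^bsub>M\<^esub> x) \<otimes>\<^bsub>M\<^esub> inv\<^bsub>M\<^esub> m"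
      using xy m by (simp only: M.m_assoc M.m_closed M.inv_closed)
    then have "(y \<otimes>\<^bsub>M\<^esub> inv\<^bsub>M\<^esub> x) \<otimes>\<^bsub>M\<^esub> (x \<otimes>\<^bsub>M\<^esub> inv\<^bsub>M\<^esub> m) = y \<otimes>\<^bsub>M\<^esub> inv\<^bsub>M\<^esub> m"
      using xy m by simp
    moreover have "(y \<otimes>\<^bsub>M\<^esub> inv\<^bsub>M\<^esub> x) \<otimes>\<^bsub>M\<^esub> z \<otimes>\<^bsub>M\<^esub> (x \<otimes>\<^bsub>M\<^esub> inv\<^bsub>M\<^esub> m) = (y \<otimes>\<^bsub>M\<^esub> inv\<^bsub>M\<^esub> x) \<otimes>\<^bsub>M\<^esub> (x \<otimes>\<^bsub>M\<^esub> inv\<^bsub>M\<^esub> m) \<otimes>\<^bsub>M\<^esub> z"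
      if "z \<in> carrier M" for z
      using that xy m M.m_assoc[of "y \<otimes>\<^bsub>M\<^esub> inv\<^bsub>M\<^esub> x" z "x \<otimes>\<^bsub>M\<^esub> inv\<^bsub>M\<^esub> m"]
        M.m_assoc[of "y \<otimes>\<^bsub>M\<^esub> inv\<^bsub>M\<^esub> x" "x \<otimes>\<^bsub>M\<^esub> inv\<^bsub>M\<^esub> m" z] M.m_comm[of z "x \<otimes>\<^bsub>M\<^esub> inv\<^bsub>M\<^esub> m"] by simp
    ultimately show ?thesis
      using xy m by simp
  qed
  also have "\<dots> = \<one>\<^bsub>M\<^esub>"
    using xy m by (intro M.r_inv) simp
  finally show ?thesis
    using hom_carrier[OF d2_hom[OF gh]] m unfolding kernel_def by blast
qed

lemma B1_Z1: "B1 \<subseteq> Z1"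
  by (rule B1_subset[OF Z1_subgroup d2_Z1])

abbreviation H1 where "H1 \<equiv> homology1 \<Gamma> M b"
text \<open>The homology group sits inside \<open>Q1\<close> with the same operation. Classes are
  formed in \<open>Q1\<close> for arbitrary chains, and a chain is a cycle exactly if its class
  falls in \<open>H1\<close>.\<close>

abbreviation Q1 where "Q1 \<equiv> C1 Mod B1"

sublocale Q1: comm_group Q1 by (rule C1.abelian_FactGroup[OF B1_subgroup])

lemma Z1_comm_group: "comm_group (C1\<lparr>carrier := Z1\<rparr>)"
proof -
  interpret Zg: group "C1\<lparr>carrier := Z1\<rparr>"
    by (rule C1.subgroup_imp_group[OF Z1_subgroup])
  show ?thesis
    by (rule Zg.group_comm_groupI) (use subgroup.subset[OF Z1_subgroup] C1.m_comm in auto)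
qed

lemma B1_subgroup_Z1: "subgroup B1 (C1\<lparr>carrier := Z1\<rparr>)"
  by (rule C1.subgroup_incl[OF B1_subgroup Z1_subgroup B1_Z1])

sublocale H1: comm_group H1
  unfolding homology1_def by (rule comm_group.abelian_FactGroup[OF Z1_comm_group B1_subgroup_Z1])

lemma carrier_H1: "carrier H1 = (\<lambda>c. B1 #>\<^bsub>C1\<^esub> c) ` Z1"
  by (simp add: homology1_def carrier_FactGroup r_coset_def)

lemma H1_mult: "x \<otimes>\<^bsub>H1\<^esub> y = x \<otimes>\<^bsub>Q1\<^esub> y"
  by (simp add: homology1_def set_mult_def)

lemma H1_one: "\<one>\<^bsub>H1\<^esub> = \<one>\<^bsub>Q1\<^esub>"
  by (simp add: homology1_def)

lemma in_H1: "c \<in> carrier C1 \<Longrightarrow> B1 #>\<^bsub>C1\<^esub> c \<in> carrier H1 \<longleftrightarrow> c \<in> Z1"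
proof
  assume c: "c \<in> carrier C1" and "B1 #>\<^bsub>C1\<^esub> c \<in> carrier H1"
  then obtain c' where c': "c' \<in> Z1" "B1 #>\<^bsub>C1\<^esub> c = B1 #>\<^bsub>C1\<^esub> c'"
    unfolding carrier_H1 by blast
  have "c \<in> B1 #>\<^bsub>C1\<^esub> c'"
    using C1.rcos_self[OF c B1_subgroup] c'(2) by simp
  then obtain w where "w \<in> B1" "c = w \<otimes>\<^bsub>C1\<^esub> c'"
    unfolding r_coset_def by blast
  then show "c \<in> Z1"
    using subgroup.m_closed[OF Z1_subgroup] B1_Z1 c'(1) by blast
qed (simp add: carrier_H1)

lemma quot_C1_hom: "(\<lambda>c. B1 #>\<^bsub>C1\<^esub> c) \<in> hom C1 Q1"
  by (rule normal.r_coset_hom_Mod[OF C1.subgroup_imp_normal[OF B1_subgroup]])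

text \<open>\<open>cls n w \<mu>\<close> is the chain \<open>\<Sum> \<mu>\<^sub>i \<otimes> [w\<^sub>i]\<close>, and \<open>qc n w \<mu>\<close> its class modulo boundaries.\<close>

definition cls where "cls n w = pext C1 n (\<lambda>i. chain1 \<Gamma> M (w i))"
definition qc where "qc n w \<mu> = B1 #>\<^bsub>C1\<^esub> cls n w \<mu>"

lemma tuple_mem: "w \<in> tuples n \<Gamma> \<Longrightarrow> i \<in> {1..n} \<Longrightarrow> w i \<in> carrier \<Gamma>"
  by auto

lemma cls_hom: "w \<in> tuples n \<Gamma> \<Longrightarrow> cls n w \<in> hom (Mp n) C1"
  unfolding cls_def by (rule pext_hom[OF comm_group_C1 chain1_hom[OF tuple_mem]])

lemma cls_closed: "w \<in> tuples n \<Gamma> \<Longrightarrow> \<mu> \<in> carrier (Mp n) \<Longrightarrow> cls n w \<mu> \<in> carrier C1"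
  using hom_carrier[OF cls_hom] by blast

lemma cls_coord: "w \<in> tuples n \<Gamma> \<Longrightarrow> i \<in> {1..n} \<Longrightarrow> m \<in> carrier M \<Longrightarrow> cls n w (coord M n i m) = chain1 \<Gamma> M (w i) m"
  unfolding cls_def by (rule pext_coord[OF comm_group_C1 chain1_hom[OF tuple_mem]])

lemma qc_hom: "w \<in> tuples n \<Gamma> \<Longrightarrow> qc n w \<in> hom (Mp n) Q1"
  using hom_compose[OF cls_hom quot_C1_hom] by (simp add: qc_def[abs_def] comp_def)

lemma qc_H1: "w \<in> tuples n \<Gamma> \<Longrightarrow> \<mu> \<in> carrier (Mp n) \<Longrightarrow> qc n w \<mu> \<in> carrier H1 \<longleftrightarrow> cls n w \<mu> \<in> Z1"
  unfolding qc_def by (rule in_H1[OF cls_closed])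

text \<open>Transpose of the map \<open>T^n \<rightarrow> T^m\<close> that sends \<open>t\<close> to
  the tuple with entries \<open>t (\<zeta> i)\<close>: exponents sent to the same index are
  added.\<close>

definition reidx where "reidx m n \<zeta> = pext (Mp n) m (\<lambda>i. coord M n (\<zeta> i))"

lemma reidx_hom: "reidx m n \<zeta> \<in> hom (Mp m) (Mp n)"
  unfolding reidx_def by (rule pext_hom[OF comm_group_Mp coord_hom])

lemma reidx_coord: "i \<in> {1..m} \<Longrightarrow> x \<in> carrier M \<Longrightarrow> reidx m n \<zeta> (coord M m i x) = coord M n (\<zeta> i) x"
  unfolding reidx_def by (rule pext_coord[OF comm_group_Mp coord_hom])

text \<open>Collecting the exponents that belong to one index does not change the chain, which only
  records group elements and not positions.\<close>

lemma cls_reidx: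
  assumes w: "w \<in> tuples n \<Gamma>" and \<zeta>: "\<zeta> \<in> {1..m} \<rightarrow> {1..n}" and \<mu>: "\<mu> \<in> carrier (Mp m)"
  shows "cls n w (reidx m n \<zeta> \<mu>) = cls m (\<lambda>i \<in> {1..m}. w (\<zeta> i)) \<mu>"
proof -
  have w\<zeta>: "(\<lambda>i \<in> {1..m}. w (\<zeta> i)) \<in> tuples m \<Gamma>"
    using w \<zeta> by auto
  have "(cls n w \<circ> reidx m n \<zeta>) \<mu> = cls m (\<lambda>i \<in> {1..m}. w (\<zeta> i)) \<mu>"
  proof (rule Mp_hom_unique[OF comm_group_C1 hom_compose[OF reidx_hom cls_hom[OF w]] cls_hom[OF w\<zeta>] _ \<mu>])
    fix i x assume i: "i \<in> {1..m}" and x: "x \<in> carrier M"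
    have "\<zeta> i \<in> {1..n}"
      using \<zeta> i by blast
    then show "(cls n w \<circ> reidx m n \<zeta>) (coord M m i x) = cls m (\<lambda>i \<in> {1..m}. w (\<zeta> i)) (coord M m i x)"
      unfolding comp_apply reidx_coord[OF i x] cls_coord[OF w\<zeta> i x] using cls_coord[OF w _ x] i by simp
  qed
  then show ?thesis
    by simp
qed

text \<open>
  The map on exponents induced by multiplying the last two entries:
  \<open>(t\<^sub>n \<rho>\<^sub>0(w\<^sub>n)) (t\<^bsub>n+1\<^esub> \<rho>\<^sub>0(w\<^bsub>n+1\<^esub>)) = t\<^sub>n \<cdot> (w\<^sub>n t\<^bsub>n+1\<^esub>) \<rho>\<^sub>0(w\<^sub>n w\<^bsub>n+1\<^esub>)\<close>.
\<close>

definition mgL where "mgL n w i m = (if i = n then coord M (Suc n) n m \<otimes>\<^bsub>Mp (Suc n)\<^esub> coord M (Suc n) (Suc n) (b (inv w n) m)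
  else coord M (Suc n) i m)"

definition mg where "mg n w = pext (Mp (Suc n)) n (mgL n w)"

lemma mgL_hom:
  assumes w: "w \<in> tuples (Suc n) \<Gamma>" and n: "1 \<le> n" and i: "i \<in> {1..n}"
  shows "mgL n w i \<in> hom M (Mp (Suc n))"
proof (rule homI)
  interpret Mp: comm_group "Mp (Suc n)" by (rule comm_group_Mp)
  have g: "inv w n \<in> carrier \<Gamma>"
    using w n by (intro \<Gamma>.inv_closed tuple_mem[OF w]) simp
  show "mgL n w i m \<in> carrier (Mp (Suc n))" if "m \<in> carrier M" for m
    using that by (simp add: mgL_def coord_closed b_closed[OF g])
  show "mgL n w i (m \<otimes>\<^bsub>M\<^esub> m') = mgL n w i m \<otimes>\<^bsub>Mp (Suc n)\<^esub> mgL n w i m'" if "m \<in> carrier M" "m' \<in> carrier M" for m m'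
    using that by (simp add: mgL_def coord_mult coord_closed hom_mult[OF b_hom[OF g]] b_closed[OF g] Mp.m_ac)
qed

lemma mg_hom: "w \<in> tuples (Suc n) \<Gamma> \<Longrightarrow> 1 \<le> n \<Longrightarrow> mg n w \<in> hom (Mp n) (Mp (Suc n))"
  unfolding mg_def by (rule pext_hom[OF comm_group_Mp mgL_hom])

lemma mg_coord: "\<lbrakk>w \<in> tuples (Suc n) \<Gamma>; 1 \<le> n; i \<in> {1..n}; m \<in> carrier M\<rbrakk> \<Longrightarrow> mg n w (coord M n i m) = mgL n w i m"
  unfolding mg_def by (rule pext_coord[OF comm_group_Mp mgL_hom])

lemma merge_tuple: "w \<in> tuples (Suc n) \<Gamma> \<Longrightarrow> 1 \<le> n \<Longrightarrow> merge_last \<Gamma> n w \<in> tuples n \<Gamma>"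
  by (auto simp: merge_last_def PiE_iff)

text \<open>Nothing changes for coordinates before the last. In the last one
  \<open>m \<otimes> [g] + g^-1 m \<otimes> [h]\<close> replaces \<open>m \<otimes> [gh]\<close>,
  and the difference is the boundary of \<open>m \<otimes> [g|h]\<close>.\<close>

lemma qc_mg:
  assumes w: "w \<in> tuples (Suc n) \<Gamma>" and n: "1 \<le> n" and \<mu>: "\<mu> \<in> carrier (Mp n)"
  shows "qc (Suc n) w (mg n w \<mu>) = qc n (merge_last \<Gamma> n w) \<mu>"
proof -
  have "(qc (Suc n) w \<circ> mg n w) \<mu> = qc n (merge_last \<Gamma> n w) \<mu>"
  proof (rule Mp_hom_unique[OF Q1.comm_group_axioms hom_compose[OF mg_hom[OF w n] qc_hom[OF w]] qc_hom[OF merge_tuple[OF w n]] _ \<mu>])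
    fix i m assume i: "i \<in> {1..n}" and m: "m \<in> carrier M"
    show "(qc (Suc n) w \<circ> mg n w) (coord M n i m) = qc n (merge_last \<Gamma> n w) (coord M n i m)"
    proof (cases "i = n")
      case False
      have i': "i \<in> {1..Suc n}"
        using i by simp
      show ?thesis
        unfolding comp_apply mg_coord[OF w n i m] qc_def cls_coord[OF merge_tuple[OF w n] i m]
        using False cls_coord[OF w i' m] i by (simp add: mgL_def merge_last_def)
    next
      case True
      have g: "w n \<in> carrier \<Gamma>" "w (Suc n) \<in> carrier \<Gamma>"
        using n by (simp_all add: tuple_mem[OF w])
      define m' where "m' = b (inv w n) m"
      have m': "m' \<in> carrier M"
        unfolding m'_def by (rule b_closed[OF \<Gamma>.inv_closed[OF g(1)] m])
      define x y z where "x = chain1 \<Gamma> M (w n) m" and "y = chain1 \<Gamma> M (w (Suc n)) m'"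
        and "z = chain1 \<Gamma> M (w n \<otimes> w (Suc n)) m"
      have xyz: "x \<in> carrier C1" "y \<in> carrier C1" "z \<in> carrier C1"
        unfolding x_def y_def z_def using g m m' by (simp_all add: chain1_closed)
      have "cls (Suc n) w (mg n w (coord M n i m)) = x \<otimes>\<^bsub>C1\<^esub> y"
        unfolding mg_coord[OF w n i m] using True n
        by (simp add: mgL_def hom_mult[OF cls_hom[OF w]] coord_closed m m' m'_def[symmetric] cls_coord[OF w] x_def y_def)
      moreover have "cls n (merge_last \<Gamma> n w) (coord M n i m) = z"
        unfolding cls_coord[OF merge_tuple[OF w n] i m] using True n by (simp add: merge_last_def z_def)
      moreover have "B1 #>\<^bsub>C1\<^esub> (x \<otimes>\<^bsub>C1\<^esub> y) = B1 #>\<^bsub>C1\<^esub> z"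
      proof (rule C1.rcoset_eqI[OF B1_subgroup xyz(3) C1.m_closed[OF xyz(1,2)]])
        have "x \<otimes>\<^bsub>C1\<^esub> y \<otimes>\<^bsub>C1\<^esub> inv\<^bsub>C1\<^esub> z = d2 (w n, w (Suc n)) m"
          unfolding d2_def using xyz by (simp add: m'_def[symmetric] x_def[symmetric] y_def[symmetric] z_def[symmetric] C1.m_ac)
        also have "\<dots> \<in> B1"
        proof -
          \<comment> \<open>The 2-chain \<open>m \<otimes> [g|h]\<close> for the last two entries
            \<open>g\<close>, \<open>h\<close> of \<open>w\<close>.\<close>
          define c where "c = (\<lambda>k \<in> carrier \<Gamma> \<times> carrier \<Gamma>. if k = (w n, w (Suc n)) then m else \<one>\<^bsub>M\<^esub>)"
          have "finite {k \<in> carrier \<Gamma> \<times> carrier \<Gamma>. c k \<noteq> \<one>\<^bsub>M\<^esub>}"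
            by (rule finite_subset[of _ "{(w n, w (Suc n))}"]) (auto simp: c_def)
          then have c: "c \<in> carrier C2"
            using m unfolding chains2_def by (auto simp: carrier_sum_group[OF M.is_group] c_def)
          have dc: "d2 (w n, w (Suc n)) m \<in> carrier C1"
            using hom_carrier[OF d2_hom[of "(w n, w (Suc n))"]] g m by auto
          have "gfinprod C1 (\<lambda>gh. d2 gh (c gh)) (carrier \<Gamma> \<times> carrier \<Gamma>) = gfinprod C1 (\<lambda>k. d2 (w n, w (Suc n)) m) {(w n, w (Suc n))}"
          proof (rule C1.gfinprod_mono_neutral_cong_right)
            show "d2 k (c k) = \<one>\<^bsub>C1\<^esub>" if "k \<in> carrier \<Gamma> \<times> carrier \<Gamma> - {(w n, w (Suc n))}" for k
            proof -
              have "k \<in> carrier \<Gamma> \<times> carrier \<Gamma>" "c k = \<one>\<^bsub>M\<^esub>"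
                using that by (auto simp: c_def)
              then show ?thesis
                using hom_one[OF d2_hom M.is_group C1.is_group] by simp
            qed
            show "(\<lambda>gh. d2 gh (c gh)) \<in> carrier \<Gamma> \<times> carrier \<Gamma> \<rightarrow> carrier C1"
            proof
              fix k assume k: "k \<in> carrier \<Gamma> \<times> carrier \<Gamma>"
              then have "c k \<in> carrier M"
                using m by (simp add: c_def)
              then show "d2 k (c k) \<in> carrier C1"
                using hom_carrier[OF d2_hom[OF k]] by blast
            qed
          qed (use g in \<open>auto simp: c_def\<close>)
          also have "\<dots> = d2 (w n, w (Suc n)) m"
            using dc by simp
          finally show ?thesis
            using c unfolding boundary2_eq by (metis (no_types, lifting) imageI)
        qed
        finally show "x \<otimes>\<^bsub>C1\<^esub> y \<otimes>\<^bsub>C1\<^esub> inv\<^bsub>C1\<^esub> z \<in> B1" .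
      qed
      ultimately show ?thesis
        by (simp add: qc_def)
    qed
  qed
  then show ?thesis
    by simp
qed

lemma cls_apply:
  assumes w: "w \<in> tuples n \<Gamma>" and \<mu>: "\<mu> \<in> carrier (Mp n)" and x: "x \<in> carrier \<Gamma>"
  shows "cls n w \<mu> x = finprod M (\<lambda>i. if x = w i then \<mu> i else \<one>\<^bsub>M\<^esub>) {1..n}"
proof -
  have "cls n w \<mu> x = finprod M (\<lambda>i. chain1 \<Gamma> M (w i) (\<mu> i) x) {1..n}"
    unfolding cls_def pext_def
    by (rule hom_finprod[OF comm_group_C1 M.comm_group_axioms C1_eval_hom[OF x]])
      (use chain1_closed[OF tuple_mem[OF w] Mp_coord[OF \<mu>]] in blast)
  then show ?thesis
    using x by (simp add: chain1_def)
qed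

lemma cls_apply_inj:
  assumes w: "w \<in> tuples n \<Gamma>" and inj: "inj_on w {1..n}" and \<mu>: "\<mu> \<in> carrier (Mp n)" and j: "j \<in> {1..n}"
  shows "cls n w \<mu> (w j) = \<mu> j"
proof -
  have "cls n w \<mu> (w j) = finprod M (\<lambda>i. if j = i then \<mu> i else \<one>\<^bsub>M\<^esub>) {1..n}"
    unfolding cls_apply[OF w \<mu> tuple_mem[OF w j]]
    by (rule M.finprod_cong') (use inj j Mp_coord[OF \<mu>] in \<open>auto dest: inj_onD\<close>)
  also have "\<dots> = \<mu> j"
    by (rule M.finprod_singleton[OF j]) (use Mp_coord[OF \<mu>] in auto)
  finally show ?thesis .
qed

text \<open>Over a tuple without repetitions, exponent vectors are the same thing as chains
  supported on its entries.\<close>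

lemma cls_surj:
  assumes w: "w \<in> tuples n \<Gamma>" and inj: "inj_on w {1..n}" and c: "c \<in> carrier C1"
    and supp: "{g \<in> carrier \<Gamma>. c g \<noteq> \<one>\<^bsub>M\<^esub>} \<subseteq> w ` {1..n}"
  shows "(\<lambda>i \<in> {1..n}. c (w i)) \<in> carrier (Mp n)" "cls n w (\<lambda>i \<in> {1..n}. c (w i)) = c"
proof -
  show \<mu>: "(\<lambda>i \<in> {1..n}. c (w i)) \<in> carrier (Mp n)"
    using C1_coeff[OF c tuple_mem[OF w]] by (simp add: carrier_Mp PiE_iff)
  have cl: "cls n w (\<lambda>i \<in> {1..n}. c (w i)) \<in> carrier C1"
    by (rule cls_closed[OF w \<mu>])
  show "cls n w (\<lambda>i \<in> {1..n}. c (w i)) = c"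
  proof (rule PiE_ext)
    show "cls n w (\<lambda>i \<in> {1..n}. c (w i)) \<in> carrier \<Gamma> \<rightarrow>\<^sub>E carrier M" "c \<in> carrier \<Gamma> \<rightarrow>\<^sub>E carrier M"
      using cl c by (simp_all add: carrier_C1)
    fix x assume x: "x \<in> carrier \<Gamma>"
    show "cls n w (\<lambda>i \<in> {1..n}. c (w i)) x = c x"
    proof (cases "x \<in> w ` {1..n}")
      case True
      then obtain j where "j \<in> {1..n}" "x = w j"
        by blast
      then show ?thesis
        using cls_apply_inj[OF w inj \<mu>] by simp
    next
      case False
      then have "c x = \<one>\<^bsub>M\<^esub>"
        using supp x by blast
      moreover have "finprod M (\<lambda>i. if x = w i then (\<lambda>i \<in> {1..n}. c (w i)) i else \<one>\<^bsub>M\<^esub>) {1..n} = \<one>\<^bsub>M\<^esub>"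
        by (rule M.finprod_one_eqI) (use False in auto)
      ultimately show ?thesis
        unfolding cls_apply[OF w \<mu> x] by simp
    qed
  qed
qed

lemma enumerate_tuple:
  assumes "finite S" "S \<subseteq> carrier \<Gamma>" "S \<noteq> {}"
  shows "\<exists>n \<ge> 1. \<exists>\<delta> \<in> tuples n \<Gamma>. inj_on \<delta> {1..n} \<and> \<delta> ` {1..n} = S"
proof -
  obtain h where h: "bij_betw h {1..card S} S"
    using ex_bij_betw_nat_finite_1[OF assms(1)] by blast
  define \<delta> where "\<delta> = restrict h {1..card S}"
  have "1 \<le> card S"
    using assms by (simp add: Suc_le_eq card_gt_0_iff)
  moreover have "bij_betw \<delta> {1..card S} S"
    unfolding \<delta>_def by (subst bij_betw_restrict_eq) (rule h)
  moreover have "\<delta> \<in> tuples (card S) \<Gamma>"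
    using h assms(2) by (auto simp: \<delta>_def bij_betw_def)
  ultimately show ?thesis
    unfolding bij_betw_def by blast
qed

end

section \<open>Invariant functions\<close>

lemma map_alg_simps:
  "x \<in> carrier (map_alg S A) \<longleftrightarrow> x \<in> S \<rightarrow>\<^sub>E carrier A"
  "x \<otimes>\<^bsub>map_alg S A\<^esub> y = (\<lambda>s \<in> S. x s \<otimes>\<^bsub>A\<^esub> y s)" "x \<oplus>\<^bsub>map_alg S A\<^esub> y = (\<lambda>s \<in> S. x s \<oplus>\<^bsub>A\<^esub> y s)"
  "a \<odot>\<^bsub>map_alg S A\<^esub> x = (\<lambda>s \<in> S. a \<odot>\<^bsub>A\<^esub> x s)" "\<one>\<^bsub>map_alg S A\<^esub> = (\<lambda>s \<in> S. \<one>\<^bsub>A\<^esub>)"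
  by (simp_all add: map_alg_def)

lemma regular_functionsI:
  fixes R :: "'u ring"
  assumes "\<And>A g. A \<in> Alg R \<Longrightarrow> g \<in> tuples n (pts Z A) \<Longrightarrow> F A g \<in> carrier A"
    and "\<And>A B \<phi> g. \<lbrakk>A \<in> Alg R; B \<in> Alg R; \<phi> \<in> alg_hom R A B; g \<in> tuples n (pts Z A)\<rbrakk>
      \<Longrightarrow> (\<lambda>i \<in> {1..n}. transport Z A B \<phi> (g i)) \<in> tuples n (pts Z B) \<and>
        F B (\<lambda>i \<in> {1..n}. transport Z A B \<phi> (g i)) = \<phi> (F A g)"
  shows "(\<lambda>A \<in> Alg R. \<lambda>g \<in> tuples n (pts Z A). F A g) \<in> regular_functions R Z n"
  unfolding regular_functions_def
proof (intro CollectI conjI ballI)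
  show "(\<lambda>A \<in> Alg R. \<lambda>g \<in> tuples n (pts Z A). F A g) \<in> (\<Pi>\<^sub>E A \<in> Alg R. tuples n (pts Z A) \<rightarrow>\<^sub>E carrier A)"
    using assms(1) by (intro restrict_PiE_iff[THEN iffD2] ballI)
  fix A B :: "('u, 'u) module" and \<phi> g assume *: "A \<in> Alg R" "B \<in> Alg R" "\<phi> \<in> alg_hom R A B" "g \<in> tuples n (pts Z A)"
  show "(\<lambda>A \<in> Alg R. \<lambda>g \<in> tuples n (pts Z A). F A g) B (\<lambda>i \<in> {1..n}. transport Z A B \<phi> (g i)) =
    \<phi> ((\<lambda>A \<in> Alg R. \<lambda>g \<in> tuples n (pts Z A). F A g) A g)"
    using assms(2)[OF *] * by (simp only: restrict_apply' simp_thms)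
qed

lemma regular_functionsD:
  fixes R :: "'u ring"
  assumes "f \<in> regular_functions R Z n" "A \<in> Alg R" "g \<in> tuples n (pts Z A)"
  shows "f A g \<in> carrier A"
    and "\<lbrakk>B \<in> Alg R; \<phi> \<in> alg_hom R A B\<rbrakk> \<Longrightarrow> f B (\<lambda>i \<in> {1..n}. transport Z A B \<phi> (g i)) = \<phi> (f A g)"
proof -
  have "f A \<in> tuples n (pts Z A) \<rightarrow>\<^sub>E carrier A"
    using assms(1,2) unfolding regular_functions_def by blast
  then show "f A g \<in> carrier A"
    using assms(3) by blast
  show "f B (\<lambda>i \<in> {1..n}. transport Z A B \<phi> (g i)) = \<phi> (f A g)" if "B \<in> Alg R" "\<phi> \<in> alg_hom R A B"
    using assms that unfolding regular_functions_def by blast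
qed

context split_extension
begin

sublocale ch: chain_groups M \<Gamma> act
  by (intro chain_groups.intro power_groups.intro M.comm_group_axioms \<Gamma> chain_groups_axioms.intro act_hom act_compose)

abbreviation Mp where "Mp \<equiv> power_group M"

lemma comm_group_units: "A \<in> Alg R \<Longrightarrow> comm_group (units_of A)"
proof -
  assume A: "A \<in> Alg R"
  interpret A: algebra R A by (rule AlgD[OF A])
  show ?thesis
    by (rule A.units_comm_group)
qed

abbreviation PM where "PM n \<equiv> monoid_algebra R (Mp n)"

lemma alg_Mp: "monoid_alg R (Mp n)"
  by (intro monoid_alg.intro R_cring comm_group.axioms(1)[OF ch.comm_group_Mp])

lemma target_Mp: "A \<in> Alg R \<Longrightarrow> monoid_alg_target R (Mp n) A"
  by (intro monoid_alg_target.intro alg_Mp AlgD)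

lemma \<chi>_hom: "A \<in> Alg R \<Longrightarrow> t \<in> Tp A \<Longrightarrow> \<chi> A t \<in> hom M (units_of A)"
  using \<chi>_char by blast

definition Tt where "Tt A n t \<longleftrightarrow> (\<forall>i \<in> {1..n}. t i \<in> Tp A)"

lemma TtD: "Tt A n t \<Longrightarrow> i \<in> {1..n} \<Longrightarrow> t i \<in> Tp A"
  unfolding Tt_def by blast

lemma TtI: "(\<And>i. i \<in> {1..n} \<Longrightarrow> t i \<in> Tp A) \<Longrightarrow> Tt A n t"
  unfolding Tt_def by blast

text \<open>\<open>hch\<close> and \<open>tch\<close> identify \<open>T(A)\<^sup>n\<close> with the characters of \<open>M\<^sup>n\<close>.\<close>

definition hch where "hch A n t = (\<lambda>\<mu> \<in> carrier (Mp n). pext (units_of A) n (\<lambda>i. \<chi> A (t i)) \<mu>)"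

definition tch where "tch A n h = (\<lambda>i \<in> {1..n}. \<tau> A (\<lambda>m \<in> carrier M. h (coord M n i m)))"

lemma hch_char:
  assumes A: "A \<in> Alg R" and t: "Tt A n t"
  shows "hch A n t \<in> characters (Mp n) A"
proof -
  interpret Mpg: comm_group "Mp n" by (rule ch.comm_group_Mp)
  have "pext (units_of A) n (\<lambda>i. \<chi> A (t i)) \<in> hom (Mp n) (units_of A)"
    by (rule ch.pext_hom[OF comm_group_units[OF A] \<chi>_hom[OF A TtD[OF t]]])
  then show ?thesis
    unfolding hch_def hom_def by (auto simp: Pi_iff)
qed

lemma hch_coord:
  assumes A: "A \<in> Alg R" and t: "Tt A n t" and i: "i \<in> {1..n}" and m: "m \<in> carrier M"
  shows "hch A n t (coord M n i m) = \<chi> A (t i) m"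
  unfolding hch_def using ch.pext_coord[OF comm_group_units[OF A] \<chi>_hom[OF A TtD[OF t]] i m] ch.coord_closed[OF m] by simp

lemma hch_eqI:
  assumes A: "A \<in> Alg R" and t: "Tt A n t" and h: "h \<in> hom (Mp n) (units_of A)"
    and eq: "\<And>i m. i \<in> {1..n} \<Longrightarrow> m \<in> carrier M \<Longrightarrow> \<chi> A (t i) m = h (coord M n i m)" and \<mu>: "\<mu> \<in> carrier (Mp n)"
  shows "hch A n t \<mu> = h \<mu>"
proof (rule ch.Mp_hom_unique[OF comm_group_units[OF A] _ h _ \<mu>])
  show "hch A n t \<in> hom (Mp n) (units_of A)"
    using hch_char[OF A t] by blast
qed (use hch_coord[OF A t] eq in simp)

lemma tch_char:
  assumes A: "A \<in> Alg R" and h: "h \<in> characters (Mp n) A"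
  shows "(\<lambda>m \<in> carrier M. h (coord M n i m)) \<in> characters M A"
  by (rule charactersI)
    (use characters_closed(1)[OF h ch.coord_closed] characters_mult[OF h ch.coord_closed ch.coord_closed] in \<open>simp_all add: ch.coord_mult\<close>)

lemma tch_closed: "A \<in> Alg R \<Longrightarrow> h \<in> characters (Mp n) A \<Longrightarrow> i \<in> {1..n} \<Longrightarrow> tch A n h i \<in> Tp A"
  unfolding tch_def using \<tau>_closed[OF _ tch_char] by simp

lemma tch_Tt: "A \<in> Alg R \<Longrightarrow> h \<in> characters (Mp n) A \<Longrightarrow> Tt A n (tch A n h)"
  by (rule TtI) (rule tch_closed)

lemma hch_tch:
  assumes A: "A \<in> Alg R" and h: "h \<in> characters (Mp n) A"
  shows "hch A n (tch A n h) = h"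
proof (rule extensionalityI)
  show "hch A n (tch A n h) \<mu> = h \<mu>" if "\<mu> \<in> carrier (Mp n)" for \<mu>
  proof (rule hch_eqI[OF A tch_Tt[OF A h] _ _ that])
    show "\<chi> A (tch A n h i) m = h (coord M n i m)" if "i \<in> {1..n}" "m \<in> carrier M" for i m
      using \<chi>_\<tau>[OF A tch_char[OF A h]] that by (simp add: tch_def)
  qed (use h in auto)
qed (use h in \<open>auto simp: hch_def\<close>)

lemma tch_hch:
  assumes A: "A \<in> Alg R" and t: "Tt A n t" and i: "i \<in> {1..n}"
  shows "tch A n (hch A n t) i = t i"
proof -
  have "\<tau> A (\<lambda>m \<in> carrier M. hch A n t (coord M n i m)) = t i"
  proof (rule \<tau>_eqI[OF A tch_char[OF A hch_char[OF A t]] TtD[OF t i]])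
    show "(\<lambda>m \<in> carrier M. hch A n t (coord M n i m)) m = \<chi> A (t i) m" if "m \<in> carrier M" for m
      using hch_coord[OF A t i that] that by simp
  qed
  then show ?thesis
    unfolding tch_def using i by simp
qed

lemma tch_tr:
  assumes A: "A \<in> Alg R" and B: "B \<in> Alg R" and \<phi>: "\<phi> \<in> alg_hom R A B" and h: "h \<in> characters (Mp n) A" and i: "i \<in> {1..n}"
  shows "tr A B \<phi> (tch A n h i) = tch B n (compose (carrier (Mp n)) \<phi> h) i"
proof -
  have "compose (carrier M) \<phi> (\<lambda>m \<in> carrier M. h (coord M n i m)) =
    (\<lambda>m \<in> carrier M. compose (carrier (Mp n)) \<phi> h (coord M n i m))"
    unfolding compose_def by (rule restrict_ext) (simp add: ch.coord_closed)
  then show ?thesis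
    using \<tau>_tr[OF A B \<phi> tch_char[OF A h]] i by (simp add: tch_def)
qed

section \<open>Laurent polynomials on the component of a tuple\<close>

definition pt where "pt A n w t = (\<lambda>i \<in> {1..n}. t i \<otimes>\<^bsub>Gp A\<^esub> r A (w i))"

lemma pt_closed:
  assumes A: "A \<in> Alg R" and w: "w \<in> tuples n \<Gamma>" and t: "Tt A n t"
  shows "pt A n w t \<in> tuples n (Gp A)"
proof -
  interpret Gp: group "Gp A" by (rule group_G[OF A])
  show ?thesis
    unfolding pt_def using T_G[OF A TtD[OF t]] r_closed[OF A ch.tuple_mem[OF w]] by (simp add: PiE_iff)
qed

text \<open>Translation by the base points identifies \<open>T(A)^n\<close>, that is the set of
  characters of \<open>M^n\<close>, with points of the component. A regular function becomes a
  natural function of characters, which is given by a Laurent polynomial.\<close>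

lemma coef_ex:
  assumes f: "f \<in> regular_functions R G n" and w: "w \<in> tuples n \<Gamma>"
  shows "\<exists>F. F \<in> carrier (PM n) \<and> (\<forall>A \<in> Alg R. \<forall>t. Tt A n t \<longrightarrow>
    f A (pt A n w t) = lin_ext R (Mp n) A (hch A n t) F)"
proof -
  define k where "k A h = f A (pt A n w (tch A n h))" for A h
  have "\<exists>F \<in> carrier (PM n). \<forall>A \<in> Alg R. \<forall>h \<in> characters (Mp n) A. k A h = lin_ext R (Mp n) A h F"
  proof (rule natural_function_expansion[OF ch.comm_group_Mp ch.countable_Mp[OF countable_M]])
    fix A :: "('u, 'u) module" and h assume A: "A \<in> Alg R" and h: "h \<in> characters (Mp n) A"
    note ptc = pt_closed[OF A w tch_Tt[OF A h]]
    show "k A h \<in> carrier A"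
      unfolding k_def by (rule regular_functionsD(1)[OF f A ptc])
    fix B :: "('u, 'u) module" and \<phi> assume B: "B \<in> Alg R" and \<phi>: "\<phi> \<in> alg_hom R A B"
    have e: "(\<lambda>i \<in> {1..n}. tr A B \<phi> (pt A n w (tch A n h) i)) = pt B n w (tch B n (compose (carrier (Mp n)) \<phi> h))"
      unfolding pt_def
    proof (rule restrict_ext)
      fix i assume i: "i \<in> {1..n}"
      show "tr A B \<phi> ((\<lambda>i \<in> {1..n}. tch A n h i \<otimes>\<^bsub>Gp A\<^esub> r A (w i)) i) =
        tch B n (compose (carrier (Mp n)) \<phi> h) i \<otimes>\<^bsub>Gp B\<^esub> r B (w i)"
        using i tr_mult[OF A B \<phi> T_G[OF A tch_closed[OF A h i]] r_closed[OF A ch.tuple_mem[OF w i]]]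
          tch_tr[OF A B \<phi> h i] tr_r[OF A B \<phi> ch.tuple_mem[OF w i]] by simp
    qed
    show "k B (compose (carrier (Mp n)) \<phi> h) = \<phi> (k A h)"
      unfolding k_def e[symmetric] by (rule regular_functionsD(2)[OF f A ptc B \<phi>])
  qed
  then obtain F where F: "F \<in> carrier (PM n)"
    and eq: "\<forall>A \<in> Alg R. \<forall>h \<in> characters (Mp n) A. k A h = lin_ext R (Mp n) A h F"
    by blast
  have "f A (pt A n w t) = lin_ext R (Mp n) A (hch A n t) F" if A: "A \<in> Alg R" and t: "Tt A n t" for A t
  proof -
    have "pt A n w (tch A n (hch A n t)) = pt A n w t"
      unfolding pt_def by (rule restrict_ext) (simp add: tch_hch[OF A t])
    then show ?thesis
      using bspec[OF bspec[OF eq A] hch_char[OF A t]] by (simp add: k_def)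
  qed
  then show ?thesis
    using F by blast
qed

text \<open>The Laurent polynomial that \<open>f\<close> is on the component of \<open>w\<close>.\<close>

definition coef where "coef n w f = (SOME F. F \<in> carrier (PM n) \<and>
  (\<forall>A \<in> Alg R. \<forall>t. Tt A n t \<longrightarrow> f A (pt A n w t) = lin_ext R (Mp n) A (hch A n t) F))"

lemma coef:
  assumes f: "f \<in> regular_functions R G n" and w: "w \<in> tuples n \<Gamma>"
  shows "coef n w f \<in> carrier (PM n)"
    and "\<lbrakk>A \<in> Alg R; Tt A n t\<rbrakk> \<Longrightarrow> f A (pt A n w t) = lin_ext R (Mp n) A (hch A n t) (coef n w f)"
proof -
  have *: "coef n w f \<in> carrier (PM n) \<and> (\<forall>A \<in> Alg R. \<forall>t. Tt A n t \<longrightarrow>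
    f A (pt A n w t) = lin_ext R (Mp n) A (hch A n t) (coef n w f))"
    unfolding coef_def by (rule someI_ex[OF coef_ex[OF f w]])
  show "coef n w f \<in> carrier (PM n)"
    using * by blast
  show "f A (pt A n w t) = lin_ext R (Mp n) A (hch A n t) (coef n w f)" if "A \<in> Alg R" "Tt A n t"
    using * that by blast
qed

lemma lin_ext_hch_eqI:
  assumes F: "F \<in> carrier (PM n)" and F': "F' \<in> carrier (PM n)"
    and eq: "\<And>(A :: ('u, 'u) module) t. A \<in> Alg R \<Longrightarrow> Tt A n t \<Longrightarrow>
      lin_ext R (Mp n) A (hch A n t) F = lin_ext R (Mp n) A (hch A n t) F'"
  shows "F = F'"
proof (rule expansion_unique[OF ch.comm_group_Mp ch.countable_Mp[OF countable_M] F F'])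
  fix A :: "('u, 'u) module" and h assume A: "A \<in> Alg R" and h: "h \<in> characters (Mp n) A"
  show "lin_ext R (Mp n) A h F = lin_ext R (Mp n) A h F'"
    using eq[OF A tch_Tt[OF A h]] by (simp add: hch_tch[OF A h])
qed

lemma coef_eqI:
  assumes w: "w \<in> tuples n \<Gamma>" and F: "F \<in> carrier (PM n)"
    and eq: "\<And>(A :: ('u, 'u) module) t. A \<in> Alg R \<Longrightarrow> Tt A n t \<Longrightarrow>
      f A (pt A n w t) = lin_ext R (Mp n) A (hch A n t) F"
  shows "coef n w f = F"
proof -
  have ex: "F \<in> carrier (PM n) \<and> (\<forall>A \<in> Alg R. \<forall>t. Tt A n t \<longrightarrow>
    f A (pt A n w t) = lin_ext R (Mp n) A (hch A n t) F)"
    using F eq by blast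
  then have ex': "\<exists>F. F \<in> carrier (PM n) \<and> (\<forall>A \<in> Alg R. \<forall>t. Tt A n t \<longrightarrow>
    f A (pt A n w t) = lin_ext R (Mp n) A (hch A n t) F)"
    by (intro exI[where x = F])
  have *: "coef n w f \<in> carrier (PM n) \<and> (\<forall>A \<in> Alg R. \<forall>t. Tt A n t \<longrightarrow>
    f A (pt A n w t) = lin_ext R (Mp n) A (hch A n t) (coef n w f))"
    unfolding coef_def by (rule someI_ex[OF ex'])
  show ?thesis
  proof (rule lin_ext_hch_eqI[OF conjunct1[OF *] F])
    fix A :: "('u, 'u) module" and t assume A: "A \<in> Alg R" and t: "Tt A n t"
    have "f A (pt A n w t) = lin_ext R (Mp n) A (hch A n t) (coef n w f)"
      using * A t by blast
    then show "lin_ext R (Mp n) A (hch A n t) (coef n w f) = lin_ext R (Mp n) A (hch A n t) F"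
      using eq[OF A t] by simp
  qed
qed

section \<open>The algebra of invariant functions\<close>

abbreviation IF where "IF n \<equiv> inv_functions R G (\<lambda>D. carrier (pts T D)) n"

lemma IF_regular: "f \<in> carrier (IF n) \<Longrightarrow> f \<in> regular_functions R G n"
  by (simp add: inv_functions_def)

definition cjt where "cjt A n s g = (\<lambda>i \<in> {1..n}. s \<otimes>\<^bsub>Gp A\<^esub> g i \<otimes>\<^bsub>Gp A\<^esub> inv\<^bsub>Gp A\<^esub> s)"

lemma IF_invariant: "\<lbrakk>f \<in> carrier (IF n); A \<in> Alg R; g \<in> tuples n (Gp A); s \<in> Tp A\<rbrakk> \<Longrightarrow> f A (cjt A n s g) = f A g"
  by (simp add: inv_functions_def cjt_def)

lemma IF_memI:
  assumes "f \<in> regular_functions R G n"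
    and "\<And>A g s. A \<in> Alg R \<Longrightarrow> g \<in> tuples n (Gp A) \<Longrightarrow> s \<in> Tp A \<Longrightarrow> f A (cjt A n s g) = f A g"
  shows "f \<in> carrier (IF n)"
  using assms by (simp add: inv_functions_def cjt_def)

lemma cjt_closed: "\<lbrakk>A \<in> Alg R; g \<in> tuples n (Gp A); s \<in> Tp A\<rbrakk> \<Longrightarrow> cjt A n s g \<in> tuples n (Gp A)"
proof -
  assume A: "A \<in> Alg R" and g: "g \<in> tuples n (Gp A)" and s: "s \<in> Tp A"
  interpret Gp: group "Gp A" by (rule group_G[OF A])
  show ?thesis
    using g T_G[OF A s] by (auto simp: cjt_def PiE_iff)
qed

lemma tuple_tr:
  assumes "A \<in> Alg R" "B \<in> Alg R" "\<phi> \<in> alg_hom R A B" "g \<in> tuples n (Gp A)"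
  shows "(\<lambda>i \<in> {1..n}. tr A B \<phi> (g i)) \<in> tuples n (Gp B)"
  using assms by (auto simp: tr_closed PiE_iff)

lemma IF_restrict:
  assumes F: "\<And>A g. A \<in> Alg R \<Longrightarrow> g \<in> tuples n (Gp A) \<Longrightarrow> F A g \<in> carrier A"
    and natural: "\<And>A B \<phi> g. \<lbrakk>A \<in> Alg R; B \<in> Alg R; \<phi> \<in> alg_hom R A B; g \<in> tuples n (Gp A)\<rbrakk>
      \<Longrightarrow> F B (\<lambda>i \<in> {1..n}. tr A B \<phi> (g i)) = \<phi> (F A g)"
    and inv: "\<And>A g s. A \<in> Alg R \<Longrightarrow> g \<in> tuples n (Gp A) \<Longrightarrow> s \<in> Tp A \<Longrightarrow> F A (cjt A n s g) = F A g"
  shows "(\<lambda>A \<in> Alg R. \<lambda>g \<in> tuples n (Gp A). F A g) \<in> carrier (IF n)"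
proof (rule IF_memI)
  show "(\<lambda>A \<in> Alg R. \<lambda>g \<in> tuples n (Gp A). F A g) \<in> regular_functions R G n"
    by (rule regular_functionsI) (use F natural tuple_tr in blast)+
  fix A g s assume A: "A \<in> Alg R" and g: "g \<in> tuples n (Gp A)" and s: "s \<in> Tp A"
  show "(\<lambda>A \<in> Alg R. \<lambda>g \<in> tuples n (Gp A). F A g) A (cjt A n s g) = (\<lambda>A \<in> Alg R. \<lambda>g \<in> tuples n (Gp A). F A g) A g"
    using inv[OF A g s] A g cjt_closed[OF A g s] by (simp only: restrict_apply' simp_thms)
qed

lemma IF_ops:
  "f \<otimes>\<^bsub>IF n\<^esub> f' = (\<lambda>A \<in> Alg R. \<lambda>g \<in> tuples n (Gp A). f A g \<otimes>\<^bsub>A\<^esub> f' A g)"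
  "f \<oplus>\<^bsub>IF n\<^esub> f' = (\<lambda>A \<in> Alg R. \<lambda>g \<in> tuples n (Gp A). f A g \<oplus>\<^bsub>A\<^esub> f' A g)"
  "a \<odot>\<^bsub>IF n\<^esub> f = (\<lambda>A \<in> Alg R. \<lambda>g \<in> tuples n (Gp A). a \<odot>\<^bsub>A\<^esub> f A g)"
  "\<one>\<^bsub>IF n\<^esub> = (\<lambda>A \<in> Alg R. \<lambda>g \<in> tuples n (Gp A). \<one>\<^bsub>A\<^esub>)"
  by (simp_all add: inv_functions_def)

lemma IF_closed:
  assumes f: "f \<in> carrier (IF n)" and f': "f' \<in> carrier (IF n)" and a: "a \<in> carrier R"
  shows "f \<otimes>\<^bsub>IF n\<^esub> f' \<in> carrier (IF n)" "f \<oplus>\<^bsub>IF n\<^esub> f' \<in> carrier (IF n)"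
    "a \<odot>\<^bsub>IF n\<^esub> f \<in> carrier (IF n)" "\<one>\<^bsub>IF n\<^esub> \<in> carrier (IF n)"
proof -
  note fD = regular_functionsD[OF IF_regular[OF f]] and fD' = regular_functionsD[OF IF_regular[OF f']]
  note inv = IF_invariant[OF f] IF_invariant[OF f']
  have alg: "a \<otimes>\<^bsub>A\<^esub> b \<in> carrier A" "a \<oplus>\<^bsub>A\<^esub> b \<in> carrier A" "k \<in> carrier R \<Longrightarrow> k \<odot>\<^bsub>A\<^esub> a \<in> carrier A" "\<one>\<^bsub>A\<^esub> \<in> carrier A"
    if "A \<in> Alg R" "a \<in> carrier A" "b \<in> carrier A" for A :: "('u, 'u) module" and a b k
  proof -
    interpret A: algebra R A by (rule AlgD[OF that(1)])
    show "a \<otimes>\<^bsub>A\<^esub> b \<in> carrier A" "a \<oplus>\<^bsub>A\<^esub> b \<in> carrier A" "k \<in> carrier R \<Longrightarrow> k \<odot>\<^bsub>A\<^esub> a \<in> carrier A" "\<one>\<^bsub>A\<^esub> \<in> carrier A"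
      using that by simp_all
  qed
  have alg3: "a \<odot>\<^bsub>A\<^esub> x \<in> carrier A" if "A \<in> Alg R" "x \<in> carrier A" for A :: "('u, 'u) module" and x
    by (rule alg(3)[OF that that(2) a])
  show "f \<otimes>\<^bsub>IF n\<^esub> f' \<in> carrier (IF n)"
    unfolding IF_ops by (rule IF_restrict) (simp_all only: alg fD fD' inv alg_hom_simps)
  show "f \<oplus>\<^bsub>IF n\<^esub> f' \<in> carrier (IF n)"
    unfolding IF_ops by (rule IF_restrict) (simp_all only: alg fD fD' inv alg_hom_simps)
  show "a \<odot>\<^bsub>IF n\<^esub> f \<in> carrier (IF n)"
    unfolding IF_ops by (rule IF_restrict) (simp_all only: alg3 fD fD' inv alg_hom_simps a)
  show "\<one>\<^bsub>IF n\<^esub> \<in> carrier (IF n)"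
    unfolding IF_ops by (rule IF_restrict) (simp_all only: alg_hom_simps alg(4)[OF _ fD(1) fD(1)])
qed

text \<open>Restriction to the component respects the operations, and the Laurent polynomial of a
  function is unique.\<close>

lemma coef_hom:
  assumes f: "f \<in> regular_functions R G n" and f': "f' \<in> regular_functions R G n" and w: "w \<in> tuples n \<Gamma>" and a: "a \<in> carrier R"
  shows "coef n w (f \<otimes>\<^bsub>IF n\<^esub> f') = coef n w f \<otimes>\<^bsub>PM n\<^esub> coef n w f'"
    "coef n w (f \<oplus>\<^bsub>IF n\<^esub> f') = coef n w f \<oplus>\<^bsub>PM n\<^esub> coef n w f'"
    "coef n w (a \<odot>\<^bsub>IF n\<^esub> f) = a \<odot>\<^bsub>PM n\<^esub> coef n w f"
    "coef n w \<one>\<^bsub>IF n\<^esub> = monomial R (Mp n) \<one>\<^bsub>Mp n\<^esub>"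
proof -
  interpret Mpg: comm_group "Mp n" by (rule ch.comm_group_Mp)
  interpret P: monoid_alg R "Mp n" by (rule alg_Mp)
  note F = coef[OF f w] and F' = coef[OF f' w]
  have hP: "hch A n t \<in> carrier (Mp n) \<rightarrow> carrier A" if "A \<in> Alg R" "Tt A n t" for A t
    by (rule funcsetI) (rule characters_closed(2)[OF hch_char[OF that]])
  show "coef n w (f \<otimes>\<^bsub>IF n\<^esub> f') = coef n w f \<otimes>\<^bsub>P.P\<^esub> coef n w f'"
  proof (rule coef_eqI[OF w P.mult_closed_P[OF F(1) F'(1)]])
    fix A :: "('u, 'u) module" and t assume A: "A \<in> Alg R" and t: "Tt A n t"
    interpret Tg: monoid_alg_target R "Mp n" A by (rule target_Mp[OF A])
    have "lin_ext R (Mp n) A (hch A n t) (coef n w f \<otimes>\<^bsub>P.P\<^esub> coef n w f') =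
      lin_ext R (Mp n) A (hch A n t) (coef n w f) \<otimes>\<^bsub>A\<^esub> lin_ext R (Mp n) A (hch A n t) (coef n w f')"
      by (rule Tg.lin_ext_mult[OF subset_refl hP[OF A t] characters_mult[OF hch_char[OF A t]] F(1) _ F'(1)]) auto
    then show "(f \<otimes>\<^bsub>IF n\<^esub> f') A (pt A n w t) = lin_ext R (Mp n) A (hch A n t) (coef n w f \<otimes>\<^bsub>P.P\<^esub> coef n w f')"
      using F(2)[OF A t] F'(2)[OF A t] A pt_closed[OF A w t] by (simp add: IF_ops)
  qed
  show "coef n w (f \<oplus>\<^bsub>IF n\<^esub> f') = coef n w f \<oplus>\<^bsub>P.P\<^esub> coef n w f'"
  proof (rule coef_eqI[OF w P.add_closed_P[OF F(1) F'(1)]])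
    fix A :: "('u, 'u) module" and t assume A: "A \<in> Alg R" and t: "Tt A n t"
    interpret Tg: monoid_alg_target R "Mp n" A by (rule target_Mp[OF A])
    show "(f \<oplus>\<^bsub>IF n\<^esub> f') A (pt A n w t) = lin_ext R (Mp n) A (hch A n t) (coef n w f \<oplus>\<^bsub>P.P\<^esub> coef n w f')"
      using F(2)[OF A t] F'(2)[OF A t] A pt_closed[OF A w t]
      by (simp add: IF_ops Tg.lin_ext_add[OF F(1) F'(1) hP[OF A t]])
  qed
  show "coef n w (a \<odot>\<^bsub>IF n\<^esub> f) = a \<odot>\<^bsub>P.P\<^esub> coef n w f"
  proof (rule coef_eqI[OF w P.smult_closed_P[OF a F(1)]])
    fix A :: "('u, 'u) module" and t assume A: "A \<in> Alg R" and t: "Tt A n t"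
    interpret Tg: monoid_alg_target R "Mp n" A by (rule target_Mp[OF A])
    show "(a \<odot>\<^bsub>IF n\<^esub> f) A (pt A n w t) = lin_ext R (Mp n) A (hch A n t) (a \<odot>\<^bsub>P.P\<^esub> coef n w f)"
      using F(2)[OF A t] A pt_closed[OF A w t]
      by (simp add: IF_ops Tg.lin_ext_smult[OF F(1) a hP[OF A t]])
  qed
  show "coef n w \<one>\<^bsub>IF n\<^esub> = monomial R (Mp n) \<one>\<^bsub>Mp n\<^esub>"
  proof (rule coef_eqI[OF w P.monomial_closed[OF Mpg.one_closed]])
    fix A :: "('u, 'u) module" and t assume A: "A \<in> Alg R" and t: "Tt A n t"
    interpret Tg: monoid_alg_target R "Mp n" A by (rule target_Mp[OF A])
    show "\<one>\<^bsub>IF n\<^esub> A (pt A n w t) = lin_ext R (Mp n) A (hch A n t) (monomial R (Mp n) \<one>\<^bsub>Mp n\<^esub>)"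
      using A pt_closed[OF A w t] characters_one[OF hch_char[OF A t] Mpg.is_group monoid_A[OF A]]
      by (simp add: IF_ops Tg.lin_ext_monomial[OF Mpg.one_closed hP[OF A t]])
  qed
qed

lemma map_Mp: "j \<in> hom (Mp m) (Mp n) \<Longrightarrow> monoid_alg_map R (Mp m) (Mp n) j"
  by (intro monoid_alg_map.intro alg_Mp monoid_alg_map_axioms.intro) (auto simp: hom_def)

text \<open>If \<open>t \<mapsto> t'\<close> is the map of tori dual to \<open>j\<close>, and
  pulling \<open>f\<close> back along it from one component gives \<open>f'\<close> on the other,
  then the Laurent polynomials correspond under \<open>push\<close>. Reindexing and merging are the
  two instances.\<close>

lemma coef_push:
  assumes f: "f \<in> regular_functions R G m" and w': "w' \<in> tuples m \<Gamma>" and w: "w \<in> tuples n \<Gamma>" and j: "j \<in> hom (Mp m) (Mp n)"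
    and t': "\<And>A t. A \<in> Alg R \<Longrightarrow> Tt A n t \<Longrightarrow>
      Tt A m (t' A t) \<and> f' A (pt A n w t) = f A (pt A m w' (t' A t)) \<and>
      (\<forall>i \<in> {1..m}. \<forall>x \<in> carrier M. \<chi> A (t' A t i) x = hch A n t (j (coord M m i x)))"
  shows "coef n w f' = monoid_alg_map.push R (Mp m) (Mp n) j (coef m w' f)"
proof -
  interpret J: monoid_alg_map R "Mp m" "Mp n" j by (rule map_Mp[OF j])
  note F = coef[OF f w']
  show ?thesis
  proof (rule coef_eqI[OF w J.push_closed[OF F(1)]])
    fix A :: "('u, 'u) module" and t assume A: "A \<in> Alg R" and t: "Tt A n t"
    note tt = t'[OF A t]
    interpret Tg: monoid_alg_target R "Mp m" A by (rule target_Mp[OF A])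
    have tT: "Tt A m (t' A t)"
      using tt by blast
    have hn: "hch A n t \<in> carrier (Mp n) \<rightarrow> carrier A"
      by (rule funcsetI) (rule characters_closed(2)[OF hch_char[OF A t]])
    have hj: "hch A m (t' A t) \<mu> = hch A n t (j \<mu>)" if \<mu>: "\<mu> \<in> carrier (Mp m)" for \<mu>
    proof -
      have "hch A m (t' A t) \<mu> = (hch A n t \<circ> j) \<mu>"
      proof (rule hch_eqI[OF A tT _ _ \<mu>])
        show "hch A n t \<circ> j \<in> hom (Mp m) (units_of A)"
          using hom_compose[OF j] hch_char[OF A t] by blast
      qed (use tt in auto)
      then show ?thesis
        by simp
    qed
    have "lin_ext R (Mp n) A (hch A n t) (J.push (coef m w' f)) = lin_ext R (Mp m) A (\<lambda>z. hch A n t (j z)) (coef m w' f)"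
      by (rule J.lin_ext_push[OF AlgD[OF A] hn F(1)])
    also have "\<dots> = lin_ext R (Mp m) A (hch A m (t' A t)) (coef m w' f)"
    proof (rule Tg.lin_ext_cong[OF F(1)])
      show "hch A m (t' A t) \<in> carrier (Mp m) \<rightarrow> carrier A"
        by (rule funcsetI) (rule characters_closed(2)[OF hch_char[OF A tT]])
    qed (simp add: hj)
    also have "\<dots> = f' A (pt A n w t)"
      using F(2)[OF A tT] tt by simp
    finally show "f' A (pt A n w t) = lin_ext R (Mp n) A (hch A n t) (J.push (coef m w' f))"
      by simp
  qed
qed

lemma coef_reindex:
  assumes f: "f \<in> regular_functions R G m" and w: "w \<in> tuples n \<Gamma>" and \<zeta>: "\<zeta> \<in> {1..m} \<rightarrow> {1..n}"
  shows "coef n w (reindex_function R G m n \<zeta> f) =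
    monoid_alg_map.push R (Mp m) (Mp n) (ch.reidx m n \<zeta>) (coef m (\<lambda>i \<in> {1..m}. w (\<zeta> i)) f)"
proof (rule coef_push[where t' = "\<lambda>A t i. t (\<zeta> i)", OF f _ w ch.reidx_hom])
  show "(\<lambda>i \<in> {1..m}. w (\<zeta> i)) \<in> tuples m \<Gamma>"
    using w \<zeta> by auto
  have \<zeta>': "\<zeta> i \<in> {1..n}" if "i \<in> {1..m}" for i
    using \<zeta> that by blast
  fix A :: "('u, 'u) module" and t assume A: "A \<in> Alg R" and t: "Tt A n t"
  have "(\<lambda>i \<in> {1..m}. pt A n w t (\<zeta> i)) = pt A m (\<lambda>i \<in> {1..m}. w (\<zeta> i)) (\<lambda>i. t (\<zeta> i))"
    unfolding pt_def by (rule restrict_ext) (use \<zeta>' in simp)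
  then show "Tt A m (\<lambda>i. t (\<zeta> i)) \<and>
    reindex_function R G m n \<zeta> f A (pt A n w t) = f A (pt A m (\<lambda>i \<in> {1..m}. w (\<zeta> i)) (\<lambda>i. t (\<zeta> i))) \<and>
    (\<forall>i \<in> {1..m}. \<forall>x \<in> carrier M. \<chi> A (t (\<zeta> i)) x = hch A n t (ch.reidx m n \<zeta> (coord M m i x)))"
    using A pt_closed[OF A w t] TtD[OF t \<zeta>'] hch_coord[OF A t \<zeta>']
    by (simp add: reindex_function_def ch.reidx_coord Tt_def)
qed

text \<open>Multiplying the last two entries moves the torus part of entry \<open>n+1\<close> past
  \<open>r A (w n)\<close>, which conjugates it; on exponents this is \<open>mg\<close>.\<close>

lemma coef_merge:
  assumes f: "f \<in> regular_functions R G n" and n: "1 \<le> n" and w: "w \<in> tuples (Suc n) \<Gamma>"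
  shows "coef (Suc n) w (merge_function R G n f) =
    monoid_alg_map.push R (Mp n) (Mp (Suc n)) (ch.mg n w) (coef n (merge_last \<Gamma> n w) f)"
proof (rule coef_push[where t' = "\<lambda>A t i. if i = n then t n \<otimes>\<^bsub>Gp A\<^esub> cj A (inv w n) (t (Suc n)) else t i",
      OF f ch.merge_tuple[OF w n] w ch.mg_hom[OF w n]])
  have g: "w n \<in> carrier \<Gamma>" "w (Suc n) \<in> carrier \<Gamma>" "inv w n \<in> carrier \<Gamma>"
    using n by (simp_all add: ch.tuple_mem[OF w])
  fix A :: "('u, 'u) module" and t assume A: "A \<in> Alg R" and t: "Tt A (Suc n) t"
  interpret Gp: group "Gp A" by (rule group_G[OF A])
  let ?t = "\<lambda>i. if i = n then t n \<otimes>\<^bsub>Gp A\<^esub> cj A (inv w n) (t (Suc n)) else t i"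
  have tn: "t n \<in> Tp A" "t (Suc n) \<in> Tp A"
    using n by (simp_all add: TtD[OF t])
  have k: "cj A (inv w n) (t (Suc n)) \<in> Tp A"
    by (rule cj_closed[OF A g(3) tn(2)])
  have T: "Tt A n ?t"
    by (rule TtI) (use TtD[OF t] T_closed[OF A tn(1) k] in simp)
  have key: "(t n \<otimes>\<^bsub>Gp A\<^esub> r A (w n)) \<otimes>\<^bsub>Gp A\<^esub> (t (Suc n) \<otimes>\<^bsub>Gp A\<^esub> r A (w (Suc n))) =
    t n \<otimes>\<^bsub>Gp A\<^esub> cj A (inv w n) (t (Suc n)) \<otimes>\<^bsub>Gp A\<^esub> r A (w n \<otimes> w (Suc n))"
  proof -
    note c = T_G[OF A tn(1)] T_G[OF A tn(2)] T_G[OF A k] r_closed[OF A g(1)] r_closed[OF A g(2)]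
    have "(t n \<otimes>\<^bsub>Gp A\<^esub> r A (w n)) \<otimes>\<^bsub>Gp A\<^esub> (t (Suc n) \<otimes>\<^bsub>Gp A\<^esub> r A (w (Suc n))) =
      t n \<otimes>\<^bsub>Gp A\<^esub> (r A (w n) \<otimes>\<^bsub>Gp A\<^esub> t (Suc n)) \<otimes>\<^bsub>Gp A\<^esub> r A (w (Suc n))"
      using c by (simp add: Gp.m_assoc)
    then show ?thesis
      unfolding conj_r[OF A g(1) tn(2)] r_mult[OF A g(1,2)] using c by (simp add: Gp.m_assoc)
  qed
  have "merge_last (Gp A) n (pt A (Suc n) w t) = pt A n (merge_last \<Gamma> n w) ?t"
    unfolding merge_last_def pt_def by (rule restrict_ext) (use n key in auto)
  then have 1: "merge_function R G n f A (pt A (Suc n) w t) = f A (pt A n (merge_last \<Gamma> n w) ?t)"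
    using A pt_closed[OF A w t] by (simp add: merge_function_def)
  have 2: "\<chi> A (?t i) x = hch A (Suc n) t (ch.mg n w (coord M n i x))" if i: "i \<in> {1..n}" and x: "x \<in> carrier M" for i x
  proof (cases "i = n")
    case False
    then show ?thesis
      unfolding ch.mg_coord[OF w n i x] using hch_coord[OF A t _ x] i by (simp add: ch.mgL_def)
  next
    case True
    note a = act_closed[OF g(3) x]
    have "hch A (Suc n) t (ch.mg n w (coord M n i x)) =
      hch A (Suc n) t (coord M (Suc n) n x) \<otimes>\<^bsub>A\<^esub> hch A (Suc n) t (coord M (Suc n) (Suc n) (act (inv w n) x))"
      unfolding ch.mg_coord[OF w n i x] using True
      characters_mult[OF hch_char[OF A t] ch.coord_closed[OF x] ch.coord_closed[OF a], of n "Suc n"] by (simp add: ch.mgL_def)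
    also have "\<dots> = \<chi> A (t n) x \<otimes>\<^bsub>A\<^esub> \<chi> A (t (Suc n)) (act (inv w n) x)"
      using hch_coord[OF A t _ x] hch_coord[OF A t _ a] n by simp
    also have "\<dots> = \<chi> A (?t i) x"
      using True \<chi>_act[OF g(3) x A tn(2)] \<chi>_mult[OF A tn(1) k x] by simp
    finally show ?thesis
      by simp
  qed
  show "Tt A n ?t \<and> merge_function R G n f A (pt A (Suc n) w t) = f A (pt A n (merge_last \<Gamma> n w) ?t) \<and>
    (\<forall>i \<in> {1..n}. \<forall>x \<in> carrier M. \<chi> A (?t i) x = hch A (Suc n) t (ch.mg n w (coord M n i x)))"
    using T 1 2 by blast
qed


section \<open>Weights of the torus under diagonal conjugation\<close>

lemma \<chi>_inv:
  assumes A: "A \<in> Alg R" and s: "s \<in> Tp A" and m: "m \<in> carrier M"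
  shows "\<chi> A (inv\<^bsub>Gp A\<^esub> s) m = \<chi> A s (inv\<^bsub>M\<^esub> m)"
proof -
  interpret A: algebra R A by (rule AlgD[OF A])
  interpret Gp: group "Gp A" by (rule group_G[OF A])
  note c = \<chi>_closed[OF A T_inv[OF A s] m] \<chi>_closed[OF A s m] \<chi>_closed[OF A s M.inv_closed[OF m]]
  have 1: "\<chi> A (inv\<^bsub>Gp A\<^esub> s) m \<otimes>\<^bsub>A\<^esub> \<chi> A s m = \<one>\<^bsub>A\<^esub>"
    using \<chi>_mult[OF A T_inv[OF A s] s m] Gp.l_inv[OF T_G[OF A s]] \<chi>_one[OF A m] by simp
  have 2: "\<chi> A s m \<otimes>\<^bsub>A\<^esub> \<chi> A s (inv\<^bsub>M\<^esub> m) = \<one>\<^bsub>A\<^esub>"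
    using \<chi>_M_mult[OF A s m M.inv_closed[OF m]] \<chi>_M_one[OF A s] m by simp
  show ?thesis
    by (rule A.inv_unique[OF 1 2 c(2) c(1) c(3)])
qed

text \<open>Up to sign, the weight of the torus on the monomial \<open>\<mu>\<close> under diagonal
  conjugation of the component of \<open>w\<close>.\<close>

definition wt where "wt n w \<mu> = boundary1 \<Gamma> M act (ch.cls n w \<mu>)"

lemma wt_hom: "w \<in> tuples n \<Gamma> \<Longrightarrow> wt n w \<in> hom (Mp n) M"
  using hom_compose[OF ch.cls_hom ch.boundary1_hom] by (simp add: wt_def[abs_def] comp_def)

lemma wt_coord: "\<lbrakk>w \<in> tuples n \<Gamma>; i \<in> {1..n}; m \<in> carrier M\<rbrakk> \<Longrightarrow> wt n w (coord M n i m) = act (inv w i) m \<otimes>\<^bsub>M\<^esub> inv\<^bsub>M\<^esub> m"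
  unfolding wt_def ch.cls_coord using ch.boundary1_chain1[OF ch.tuple_mem] by (simp only: ch.d1_def)

text \<open>The commutator of \<open>s\<close> with \<open>r A g\<close>; for \<open>s\<close> in
  the torus it lies in the torus.\<close>

abbreviation dv where "dv A s g \<equiv> s \<otimes>\<^bsub>Gp A\<^esub> cj A (inv g) (inv\<^bsub>Gp A\<^esub> s)"

text \<open>As \<open>s\<close> commutes with \<open>t i\<close>, conjugating \<open>t i\<close>
  times the base point by \<open>s\<close> stays in the component and multiplies \<open>t i\<close>
  by the commutator.\<close>

lemma conj_pt:
  assumes A: "A \<in> Alg R" and w: "w \<in> tuples n \<Gamma>" and t: "Tt A n t" and s: "s \<in> Tp A"
  shows "cjt A n s (pt A n w t) = pt A n w (\<lambda>i. t i \<otimes>\<^bsub>Gp A\<^esub> (dv A s (w i)))"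
  unfolding cjt_def pt_def
proof (rule restrict_ext)
  interpret Gp: group "Gp A" by (rule group_G[OF A])
  fix i assume i: "i \<in> {1..n}"
  note g = ch.tuple_mem[OF w i]
  note k = cj_closed[OF A \<Gamma>.inv_closed[OF g] T_inv[OF A s]]
  note c = T_G[OF A TtD[OF t i]] T_G[OF A s] T_G[OF A T_inv[OF A s]] r_closed[OF A g] T_G[OF A k]
  have "s \<otimes>\<^bsub>Gp A\<^esub> (t i \<otimes>\<^bsub>Gp A\<^esub> r A (w i)) \<otimes>\<^bsub>Gp A\<^esub> inv\<^bsub>Gp A\<^esub> s =
    (s \<otimes>\<^bsub>Gp A\<^esub> t i) \<otimes>\<^bsub>Gp A\<^esub> (r A (w i) \<otimes>\<^bsub>Gp A\<^esub> inv\<^bsub>Gp A\<^esub> s)"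
    using c by (simp add: Gp.m_assoc)
  also have "\<dots> = t i \<otimes>\<^bsub>Gp A\<^esub> (dv A s (w i)) \<otimes>\<^bsub>Gp A\<^esub> r A (w i)"
    unfolding conj_r[OF A g T_inv[OF A s]] T_comm[OF A s TtD[OF t i]] using c by (simp add: Gp.m_assoc)
  finally show "s \<otimes>\<^bsub>Gp A\<^esub> (\<lambda>i \<in> {1..n}. t i \<otimes>\<^bsub>Gp A\<^esub> r A (w i)) i \<otimes>\<^bsub>Gp A\<^esub> inv\<^bsub>Gp A\<^esub> s =
    t i \<otimes>\<^bsub>Gp A\<^esub> (dv A s (w i)) \<otimes>\<^bsub>Gp A\<^esub> r A (w i)"
    using i by simp
qed

lemma \<chi>_conj_pt:
  assumes A: "A \<in> Alg R" and g: "g \<in> carrier \<Gamma>" and t: "t \<in> Tp A" and s: "s \<in> Tp A" and m: "m \<in> carrier M"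
  shows "t \<otimes>\<^bsub>Gp A\<^esub> (dv A s g) \<in> Tp A"
    "\<chi> A (t \<otimes>\<^bsub>Gp A\<^esub> (dv A s g)) m =
      \<chi> A t m \<otimes>\<^bsub>A\<^esub> \<chi> A s (inv\<^bsub>M\<^esub> (act (inv g) m \<otimes>\<^bsub>M\<^esub> inv\<^bsub>M\<^esub> m))"
proof -
  note i = \<Gamma>.inv_closed[OF g]
  note k = cj_closed[OF A i T_inv[OF A s]]
  note y = act_closed[OF i m]
  show "t \<otimes>\<^bsub>Gp A\<^esub> (dv A s g) \<in> Tp A"
    by (rule T_closed[OF A t T_closed[OF A s k]])
  have "\<chi> A (dv A s g) m = \<chi> A s m \<otimes>\<^bsub>A\<^esub> \<chi> A s (inv\<^bsub>M\<^esub> act (inv g) m)"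
    unfolding \<chi>_mult[OF A s k m] \<chi>_act[OF i m A T_inv[OF A s], symmetric] \<chi>_inv[OF A s y] ..
  also have "\<dots> = \<chi> A s (m \<otimes>\<^bsub>M\<^esub> inv\<^bsub>M\<^esub> act (inv g) m)"
    by (rule \<chi>_M_mult[OF A s m M.inv_closed[OF y], symmetric])
  also have "m \<otimes>\<^bsub>M\<^esub> inv\<^bsub>M\<^esub> act (inv g) m = inv\<^bsub>M\<^esub> (act (inv g) m \<otimes>\<^bsub>M\<^esub> inv\<^bsub>M\<^esub> m)"
    using m y by (simp add: M.inv_mult_group)
  finally show "\<chi> A (t \<otimes>\<^bsub>Gp A\<^esub> (dv A s g)) m =
      \<chi> A t m \<otimes>\<^bsub>A\<^esub> \<chi> A s (inv\<^bsub>M\<^esub> (act (inv g) m \<otimes>\<^bsub>M\<^esub> inv\<^bsub>M\<^esub> m))"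
    unfolding \<chi>_mult[OF A t T_closed[OF A s k] m] by simp
qed

text \<open>Let \<open>F\<close> be the Laurent polynomial of the invariant function. Invariance
  under every \<open>s\<close> says that the sums of \<open>F_\<mu> t^\<mu> s^(-wt \<mu>)\<close>
  and of \<open>F_\<mu> t^\<mu>\<close> agree as functions of \<open>(t, s)\<close>, hence as
  elements of the group algebra of \<open>M^n \<times> M\<close>. Comparing coefficients at
  \<open>(\<mu>, 0)\<close> leaves only exponents of weight zero, and these are the cycles.\<close>

lemma coef_supp:
  assumes f: "f \<in> carrier (IF n)" and w: "w \<in> tuples n \<Gamma>" and \<mu>: "\<mu> \<in> carrier (Mp n)" and nz: "coef n w f \<mu> \<noteq> \<zero>\<^bsub>R\<^esub>"
  shows "ch.cls n w \<mu> \<in> ch.Z1"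
proof -
  let ?N = "Mp n \<times>\<times> M"
  interpret Mpg: comm_group "Mp n" by (rule ch.comm_group_Mp)
  have N: "comm_group ?N" "countable (carrier ?N)"
    by (rule comm_group_DirProd[OF ch.comm_group_Mp M.comm_group_axioms])
      (simp add: DirProd_def ch.countable_Mp countable_M)
  interpret Ng: comm_group ?N by (rule N)
  have wc: "wt n w z \<in> carrier M" if "z \<in> carrier (Mp n)" for z
    using hom_carrier[OF wt_hom[OF w]] that by blast
  interpret PN: monoid_alg R ?N by (intro monoid_alg.intro R_cring Ng.comm_monoid_axioms)
  interpret J1: monoid_alg_map R "Mp n" ?N "\<lambda>z. (z, inv\<^bsub>M\<^esub> wt n w z)"
    by (intro monoid_alg_map.intro alg_Mp PN.monoid_alg_axioms monoid_alg_map_axioms.intro) (simp add: DirProd_def wc)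
  interpret J2: monoid_alg_map R "Mp n" ?N "\<lambda>z. (z, \<one>\<^bsub>M\<^esub>)"
    by (intro monoid_alg_map.intro alg_Mp PN.monoid_alg_axioms monoid_alg_map_axioms.intro) (simp add: DirProd_def)
  note F = coef[OF IF_regular[OF f] w]
  \<comment> \<open>\<open>J1\<close> carries the conjugated Laurent polynomial and
    \<open>J2\<close> the original one; a character of the product is a pair of a point
    \<open>t\<close> of \<open>T^n\<close> and a point \<open>s\<close> of \<open>T\<close>.\<close>
  have "J1.push (coef n w f) = J2.push (coef n w f)"
  proof (rule expansion_unique[OF N J1.push_closed[OF F(1)] J2.push_closed[OF F(1)]])
    fix A :: "('u, 'u) module" and h assume A: "A \<in> Alg R" and h: "h \<in> characters ?N A"
    interpret A: algebra R A by (rule AlgD[OF A])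
    interpret Tg: monoid_alg_target R "Mp n" A by (rule target_Mp[OF A])
    have c: "(x, y) \<in> carrier ?N" if "x \<in> carrier (Mp n)" "y \<in> carrier M" for x y
      using that by (simp add: DirProd_def)
    have hPi: "h \<in> carrier ?N \<rightarrow> carrier A"
      by (rule funcsetI) (rule characters_closed(2)[OF h])
    have hm: "h (x \<otimes>\<^bsub>Mp n\<^esub> x', y \<otimes>\<^bsub>M\<^esub> y') = h (x, y) \<otimes>\<^bsub>A\<^esub> h (x', y')"
      if "x \<in> carrier (Mp n)" "y \<in> carrier M" "x' \<in> carrier (Mp n)" "y' \<in> carrier M" for x y x' y'
      using characters_mult[OF h c[OF that(1,2)] c[OF that(3,4)]] by simp
    define h1 h2 where "h1 = (\<lambda>z \<in> carrier (Mp n). h (z, \<one>\<^bsub>M\<^esub>))" and "h2 = (\<lambda>m \<in> carrier M. h (\<one>\<^bsub>Mp n\<^esub>, m))"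
    have h1: "h1 \<in> characters (Mp n) A"
    proof (rule charactersI)
      show "h1 (x \<otimes>\<^bsub>Mp n\<^esub> y) = h1 x \<otimes>\<^bsub>A\<^esub> h1 y" if "x \<in> carrier (Mp n)" "y \<in> carrier (Mp n)" for x y
        using hm[of x "\<one>\<^bsub>M\<^esub>" y "\<one>\<^bsub>M\<^esub>"] that Mpg.m_closed[OF that] by (simp add: h1_def)
    qed (use characters_closed(1)[OF h c] in \<open>simp_all add: h1_def\<close>)
    have h2: "h2 \<in> characters M A"
    proof (rule charactersI)
      show "h2 (x \<otimes>\<^bsub>M\<^esub> y) = h2 x \<otimes>\<^bsub>A\<^esub> h2 y" if "x \<in> carrier M" "y \<in> carrier M" for x y
        using hm[OF Mpg.one_closed that(1) Mpg.one_closed that(2)] that by (simp add: h2_def)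
    qed (use characters_closed(1)[OF h c] in \<open>simp_all add: h2_def\<close>)
    define t s where "t = tch A n h1" and "s = \<tau> A h2"
    have t: "Tt A n t" and s: "s \<in> Tp A"
      unfolding t_def s_def by (rule tch_Tt[OF A h1], rule \<tau>_closed[OF A h2])
    define t' where "t' i = t i \<otimes>\<^bsub>Gp A\<^esub> (dv A s (w i))" for i
    have t': "Tt A n t'"
      unfolding t'_def by (rule TtI) (rule \<chi>_conj_pt(1)[OF A ch.tuple_mem[OF w] TtD[OF t] s M.one_closed])
    have split: "h (x, y) = h (x, \<one>\<^bsub>M\<^esub>) \<otimes>\<^bsub>A\<^esub> h (\<one>\<^bsub>Mp n\<^esub>, y)" if "x \<in> carrier (Mp n)" "y \<in> carrier M" for x y
      using hm[OF that(1) M.one_closed Mpg.one_closed that(2)] Mpg.r_one[OF that(1)] that(2) by simp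
    have ht': "hch A n t' z = h (z, inv\<^bsub>M\<^esub> wt n w z)" if z: "z \<in> carrier (Mp n)" for z
    proof (rule hch_eqI[where h = "\<lambda>z. h (z, inv\<^bsub>M\<^esub> wt n w z)", OF A t' _ _ z])
      show "(\<lambda>z. h (z, inv\<^bsub>M\<^esub> wt n w z)) \<in> hom (Mp n) (units_of A)"
      proof (rule homI)
        show "h (z, inv\<^bsub>M\<^esub> wt n w z) \<in> carrier (units_of A)" if "z \<in> carrier (Mp n)" for z
          using characters_closed(1)[OF h c[OF that M.inv_closed[OF wc[OF that]]]] by (simp add: units_of_carrier)
        show "h (x \<otimes>\<^bsub>Mp n\<^esub> y, inv\<^bsub>M\<^esub> wt n w (x \<otimes>\<^bsub>Mp n\<^esub> y)) = h (x, inv\<^bsub>M\<^esub> wt n w x) \<otimes>\<^bsub>units_of A\<^esub> h (y, inv\<^bsub>M\<^esub> wt n w y)"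
          if "x \<in> carrier (Mp n)" "y \<in> carrier (Mp n)" for x y
          using hm[OF that(1) M.inv_closed[OF wc[OF that(1)]] that(2) M.inv_closed[OF wc[OF that(2)]]]
            hom_mult[OF wt_hom[OF w] that] wc[OF that(1)] wc[OF that(2)] by (simp add: units_of_mult M.inv_mult)
      qed
      fix i m assume i: "i \<in> {1..n}" and m: "m \<in> carrier M"
      define y where "y = inv\<^bsub>M\<^esub> (act (inv w i) m \<otimes>\<^bsub>M\<^esub> inv\<^bsub>M\<^esub> m)"
      have y: "y \<in> carrier M"
        unfolding y_def using m act_closed[OF \<Gamma>.inv_closed[OF ch.tuple_mem[OF w i]] m] by simp
      have "\<chi> A (t' i) m = \<chi> A (t i) m \<otimes>\<^bsub>A\<^esub> \<chi> A s y"
        unfolding t'_def y_def by (rule \<chi>_conj_pt(2)[OF A ch.tuple_mem[OF w i] TtD[OF t i] s m])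
      also have "\<chi> A (t i) m = h (coord M n i m, \<one>\<^bsub>M\<^esub>)"
        using hch_coord[OF A t i m] hch_tch[OF A h1] ch.coord_closed[OF m] by (simp add: t_def h1_def)
      also have "\<chi> A s y = h (\<one>\<^bsub>Mp n\<^esub>, y)"
        using \<chi>_\<tau>[OF A h2] y by (simp add: s_def h2_def)
      also have "h (coord M n i m, \<one>\<^bsub>M\<^esub>) \<otimes>\<^bsub>A\<^esub> h (\<one>\<^bsub>Mp n\<^esub>, y) = h (coord M n i m, y)"
        by (rule split[OF ch.coord_closed[OF m] y, symmetric])
      finally show "\<chi> A (t' i) m = h (coord M n i m, inv\<^bsub>M\<^esub> wt n w (coord M n i m))"
        unfolding wt_coord[OF w i m] y_def .
    qed
    have "lin_ext R ?N A h (J1.push (coef n w f)) = lin_ext R (Mp n) A (\<lambda>z. h (z, inv\<^bsub>M\<^esub> wt n w z)) (coef n w f)"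
      by (rule J1.lin_ext_push[OF AlgD[OF A] hPi F(1)])
    also have "\<dots> = lin_ext R (Mp n) A (hch A n t') (coef n w f)"
      by (rule Tg.lin_ext_cong[OF F(1)]) (use characters_closed(2)[OF hch_char[OF A t']] ht' in auto)
    also have "\<dots> = f A (pt A n w t')"
      by (rule F(2)[OF A t', symmetric])
    also have "\<dots> = f A (cjt A n s (pt A n w t))"
      unfolding conj_pt[OF A w t s] t'_def ..
    also have "\<dots> = f A (pt A n w t)"
      by (rule IF_invariant[OF f A pt_closed[OF A w t] s])
    also have "\<dots> = lin_ext R (Mp n) A h1 (coef n w f)"
      using F(2)[OF A t] hch_tch[OF A h1] by (simp add: t_def)
    also have "\<dots> = lin_ext R (Mp n) A (\<lambda>z. h (z, \<one>\<^bsub>M\<^esub>)) (coef n w f)"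
      by (rule Tg.lin_ext_cong[OF F(1)]) (use characters_closed(2)[OF h c[OF _ M.one_closed]] in \<open>auto simp: h1_def\<close>)
    also have "\<dots> = lin_ext R ?N A h (J2.push (coef n w f))"
      by (rule J2.lin_ext_push[OF AlgD[OF A] hPi F(1), symmetric])
    finally show "lin_ext R ?N A h (J1.push (coef n w f)) = lin_ext R ?N A h (J2.push (coef n w f))" .
  qed
  moreover have "J2.push (coef n w f) (\<mu>, \<one>\<^bsub>M\<^esub>) = coef n w f \<mu>"
    by (rule J2.push_coeff_inj[OF _ F(1) \<mu>]) (simp add: inj_on_def)
  ultimately have "J1.push (coef n w f) (\<mu>, \<one>\<^bsub>M\<^esub>) \<noteq> \<zero>\<^bsub>R\<^esub>"
    using nz by simp
  \<comment> \<open>The exponents occurring in \<open>J1.push\<close> have the form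
    \<open>(z, - wt z)\<close>, so a nonzero coefficient at \<open>(\<mu>, 0)\<close> forces
    \<open>z = \<mu>\<close> and weight zero.\<close>
  then have "(\<mu>, \<one>\<^bsub>M\<^esub>) \<in> (\<lambda>z. (z, inv\<^bsub>M\<^esub> wt n w z)) ` carrier (Mp n)"
    using J1.push_coeff_outside[OF _ _ F(1), of "(\<mu>, \<one>\<^bsub>M\<^esub>)"] \<mu> by (auto simp: DirProd_def)
  then have "inv\<^bsub>M\<^esub> wt n w \<mu> = \<one>\<^bsub>M\<^esub>"
    by auto
  then have "wt n w \<mu> = \<one>\<^bsub>M\<^esub>"
    using wc[OF \<mu>] by (metis M.inv_inv M.inv_one)
  then show ?thesis
    using ch.cls_closed[OF w \<mu>] by (simp add: kernel_def wt_def)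
qed

section \<open>Operations that preserve invariance\<close>

lemma reindex_IF:
  assumes f: "f \<in> carrier (IF m)" and \<zeta>: "\<zeta> \<in> {1..m} \<rightarrow> {1..n}"
  shows "reindex_function R G m n \<zeta> f \<in> carrier (IF n)"
  unfolding reindex_function_def
proof (rule IF_restrict)
  have \<zeta>': "\<zeta> i \<in> {1..n}" if "i \<in> {1..m}" for i
    using \<zeta> that by blast
  fix A :: "('u, 'u) module" and g assume A: "A \<in> Alg R" and g: "g \<in> tuples n (Gp A)"
  have g': "(\<lambda>i \<in> {1..m}. g (\<zeta> i)) \<in> tuples m (Gp A)"
    using g \<zeta>' by (simp add: PiE_iff)
  note D = regular_functionsD[OF IF_regular[OF f] A g']
  show "f A (\<lambda>i \<in> {1..m}. g (\<zeta> i)) \<in> carrier A"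
    by (rule D(1))
  show "f B (\<lambda>i \<in> {1..m}. (\<lambda>i \<in> {1..n}. tr A B \<phi> (g i)) (\<zeta> i)) = \<phi> (f A (\<lambda>i \<in> {1..m}. g (\<zeta> i)))"
    if B: "B \<in> Alg R" and \<phi>: "\<phi> \<in> alg_hom R A B" for B \<phi>
  proof -
    have "(\<lambda>i \<in> {1..m}. (\<lambda>i \<in> {1..n}. tr A B \<phi> (g i)) (\<zeta> i)) = (\<lambda>i \<in> {1..m}. tr A B \<phi> ((\<lambda>i \<in> {1..m}. g (\<zeta> i)) i))"
      by (rule restrict_ext) (use \<zeta>' in simp)
    then show ?thesis
      using D(2)[OF B \<phi>] by (simp only:)
  qed
  show "f A (\<lambda>i \<in> {1..m}. cjt A n s g (\<zeta> i)) = f A (\<lambda>i \<in> {1..m}. g (\<zeta> i))" if s: "s \<in> Tp A" for s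
  proof -
    have "(\<lambda>i \<in> {1..m}. cjt A n s g (\<zeta> i)) = cjt A m s (\<lambda>i \<in> {1..m}. g (\<zeta> i))"
      unfolding cjt_def by (rule restrict_ext) (use \<zeta>' in simp)
    then show ?thesis
      using IF_invariant[OF f A g' s] by (simp only:)
  qed
qed

lemma merge_IF:
  assumes f: "f \<in> carrier (IF n)" and n: "1 \<le> n"
  shows "merge_function R G n f \<in> carrier (IF (Suc n))"
  unfolding merge_function_def
proof (rule IF_restrict)
  fix A :: "('u, 'u) module" and g assume A: "A \<in> Alg R" and g: "g \<in> tuples (Suc n) (Gp A)"
  interpret Gp: group "Gp A" by (rule group_G[OF A])
  have gi: "g i \<in> carrier (Gp A)" if "i \<in> {1..Suc n}" for i
    using g that by blast
  then have gn: "g n \<in> carrier (Gp A)" "g (Suc n) \<in> carrier (Gp A)"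
    using n by simp_all
  have g': "merge_last (Gp A) n g \<in> tuples n (Gp A)"
    using gi gn by (simp add: merge_last_def PiE_iff)
  note D = regular_functionsD[OF IF_regular[OF f] A g']
  show "f A (merge_last (Gp A) n g) \<in> carrier A"
    by (rule D(1))
  show "f B (merge_last (Gp B) n (\<lambda>i \<in> {1..Suc n}. tr A B \<phi> (g i))) = \<phi> (f A (merge_last (Gp A) n g))"
    if B: "B \<in> Alg R" and \<phi>: "\<phi> \<in> alg_hom R A B" for B \<phi>
  proof -
    have "merge_last (Gp B) n (\<lambda>i \<in> {1..Suc n}. tr A B \<phi> (g i)) = (\<lambda>i \<in> {1..n}. tr A B \<phi> (merge_last (Gp A) n g i))"
      unfolding merge_last_def by (rule restrict_ext) (use n tr_mult[OF A B \<phi> gn] in auto)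
    then show ?thesis
      using D(2)[OF B \<phi>] by (simp only:)
  qed
  show "f A (merge_last (Gp A) n (cjt A (Suc n) s g)) = f A (merge_last (Gp A) n g)" if s: "s \<in> Tp A" for s
  proof -
    have sG: "s \<in> carrier (Gp A)"
      by (rule T_G[OF A s])
    have cancel: "inv\<^bsub>Gp A\<^esub> s \<otimes>\<^bsub>Gp A\<^esub> (s \<otimes>\<^bsub>Gp A\<^esub> y) = y" if "y \<in> carrier (Gp A)" for y
      using that sG by (simp add: Gp.m_assoc[symmetric])
    have "(s \<otimes>\<^bsub>Gp A\<^esub> g n \<otimes>\<^bsub>Gp A\<^esub> inv\<^bsub>Gp A\<^esub> s) \<otimes>\<^bsub>Gp A\<^esub> (s \<otimes>\<^bsub>Gp A\<^esub> g (Suc n) \<otimes>\<^bsub>Gp A\<^esub> inv\<^bsub>Gp A\<^esub> s) =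
      s \<otimes>\<^bsub>Gp A\<^esub> (g n \<otimes>\<^bsub>Gp A\<^esub> g (Suc n)) \<otimes>\<^bsub>Gp A\<^esub> inv\<^bsub>Gp A\<^esub> s"
      using gn sG by (simp add: Gp.m_assoc cancel)
    then have "merge_last (Gp A) n (cjt A (Suc n) s g) = cjt A n s (merge_last (Gp A) n g)"
      unfolding merge_last_def cjt_def by (intro restrict_ext) (use n in auto)
    then show ?thesis
      using IF_invariant[OF f A g' s] by (simp only:)
  qed
qed

lemma \<pi>_conj:
  assumes A: "A \<in> Alg R" and s: "s \<in> Tp A" and g: "g \<in> carrier (Gp A)"
  shows "\<pi> A (s \<otimes>\<^bsub>Gp A\<^esub> g \<otimes>\<^bsub>Gp A\<^esub> inv\<^bsub>Gp A\<^esub> s) = \<pi> A g"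
proof (rule extensionalityI)
  interpret Gp: group "Gp A" by (rule group_G[OF A])
  have sG: "s \<in> carrier (Gp A)" "\<forall>Q \<in> spec A. \<pi> A s Q = \<one>\<^bsub>C\<^esub>"
    using s by (simp_all add: T_iff[OF A])
  show "\<pi> A (s \<otimes>\<^bsub>Gp A\<^esub> g \<otimes>\<^bsub>Gp A\<^esub> inv\<^bsub>Gp A\<^esub> s) \<in> extensional (spec A)" "\<pi> A g \<in> extensional (spec A)"
    by (rule \<pi>_ext[OF A], use sG g in simp, rule \<pi>_ext[OF A g])
  show "\<pi> A (s \<otimes>\<^bsub>Gp A\<^esub> g \<otimes>\<^bsub>Gp A\<^esub> inv\<^bsub>Gp A\<^esub> s) Q = \<pi> A g Q" if Q: "Q \<in> spec A" for Q
    using sG g Q \<pi>_pt[OF A g Q] by (simp add: \<pi>_mult[OF A] \<pi>_inv[OF A])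
qed

abbreviation Cf where "Cf \<equiv> constant_group C"

lemma \<pi>_transport:
  assumes "A \<in> Alg R" "B \<in> Alg R" "\<phi> \<in> alg_hom R A B" "g \<in> carrier (Gp A)"
  shows "\<pi> B (tr A B \<phi> g) = transport Cf A B \<phi> (\<pi> A g)"
  using \<pi> assms unfolding group_functor_hom_def by blast

text \<open>Conjugation by the torus does not change the image under \<open>\<pi>\<close>.\<close>

lemma pull_IF:
  assumes f: "f \<in> regular_functions R Cf n"
  shows "pull_function R G n \<pi> f \<in> carrier (IF n)"
  unfolding pull_function_def
proof (rule IF_restrict)
  fix A :: "('u, 'u) module" and g assume A: "A \<in> Alg R" and g: "g \<in> tuples n (Gp A)"
  have gi: "g i \<in> carrier (Gp A)" if "i \<in> {1..n}" for i
    using g that by blast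
  have g': "(\<lambda>i \<in> {1..n}. \<pi> A (g i)) \<in> tuples n (pts Cf A)"
    using \<pi>_closed[OF A gi] by (simp add: PiE_iff)
  note D = regular_functionsD[OF f A g']
  show "f A (\<lambda>i \<in> {1..n}. \<pi> A (g i)) \<in> carrier A"
    by (rule D(1))
  show "f B (\<lambda>i \<in> {1..n}. \<pi> B ((\<lambda>i \<in> {1..n}. tr A B \<phi> (g i)) i)) = \<phi> (f A (\<lambda>i \<in> {1..n}. \<pi> A (g i)))"
    if B: "B \<in> Alg R" and \<phi>: "\<phi> \<in> alg_hom R A B" for B \<phi>
  proof -
    have "(\<lambda>i \<in> {1..n}. \<pi> B ((\<lambda>i \<in> {1..n}. tr A B \<phi> (g i)) i)) =
      (\<lambda>i \<in> {1..n}. transport Cf A B \<phi> ((\<lambda>i \<in> {1..n}. \<pi> A (g i)) i))"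
      by (rule restrict_ext) (use \<pi>_transport[OF A B \<phi> gi] in simp)
    then show ?thesis
      using D(2)[OF B \<phi>] by (simp only:)
  qed
  show "f A (\<lambda>i \<in> {1..n}. \<pi> A (cjt A n s g i)) = f A (\<lambda>i \<in> {1..n}. \<pi> A (g i))" if s: "s \<in> Tp A" for s
  proof -
    have "(\<lambda>i \<in> {1..n}. \<pi> A (cjt A n s g i)) = (\<lambda>i \<in> {1..n}. \<pi> A (g i))"
      by (rule restrict_ext) (use \<pi>_conj[OF A s gi] in \<open>simp add: cjt_def\<close>)
    then show ?thesis
      by (simp only:)
  qed
qed

abbreviation rr where "rr \<equiv> reduced_rep R Cf \<pi> \<rho>\<^sub>0"

text \<open>All points of the component of \<open>w\<close> have the image under
  \<open>\<pi>\<close> of the reference point, so the pulled back function is constant there. The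
  constant lies in the base ring because the reference point is defined over it.\<close>

lemma coef_pull:
  assumes f: "f \<in> regular_functions R Cf n" and w: "w \<in> tuples n \<Gamma>"
  defines "c \<equiv> f (base_alg R) (\<lambda>i \<in> {1..n}. \<pi> (base_alg R) (\<rho>\<^sub>0 (w i)))"
  shows "c \<in> carrier R"
    and "coef n w (pull_function R G n \<pi> f) = c \<odot>\<^bsub>PM n\<^esub> monomial R (Mp n) \<one>\<^bsub>Mp n\<^esub>"
    and "A \<in> Alg R \<Longrightarrow> f A (\<lambda>i \<in> {1..n}. rr A (w i)) = c \<odot>\<^bsub>A\<^esub> \<one>\<^bsub>A\<^esub>"
proof -
  interpret Mpg: comm_group "Mp n" by (rule ch.comm_group_Mp)
  interpret P: monoid_alg R "Mp n" by (rule alg_Mp)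
  have g': "(\<lambda>i \<in> {1..n}. \<pi> (base_alg R) (\<rho>\<^sub>0 (w i))) \<in> tuples n (pts Cf (base_alg R))"
    using \<pi>_closed[OF base_alg_Alg \<rho>\<^sub>0_closed[OF ch.tuple_mem[OF w]]] by (simp add: PiE_iff)
  note D = regular_functionsD[OF f base_alg_Alg g']
  show c: "c \<in> carrier R"
    unfolding c_def using D(1) by simp
  have red: "f A (\<lambda>i \<in> {1..n}. rr A (w i)) = c \<odot>\<^bsub>A\<^esub> \<one>\<^bsub>A\<^esub>" if A: "A \<in> Alg R" for A
  proof -
    have "(\<lambda>i \<in> {1..n}. rr A (w i)) =
      (\<lambda>i \<in> {1..n}. transport Cf (base_alg R) A (structure_map R A) ((\<lambda>i \<in> {1..n}. \<pi> (base_alg R) (\<rho>\<^sub>0 (w i))) i))"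
      by (rule restrict_ext) (simp add: reduced_rep_def)
    then have "f A (\<lambda>i \<in> {1..n}. rr A (w i)) = structure_map R A c"
      unfolding c_def using D(2)[OF A structure_map_hom[OF A]] by (simp only:)
    then show ?thesis
      using c by (simp add: structure_map_def)
  qed
  show "A \<in> Alg R \<Longrightarrow> f A (\<lambda>i \<in> {1..n}. rr A (w i)) = c \<odot>\<^bsub>A\<^esub> \<one>\<^bsub>A\<^esub>"
    by (rule red)
  show "coef n w (pull_function R G n \<pi> f) = c \<odot>\<^bsub>P.P\<^esub> monomial R (Mp n) \<one>\<^bsub>Mp n\<^esub>"
  proof (rule coef_eqI[OF w P.smult_closed_P[OF c P.monomial_closed[OF Mpg.one_closed]]])
    fix A :: "('u, 'u) module" and t assume A: "A \<in> Alg R" and t: "Tt A n t"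
    interpret Tg: monoid_alg_target R "Mp n" A by (rule target_Mp[OF A])
    have hP: "hch A n t \<in> carrier (Mp n) \<rightarrow> carrier A"
      by (rule funcsetI) (rule characters_closed(2)[OF hch_char[OF A t]])
    have "(\<lambda>i \<in> {1..n}. \<pi> A (pt A n w t i)) = (\<lambda>i \<in> {1..n}. rr A (w i))"
    proof (rule restrict_ext)
      fix i assume i: "i \<in> {1..n}"
      show "\<pi> A (pt A n w t i) = rr A (w i)"
        using \<pi>_T_mult[OF A TtD[OF t i] r_closed[OF A ch.tuple_mem[OF w i]]] reduced_rep_eq[OF A ch.tuple_mem[OF w i]] i
        by (simp add: pt_def)
    qed
    then have "pull_function R G n \<pi> f A (pt A n w t) = c \<odot>\<^bsub>A\<^esub> \<one>\<^bsub>A\<^esub>"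
      using A pt_closed[OF A w t] red[OF A] unfolding pull_function_def by (simp only: restrict_apply' simp_thms)
    also have "\<one>\<^bsub>A\<^esub> = hch A n t \<one>\<^bsub>Mp n\<^esub>"
      using characters_one[OF hch_char[OF A t] Mpg.is_group monoid_A[OF A]] by simp
    finally show "pull_function R G n \<pi> f A (pt A n w t) =
      lin_ext R (Mp n) A (hch A n t) (c \<odot>\<^bsub>P.P\<^esub> monomial R (Mp n) \<one>\<^bsub>Mp n\<^esub>)"
      unfolding Tg.lin_ext_smult[OF P.monomial_closed[OF Mpg.one_closed] c hP] Tg.lin_ext_monomial[OF Mpg.one_closed hP] .
  qed
qed


section \<open>Pseudocharacters\<close>

definition cycles where "cycles n w = {\<mu> \<in> carrier (Mp n). ch.cls n w \<mu> \<in> ch.Z1}"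

text \<open>
  The value 0 off \<open>H\<^sub>1\<close> is arbitrary: the coefficients of invariant functions are supported on cycles.
\<close>

definition hx where "hx A \<psi> n w \<mu> =
  (if ch.qc n w \<mu> \<in> carrier ch.H1 then \<psi> (ch.qc n w \<mu>) else \<zero>\<^bsub>A\<^esub>)"

text \<open>An evaluation of invariant functions at a point that need not exist:
  \<open>\<psi>\<close> prescribes values only for the monomials whose exponent is a cycle, and no
  others occur in invariant functions.\<close>

definition Th where "Th A \<psi> n f w = lin_ext R (Mp n) A (hx A \<psi> n w) (coef n w f)"

definition pcm where "pcm A \<psi> = (\<lambda>n \<in> {1..}. \<lambda>f \<in> carrier (IF n). \<lambda>w \<in> tuples n \<Gamma>. Th A \<psi> n f w)"

lemma cyclesI: "\<mu> \<in> carrier (Mp n) \<Longrightarrow> ch.cls n w \<mu> \<in> ch.Z1 \<Longrightarrow> \<mu> \<in> cycles n w"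
  by (simp add: cycles_def)

lemma cyclesD: "\<mu> \<in> cycles n w \<Longrightarrow> \<mu> \<in> carrier (Mp n)" "\<mu> \<in> cycles n w \<Longrightarrow> ch.cls n w \<mu> \<in> ch.Z1"
  by (simp_all add: cycles_def)

lemma cycles_carrier: "cycles n w \<subseteq> carrier (Mp n)"
  by (simp add: cycles_def)

lemma coef_cycles: "f \<in> carrier (IF n) \<Longrightarrow> w \<in> tuples n \<Gamma> \<Longrightarrow> {\<mu> \<in> carrier (Mp n). coef n w f \<mu> \<noteq> \<zero>\<^bsub>R\<^esub>} \<subseteq> cycles n w"
  using coef_supp by (intro subsetI cyclesI) blast+

lemma cycles_subgroup:
  assumes w: "w \<in> tuples n \<Gamma>"
  shows "subgroup (cycles n w) (Mp n)"
proof -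
  interpret Mpg: comm_group "Mp n" by (rule ch.comm_group_Mp)
  interpret h: group_hom "Mp n" ch.C1 "ch.cls n w"
    by (intro group_hom.intro group_hom_axioms.intro Mpg.is_group ch.C1.is_group ch.cls_hom[OF w])
  interpret Z: subgroup ch.Z1 ch.C1 by (rule ch.Z1_subgroup)
  show ?thesis
    by (rule Mpg.subgroupI) (auto simp: cycles_def intro!: exI[where x = "\<one>\<^bsub>Mp n\<^esub>"])
qed

lemma qc_cycles: "w \<in> tuples n \<Gamma> \<Longrightarrow> \<mu> \<in> cycles n w \<Longrightarrow> ch.qc n w \<mu> \<in> carrier ch.H1"
  using ch.qc_H1 cyclesD by blast

lemma hx_cycles: "w \<in> tuples n \<Gamma> \<Longrightarrow> \<mu> \<in> cycles n w \<Longrightarrow> hx A \<psi> n w \<mu> = \<psi> (ch.qc n w \<mu>)"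
  by (simp add: hx_def qc_cycles)

lemma qc_one: "w \<in> tuples n \<Gamma> \<Longrightarrow> ch.qc n w \<one>\<^bsub>Mp n\<^esub> = \<one>\<^bsub>ch.H1\<^esub>"
  using hom_one[OF ch.qc_hom comm_group.axioms(2)[OF ch.comm_group_Mp] ch.Q1.is_group] by (simp add: ch.H1_one)

lemma hx_closed:
  assumes A: "A \<in> Alg R" and \<psi>: "\<psi> \<in> characters ch.H1 A"
  shows "hx A \<psi> n w \<in> carrier (Mp n) \<rightarrow> carrier A"
proof -
  interpret A: algebra R A by (rule AlgD[OF A])
  show ?thesis
    using characters_closed(2)[OF \<psi>] by (auto simp: hx_def)
qed

lemma hx_mult:
  assumes A: "A \<in> Alg R" and \<psi>: "\<psi> \<in> characters ch.H1 A" and w: "w \<in> tuples n \<Gamma>"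
    and \<mu>: "\<mu> \<in> cycles n w" and \<nu>: "\<nu> \<in> cycles n w"
  shows "hx A \<psi> n w (\<mu> \<otimes>\<^bsub>Mp n\<^esub> \<nu>) = hx A \<psi> n w \<mu> \<otimes>\<^bsub>A\<^esub> hx A \<psi> n w \<nu>"
proof -
  have m: "\<mu> \<otimes>\<^bsub>Mp n\<^esub> \<nu> \<in> cycles n w"
    by (rule subgroup.m_closed[OF cycles_subgroup[OF w] \<mu> \<nu>])
  have "ch.qc n w (\<mu> \<otimes>\<^bsub>Mp n\<^esub> \<nu>) = ch.qc n w \<mu> \<otimes>\<^bsub>ch.H1\<^esub> ch.qc n w \<nu>"
    using hom_mult[OF ch.qc_hom[OF w] cyclesD(1)[OF \<mu>] cyclesD(1)[OF \<nu>]] by (simp add: ch.H1_mult)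
  then show ?thesis
    using characters_mult[OF \<psi> qc_cycles[OF w \<mu>] qc_cycles[OF w \<nu>]]
    by (simp add: hx_cycles[OF w] m \<mu> \<nu>)
qed

lemma hx_one:
  assumes A: "A \<in> Alg R" and \<psi>: "\<psi> \<in> characters ch.H1 A" and w: "w \<in> tuples n \<Gamma>"
  shows "hx A \<psi> n w \<one>\<^bsub>Mp n\<^esub> = \<one>\<^bsub>A\<^esub>"
  using characters_one[OF \<psi> ch.H1.is_group monoid_A[OF A]] by (simp add: hx_def qc_one[OF w])

lemma Th_closed:
  assumes A: "A \<in> Alg R" and \<psi>: "\<psi> \<in> characters ch.H1 A" and f: "f \<in> carrier (IF n)" and w: "w \<in> tuples n \<Gamma>"
  shows "Th A \<psi> n f w \<in> carrier A"
proof -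
  interpret Tg: monoid_alg_target R "Mp n" A by (rule target_Mp[OF A])
  show ?thesis
    unfolding Th_def by (rule Tg.lin_ext_closed[OF coef(1)[OF IF_regular[OF f] w] hx_closed[OF A \<psi>]])
qed

text \<open>\<open>hx\<close> is multiplicative on cycles only. Products are preserved because the
  Laurent polynomials of invariant functions are supported there.\<close>

lemma Th_hom:
  assumes A: "A \<in> Alg R" and \<psi>: "\<psi> \<in> characters ch.H1 A" and w: "w \<in> tuples n \<Gamma>"
    and f: "f \<in> carrier (IF n)" and f': "f' \<in> carrier (IF n)" and a: "a \<in> carrier R"
  shows "Th A \<psi> n (f \<otimes>\<^bsub>IF n\<^esub> f') w = Th A \<psi> n f w \<otimes>\<^bsub>A\<^esub> Th A \<psi> n f' w"
    "Th A \<psi> n (f \<oplus>\<^bsub>IF n\<^esub> f') w = Th A \<psi> n f w \<oplus>\<^bsub>A\<^esub> Th A \<psi> n f' w"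
    "Th A \<psi> n (a \<odot>\<^bsub>IF n\<^esub> f) w = a \<odot>\<^bsub>A\<^esub> Th A \<psi> n f w"
    "Th A \<psi> n \<one>\<^bsub>IF n\<^esub> w = \<one>\<^bsub>A\<^esub>"
proof -
  interpret Mpg: comm_group "Mp n" by (rule ch.comm_group_Mp)
  interpret Tg: monoid_alg_target R "Mp n" A by (rule target_Mp[OF A])
  note F = coef(1)[OF IF_regular[OF f] w] and F' = coef(1)[OF IF_regular[OF f'] w]
    and h = hx_closed[OF A \<psi>] and H = coef_hom[OF IF_regular[OF f] IF_regular[OF f'] w a]
  show "Th A \<psi> n (f \<otimes>\<^bsub>IF n\<^esub> f') w = Th A \<psi> n f w \<otimes>\<^bsub>A\<^esub> Th A \<psi> n f' w"
    unfolding Th_def H(1)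
    by (rule Tg.lin_ext_mult[OF cycles_carrier h hx_mult[OF A \<psi> w] F coef_cycles[OF f w] F' coef_cycles[OF f' w]])
  show "Th A \<psi> n (f \<oplus>\<^bsub>IF n\<^esub> f') w = Th A \<psi> n f w \<oplus>\<^bsub>A\<^esub> Th A \<psi> n f' w"
    unfolding Th_def H(2) by (rule Tg.lin_ext_add[OF F F' h])
  show "Th A \<psi> n (a \<odot>\<^bsub>IF n\<^esub> f) w = a \<odot>\<^bsub>A\<^esub> Th A \<psi> n f w"
    unfolding Th_def H(3) by (rule Tg.lin_ext_smult[OF F a h])
  show "Th A \<psi> n \<one>\<^bsub>IF n\<^esub> w = \<one>\<^bsub>A\<^esub>"
    unfolding Th_def H(4) Tg.lin_ext_monomial[OF Mpg.one_closed h] by (rule hx_one[OF A \<psi> w])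
qed

abbreviation Thr where "Thr A \<psi> n \<equiv> \<lambda>f \<in> carrier (IF n). \<lambda>w \<in> tuples n \<Gamma>. Th A \<psi> n f w"

lemma Th_alg_hom:
  assumes A: "A \<in> Alg R" and \<psi>: "\<psi> \<in> characters ch.H1 A"
  shows "Thr A \<psi> n \<in> alg_hom R (IF n) (map_alg (tuples n \<Gamma>) A)"
  unfolding alg_hom_def
proof (intro CollectI conjI IntI ballI ring_hom_memI)
  fix f assume f: "f \<in> carrier (IF n)"
  show "Thr A \<psi> n f \<in> carrier (map_alg (tuples n \<Gamma>) A)"
    unfolding map_alg_simps restrict_apply'[OF f] restrict_PiE_iff
    by (intro ballI Th_closed[OF A \<psi> f])
  fix f' assume f': "f' \<in> carrier (IF n)"
  note c = IF_closed[OF f f' R.zero_closed]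
  show "Thr A \<psi> n (f \<otimes>\<^bsub>IF n\<^esub> f') =
    Thr A \<psi> n f \<otimes>\<^bsub>map_alg (tuples n \<Gamma>) A\<^esub>
    Thr A \<psi> n f'"
    unfolding map_alg_simps restrict_apply'[OF f] restrict_apply'[OF f'] restrict_apply'[OF c(1)]
  proof (rule restrict_ext)
    fix w assume w: "w \<in> tuples n \<Gamma>"
    show "Th A \<psi> n (f \<otimes>\<^bsub>IF n\<^esub> f') w = (\<lambda>w \<in> tuples n \<Gamma>. Th A \<psi> n f w) w \<otimes>\<^bsub>A\<^esub> (\<lambda>w \<in> tuples n \<Gamma>. Th A \<psi> n f' w) w"
      unfolding restrict_apply'[OF w] by (rule Th_hom(1)[OF A \<psi> w f f' R.zero_closed])
  qed
  show "Thr A \<psi> n (f \<oplus>\<^bsub>IF n\<^esub> f') =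
    Thr A \<psi> n f \<oplus>\<^bsub>map_alg (tuples n \<Gamma>) A\<^esub>
    Thr A \<psi> n f'"
    unfolding map_alg_simps restrict_apply'[OF f] restrict_apply'[OF f'] restrict_apply'[OF c(2)]
  proof (rule restrict_ext)
    fix w assume w: "w \<in> tuples n \<Gamma>"
    show "Th A \<psi> n (f \<oplus>\<^bsub>IF n\<^esub> f') w = (\<lambda>w \<in> tuples n \<Gamma>. Th A \<psi> n f w) w \<oplus>\<^bsub>A\<^esub> (\<lambda>w \<in> tuples n \<Gamma>. Th A \<psi> n f' w) w"
      unfolding restrict_apply'[OF w] by (rule Th_hom(2)[OF A \<psi> w f f' R.zero_closed])
  qed
next
  fix a f assume a: "a \<in> carrier R" and f: "f \<in> carrier (IF n)"
  show "Thr A \<psi> n (a \<odot>\<^bsub>IF n\<^esub> f) =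
    a \<odot>\<^bsub>map_alg (tuples n \<Gamma>) A\<^esub> Thr A \<psi> n f"
    unfolding map_alg_simps restrict_apply'[OF f] restrict_apply'[OF IF_closed(3)[OF f f a]]
  proof (rule restrict_ext)
    fix w assume w: "w \<in> tuples n \<Gamma>"
    show "Th A \<psi> n (a \<odot>\<^bsub>IF n\<^esub> f) w = a \<odot>\<^bsub>A\<^esub> (\<lambda>w \<in> tuples n \<Gamma>. Th A \<psi> n f w) w"
      unfolding restrict_apply'[OF w] by (rule Th_hom(3)[OF A \<psi> w f f a])
  qed
next
  have one: "\<one>\<^bsub>IF n\<^esub> \<in> carrier (IF n)"
    unfolding IF_ops(4)
  proof (rule IF_restrict)
    show "\<one>\<^bsub>A\<^esub> \<in> carrier A" if "A \<in> Alg R" for A :: "('u, 'u) module"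
      by (rule monoid.one_closed[OF monoid_A[OF that]])
  qed (simp_all add: alg_hom_simps(3))
  show "Thr A \<psi> n \<one>\<^bsub>IF n\<^esub> = \<one>\<^bsub>map_alg (tuples n \<Gamma>) A\<^esub>"
    unfolding map_alg_simps restrict_apply'[OF one]
    by (rule restrict_ext) (rule Th_hom(4)[OF A \<psi> _ one one R.zero_closed])
qed (rule restrict_extensional)

text \<open>Both compatibilities of a pseudocharacter come from maps \<open>j\<close> of exponents,
  and hold because \<open>j\<close> preserves the class of the chain modulo boundaries. The class
  also decides membership in \<open>H1\<close>, so the default value of \<open>hx\<close> is used on
  both sides or on neither.\<close>

lemma Th_push:
  assumes A: "A \<in> Alg R" and \<psi>: "\<psi> \<in> characters ch.H1 A"
    and f: "f \<in> regular_functions R G m" and w': "w' \<in> tuples m \<Gamma>" and j: "j \<in> hom (Mp m) (Mp n)"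
    and cf: "coef n w f' = monoid_alg_map.push R (Mp m) (Mp n) j (coef m w' f)"
    and qc: "\<And>\<mu>. \<mu> \<in> carrier (Mp m) \<Longrightarrow> ch.qc n w (j \<mu>) = ch.qc m w' \<mu>"
  shows "Th A \<psi> n f' w = Th A \<psi> m f w'"
proof -
  interpret J: monoid_alg_map R "Mp m" "Mp n" j by (rule map_Mp[OF j])
  interpret Tg: monoid_alg_target R "Mp m" A by (rule target_Mp[OF A])
  show ?thesis
    unfolding Th_def cf J.lin_ext_push[OF AlgD[OF A] hx_closed[OF A \<psi>] coef(1)[OF f w']]
    by (rule Tg.lin_ext_cong[OF coef(1)[OF f w'] hx_closed[OF A \<psi>]]) (simp add: hx_def qc)
qed

lemma reindex_tuple: "w \<in> tuples n \<Gamma> \<Longrightarrow> \<zeta> \<in> {1..m} \<rightarrow> {1..n} \<Longrightarrow> (\<lambda>i \<in> {1..m}. w (\<zeta> i)) \<in> tuples m \<Gamma>"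
  by (auto simp: PiE_iff)

lemma pcm_apply: "\<lbrakk>1 \<le> n; f \<in> carrier (IF n); w \<in> tuples n \<Gamma>\<rbrakk> \<Longrightarrow> pcm A \<psi> n f w = Th A \<psi> n f w"
  unfolding pcm_def by (simp only: restrict_apply' atLeast_iff)

abbreviation PCh where "PCh \<equiv> PC R G T Cf \<pi> \<Gamma> \<rho>\<^sub>0"

text \<open>Reindexing preserves the chain and merging preserves it modulo boundaries. Functions
  pulled back from the component group are constant on the component of a tuple, so there
  \<open>\<psi>\<close> is evaluated at the neutral element.\<close>

lemma pcm_mem:
  assumes A: "A \<in> Alg R" and \<psi>: "\<psi> \<in> characters ch.H1 A"
  shows "pcm A \<psi> \<in> PCh A"
  unfolding PC_def pseudocharacters_def
proof (intro CollectI conjI allI impI ballI)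
  show "pcm A \<psi> \<in> (\<Pi>\<^sub>E n \<in> {1..}. alg_hom R (IF n) (map_alg (tuples n \<Gamma>) A))"
    unfolding pcm_def restrict_PiE_iff by (intro ballI Th_alg_hom[OF A \<psi>])
  fix m n :: nat and \<zeta> f w
  assume m: "1 \<le> m" and n: "1 \<le> n" and \<zeta>: "\<zeta> \<in> {1..m} \<rightarrow> {1..n}" and f: "f \<in> carrier (IF m)" and w: "w \<in> tuples n \<Gamma>"
  note w' = reindex_tuple[OF w \<zeta>]
  show "pcm A \<psi> n (reindex_function R G m n \<zeta> f) w = pcm A \<psi> m f (\<lambda>i \<in> {1..m}. w (\<zeta> i))"
    unfolding pcm_apply[OF n reindex_IF[OF f \<zeta>] w] pcm_apply[OF m f w']
    by (rule Th_push[OF A \<psi> IF_regular[OF f] w' ch.reidx_hom coef_reindex[OF IF_regular[OF f] w \<zeta>]])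
      (simp only: ch.qc_def ch.cls_reidx[OF w \<zeta>])
next
  fix n :: nat and f w assume n: "1 \<le> n" and f: "f \<in> carrier (IF n)" and w: "w \<in> tuples (Suc n) \<Gamma>"
  have sn: "1 \<le> Suc n" by simp
  note w' = ch.merge_tuple[OF w n]
  show "pcm A \<psi> (Suc n) (merge_function R G n f) w = pcm A \<psi> n f (merge_last \<Gamma> n w)"
    unfolding pcm_apply[OF sn merge_IF[OF f n] w] pcm_apply[OF n f w']
    by (rule Th_push[OF A \<psi> IF_regular[OF f] w' ch.mg_hom[OF w n] coef_merge[OF IF_regular[OF f] n w] ch.qc_mg[OF w n]])
next
  show "push_pseudocharacter R G Cf (\<lambda>B. {\<one>\<^bsub>pts Cf B\<^esub>}) \<pi> (pcm A \<psi>) =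
    attached_pseudocharacter R Cf (\<lambda>B. {\<one>\<^bsub>pts Cf B\<^esub>}) \<Gamma> A (rr A)"
    unfolding push_pseudocharacter_def attached_pseudocharacter_def
  proof (intro restrict_ext)
    fix n :: nat and f assume "n \<in> {1..}" and f: "f \<in> carrier (inv_functions R Cf (\<lambda>B. {\<one>\<^bsub>pts Cf B\<^esub>}) n)"
    then have n: "1 \<le> n" by simp
    have fr: "f \<in> regular_functions R Cf n"
      using f by (simp add: inv_functions_def)
    interpret Mpg: comm_group "Mp n" by (rule ch.comm_group_Mp)
    interpret Tg: monoid_alg_target R "Mp n" A by (rule target_Mp[OF A])
    show "pcm A \<psi> n (pull_function R G n \<pi> f) = (\<lambda>w \<in> tuples n \<Gamma>. f A (\<lambda>i \<in> {1..n}. rr A (w i)))"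
    proof -
      have "pcm A \<psi> n (pull_function R G n \<pi> f) = (\<lambda>w \<in> tuples n \<Gamma>. Th A \<psi> n (pull_function R G n \<pi> f) w)"
        unfolding pcm_def using n pull_IF[OF fr] by (simp only: restrict_apply' atLeast_iff)
      also have "\<dots> = (\<lambda>w \<in> tuples n \<Gamma>. f A (\<lambda>i \<in> {1..n}. rr A (w i)))"
      proof (rule restrict_ext)
        fix w assume w: "w \<in> tuples n \<Gamma>"
        show "Th A \<psi> n (pull_function R G n \<pi> f) w = f A (\<lambda>i \<in> {1..n}. rr A (w i))"
          unfolding Th_def coef_pull(2)[OF fr w] coef_pull(3)[OF fr w A]
            Tg.lin_ext_smult[OF Tg.monomial_closed[OF Mpg.one_closed] coef_pull(1)[OF fr w] hx_closed[OF A \<psi>]]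
            Tg.lin_ext_monomial[OF Mpg.one_closed hx_closed[OF A \<psi>]] hx_one[OF A \<psi> w] ..
      qed
      finally show ?thesis .
    qed
  qed
qed

lemma alg_hom_lin_ext:
  assumes A: "A \<in> Alg R" and B: "B \<in> Alg R" and \<phi>: "\<phi> \<in> alg_hom R A B"
    and h: "h \<in> carrier (Mp n) \<rightarrow> carrier A" and F: "F \<in> carrier (PM n)"
  shows "\<phi> (lin_ext R (Mp n) A h F) = lin_ext R (Mp n) B (\<lambda>z. \<phi> (h z)) F"
proof -
  interpret TA: monoid_alg_target R "Mp n" A by (rule target_Mp[OF A])
  interpret TB: monoid_alg_target R "Mp n" B by (rule target_Mp[OF B])
  show ?thesis
  proof (rule TB.linear_eq_lin_ext[where \<phi> = "\<lambda>F. \<phi> (lin_ext R (Mp n) A h F)", OF _ _ _ _ F])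
    show "(\<lambda>z. \<phi> (h z)) \<in> carrier (Mp n) \<rightarrow> carrier B"
      using h alg_hom_closed[OF \<phi>] by blast
  qed (simp_all add: TA.lin_ext_add[OF _ _ h] TA.lin_ext_smult[OF _ _ h] TA.lin_ext_monomial[OF _ h]
      TA.lin_ext_closed[OF _ h] alg_hom_simps[OF \<phi>])
qed

lemma pcm_natural:
  assumes A: "A \<in> Alg R" and B: "B \<in> Alg R" and \<phi>: "\<phi> \<in> alg_hom R A B" and \<psi>: "\<psi> \<in> characters ch.H1 A"
  shows "pcm B (compose (carrier ch.H1) \<phi> \<psi>) = PC_map R G T \<Gamma> A B \<phi> (pcm A \<psi>)"
  unfolding PC_map_def
proof (subst pcm_def, intro restrict_ext)
  fix n :: nat and f w assume n: "n \<in> {1..}" and f: "f \<in> carrier (IF n)" and w: "w \<in> tuples n \<Gamma>"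
  interpret A: algebra R A by (rule AlgD[OF A])
  interpret B: algebra R B by (rule AlgD[OF B])
  have n1: "1 \<le> n" using n by simp
  \<comment> \<open>The default value 0 outside the cycles is preserved by \<open>\<phi>\<close>, so
    the two functions agree everywhere.\<close>
  have "hx B (compose (carrier ch.H1) \<phi> \<psi>) n w = (\<lambda>z. \<phi> (hx A \<psi> n w z))"
    using alg_hom_zero[OF \<phi> A.ring_axioms B.ring_axioms] by (auto simp: hx_def compose_eq)
  then show "Th B (compose (carrier ch.H1) \<phi> \<psi>) n f w = \<phi> (pcm A \<psi> n f w)"
    unfolding pcm_apply[OF n1 f w] Th_def alg_hom_lin_ext[OF A B \<phi> hx_closed[OF A \<psi>] coef(1)[OF IF_regular[OF f] w]]
    by (simp only:)
qed

end

lemma (in monoid_alg_target) lin_ext_cong_on: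
  assumes F: "F \<in> carrier P" and h': "h' \<in> carrier N \<rightarrow> carrier A"
    and eq: "\<And>z. z \<in> supp F \<Longrightarrow> h z = h' z"
  shows "lin_ext R N A h F = lin_ext R N A h' F"
  unfolding lin_ext_def by (rule A.finsum_cong') (use F h' eq in auto)

section \<open>Indicator functions of components\<close>

context split_extension
begin

lemma tr_id: "A \<in> Alg R \<Longrightarrow> g \<in> carrier (Gp A) \<Longrightarrow> tr A A (\<lambda>a \<in> carrier A. a) g = g"
  using G unfolding is_group_functor_def by blast

definition agree where "agree A n w x = {Q \<in> spec A. \<forall>i \<in> {1..n}. x i Q = \<pi> A (r A (w i)) Q}"

text \<open>The entries of \<open>x\<close> and the images of the reference points are locally
  constant, so every relation between their values defines an open set. Equality gives the locus,
  its negation the complement.\<close>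

lemma agree_clopen:
  assumes A: "A \<in> Alg R" and w: "w \<in> tuples n \<Gamma>" and x: "x \<in> tuples n (pts Cf A)"
  shows "openin (zariski A) (agree A n w x)" "openin (zariski A) (spec A - agree A n w x)"
proof -
  interpret A: algebra R A by (rule AlgD[OF A])
  note top = A.topspace_zariski
  have rel: "openin (zariski A) {Q \<in> spec A. (x i Q, \<pi> A (r A (w i)) Q) \<in> S}"
    if i: "i \<in> {1..n}" for i S
  proof -
    define u where "u = \<pi> A (r A (w i))"
    have xi: "x i \<in> carrier (pts Cf A)" and ui: "u \<in> carrier (pts Cf A)"
      unfolding u_def using x i \<pi>_closed[OF A r_closed[OF A ch.tuple_mem[OF w i]]] by blast+
    have op: "openin (zariski A) {Q \<in> spec A. y Q = c}" if "y \<in> carrier (pts Cf A)" "c \<in> carrier C" for y c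
    proof -
      have "continuous_map (zariski A) (discrete_topology (carrier C)) y"
        using that(1) by (simp add: constant_group_def)
      from openin_continuous_map_preimage[OF this, of "{c}"] show ?thesis
        using that(2) by (simp add: top)
    qed
    have cl: "y Q \<in> carrier C" if "y \<in> carrier (pts Cf A)" "Q \<in> spec A" for y Q
      using that by (auto simp: constant_group_def)
    have "{Q \<in> spec A. (x i Q, u Q) \<in> S} =
      (\<Union>p \<in> S \<inter> carrier C \<times> carrier C. {Q \<in> spec A. x i Q = fst p} \<inter> {Q \<in> spec A. u Q = snd p})"
      using cl[OF xi] cl[OF ui] by force
    also have "openin (zariski A) \<dots>"
      by (intro openin_Union ballI) (use op[OF xi] op[OF ui] in auto)
    finally show ?thesis
      unfolding u_def .
  qed
  \<comment> \<open>The whole spectrum is inserted so that the intersection is correct for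
    \<open>n = 0\<close>.\<close>
  have "openin (zariski A) (\<Inter> (insert (spec A) ((\<lambda>i. {Q \<in> spec A. (x i Q, \<pi> A (r A (w i)) Q) \<in> Id}) ` {1..n})))"
  proof (rule openin_Inter)
    fix U assume "U \<in> insert (spec A) ((\<lambda>i. {Q \<in> spec A. (x i Q, \<pi> A (r A (w i)) Q) \<in> Id}) ` {1..n})"
    then show "openin (zariski A) U"
      using rel openin_topspace[of "zariski A"] unfolding top by blast
  qed simp_all
  moreover have "\<Inter> (insert (spec A) ((\<lambda>i. {Q \<in> spec A. (x i Q, \<pi> A (r A (w i)) Q) \<in> Id}) ` {1..n})) = agree A n w x"
    by (auto simp: agree_def)
  ultimately show "openin (zariski A) (agree A n w x)"
    by simp
  have "openin (zariski A) (\<Union>i \<in> {1..n}. {Q \<in> spec A. (x i Q, \<pi> A (r A (w i)) Q) \<in> - Id})"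
    using rel by (intro openin_Union) blast
  moreover have "(\<Union>i \<in> {1..n}. {Q \<in> spec A. (x i Q, \<pi> A (r A (w i)) Q) \<in> - Id}) = spec A - agree A n w x"
    by (auto simp: agree_def)
  ultimately show "openin (zariski A) (spec A - agree A n w x)"
    by simp
qed

text \<open>
  The indicator function, as an idempotent of \<open>A\<close>, of the locus where a point of \<open>(G/T)\<^sup>n\<close> lies in the component of \<open>w\<close>.
\<close>

definition ei where "ei A n w x = idem_of A (agree A n w x)"

lemma ei:
  assumes A: "A \<in> Alg R" and w: "w \<in> tuples n \<Gamma>" and x: "x \<in> tuples n (pts Cf A)"
  shows "ei A n w x \<in> carrier A" "ei A n w x \<otimes>\<^bsub>A\<^esub> ei A n w x = ei A n w x"
    "Q \<in> spec A \<Longrightarrow> ei A n w x \<notin> Q \<longleftrightarrow> Q \<in> agree A n w x"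
proof -
  interpret A: algebra R A by (rule AlgD[OF A])
  show "ei A n w x \<in> carrier A" "ei A n w x \<otimes>\<^bsub>A\<^esub> ei A n w x = ei A n w x"
    "Q \<in> spec A \<Longrightarrow> ei A n w x \<notin> Q \<longleftrightarrow> Q \<in> agree A n w x"
    unfolding ei_def by (rule A.idem_of[OF agree_clopen[OF A w x]])+
qed

lemma ei_eqI:
  assumes A: "A \<in> Alg R" and w: "w \<in> tuples n \<Gamma>" and x: "x \<in> tuples n (pts Cf A)"
    and e: "e \<in> carrier A" "e \<otimes>\<^bsub>A\<^esub> e = e" "\<And>Q. Q \<in> spec A \<Longrightarrow> e \<notin> Q \<longleftrightarrow> Q \<in> agree A n w x"
  shows "ei A n w x = e"
proof -
  interpret A: algebra R A by (rule AlgD[OF A])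
  show ?thesis
    unfolding ei_def by (rule A.idem_of_eqI[OF agree_clopen[OF A w x] e])
qed

text \<open>An idempotent is determined by the primes that avoid it, and the locus of agreement is
  compatible with base change.\<close>

lemma ei_natural:
  assumes A: "A \<in> Alg R" and B: "B \<in> Alg R" and \<phi>: "\<phi> \<in> alg_hom R A B" and w: "w \<in> tuples n \<Gamma>"
    and x: "x \<in> tuples n (pts Cf A)" and y: "y \<in> tuples n (pts Cf B)"
    and xy: "\<And>i Q. i \<in> {1..n} \<Longrightarrow> Q \<in> spec B \<Longrightarrow> y i Q = x i (spec_map A \<phi> Q)"
  shows "ei B n w y = \<phi> (ei A n w x)"
proof (rule ei_eqI[OF B w y])
  note e = ei[OF A w x]
  show "\<phi> (ei A n w x) \<in> carrier B" "\<phi> (ei A n w x) \<otimes>\<^bsub>B\<^esub> \<phi> (ei A n w x) = \<phi> (ei A n w x)"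
    using e(1,2) alg_hom_closed[OF \<phi>] alg_hom_simps(1)[OF \<phi> e(1) e(1)] by simp_all
  fix Q assume Q: "Q \<in> spec B"
  note Q' = spec_map_spec[OF AlgD[OF A] AlgD[OF B] \<phi> Q]
  have "\<phi> (ei A n w x) \<notin> Q \<longleftrightarrow> ei A n w x \<notin> spec_map A \<phi> Q"
    using e(1) by (simp add: spec_map_def)
  also have "\<dots> \<longleftrightarrow> spec_map A \<phi> Q \<in> agree A n w x"
    by (rule e(3)[OF Q'])
  also have "\<dots> \<longleftrightarrow> Q \<in> agree B n w y"
  proof -
    have "x i (spec_map A \<phi> Q) = y i Q \<and> \<pi> A (r A (w i)) (spec_map A \<phi> Q) = \<pi> B (r B (w i)) Q" if i: "i \<in> {1..n}" for i
      using xy[OF i Q] \<pi>_tr[OF A B \<phi> r_closed[OF A ch.tuple_mem[OF w i]] Q] tr_r[OF A B \<phi> ch.tuple_mem[OF w i]] by simp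
    then show ?thesis
      using Q Q' unfolding agree_def by simp
  qed
  finally show "\<phi> (ei A n w x) \<notin> Q \<longleftrightarrow> Q \<in> agree B n w y" .
qed

lemma ei_all:
  assumes A: "A \<in> Alg R" and w: "w \<in> tuples n \<Gamma>" and x: "x \<in> tuples n (pts Cf A)"
    and eq: "\<And>i. i \<in> {1..n} \<Longrightarrow> x i = \<pi> A (r A (w i))"
  shows "ei A n w x = \<one>\<^bsub>A\<^esub>"
proof (rule ei_eqI[OF A w x])
  interpret A: algebra R A by (rule AlgD[OF A])
  show "\<one>\<^bsub>A\<^esub> \<in> carrier A" "\<one>\<^bsub>A\<^esub> \<otimes>\<^bsub>A\<^esub> \<one>\<^bsub>A\<^esub> = \<one>\<^bsub>A\<^esub>"
    by simp_all
  show "\<one>\<^bsub>A\<^esub> \<notin> Q \<longleftrightarrow> Q \<in> agree A n w x" if "Q \<in> spec A" for Q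
    using that A.spec_mem(2)[OF that A.one_closed A.one_closed] eq by (simp add: agree_def)
qed

definition ind where "ind n w = (\<lambda>A \<in> Alg R. \<lambda>x \<in> tuples n (pts Cf A). ei A n w x)"

text \<open>Locally constant functions pull back along the map of spectra, which is continuous since
  the preimage of \<open>D(a)\<close> is \<open>D(\<phi> a)\<close>.\<close>

lemma transport_Cf_tuple:
  assumes A: "A \<in> Alg R" and B: "B \<in> Alg R" and \<phi>: "\<phi> \<in> alg_hom R A B" and x: "x \<in> tuples n (pts Cf A)"
  shows "(\<lambda>i \<in> {1..n}. transport Cf A B \<phi> (x i)) \<in> tuples n (pts Cf B)"
proof -
  interpret A: algebra R A by (rule AlgD[OF A])
  interpret B: algebra R B by (rule AlgD[OF B])
  have "transport Cf A B \<phi> y \<in> carrier (pts Cf B)" if y: "y \<in> carrier (pts Cf A)" for y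
  proof -
    have yC: "y Q \<in> carrier C" if "Q \<in> spec A" for Q
      using y that by (auto simp: constant_group_def)
    have cont: "continuous_map (zariski A) (discrete_topology (carrier C)) y"
      using y by (simp add: constant_group_def)
    have sp: "spec_map A \<phi> Q \<in> spec A" if "Q \<in> spec B" for Q
      by (rule spec_map_spec[OF AlgD[OF A] AlgD[OF B] \<phi> that])
    have "continuous_map (zariski B) (zariski A) (spec_map A \<phi>)"
      unfolding zariski_def[of A]
    proof (rule continuous_on_generated_topo)
      fix U assume "U \<in> {{P \<in> spec A. a \<notin> P} |a. a \<in> carrier A}"
      then obtain a where a: "a \<in> carrier A" and U: "U = {P \<in> spec A. a \<notin> P}"
        by blast
      have "spec_map A \<phi> -` U \<inter> topspace (zariski B) = {Q \<in> spec B. \<phi> a \<notin> Q}"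
        using sp a by (auto simp: U B.topspace_zariski spec_map_def)
      then show "openin (zariski B) (spec_map A \<phi> -` U \<inter> topspace (zariski B))"
        using B.zariski_open_basic[OF alg_hom_closed[OF \<phi> a]] by simp
    next
      have "\<one>\<^bsub>A\<^esub> \<notin> P" if "P \<in> spec A" for P
        using A.spec_mem(2)[OF that A.one_closed A.one_closed] .
      then have "spec A \<subseteq> \<Union> {{P \<in> spec A. a \<notin> P} |a. a \<in> carrier A}"
        by blast
      then show "spec_map A \<phi> ` topspace (zariski B) \<subseteq> \<Union> {{P \<in> spec A. a \<notin> P} |a. a \<in> carrier A}"
        using sp by (auto simp: B.topspace_zariski)
    qed
    from continuous_map_compose[OF this cont]
    have "continuous_map (zariski B) (discrete_topology (carrier C)) (\<lambda>Q \<in> spec B. y (spec_map A \<phi> Q))"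
      by (rule continuous_map_eq) (simp add: B.topspace_zariski)
    then show ?thesis
      using yC[OF sp] by (simp add: constant_group_def)
  qed
  then show ?thesis
    using x by (auto simp: PiE_iff)
qed

lemma ind_regular:
  assumes w: "w \<in> tuples n \<Gamma>"
  shows "ind n w \<in> regular_functions R Cf n"
  unfolding ind_def
proof (rule regular_functionsI, rule ei(1)[OF _ w], assumption+, rule conjI)
  fix A B :: "('u, 'u) module" and \<phi> x
  assume A: "A \<in> Alg R" and B: "B \<in> Alg R" and \<phi>: "\<phi> \<in> alg_hom R A B" and x: "x \<in> tuples n (pts Cf A)"
  show y: "(\<lambda>i \<in> {1..n}. transport Cf A B \<phi> (x i)) \<in> tuples n (pts Cf B)"
    by (rule transport_Cf_tuple[OF A B \<phi> x])
  show "ei B n w (\<lambda>i \<in> {1..n}. transport Cf A B \<phi> (x i)) = \<phi> (ei A n w x)"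
    by (rule ei_natural[OF A B \<phi> w x y]) (simp add: constant_group_def)
qed

text \<open>On the component group only conjugation by the neutral element is imposed, so invariance
  amounts to the unit laws for locally constant functions.\<close>

lemma ind_inv_functions:
  assumes w: "w \<in> tuples n \<Gamma>"
  shows "ind n w \<in> carrier (inv_functions R Cf (\<lambda>B. {\<one>\<^bsub>pts Cf B\<^esub>}) n)"
proof -
  have "(\<lambda>i \<in> {1..n}. \<one>\<^bsub>pts Cf A\<^esub> \<otimes>\<^bsub>pts Cf A\<^esub> x i \<otimes>\<^bsub>pts Cf A\<^esub> inv\<^bsub>pts Cf A\<^esub> \<one>\<^bsub>pts Cf A\<^esub>) = x"
    if A: "A \<in> Alg R" and x: "x \<in> tuples n (pts Cf A)" for A :: "('u, 'u) module" and x
  proof -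
    have ext: "y \<in> spec A \<rightarrow>\<^sub>E carrier C" if "y \<in> carrier (pts Cf A)" for y
      using that by (simp add: constant_group_def)
    have l: "\<one>\<^bsub>pts Cf A\<^esub> \<otimes>\<^bsub>pts Cf A\<^esub> y = y" if "y \<in> carrier (pts Cf A)" for y
      unfolding constant_group_def by (rule PiE_ext[OF _ ext[OF that]]) (use ext[OF that] in \<open>auto simp: PiE_iff\<close>)
    have rr: "y \<otimes>\<^bsub>pts Cf A\<^esub> \<one>\<^bsub>pts Cf A\<^esub> = y" if "y \<in> carrier (pts Cf A)" for y
      unfolding constant_group_def by (rule PiE_ext[OF _ ext[OF that]]) (use ext[OF that] in \<open>auto simp: PiE_iff\<close>)
    have one: "\<one>\<^bsub>pts Cf A\<^esub> \<in> carrier (pts Cf A)"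
    proof -
      interpret A: algebra R A by (rule AlgD[OF A])
      have "continuous_map (zariski A) (discrete_topology (carrier C)) (\<lambda>Q \<in> spec A. \<one>\<^bsub>C\<^esub>)"
        by (rule continuous_map_eq[where f = "\<lambda>_. \<one>\<^bsub>C\<^esub>"]) (simp_all add: A.topspace_zariski)
      then show ?thesis
        by (simp add: constant_group_def)
    qed
    have "inv\<^bsub>pts Cf A\<^esub> \<one>\<^bsub>pts Cf A\<^esub> = \<one>\<^bsub>pts Cf A\<^esub>"
      unfolding m_inv_def by (rule the_equality) (use one l in auto)
    then show ?thesis
      by (intro extensionalityI[where A = "{1..n}"]) (use x l rr in \<open>auto simp: PiE_iff\<close>)
  qed
  then show ?thesis
    using ind_regular[OF w] by (simp add: inv_functions_def)
qed


text \<open>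
  \<open>Xf n w F\<close> is the Laurent polynomial \<open>F\<close> on the component of \<open>w\<close> and 0 on the other components. At a
  point \<open>g\<close> over \<open>A\<close> it is evaluated over the factor \<open>crn A n w g\<close> of \<open>A\<close> over which \<open>g\<close> lies in the component of \<open>w\<close>.
\<close>

definition \<pi>t where "\<pi>t A n g = (\<lambda>i \<in> {1..n}. \<pi> A (g i))"

definition eg where "eg A n w g = ei A n w (\<pi>t A n g)"

definition crn where "crn A n w g = corner A (eg A n w g)"

definition crm where "crm A n w g = corner_map A (eg A n w g)"

text \<open>The torus coordinates of \<open>g\<close> relative to the reference points, over the
  factor on which both lie in the same component.\<close>

definition sg where "sg A n w g = (\<lambda>i \<in> {1..n}. tr A (crn A n w g) (crm A n w g) (g i)
  \<otimes>\<^bsub>Gp (crn A n w g)\<^esub> inv\<^bsub>Gp (crn A n w g)\<^esub> r (crn A n w g) (w i))"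

definition Xv where "Xv n w F A g = lin_ext R (Mp n) (crn A n w g) (hch (crn A n w g) n (sg A n w g)) F"

definition Xf where "Xf n w F = (\<lambda>A \<in> Alg R. \<lambda>g \<in> tuples n (Gp A). Xv n w F A g)"

section \<open>Functions supported on a single component\<close>

lemma \<pi>t_closed: "A \<in> Alg R \<Longrightarrow> g \<in> tuples n (Gp A) \<Longrightarrow> \<pi>t A n g \<in> tuples n (pts Cf A)"
  unfolding \<pi>t_def using \<pi>_closed by (simp add: PiE_iff)

lemma eg:
  assumes A: "A \<in> Alg R" and w: "w \<in> tuples n \<Gamma>" and g: "g \<in> tuples n (Gp A)"
  shows "eg A n w g \<in> carrier A" "eg A n w g \<otimes>\<^bsub>A\<^esub> eg A n w g = eg A n w g"
    "Q \<in> spec A \<Longrightarrow> eg A n w g \<notin> Q \<longleftrightarrow> Q \<in> agree A n w (\<pi>t A n g)"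
  unfolding eg_def by (rule ei[OF A w \<pi>t_closed[OF A g]])+

lemma crn_Alg: "\<lbrakk>A \<in> Alg R; w \<in> tuples n \<Gamma>; g \<in> tuples n (Gp A)\<rbrakk> \<Longrightarrow> crn A n w g \<in> Alg R"
  unfolding crn_def by (rule corner_Alg[OF _ eg(1,2)])

lemma crm_hom: "\<lbrakk>A \<in> Alg R; w \<in> tuples n \<Gamma>; g \<in> tuples n (Gp A)\<rbrakk> \<Longrightarrow> crm A n w g \<in> alg_hom R A (crn A n w g)"
  unfolding crn_def crm_def by (rule corner_map_hom[OF AlgD eg(1,2)])

lemma tuple_gi: "g \<in> tuples n (Gp A) \<Longrightarrow> i \<in> {1..n} \<Longrightarrow> g i \<in> carrier (Gp A)"
  by blast

text \<open>A prime of the factor contracts to a prime of \<open>A\<close> that does not contain the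
  idempotent, and there \<open>g\<close> lies in the component of \<open>w\<close>. So
  \<open>g i\<close> and the reference point have the same image under \<open>\<pi>\<close> over the
  factor.\<close>

lemma sg_Tt:
  assumes A: "A \<in> Alg R" and w: "w \<in> tuples n \<Gamma>" and g: "g \<in> tuples n (Gp A)"
  shows "Tt (crn A n w g) n (sg A n w g)"
proof (rule TtI)
  let ?D = "crn A n w g" and ?\<kappa> = "crm A n w g"
  note D = crn_Alg[OF A w g] and \<kappa> = crm_hom[OF A w g]
  interpret A: algebra R A by (rule AlgD[OF A])
  interpret D: algebra R ?D by (rule AlgD[OF D])
  fix i assume i: "i \<in> {1..n}"
  note gi = tuple_gi[OF g i] and ri = ch.tuple_mem[OF w i]
  have "tr A ?D ?\<kappa> (g i) \<otimes>\<^bsub>Gp ?D\<^esub> inv\<^bsub>Gp ?D\<^esub> r ?D (w i) \<in> Tp ?D"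
  proof (rule same_\<pi>[OF D tr_closed[OF A D \<kappa> gi] r_closed[OF D ri]])
    fix Q assume Q: "Q \<in> spec ?D"
    note Q' = spec_map_spec[OF AlgD[OF A] AlgD[OF D] \<kappa> Q]
    have "?\<kappa> (eg A n w g) = \<one>\<^bsub>?D\<^esub>"
      using eg(1,2)[OF A w g] by (simp add: crm_def corner_map_def crn_def)
    then have "eg A n w g \<notin> spec_map A ?\<kappa> Q"
      using D.spec_mem(2)[OF Q D.one_closed D.one_closed] by (simp add: spec_map_def)
    then have "spec_map A ?\<kappa> Q \<in> agree A n w (\<pi>t A n g)"
      using eg(3)[OF A w g Q'] by simp
    then have "\<pi> A (g i) (spec_map A ?\<kappa> Q) = \<pi> A (r A (w i)) (spec_map A ?\<kappa> Q)"
      using i by (simp add: agree_def \<pi>t_def)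
    then show "\<pi> ?D (tr A ?D ?\<kappa> (g i)) Q = \<pi> ?D (r ?D (w i)) Q"
      using \<pi>_tr[OF A D \<kappa> gi Q] \<pi>_tr[OF A D \<kappa> r_closed[OF A ri] Q] tr_r[OF A D \<kappa> ri] by simp
  qed
  then show "sg A n w g i \<in> Tp ?D"
    using i by (simp add: sg_def)
qed

lemma hch_funcset: "A \<in> Alg R \<Longrightarrow> Tt A n t \<Longrightarrow> hch A n t \<in> carrier (Mp n) \<rightarrow> carrier A"
  by (rule funcsetI) (rule characters_closed(2)[OF hch_char])

text \<open>Torus coordinates are constrained at the indices from 1 to \<open>n\<close> only and may
  be arbitrary elsewhere.\<close>

lemma hch_cong:
  assumes A: "A \<in> Alg R" and t: "Tt A n t" and eq: "\<And>i. i \<in> {1..n} \<Longrightarrow> t i = t' i"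
  shows "hch A n t = hch A n t'"
proof -
  have t': "Tt A n t'"
    using t eq by (simp add: Tt_def)
  show ?thesis
  proof (rule extensionalityI[where A = "carrier (Mp n)"])
    show "hch A n t \<mu> = hch A n t' \<mu>" if "\<mu> \<in> carrier (Mp n)" for \<mu>
      by (rule hch_eqI[OF A t _ _ that]) (use hch_char[OF A t'] hch_coord[OF A t'] eq in auto)
  qed (simp_all add: hch_def)
qed

lemma hch_tr:
  assumes A: "A \<in> Alg R" and B: "B \<in> Alg R" and \<phi>: "\<phi> \<in> alg_hom R A B" and t: "Tt A n t" and \<mu>: "\<mu> \<in> carrier (Mp n)"
  shows "hch B n (\<lambda>i. tr A B \<phi> (t i)) \<mu> = \<phi> (hch A n t \<mu>)"
proof -
  note c = characters_compose[OF \<phi> hch_char[OF A t] comm_group.axioms(2)[OF ch.comm_group_Mp]]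
  have "hch B n (\<lambda>i. tr A B \<phi> (t i)) \<mu> = compose (carrier (Mp n)) \<phi> (hch A n t) \<mu>"
  proof (rule hch_eqI[OF B _ _ _ \<mu>])
    show "Tt B n (\<lambda>i. tr A B \<phi> (t i))"
      by (rule TtI) (rule T_tr[OF A B \<phi> TtD[OF t]])
    show "compose (carrier (Mp n)) \<phi> (hch A n t) \<in> hom (Mp n) (units_of B)"
      using c by blast
    show "\<chi> B (tr A B \<phi> (t i)) m = compose (carrier (Mp n)) \<phi> (hch A n t) (coord M n i m)" if "i \<in> {1..n}" "m \<in> carrier M" for i m
      using \<chi>_tr[OF A B \<phi> TtD[OF t that(1)]] hch_coord[OF A t that] that(2) by (simp add: compose_eq ch.coord_closed)
  qed
  then show ?thesis
    using \<mu> by (simp add: compose_eq)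
qed

text \<open>Conjugation by \<open>s\<close> multiplies the monomial \<open>\<mu>\<close> by the
  value of \<open>s\<close> at minus its weight, and cycles have weight zero.\<close>

lemma hch_conj:
  assumes A: "A \<in> Alg R" and w: "w \<in> tuples n \<Gamma>" and t: "Tt A n t" and s: "s \<in> Tp A" and \<mu>: "\<mu> \<in> cycles n w"
  shows "hch A n (\<lambda>i. t i \<otimes>\<^bsub>Gp A\<^esub> (dv A s (w i))) \<mu> = hch A n t \<mu>"
proof -
  interpret A: algebra R A by (rule AlgD[OF A])
  interpret Mpg: comm_group "Mp n" by (rule ch.comm_group_Mp)
  define k where "k \<nu> = hch A n t \<nu> \<otimes>\<^bsub>A\<^esub> \<chi> A s (inv\<^bsub>M\<^esub> wt n w \<nu>)" for \<nu>
  have wc: "wt n w \<nu> \<in> carrier M" if "\<nu> \<in> carrier (Mp n)" for \<nu>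
    using hom_in_carrier[OF wt_hom[OF w] that] .
  note hu = characters_closed[OF hch_char[OF A t]]
  have "hch A n (\<lambda>i. t i \<otimes>\<^bsub>Gp A\<^esub> (dv A s (w i))) \<mu> = k \<mu>"
  proof (rule hch_eqI[OF A _ _ _ cyclesD(1)[OF \<mu>]])
    show "Tt A n (\<lambda>i. t i \<otimes>\<^bsub>Gp A\<^esub> (dv A s (w i)))"
      by (rule TtI) (rule \<chi>_conj_pt(1)[OF A ch.tuple_mem[OF w] TtD[OF t] s M.one_closed])
    show "k \<in> hom (Mp n) (units_of A)"
    proof (rule homI)
      show "k x \<in> carrier (units_of A)" if "x \<in> carrier (Mp n)" for x
        unfolding k_def units_of_carrier by (intro A.Units_m_closed hu(1)[OF that] \<chi>_Unit[OF A s] M.inv_closed wc[OF that])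
      fix x y assume x: "x \<in> carrier (Mp n)" and y: "y \<in> carrier (Mp n)"
      show "k (x \<otimes>\<^bsub>Mp n\<^esub> y) = k x \<otimes>\<^bsub>units_of A\<^esub> k y"
        using characters_mult[OF hch_char[OF A t] x y] hom_mult[OF wt_hom[OF w] x y] wc[OF x] wc[OF y]
          hu(2)[OF x] hu(2)[OF y] \<chi>_closed[OF A s M.inv_closed[OF wc[OF x]]] \<chi>_closed[OF A s M.inv_closed[OF wc[OF y]]]
        by (simp add: k_def units_of_mult M.inv_mult \<chi>_M_mult[OF A s] A.m_ac)
    qed
    show "\<chi> A (t i \<otimes>\<^bsub>Gp A\<^esub> (dv A s (w i))) m = k (coord M n i m)"
      if i: "i \<in> {1..n}" and m: "m \<in> carrier M" for i m
      using \<chi>_conj_pt(2)[OF A ch.tuple_mem[OF w i] TtD[OF t i] s m]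
      by (simp add: k_def hch_coord[OF A t i m] wt_coord[OF w i m])
  qed
  also have "wt n w \<mu> = \<one>\<^bsub>M\<^esub>"
    using cyclesD(2)[OF \<mu>] by (simp add: wt_def kernel_def)
  then have "k \<mu> = hch A n t \<mu>"
    using hu(2)[OF cyclesD(1)[OF \<mu>]] by (simp add: k_def \<chi>_M_one[OF A s])
  finally show ?thesis .
qed

lemma pt_sg:
  assumes A: "A \<in> Alg R" and w: "w \<in> tuples n \<Gamma>" and g: "g \<in> tuples n (Gp A)"
  shows "pt (crn A n w g) n w (sg A n w g) = (\<lambda>i \<in> {1..n}. tr A (crn A n w g) (crm A n w g) (g i))"
  unfolding pt_def
proof (rule restrict_ext)
  let ?D = "crn A n w g" and ?\<kappa> = "crm A n w g"
  note D = crn_Alg[OF A w g] and \<kappa> = crm_hom[OF A w g]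
  interpret Gp: group "Gp ?D" by (rule group_G[OF D])
  fix i assume i: "i \<in> {1..n}"
  show "sg A n w g i \<otimes>\<^bsub>Gp ?D\<^esub> r ?D (w i) = tr A ?D ?\<kappa> (g i)"
    using i tr_closed[OF A D \<kappa> tuple_gi[OF g i]] r_closed[OF D ch.tuple_mem[OF w i]] by (simp add: sg_def Gp.m_assoc)
qed

lemma Xv_closed:
  assumes A: "A \<in> Alg R" and w: "w \<in> tuples n \<Gamma>" and g: "g \<in> tuples n (Gp A)" and F: "F \<in> carrier (PM n)"
  shows "Xv n w F A g \<in> carrier (crn A n w g)" "Xv n w F A g \<in> carrier A"
proof -
  note D = crn_Alg[OF A w g]
  interpret Tg: monoid_alg_target R "Mp n" "crn A n w g" by (rule target_Mp[OF D])
  show "Xv n w F A g \<in> carrier (crn A n w g)"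
    unfolding Xv_def by (rule Tg.lin_ext_closed[OF F hch_funcset[OF D sg_Tt[OF A w g]]])
  then show "Xv n w F A g \<in> carrier A"
    by (simp add: crn_def)
qed

text \<open>The idempotent of \<open>g\<close> is carried to that of its image, so
  \<open>\<phi>\<close> restricts to the factors. The restriction carries torus coordinates to torus
  coordinates, and evaluating a Laurent polynomial is natural.\<close>

lemma Xv_natural:
  assumes A: "A \<in> Alg R" and B: "B \<in> Alg R" and \<phi>: "\<phi> \<in> alg_hom R A B" and w: "w \<in> tuples n \<Gamma>"
    and g: "g \<in> tuples n (Gp A)" and F: "F \<in> carrier (PM n)"
  shows "Xv n w F B (\<lambda>i \<in> {1..n}. tr A B \<phi> (g i)) = \<phi> (Xv n w F A g)"
proof -
  define g' where "g' = (\<lambda>i \<in> {1..n}. tr A B \<phi> (g i))"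
  have g': "g' \<in> tuples n (Gp B)"
    unfolding g'_def by (rule tuple_tr[OF A B \<phi> g])
  let ?D = "crn A n w g" and ?D' = "crn B n w g'"
  note D = crn_Alg[OF A w g] and \<kappa> = crm_hom[OF A w g] and D' = crn_Alg[OF B w g'] and \<kappa>' = crm_hom[OF B w g']
  note e = eg(1,2)[OF A w g]
  have e': "eg B n w g' = \<phi> (eg A n w g)"
    unfolding eg_def
    by (rule ei_natural[OF A B \<phi> w \<pi>t_closed[OF A g] \<pi>t_closed[OF B g']])
      (simp add: \<pi>t_def g'_def \<pi>_tr[OF A B \<phi> tuple_gi[OF g]])
  define \<phi>' where "\<phi>' = restrict \<phi> (carrier ?D)"
  have \<phi>': "\<phi>' \<in> alg_hom R ?D ?D'"
    unfolding \<phi>'_def crn_def e' by (rule corner_restrict_hom(1)[OF AlgD[OF A] AlgD[OF B] \<phi> e])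
  have comm: "compose (carrier A) \<phi>' (crm A n w g) = compose (carrier A) (crm B n w g') \<phi>"
    unfolding \<phi>'_def crn_def crm_def e' by (rule corner_restrict_hom(2)[OF AlgD[OF A] AlgD[OF B] \<phi> e])
  interpret GD: group "Gp ?D" by (rule group_G[OF D])
  interpret Tg: monoid_alg_target R "Mp n" ?D' by (rule target_Mp[OF D'])
  have s: "tr ?D ?D' \<phi>' (sg A n w g i) = sg B n w g' i" if i: "i \<in> {1..n}" for i
  proof -
    note gi = tuple_gi[OF g i] and ri = ch.tuple_mem[OF w i]
    have "tr ?D ?D' \<phi>' (tr A ?D (crm A n w g) (g i)) = tr B ?D' (crm B n w g') (tr A B \<phi> (g i))"
      using tr_compose[OF A D D' \<kappa> \<phi>' gi] tr_compose[OF A B D' \<phi> \<kappa>' gi] by (simp add: comm)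
    then show ?thesis
      using i tr_mult[OF D D' \<phi>' tr_closed[OF A D \<kappa> gi] GD.inv_closed[OF r_closed[OF D ri]]]
        tr_inv[OF D D' \<phi>' r_closed[OF D ri]] tr_r[OF D D' \<phi>' ri] by (simp add: sg_def g'_def)
  qed
  have st: "Tt ?D' n (\<lambda>i. tr ?D ?D' \<phi>' (sg A n w g i))"
    by (rule TtI) (rule T_tr[OF D D' \<phi>' TtD[OF sg_Tt[OF A w g]]])
  have "hch ?D' n (sg B n w g') = hch ?D' n (\<lambda>i. tr ?D ?D' \<phi>' (sg A n w g i))"
    by (rule hch_cong[OF D' st s, symmetric])
  then have "Xv n w F B g' = lin_ext R (Mp n) ?D' (hch ?D' n (\<lambda>i. tr ?D ?D' \<phi>' (sg A n w g i))) F"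
    by (simp add: Xv_def)
  also have "\<dots> = lin_ext R (Mp n) ?D' (\<lambda>z. \<phi>' (hch ?D n (sg A n w g) z)) F"
    by (rule Tg.lin_ext_cong[OF F]) (use hch_funcset[OF D sg_Tt[OF A w g]] alg_hom_closed[OF \<phi>'] hch_tr[OF D D' \<phi>' sg_Tt[OF A w g]] in auto)
  also have "\<dots> = \<phi>' (Xv n w F A g)"
    unfolding Xv_def by (rule alg_hom_lin_ext[OF D D' \<phi>' hch_funcset[OF D sg_Tt[OF A w g]] F, symmetric])
  also have "\<dots> = \<phi> (Xv n w F A g)"
    unfolding \<phi>'_def using Xv_closed(1)[OF A w g F] by simp
  finally show ?thesis
    unfolding g'_def .
qed

text \<open>Conjugation by the torus changes neither the image under \<open>\<pi>\<close> nor,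
  therefore, the factor. It multiplies the torus coordinates by commutators, which monomials with a
  cycle as exponent do not see.\<close>

lemma Xv_conj:
  assumes A: "A \<in> Alg R" and w: "w \<in> tuples n \<Gamma>" and g: "g \<in> tuples n (Gp A)" and s: "s \<in> Tp A"
    and F: "F \<in> carrier (PM n)" "{\<mu> \<in> carrier (Mp n). F \<mu> \<noteq> \<zero>\<^bsub>R\<^esub>} \<subseteq> cycles n w"
  shows "Xv n w F A (cjt A n s g) = Xv n w F A g"
proof -
  define g' where "g' = cjt A n s g"
  have g': "g' \<in> tuples n (Gp A)"
    unfolding g'_def by (rule cjt_closed[OF A g s])
  have "\<pi>t A n g' = \<pi>t A n g"
    unfolding \<pi>t_def g'_def cjt_def by (rule restrict_ext) (simp add: \<pi>_conj[OF A s tuple_gi[OF g]])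
  then have eq: "crn A n w g' = crn A n w g" "crm A n w g' = crm A n w g"
    by (simp_all add: crn_def crm_def eg_def)
  let ?D = "crn A n w g" and ?\<kappa> = "crm A n w g" and ?s = "sg A n w g"
  note D = crn_Alg[OF A w g] and \<kappa> = crm_hom[OF A w g] and st = sg_Tt[OF A w g]
  define \<sigma> where "\<sigma> = tr A ?D ?\<kappa> s"
  have \<sigma>: "\<sigma> \<in> Tp ?D"
    unfolding \<sigma>_def by (rule T_tr[OF A D \<kappa> s])
  interpret GA: group "Gp A" by (rule group_G[OF A])
  interpret GD: group "Gp ?D" by (rule group_G[OF D])
  interpret Tg: monoid_alg_target R "Mp n" ?D by (rule target_Mp[OF D])
  define t' where "t' i = ?s i \<otimes>\<^bsub>Gp ?D\<^esub> (dv ?D \<sigma> (w i))" for i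
  have t': "Tt ?D n t'"
    unfolding t'_def by (rule TtI) (rule \<chi>_conj_pt(1)[OF D ch.tuple_mem[OF w] TtD[OF st] \<sigma> M.one_closed])
  have sG: "s \<in> carrier (Gp A)"
    by (rule T_G[OF A s])
  have "(\<lambda>i \<in> {1..n}. tr A ?D ?\<kappa> (g' i)) = cjt ?D n \<sigma> (\<lambda>i \<in> {1..n}. tr A ?D ?\<kappa> (g i))"
    unfolding cjt_def
  proof (rule restrict_ext)
    fix i assume i: "i \<in> {1..n}"
    show "tr A ?D ?\<kappa> (g' i) = \<sigma> \<otimes>\<^bsub>Gp ?D\<^esub> (\<lambda>i \<in> {1..n}. tr A ?D ?\<kappa> (g i)) i \<otimes>\<^bsub>Gp ?D\<^esub> inv\<^bsub>Gp ?D\<^esub> \<sigma>"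
      using i tuple_gi[OF g i] sG by (simp add: g'_def cjt_def \<sigma>_def tr_mult[OF A D \<kappa>] tr_inv[OF A D \<kappa>])
  qed
  also have "\<dots> = pt ?D n w t'"
    unfolding pt_sg[OF A w g, symmetric] t'_def by (rule conj_pt[OF D w st \<sigma>])
  finally have p: "pt ?D n w (sg A n w g') = pt ?D n w t'"
    using pt_sg[OF A w g'] by (simp only: eq)
  have st': "Tt ?D n (sg A n w g')"
    using sg_Tt[OF A w g'] by (simp only: eq)
  have "t' i = sg A n w g' i" if i: "i \<in> {1..n}" for i
  proof -
    have "sg A n w g' i \<otimes>\<^bsub>Gp ?D\<^esub> r ?D (w i) = t' i \<otimes>\<^bsub>Gp ?D\<^esub> r ?D (w i)"
      using fun_cong[OF p, of i] i by (simp add: pt_def)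
    then show ?thesis
      using T_G[OF D TtD[OF t' i]] T_G[OF D TtD[OF st' i]] r_closed[OF D ch.tuple_mem[OF w i]] by simp
  qed
  then have "hch ?D n (sg A n w g') = hch ?D n t'"
    by (rule hch_cong[OF D t', symmetric])
  then have "Xv n w F A g' = lin_ext R (Mp n) ?D (hch ?D n t') F"
    by (simp add: Xv_def eq)
  also have "\<dots> = lin_ext R (Mp n) ?D (hch ?D n ?s) F"
  proof (rule Tg.lin_ext_cong_on[OF F(1) hch_funcset[OF D st]])
    fix \<mu> assume "\<mu> \<in> {\<mu> \<in> carrier (Mp n). F \<mu> \<noteq> \<zero>\<^bsub>R\<^esub>}"
    then have "\<mu> \<in> cycles n w"
      using F(2) by blast
    then show "hch ?D n t' \<mu> = hch ?D n ?s \<mu>"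
      unfolding t'_def by (rule hch_conj[OF D w st \<sigma>])
  qed
  finally show ?thesis
    by (simp add: g'_def Xv_def)
qed

lemma Xf_IF:
  assumes w: "w \<in> tuples n \<Gamma>" and F: "F \<in> carrier (PM n)" "{\<mu> \<in> carrier (Mp n). F \<mu> \<noteq> \<zero>\<^bsub>R\<^esub>} \<subseteq> cycles n w"
  shows "Xf n w F \<in> carrier (IF n)"
  unfolding Xf_def
  by (rule IF_restrict[OF Xv_closed(2)[OF _ w _ F(1)] Xv_natural[OF _ _ _ w _ F(1)] Xv_conj[OF _ w _ _ F]])

lemma Xf_apply: "A \<in> Alg R \<Longrightarrow> g \<in> tuples n (Gp A) \<Longrightarrow> Xf n w F A g = Xv n w F A g"
  unfolding Xf_def by (simp only: restrict_apply')

text \<open>At a point of the component of \<open>w\<close> the idempotent is 1, so the factor is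
  \<open>A\<close> itself and the torus coordinates are the given ones.\<close>

lemma coef_Xf:
  assumes w: "w \<in> tuples n \<Gamma>" and F: "F \<in> carrier (PM n)"
  shows "coef n w (Xf n w F) = F"
proof (rule coef_eqI[OF w F])
  fix A :: "('u, 'u) module" and t assume A: "A \<in> Alg R" and t: "Tt A n t"
  interpret A: algebra R A by (rule AlgD[OF A])
  interpret Gp: group "Gp A" by (rule group_G[OF A])
  note g = pt_closed[OF A w t]
  have e: "eg A n w (pt A n w t) = \<one>\<^bsub>A\<^esub>"
    unfolding eg_def
    by (rule ei_all[OF A w \<pi>t_closed[OF A g]])
      (simp add: \<pi>t_def pt_def \<pi>_T_mult[OF A TtD[OF t] r_closed[OF A ch.tuple_mem[OF w]]])
  have c: "crn A n w (pt A n w t) = A"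
    unfolding crn_def e corner_def by (rule module.equality) auto
  have m: "crm A n w (pt A n w t) = (\<lambda>a \<in> carrier A. a)"
    unfolding crm_def e corner_map_def by (rule restrict_ext) simp
  have "hch A n t = hch A n (sg A n w (pt A n w t))"
  proof (rule hch_cong[OF A t])
    fix i assume i: "i \<in> {1..n}"
    have "sg A n w (pt A n w t) i = pt A n w t i \<otimes>\<^bsub>Gp A\<^esub> inv\<^bsub>Gp A\<^esub> r A (w i)"
      using i tr_id[OF A tuple_gi[OF g i]] by (simp add: sg_def c m)
    then show "t i = sg A n w (pt A n w t) i"
      using i T_G[OF A TtD[OF t i]] r_closed[OF A ch.tuple_mem[OF w i]] by (simp add: pt_def Gp.m_assoc)
  qed
  then show "Xf n w F A (pt A n w t) = lin_ext R (Mp n) A (hch A n t) F"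
    by (simp add: Xf_apply[OF A g] Xv_def c)
qed

text \<open>The constant polynomial takes as value the unit of the factor, which as an element of
  \<open>A\<close> is the idempotent.\<close>

lemma Xf_one:
  assumes w: "w \<in> tuples n \<Gamma>"
  shows "Xf n w (monomial R (Mp n) \<one>\<^bsub>Mp n\<^esub>) = pull_function R G n \<pi> (ind n w)"
proof -
  interpret Mpg: comm_group "Mp n" by (rule ch.comm_group_Mp)
  have "Xv n w (monomial R (Mp n) \<one>\<^bsub>Mp n\<^esub>) A g = ind n w A (\<lambda>i \<in> {1..n}. \<pi> A (g i))"
    if A: "A \<in> Alg R" and g: "g \<in> tuples n (Gp A)" for A :: "('u, 'u) module" and g
  proof -
    note D = crn_Alg[OF A w g]
    interpret Tg: monoid_alg_target R "Mp n" "crn A n w g" by (rule target_Mp[OF D])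
    have "ind n w A (\<pi>t A n g) = eg A n w g"
      unfolding ind_def eg_def using A \<pi>t_closed[OF A g] by (simp only: restrict_apply')
    then show ?thesis
      unfolding Xv_def Tg.lin_ext_monomial[OF Mpg.one_closed hch_funcset[OF D sg_Tt[OF A w g]]]
        characters_one[OF hch_char[OF D sg_Tt[OF A w g]] Mpg.is_group monoid_A[OF D]] \<pi>t_def
      by (simp add: crn_def)
  qed
  then show ?thesis
    unfolding Xf_def pull_function_def by (intro restrict_ext)
qed

text \<open>A factor inherits sum, product and scalars from \<open>A\<close> but not the unit; the
  unit polynomial goes to the indicator function of the component, in general not to 1.\<close>

lemma Xf_hom:
  assumes w: "w \<in> tuples n \<Gamma>" and F: "F \<in> carrier (PM n)" and F': "F' \<in> carrier (PM n)"
    and a: "a \<in> carrier R"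
  shows "Xf n w (F \<otimes>\<^bsub>PM n\<^esub> F') = Xf n w F \<otimes>\<^bsub>IF n\<^esub> Xf n w F'"
    "Xf n w (F \<oplus>\<^bsub>PM n\<^esub> F') = Xf n w F \<oplus>\<^bsub>IF n\<^esub> Xf n w F'"
    "Xf n w (a \<odot>\<^bsub>PM n\<^esub> F) = a \<odot>\<^bsub>IF n\<^esub> Xf n w F"
proof -
  have *: "Xv n w (F \<otimes>\<^bsub>PM n\<^esub> F') A g = Xf n w F A g \<otimes>\<^bsub>A\<^esub> Xf n w F' A g"
    "Xv n w (F \<oplus>\<^bsub>PM n\<^esub> F') A g = Xf n w F A g \<oplus>\<^bsub>A\<^esub> Xf n w F' A g"
    "Xv n w (a \<odot>\<^bsub>PM n\<^esub> F) A g = a \<odot>\<^bsub>A\<^esub> Xf n w F A g"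
    if A: "A \<in> Alg R" and g: "g \<in> tuples n (Gp A)" for A :: "('u, 'u) module" and g
  proof -
    note D = crn_Alg[OF A w g]
    note hc = hch_char[OF D sg_Tt[OF A w g]] and hf = hch_funcset[OF D sg_Tt[OF A w g]]
    interpret Tg: monoid_alg_target R "Mp n" "crn A n w g" by (rule target_Mp[OF D])
    have ops: "x \<otimes>\<^bsub>crn A n w g\<^esub> y = x \<otimes>\<^bsub>A\<^esub> y" "x \<oplus>\<^bsub>crn A n w g\<^esub> y = x \<oplus>\<^bsub>A\<^esub> y" "a \<odot>\<^bsub>crn A n w g\<^esub> y = a \<odot>\<^bsub>A\<^esub> y" for x y
      by (simp_all add: crn_def)
    show "Xv n w (F \<otimes>\<^bsub>PM n\<^esub> F') A g = Xf n w F A g \<otimes>\<^bsub>A\<^esub> Xf n w F' A g"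
      unfolding Xf_apply[OF A g] ops(1)[symmetric] Xv_def
      by (rule Tg.lin_ext_mult[OF subset_refl hf characters_mult[OF hc] F _ F']) auto
    show "Xv n w (F \<oplus>\<^bsub>PM n\<^esub> F') A g = Xf n w F A g \<oplus>\<^bsub>A\<^esub> Xf n w F' A g"
      unfolding Xf_apply[OF A g] ops(2)[symmetric] Xv_def by (rule Tg.lin_ext_add[OF F F' hf])
    show "Xv n w (a \<odot>\<^bsub>PM n\<^esub> F) A g = a \<odot>\<^bsub>A\<^esub> Xf n w F A g"
      unfolding Xf_apply[OF A g] ops(3)[symmetric] Xv_def by (rule Tg.lin_ext_smult[OF F a hf])
  qed
  show "Xf n w (F \<otimes>\<^bsub>PM n\<^esub> F') = Xf n w F \<otimes>\<^bsub>IF n\<^esub> Xf n w F'"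
    unfolding IF_ops by (subst Xf_def, intro restrict_ext) (rule *(1))
  show "Xf n w (F \<oplus>\<^bsub>PM n\<^esub> F') = Xf n w F \<oplus>\<^bsub>IF n\<^esub> Xf n w F'"
    unfolding IF_ops by (subst Xf_def, intro restrict_ext) (rule *(2))
  show "Xf n w (a \<odot>\<^bsub>PM n\<^esub> F) = a \<odot>\<^bsub>IF n\<^esub> Xf n w F"
    unfolding IF_ops by (subst Xf_def, intro restrict_ext) (rule *(3))
qed

text \<open>Multiplication by the idempotent is the passage to the factor, over which
  \<open>g\<close> is a point of the component of \<open>w\<close> and \<open>f\<close> is given by
  its Laurent polynomial.\<close>

lemma mult_Xf_one:
  assumes w: "w \<in> tuples n \<Gamma>" and f: "f \<in> carrier (IF n)"
  shows "f \<otimes>\<^bsub>IF n\<^esub> Xf n w (monomial R (Mp n) \<one>\<^bsub>Mp n\<^esub>) = Xf n w (coef n w f)"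
proof -
  interpret Mpg: comm_group "Mp n" by (rule ch.comm_group_Mp)
  have "f A g \<otimes>\<^bsub>A\<^esub> Xf n w (monomial R (Mp n) \<one>\<^bsub>Mp n\<^esub>) A g = Xv n w (coef n w f) A g"
    if A: "A \<in> Alg R" and g: "g \<in> tuples n (Gp A)" for A :: "('u, 'u) module" and g
  proof -
    let ?D = "crn A n w g" and ?\<kappa> = "crm A n w g"
    note D = crn_Alg[OF A w g] and \<kappa> = crm_hom[OF A w g] and st = sg_Tt[OF A w g]
    interpret A: algebra R A by (rule AlgD[OF A])
    interpret Tg: monoid_alg_target R "Mp n" ?D by (rule target_Mp[OF D])
    note fD = regular_functionsD[OF IF_regular[OF f] A g]
    have "Xf n w (monomial R (Mp n) \<one>\<^bsub>Mp n\<^esub>) A g = eg A n w g"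
      unfolding Xf_apply[OF A g] Xv_def Tg.lin_ext_monomial[OF Mpg.one_closed hch_funcset[OF D st]]
        characters_one[OF hch_char[OF D st] Mpg.is_group monoid_A[OF D]] by (simp add: crn_def)
    then have "f A g \<otimes>\<^bsub>A\<^esub> Xf n w (monomial R (Mp n) \<one>\<^bsub>Mp n\<^esub>) A g = ?\<kappa> (f A g)"
      using fD(1) eg(1)[OF A w g] by (simp add: crm_def corner_map_def A.m_comm)
    also have "\<dots> = f ?D (pt ?D n w (sg A n w g))"
      unfolding pt_sg[OF A w g] by (rule fD(2)[OF D \<kappa>, symmetric])
    also have "\<dots> = Xv n w (coef n w f) A g"
      unfolding Xv_def by (rule coef(2)[OF IF_regular[OF f] w D st])
    finally show ?thesis .
  qed
  then show ?thesis
    unfolding IF_ops by (subst (2) Xf_def, intro restrict_ext)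
qed

end

lemma (in monoid_alg) zero_smult_zero_P: "\<zero>\<^bsub>R\<^esub> \<odot>\<^bsub>P\<^esub> \<zero>\<^bsub>P\<^esub> = \<zero>\<^bsub>P\<^esub>"
  by (rule P_eqI) simp_all

lemma (in monoid_alg_map) push_monomial: "z \<in> carrier N \<Longrightarrow> push (monomial R N z) = monomial R N' (j z)"
  unfolding push_def by (rule target.lin_ext_monomial[OF _ jm])

section \<open>Presenting chains by tuples\<close>

context chain_groups
begin

lemma tuple_cover:
  assumes S: "finite S" "S \<subseteq> carrier \<Gamma>"
  obtains k \<delta> where "1 \<le> k" "\<delta> \<in> tuples k \<Gamma>" "inj_on \<delta> {1..k}" "S \<subseteq> \<delta> ` {1..k}"
proof -
  \<comment> \<open>Adding the neutral element keeps the length positive even for empty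
    \<open>S\<close>.\<close>
  have "finite (insert \<one> S)" "insert \<one> S \<subseteq> carrier \<Gamma>" "insert \<one> S \<noteq> {}"
    using S by simp_all
  from enumerate_tuple[OF this] obtain k \<delta> where "1 \<le> k" "\<delta> \<in> tuples k \<Gamma>" "inj_on \<delta> {1..k}" "\<delta> ` {1..k} = insert \<one> S"
    by blast
  then show thesis
    using that by blast
qed

text \<open>A tuple, possibly with repetitions, is a reindexing of any tuple \<open>\<delta>\<close>
  without repetitions that contains its entries; over \<open>\<delta>\<close> the exponents are the
  coefficients of the chain.\<close>

lemma reidx_cover:
  assumes w: "w \<in> tuples n \<Gamma>" and \<mu>: "\<mu> \<in> carrier (Mp n)"
    and \<delta>: "\<delta> \<in> tuples k \<Gamma>" "inj_on \<delta> {1..k}" and sub: "w ` {1..n} \<subseteq> \<delta> ` {1..k}"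
  obtains \<zeta> where "\<zeta> \<in> {1..n} \<rightarrow> {1..k}" "(\<lambda>i \<in> {1..n}. \<delta> (\<zeta> i)) = w"
    "reidx n k \<zeta> \<mu> = (\<lambda>i \<in> {1..k}. cls n w \<mu> (\<delta> i))"
proof -
  define \<zeta> where "\<zeta> i = inv_into {1..k} \<delta> (w i)" for i
  have im: "w i \<in> \<delta> ` {1..k}" if "i \<in> {1..n}" for i
    using sub that by blast
  have \<zeta>: "\<zeta> \<in> {1..n} \<rightarrow> {1..k}"
    unfolding \<zeta>_def using inv_into_into[OF im] by blast
  have eq: "(\<lambda>i \<in> {1..n}. \<delta> (\<zeta> i)) = w"
    by (rule extensionalityI[where A = "{1..n}"]) (use w f_inv_into_f[OF im] in \<open>auto simp: \<zeta>_def PiE_iff\<close>)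
  have rc: "reidx n k \<zeta> \<mu> \<in> carrier (Mp k)"
    by (rule hom_in_carrier[OF reidx_hom \<mu>])
  have "reidx n k \<zeta> \<mu> i = cls n w \<mu> (\<delta> i)" if "i \<in> {1..k}" for i
    using cls_apply_inj[OF \<delta> rc that] cls_reidx[OF \<delta>(1) \<zeta> \<mu>, unfolded eq] by simp
  then have "reidx n k \<zeta> \<mu> = (\<lambda>i \<in> {1..k}. cls n w \<mu> (\<delta> i))"
    by (intro extensionalityI[where A = "{1..k}"]) (use rc in \<open>auto simp: carrier_Mp PiE_iff\<close>)
  then show thesis
    by (rule that[OF \<zeta> eq])
qed

lemma Z1_C1: "c \<in> Z1 \<Longrightarrow> c \<in> carrier C1"
  by (simp add: kernel_def)

text \<open>Presenting two chains over one tuple turns their sum into a sum of exponents. The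
  supports of both are enumerated together.\<close>

lemma common_tuple:
  assumes c: "c \<in> carrier C1" and d: "d \<in> carrier C1"
  obtains n w \<mu> \<nu> where "1 \<le> n" "w \<in> tuples n \<Gamma>" "\<mu> \<in> carrier (Mp n)" "\<nu> \<in> carrier (Mp n)" "cls n w \<mu> = c" "cls n w \<nu> = d"
proof -
  define S where "S = {g \<in> carrier \<Gamma>. c g \<noteq> \<one>\<^bsub>M\<^esub>} \<union> {g \<in> carrier \<Gamma>. d g \<noteq> \<one>\<^bsub>M\<^esub>}"
  have "finite S" "S \<subseteq> carrier \<Gamma>"
    unfolding S_def using c d by (auto simp: carrier_C1)
  from tuple_cover[OF this] obtain k \<delta> where k: "1 \<le> k" "\<delta> \<in> tuples k \<Gamma>" "inj_on \<delta> {1..k}" "S \<subseteq> \<delta> ` {1..k}"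
    by blast
  have "{g \<in> carrier \<Gamma>. c g \<noteq> \<one>\<^bsub>M\<^esub>} \<subseteq> \<delta> ` {1..k}" "{g \<in> carrier \<Gamma>. d g \<noteq> \<one>\<^bsub>M\<^esub>} \<subseteq> \<delta> ` {1..k}"
    using k(4) unfolding S_def by blast+
  note s = cls_surj[OF k(2,3) c this(1)] cls_surj[OF k(2,3) d this(2)]
  show thesis
    by (rule that[OF k(1,2) s(1,3,2,4)])
qed

text \<open>A boundary is carried by a triple on which merging the last two entries leaves the zero chain.\<close>

lemma d2_merge:
  assumes g: "g \<in> carrier \<Gamma>" and h: "h \<in> carrier \<Gamma>" and m: "m \<in> carrier M"
  obtains n w \<mu> where "1 \<le> n" "w \<in> tuples (Suc n) \<Gamma>" "\<mu> \<in> carrier (Mp n)"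
    "cls (Suc n) w (mg n w \<mu>) = d2 (g, h) m" "cls n (merge_last \<Gamma> n w) \<mu> = \<one>\<^bsub>C1\<^esub>"
proof -
  define k where "k = (2 :: nat)"
  have k: "1 \<le> k" "(1 :: nat) \<in> {1..k}" "k \<in> {1..k}" "1 \<noteq> k" "k \<in> {1..Suc k}" "Suc k \<in> {1..Suc k}" "1 \<in> {1..Suc k}" "1 \<noteq> Suc k" "k \<noteq> Suc k"
    by (simp_all add: k_def)
  \<comment> \<open>The triple is \<open>(gh, g, h)\<close>, which merging turns into
    \<open>(gh, gh)\<close>.\<close>
  define w where "w = (\<lambda>i \<in> {1..Suc k}. if i = k then g else if i = Suc k then h else g \<otimes> h)"
  have gh: "g \<otimes> h \<in> carrier \<Gamma>"
    using g h by simp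
  have w: "w \<in> tuples (Suc k) \<Gamma>"
    unfolding w_def restrict_PiE_iff using g h by simp
  have wv: "w k = g" "w (Suc k) = h" "w 1 = g \<otimes> h"
    unfolding w_def using k by simp_all
  have w': "merge_last \<Gamma> k w k = g \<otimes> h" "merge_last \<Gamma> k w 1 = g \<otimes> h"
    unfolding merge_last_def using k wv by simp_all
  note mt = merge_tuple[OF w k(1)]
  have im: "inv\<^bsub>M\<^esub> m \<in> carrier M"
    using m by simp
  \<comment> \<open>The exponents \<open>(-m, m)\<close> cancel over \<open>(gh, gh)\<close>, while
    \<open>mg\<close> sends them to \<open>(-m, m, g^-1 m)\<close>, whose chain over the triple is
    the boundary of \<open>m \<otimes> [g|h]\<close>.\<close>
  define \<mu> where "\<mu> = coord M k 1 (inv\<^bsub>M\<^esub> m) \<otimes>\<^bsub>Mp k\<^esub> coord M k k m"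
  interpret Mk: comm_group "Mp k" by (rule comm_group_Mp)
  interpret Ms: comm_group "Mp (Suc k)" by (rule comm_group_Mp)
  have \<mu>: "\<mu> \<in> carrier (Mp k)"
    unfolding \<mu>_def by (intro Mk.m_closed coord_closed im m)
  have bm: "b (inv g) m \<in> carrier M"
    using b_closed[OF \<Gamma>.inv_closed[OF g] m] .
  have "mg k w \<mu> = mg k w (coord M k 1 (inv\<^bsub>M\<^esub> m)) \<otimes>\<^bsub>Mp (Suc k)\<^esub> mg k w (coord M k k m)"
    unfolding \<mu>_def by (rule hom_mult[OF mg_hom[OF w k(1)] coord_closed[OF im] coord_closed[OF m]])
  also have "\<dots> = coord M (Suc k) 1 (inv\<^bsub>M\<^esub> m) \<otimes>\<^bsub>Mp (Suc k)\<^esub>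
    (coord M (Suc k) k m \<otimes>\<^bsub>Mp (Suc k)\<^esub> coord M (Suc k) (Suc k) (b (inv g) m))"
    unfolding mg_coord[OF w k(1,2) im] mg_coord[OF w k(1,3) m] mgL_def wv using k(4) by (simp only: if_False if_True refl)
  finally have "cls (Suc k) w (mg k w \<mu>) = chain1 \<Gamma> M (g \<otimes> h) (inv\<^bsub>M\<^esub> m) \<otimes>\<^bsub>C1\<^esub>
    (chain1 \<Gamma> M g m \<otimes>\<^bsub>C1\<^esub> chain1 \<Gamma> M h (b (inv g) m))"
    using hom_mult[OF cls_hom[OF w] coord_closed[OF im] Ms.m_closed[OF coord_closed[OF m] coord_closed[OF bm]], of 1 k "Suc k"]
      hom_mult[OF cls_hom[OF w] coord_closed[OF m] coord_closed[OF bm], of k "Suc k"]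
      cls_coord[OF w k(7) im] cls_coord[OF w k(5) m] cls_coord[OF w k(6) bm] by (simp only: wv)
  also have "chain1 \<Gamma> M (g \<otimes> h) (inv\<^bsub>M\<^esub> m) = inv\<^bsub>C1\<^esub> chain1 \<Gamma> M (g \<otimes> h) m"
    by (rule group_hom.hom_inv[OF group_hom.intro[OF M.is_group C1.is_group group_hom_axioms.intro[OF chain1_hom[OF gh]]] m])
  also have "inv\<^bsub>C1\<^esub> chain1 \<Gamma> M (g \<otimes> h) m \<otimes>\<^bsub>C1\<^esub> (chain1 \<Gamma> M g m \<otimes>\<^bsub>C1\<^esub> chain1 \<Gamma> M h (b (inv g) m)) = d2 (g, h) m"
    using chain1_closed[OF gh m] chain1_closed[OF g m] chain1_closed[OF h bm] by (simp add: d2_def C1.m_ac)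
  finally have c1: "cls (Suc k) w (mg k w \<mu>) = d2 (g, h) m" .
  have "cls k (merge_last \<Gamma> k w) \<mu> = chain1 \<Gamma> M (g \<otimes> h) (inv\<^bsub>M\<^esub> m) \<otimes>\<^bsub>C1\<^esub> chain1 \<Gamma> M (g \<otimes> h) m"
    using hom_mult[OF cls_hom[OF mt] coord_closed[OF im] coord_closed[OF m], of 1 k] cls_coord[OF mt k(2) im] cls_coord[OF mt k(3) m]
    by (simp only: \<mu>_def w')
  also have "\<dots> = chain1 \<Gamma> M (g \<otimes> h) \<one>\<^bsub>M\<^esub>"
    using chain1_mult[OF im m] m by simp
  also have "\<dots> = \<one>\<^bsub>C1\<^esub>"
    by (rule hom_one[OF chain1_hom[OF gh] M.is_group C1.is_group])
  finally show thesis
    by (rule that[OF k(1) w \<mu> c1])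
qed

end

section \<open>The character of homology defined by a pseudocharacter\<close>

context split_extension
begin

lemma supp_monomial: "\<mu> \<in> cycles n w \<Longrightarrow> {\<nu> \<in> carrier (Mp n). monomial R (Mp n) \<mu> \<nu> \<noteq> \<zero>\<^bsub>R\<^esub>} \<subseteq> cycles n w"
  by (auto simp: monomial_def split: if_splits)

lemma monomial_P: "\<mu> \<in> carrier (Mp n) \<Longrightarrow> monomial R (Mp n) \<mu> \<in> carrier (PM n)"
  by (rule monoid_alg.monomial_closed[OF alg_Mp])

lemma Xf_monomial: "w \<in> tuples n \<Gamma> \<Longrightarrow> \<mu> \<in> cycles n w \<Longrightarrow> Xf n w (monomial R (Mp n) \<mu>) \<in> carrier (IF n)"
  by (rule Xf_IF[OF _ monomial_P[OF cyclesD(1)] supp_monomial])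

lemma one_cycles: "w \<in> tuples n \<Gamma> \<Longrightarrow> \<one>\<^bsub>Mp n\<^esub> \<in> cycles n w"
  by (rule subgroup.one_closed[OF cycles_subgroup])

lemma one_Z1: "\<one>\<^bsub>ch.C1\<^esub> \<in> ch.Z1"
  by (rule subgroup.one_closed[OF ch.Z1_subgroup])

context
  fixes A \<Theta> assumes A: "A \<in> Alg R" and \<Theta>: "\<Theta> \<in> PCh A"
begin

lemma PC_hom: "1 \<le> n \<Longrightarrow> \<Theta> n \<in> alg_hom R (IF n) (map_alg (tuples n \<Gamma>) A)"
proof -
  assume n: "1 \<le> n"
  have "\<Theta> \<in> (\<Pi>\<^sub>E n \<in> {1..}. alg_hom R (IF n) (map_alg (tuples n \<Gamma>) A))"
    using \<Theta> unfolding PC_def pseudocharacters_def by blast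
  then show ?thesis
    by (rule PiE_mem) (use n in simp)
qed

lemma PC_ops:
  assumes n: "1 \<le> n" and f: "f \<in> carrier (IF n)" and f': "f' \<in> carrier (IF n)" and a: "a \<in> carrier R" and w: "w \<in> tuples n \<Gamma>"
  shows "\<Theta> n f w \<in> carrier A" "\<Theta> n (f \<otimes>\<^bsub>IF n\<^esub> f') w = \<Theta> n f w \<otimes>\<^bsub>A\<^esub> \<Theta> n f' w"
    "\<Theta> n (f \<oplus>\<^bsub>IF n\<^esub> f') w = \<Theta> n f w \<oplus>\<^bsub>A\<^esub> \<Theta> n f' w" "\<Theta> n (a \<odot>\<^bsub>IF n\<^esub> f) w = a \<odot>\<^bsub>A\<^esub> \<Theta> n f w"
proof -
  note h = PC_hom[OF n]
  show "\<Theta> n f w \<in> carrier A"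
    by (rule PiE_mem[OF alg_hom_closed[OF h f, unfolded map_alg_simps] w])
  show "\<Theta> n (f \<otimes>\<^bsub>IF n\<^esub> f') w = \<Theta> n f w \<otimes>\<^bsub>A\<^esub> \<Theta> n f' w"
    unfolding alg_hom_simps(1)[OF h f f'] map_alg_simps using w by (simp only: restrict_apply')
  show "\<Theta> n (f \<oplus>\<^bsub>IF n\<^esub> f') w = \<Theta> n f w \<oplus>\<^bsub>A\<^esub> \<Theta> n f' w"
    unfolding alg_hom_simps(2)[OF h f f'] map_alg_simps using w by (simp only: restrict_apply')
  show "\<Theta> n (a \<odot>\<^bsub>IF n\<^esub> f) w = a \<odot>\<^bsub>A\<^esub> \<Theta> n f w"
    unfolding alg_hom_simps(4)[OF h a f] map_alg_simps using w by (simp only: restrict_apply')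
qed

lemma PC_reindex:
  "\<lbrakk>1 \<le> m; 1 \<le> n; \<zeta> \<in> {1..m} \<rightarrow> {1..n}; f \<in> carrier (IF m); w \<in> tuples n \<Gamma>\<rbrakk>
    \<Longrightarrow> \<Theta> n (reindex_function R G m n \<zeta> f) w = \<Theta> m f (\<lambda>i \<in> {1..m}. w (\<zeta> i))"
  using \<Theta> unfolding PC_def pseudocharacters_def by blast

lemma PC_merge:
  "\<lbrakk>1 \<le> n; f \<in> carrier (IF n); w \<in> tuples (Suc n) \<Gamma>\<rbrakk> \<Longrightarrow> \<Theta> (Suc n) (merge_function R G n f) w = \<Theta> n f (merge_last \<Gamma> n w)"
  using \<Theta> unfolding PC_def pseudocharacters_def by blast

lemma PC_pull:
  assumes n: "1 \<le> n" and f: "f \<in> carrier (inv_functions R Cf (\<lambda>B. {\<one>\<^bsub>pts Cf B\<^esub>}) n)" and w: "w \<in> tuples n \<Gamma>"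
  shows "\<Theta> n (pull_function R G n \<pi> f) w = f A (\<lambda>i \<in> {1..n}. rr A (w i))"
proof -
  have eq: "push_pseudocharacter R G Cf (\<lambda>B. {\<one>\<^bsub>pts Cf B\<^esub>}) \<pi> \<Theta> =
    attached_pseudocharacter R Cf (\<lambda>B. {\<one>\<^bsub>pts Cf B\<^esub>}) \<Gamma> A (rr A)"
    using \<Theta> unfolding PC_def by blast
  have "push_pseudocharacter R G Cf (\<lambda>B. {\<one>\<^bsub>pts Cf B\<^esub>}) \<pi> \<Theta> n f w =
    attached_pseudocharacter R Cf (\<lambda>B. {\<one>\<^bsub>pts Cf B\<^esub>}) \<Gamma> A (rr A) n f w"
    unfolding eq ..
  then show ?thesis
    unfolding push_pseudocharacter_def attached_pseudocharacter_def using n f w by (simp only: restrict_apply' atLeast_iff)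
qed

text \<open>The candidate for the value of the character at the chain of \<open>\<mu>\<close> over
  \<open>w\<close>. It is used for cycles \<open>\<mu>\<close>, for which the monomial on the
  component of \<open>w\<close> is an invariant function.\<close>

definition \<theta> where "\<theta> n w \<mu> = \<Theta> n (Xf n w (monomial R (Mp n) \<mu>)) w"

lemma \<theta>_closed: "\<lbrakk>1 \<le> n; w \<in> tuples n \<Gamma>; \<mu> \<in> cycles n w\<rbrakk> \<Longrightarrow> \<theta> n w \<mu> \<in> carrier A"
  unfolding \<theta>_def by (rule PC_ops(1)[OF _ Xf_monomial Xf_monomial R.zero_closed])

text \<open>The unit monomial gives the indicator function of the component, pulled back from the
  component group. The prescribed reduction evaluates it at the reference point, which lies in that
  component.\<close>

lemma \<theta>_one:
  assumes n: "1 \<le> n" and w: "w \<in> tuples n \<Gamma>"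
  shows "\<theta> n w \<one>\<^bsub>Mp n\<^esub> = \<one>\<^bsub>A\<^esub>"
proof -
  have red: "(\<lambda>i \<in> {1..n}. rr A (w i)) = (\<lambda>i \<in> {1..n}. \<pi> A (r A (w i)))"
    by (rule restrict_ext) (rule reduced_rep_eq[OF A ch.tuple_mem[OF w]])
  have x: "(\<lambda>i \<in> {1..n}. \<pi> A (r A (w i))) \<in> tuples n (pts Cf A)"
    using \<pi>_closed[OF A r_closed[OF A ch.tuple_mem[OF w]]] by (simp add: PiE_iff)
  have "\<theta> n w \<one>\<^bsub>Mp n\<^esub> = ind n w A (\<lambda>i \<in> {1..n}. \<pi> A (r A (w i)))"
    unfolding \<theta>_def Xf_one[OF w] PC_pull[OF n ind_inv_functions[OF w] w] red ..
  also have "\<dots> = ei A n w (\<lambda>i \<in> {1..n}. \<pi> A (r A (w i)))"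
    unfolding ind_def using A x by (simp only: restrict_apply')
  also have "\<dots> = \<one>\<^bsub>A\<^esub>"
    by (rule ei_all[OF A w x]) simp
  finally show ?thesis .
qed

text \<open>A pseudocharacter sees an invariant function only on the component of \<open>w\<close>, since the indicator
  function of that component is pulled back from the component group.\<close>

lemma PC_coef:
  assumes n: "1 \<le> n" and w: "w \<in> tuples n \<Gamma>" and f: "f \<in> carrier (IF n)"
  shows "\<Theta> n f w = \<Theta> n (Xf n w (coef n w f)) w"
proof -
  interpret A: algebra R A by (rule AlgD[OF A])
  have "\<Theta> n (Xf n w (coef n w f)) w = \<Theta> n f w \<otimes>\<^bsub>A\<^esub> \<theta> n w \<one>\<^bsub>Mp n\<^esub>"
    unfolding mult_Xf_one[OF w f, symmetric] \<theta>_def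
    by (rule PC_ops(2)[OF n f Xf_monomial[OF w one_cycles[OF w]] R.zero_closed w])
  then show ?thesis
    using PC_ops(1)[OF n f f R.zero_closed w] by (simp add: \<theta>_one[OF n w])
qed

text \<open>On the component of \<open>w\<close> an invariant function is a linear combination of
  monomials whose exponents are cycles, and the pseudocharacter is linear and sees only this
  component.\<close>

lemma PC_lin_ext:
  assumes n: "1 \<le> n" and w: "w \<in> tuples n \<Gamma>" and f: "f \<in> carrier (IF n)"
    and h: "h \<in> carrier (Mp n) \<rightarrow> carrier A" and eq: "\<And>\<mu>. \<mu> \<in> cycles n w \<Longrightarrow> \<theta> n w \<mu> = h \<mu>"
  shows "\<Theta> n f w = lin_ext R (Mp n) A h (coef n w f)"
proof -
  interpret A: algebra R A by (rule AlgD[OF A])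
  interpret Tg: monoid_alg_target R "Mp n" A by (rule target_Mp[OF A])
  have "\<Theta> n (Xf n w F) w = lin_ext R (Mp n) A h F"
    if F: "F \<in> carrier Tg.P" "{\<mu> \<in> carrier (Mp n). F \<mu> \<noteq> \<zero>\<^bsub>R\<^esub>} \<subseteq> cycles n w" for F
    using F cycles_carrier
  proof (induction F rule: Tg.P_induct_on)
    case zero
    have z: "{\<mu> \<in> carrier (Mp n). \<zero>\<^bsub>Tg.P\<^esub> \<mu> \<noteq> \<zero>\<^bsub>R\<^esub>} \<subseteq> cycles n w"
      by auto
    have zz: "\<zero>\<^bsub>R\<^esub> \<odot>\<^bsub>Tg.P\<^esub> \<zero>\<^bsub>Tg.P\<^esub> = \<zero>\<^bsub>Tg.P\<^esub>"
      by (rule Tg.zero_smult_zero_P)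
    have X0: "Xf n w \<zero>\<^bsub>Tg.P\<^esub> \<in> carrier (IF n)"
      by (rule Xf_IF[OF w Tg.zero_closed_P z])
    \<comment> \<open>The function attached to the zero polynomial is 0 times itself, so linearity
      in scalars makes its value zero.\<close>
    have "\<Theta> n (Xf n w \<zero>\<^bsub>Tg.P\<^esub>) w = \<zero>\<^bsub>R\<^esub> \<odot>\<^bsub>A\<^esub> \<Theta> n (Xf n w \<zero>\<^bsub>Tg.P\<^esub>) w"
      using PC_ops(4)[OF n X0 X0 R.zero_closed w] Xf_hom(3)[OF w Tg.zero_closed_P Tg.zero_closed_P R.zero_closed] by (simp only: zz)
    also have "\<dots> = \<zero>\<^bsub>A\<^esub>"
      by (rule A.smult_l_null[OF PC_ops(1)[OF n X0 X0 R.zero_closed w]])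
    finally show ?case
      unfolding Tg.lin_ext_zero .
  next
    case (step F a z)
    have zc: "z \<in> carrier (Mp n)"
      by (rule cyclesD(1)[OF step(4)])
    note mz = monomial_P[OF zc] and Xz = Xf_monomial[OF w step(4)]
    note XF = Xf_IF[OF w step(1,2)]
    have "\<Theta> n (Xf n w (F \<oplus>\<^bsub>Tg.P\<^esub> a \<odot>\<^bsub>Tg.P\<^esub> monomial R (Mp n) z)) w = \<Theta> n (Xf n w F) w \<oplus>\<^bsub>A\<^esub> a \<odot>\<^bsub>A\<^esub> h z"
      unfolding Xf_hom(2)[OF w step(1) Tg.smult_closed_P[OF step(3) mz] step(3)] Xf_hom(3)[OF w mz mz step(3)]
        PC_ops(3)[OF n XF IF_closed(3)[OF Xz Xz step(3)] step(3) w] PC_ops(4)[OF n Xz Xz step(3) w]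
        \<theta>_def[symmetric] eq[OF step(4)] ..
    then show ?case
      unfolding step.IH Tg.lin_ext_add[OF step(1) Tg.smult_closed_P[OF step(3) mz] h] Tg.lin_ext_smult[OF mz step(3) h]
        Tg.lin_ext_monomial[OF zc h] .
  qed
  from this[OF coef(1)[OF IF_regular[OF f] w] coef_cycles[OF f w]] show ?thesis
    unfolding PC_coef[OF n w f] .
qed

lemma \<theta>_mult:
  assumes n: "1 \<le> n" and w: "w \<in> tuples n \<Gamma>" and \<mu>: "\<mu> \<in> cycles n w" and \<nu>: "\<nu> \<in> cycles n w"
  shows "\<theta> n w (\<mu> \<otimes>\<^bsub>Mp n\<^esub> \<nu>) = \<theta> n w \<mu> \<otimes>\<^bsub>A\<^esub> \<theta> n w \<nu>"
proof -
  interpret P: monoid_alg R "Mp n" by (rule alg_Mp)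
  note c = cyclesD(1)[OF \<mu>] cyclesD(1)[OF \<nu>]
  show ?thesis
    unfolding \<theta>_def P.monomial_mult[OF c, symmetric] Xf_hom(1)[OF w monomial_P[OF c(1)] monomial_P[OF c(2)] R.zero_closed]
    by (rule PC_ops(2)[OF n Xf_monomial[OF w \<mu>] Xf_monomial[OF w \<nu>] R.zero_closed w])
qed

text \<open>Reindexing a function that is a monomial on one component gives an invariant function on
  \<open>G^n\<close> whose Laurent polynomial on the component of \<open>w\<close> is again a
  monomial; its behaviour on other components is invisible to the pseudocharacter.\<close>

lemma \<theta>_reidx:
  assumes m: "1 \<le> m" and n: "1 \<le> n" and w: "w \<in> tuples n \<Gamma>" and \<zeta>: "\<zeta> \<in> {1..m} \<rightarrow> {1..n}"
    and \<mu>: "\<mu> \<in> cycles m (\<lambda>i \<in> {1..m}. w (\<zeta> i))"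
  shows "\<theta> n w (ch.reidx m n \<zeta> \<mu>) = \<theta> m (\<lambda>i \<in> {1..m}. w (\<zeta> i)) \<mu>"
proof -
  note w' = reindex_tuple[OF w \<zeta>] and \<mu>c = cyclesD(1)[OF \<mu>]
  note f = Xf_monomial[OF w' \<mu>]
  interpret J: monoid_alg_map R "Mp m" "Mp n" "ch.reidx m n \<zeta>" by (rule map_Mp[OF ch.reidx_hom])
  show ?thesis
    unfolding \<theta>_def PC_reindex[OF m n \<zeta> f w, symmetric] PC_coef[OF n w reindex_IF[OF f \<zeta>]]
      coef_reindex[OF IF_regular[OF f] w \<zeta>] coef_Xf[OF w' monomial_P[OF \<mu>c]] J.push_monomial[OF \<mu>c] ..
qed

lemma \<theta>_mg:
  assumes n: "1 \<le> n" and w: "w \<in> tuples (Suc n) \<Gamma>" and \<mu>: "\<mu> \<in> cycles n (merge_last \<Gamma> n w)"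
  shows "\<theta> (Suc n) w (ch.mg n w \<mu>) = \<theta> n (merge_last \<Gamma> n w) \<mu>"
proof -
  note w' = ch.merge_tuple[OF w n] and \<mu>c = cyclesD(1)[OF \<mu>]
  note f = Xf_monomial[OF w' \<mu>]
  have sn: "1 \<le> Suc n" by simp
  interpret J: monoid_alg_map R "Mp n" "Mp (Suc n)" "ch.mg n w" by (rule map_Mp[OF ch.mg_hom[OF w n]])
  show ?thesis
    unfolding \<theta>_def PC_merge[OF n f w, symmetric] PC_coef[OF sn w merge_IF[OF f n]]
      coef_merge[OF IF_regular[OF f] n w] coef_Xf[OF w' monomial_P[OF \<mu>c]] J.push_monomial[OF \<mu>c] ..
qed

text \<open>Transfers the value to a tuple without repetitions, where exponents and chains are the
  same thing.\<close>

lemma \<theta>_cover: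
  assumes n: "1 \<le> n" and w: "w \<in> tuples n \<Gamma>" and \<mu>: "\<mu> \<in> cycles n w"
    and k: "1 \<le> k" and \<delta>: "\<delta> \<in> tuples k \<Gamma>" "inj_on \<delta> {1..k}" and sub: "w ` {1..n} \<subseteq> \<delta> ` {1..k}"
  shows "\<theta> n w \<mu> = \<theta> k \<delta> (\<lambda>i \<in> {1..k}. ch.cls n w \<mu> (\<delta> i))"
proof -
  obtain \<zeta> where \<zeta>: "\<zeta> \<in> {1..n} \<rightarrow> {1..k}" and eq: "(\<lambda>i \<in> {1..n}. \<delta> (\<zeta> i)) = w"
    and re: "ch.reidx n k \<zeta> \<mu> = (\<lambda>i \<in> {1..k}. ch.cls n w \<mu> (\<delta> i))"
    by (rule ch.reidx_cover[OF w cyclesD(1)[OF \<mu>] \<delta> sub])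
  show ?thesis
    using \<theta>_reidx[OF n k \<delta>(1) \<zeta>, unfolded eq, OF \<mu>] unfolding re by (rule sym)
qed

text \<open>Over a common tuple without repetitions both exponents are given by the coefficients of
  one and the same chain.\<close>

lemma \<theta>_cls:
  assumes n: "1 \<le> n" and w: "w \<in> tuples n \<Gamma>" and \<mu>: "\<mu> \<in> cycles n w"
    and m: "1 \<le> m" and w': "w' \<in> tuples m \<Gamma>" and \<mu>': "\<mu>' \<in> cycles m w'"
    and eq: "ch.cls n w \<mu> = ch.cls m w' \<mu>'"
  shows "\<theta> n w \<mu> = \<theta> m w' \<mu>'"
proof -
  have "finite (w ` {1..n} \<union> w' ` {1..m})" "w ` {1..n} \<union> w' ` {1..m} \<subseteq> carrier \<Gamma>"
    using w w' by auto
  from ch.tuple_cover[OF this] obtain k \<delta> where k: "1 \<le> k" "\<delta> \<in> tuples k \<Gamma>" "inj_on \<delta> {1..k}"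
    "w ` {1..n} \<union> w' ` {1..m} \<subseteq> \<delta> ` {1..k}"
    by blast
  then have sub: "w ` {1..n} \<subseteq> \<delta> ` {1..k}" "w' ` {1..m} \<subseteq> \<delta> ` {1..k}"
    by blast+
  show ?thesis
    unfolding \<theta>_cover[OF n w \<mu> k(1-3) sub(1)] \<theta>_cover[OF m w' \<mu>' k(1-3) sub(2)] eq ..
qed

text \<open>By \<open>\<theta>_cls\<close> the value does not depend on how a cycle is presented by
  a tuple and an exponent, so the choice is harmless.\<close>

definition \<psi>\<^sub>0 where "\<psi>\<^sub>0 c = (SOME v. \<exists>n \<ge> 1. \<exists>w \<in> tuples n \<Gamma>. \<exists>\<mu> \<in> cycles n w. ch.cls n w \<mu> = c \<and> v = \<theta> n w \<mu>)"

lemma \<psi>\<^sub>0_cls: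
  assumes n: "1 \<le> n" and w: "w \<in> tuples n \<Gamma>" and \<mu>: "\<mu> \<in> cycles n w"
  shows "\<psi>\<^sub>0 (ch.cls n w \<mu>) = \<theta> n w \<mu>"
  unfolding \<psi>\<^sub>0_def
proof (rule some_equality)
  show "\<exists>k \<ge> 1. \<exists>\<delta> \<in> tuples k \<Gamma>. \<exists>\<nu> \<in> cycles k \<delta>. ch.cls k \<delta> \<nu> = ch.cls n w \<mu> \<and> \<theta> n w \<mu> = \<theta> k \<delta> \<nu>"
    using n w \<mu> by blast
  fix v assume "\<exists>k \<ge> 1. \<exists>\<delta> \<in> tuples k \<Gamma>. \<exists>\<nu> \<in> cycles k \<delta>. ch.cls k \<delta> \<nu> = ch.cls n w \<mu> \<and> v = \<theta> k \<delta> \<nu>"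
  then show "v = \<theta> n w \<mu>"
    using \<theta>_cls[OF _ _ _ n w \<mu>] by blast
qed

lemma \<psi>\<^sub>0_mult:
  assumes c: "c \<in> ch.Z1" and d: "d \<in> ch.Z1"
  shows "\<psi>\<^sub>0 c \<in> carrier A" "\<psi>\<^sub>0 (c \<otimes>\<^bsub>ch.C1\<^esub> d) = \<psi>\<^sub>0 c \<otimes>\<^bsub>A\<^esub> \<psi>\<^sub>0 d" "\<psi>\<^sub>0 \<one>\<^bsub>ch.C1\<^esub> = \<one>\<^bsub>A\<^esub>"
proof -
  obtain n w \<mu> \<nu> where n: "1 \<le> n" and w: "w \<in> tuples n \<Gamma>" and \<mu>: "\<mu> \<in> carrier (Mp n)" and \<nu>: "\<nu> \<in> carrier (Mp n)"
    and e: "ch.cls n w \<mu> = c" "ch.cls n w \<nu> = d"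
    by (rule ch.common_tuple[OF ch.Z1_C1[OF c] ch.Z1_C1[OF d]])
  have cy: "\<mu> \<in> cycles n w" "\<nu> \<in> cycles n w"
    using c d \<mu> \<nu> e by (auto intro: cyclesI)
  note cm = subgroup.m_closed[OF cycles_subgroup[OF w] cy]
  have cl: "\<psi>\<^sub>0 c = \<theta> n w \<mu>" "\<psi>\<^sub>0 d = \<theta> n w \<nu>"
    using \<psi>\<^sub>0_cls[OF n w cy(1)] \<psi>\<^sub>0_cls[OF n w cy(2)] by (simp_all add: e)
  show "\<psi>\<^sub>0 c \<in> carrier A"
    unfolding cl by (rule \<theta>_closed[OF n w cy(1)])
  have "c \<otimes>\<^bsub>ch.C1\<^esub> d = ch.cls n w (\<mu> \<otimes>\<^bsub>Mp n\<^esub> \<nu>)"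
    using hom_mult[OF ch.cls_hom[OF w] \<mu> \<nu>] e by simp
  then show "\<psi>\<^sub>0 (c \<otimes>\<^bsub>ch.C1\<^esub> d) = \<psi>\<^sub>0 c \<otimes>\<^bsub>A\<^esub> \<psi>\<^sub>0 d"
    using \<psi>\<^sub>0_cls[OF n w cm] \<theta>_mult[OF n w cy] by (simp add: cl)
  have "\<one>\<^bsub>ch.C1\<^esub> = ch.cls n w \<one>\<^bsub>Mp n\<^esub>"
    by (rule hom_one[OF ch.cls_hom[OF w] comm_group.axioms(2)[OF ch.comm_group_Mp] ch.C1.is_group, symmetric])
  then show "\<psi>\<^sub>0 \<one>\<^bsub>ch.C1\<^esub> = \<one>\<^bsub>A\<^esub>"
    using \<psi>\<^sub>0_cls[OF n w one_cycles[OF w]] \<theta>_one[OF n w] by simp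
qed

lemma \<psi>\<^sub>0_inverse:
  assumes c: "c \<in> ch.Z1"
  shows "inv\<^bsub>ch.C1\<^esub> c \<in> ch.Z1" "\<psi>\<^sub>0 (inv\<^bsub>ch.C1\<^esub> c) \<otimes>\<^bsub>A\<^esub> \<psi>\<^sub>0 c = \<one>\<^bsub>A\<^esub>" "\<psi>\<^sub>0 c \<in> Units A"
proof -
  interpret A: algebra R A by (rule AlgD[OF A])
  show i: "inv\<^bsub>ch.C1\<^esub> c \<in> ch.Z1"
    by (rule subgroup.m_inv_closed[OF ch.Z1_subgroup c])
  show e: "\<psi>\<^sub>0 (inv\<^bsub>ch.C1\<^esub> c) \<otimes>\<^bsub>A\<^esub> \<psi>\<^sub>0 c = \<one>\<^bsub>A\<^esub>"
    using \<psi>\<^sub>0_mult(2)[OF i c] \<psi>\<^sub>0_mult(3)[OF c c] ch.Z1_C1[OF c] by simp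
  then have "\<psi>\<^sub>0 c \<otimes>\<^bsub>A\<^esub> \<psi>\<^sub>0 (inv\<^bsub>ch.C1\<^esub> c) = \<one>\<^bsub>A\<^esub>"
    using A.m_comm[OF \<psi>\<^sub>0_mult(1)[OF i i] \<psi>\<^sub>0_mult(1)[OF c c]] by simp
  then show "\<psi>\<^sub>0 c \<in> Units A"
    using e \<psi>\<^sub>0_mult(1)[OF i i] \<psi>\<^sub>0_mult(1)[OF c c] unfolding Units_def by blast
qed

text \<open>The cycles with value 1 form a subgroup, so elementary boundaries suffice. Such a
  boundary is the chain, before merging, of an exponent whose chain after merging is zero, and
  merging does not change the value.\<close>

lemma \<psi>\<^sub>0_B1:
  assumes c: "c \<in> ch.B1"
  shows "\<psi>\<^sub>0 c = \<one>\<^bsub>A\<^esub>"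
proof -
  interpret A: algebra R A by (rule AlgD[OF A])
  have "subgroup {c \<in> ch.Z1. \<psi>\<^sub>0 c = \<one>\<^bsub>A\<^esub>} ch.C1"
  proof (rule ch.C1.subgroupI)
    show "{c \<in> ch.Z1. \<psi>\<^sub>0 c = \<one>\<^bsub>A\<^esub>} \<subseteq> carrier ch.C1"
      using ch.Z1_C1 by blast
    show "{c \<in> ch.Z1. \<psi>\<^sub>0 c = \<one>\<^bsub>A\<^esub>} \<noteq> {}"
      using one_Z1 \<psi>\<^sub>0_mult(3)[OF one_Z1 one_Z1] by blast
    show "inv\<^bsub>ch.C1\<^esub> c \<in> {c \<in> ch.Z1. \<psi>\<^sub>0 c = \<one>\<^bsub>A\<^esub>}" if "c \<in> {c \<in> ch.Z1. \<psi>\<^sub>0 c = \<one>\<^bsub>A\<^esub>}" for c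
    proof -
      have c: "c \<in> ch.Z1" "\<psi>\<^sub>0 c = \<one>\<^bsub>A\<^esub>"
        using that by blast+
      show ?thesis
        using \<psi>\<^sub>0_inverse(1,2)[OF c(1)] c(2) \<psi>\<^sub>0_mult(1)[OF \<psi>\<^sub>0_inverse(1)[OF c(1)] c(1)] by simp
    qed
    show "c \<otimes>\<^bsub>ch.C1\<^esub> d \<in> {c \<in> ch.Z1. \<psi>\<^sub>0 c = \<one>\<^bsub>A\<^esub>}"
      if "c \<in> {c \<in> ch.Z1. \<psi>\<^sub>0 c = \<one>\<^bsub>A\<^esub>}" "d \<in> {c \<in> ch.Z1. \<psi>\<^sub>0 c = \<one>\<^bsub>A\<^esub>}" for c d
    proof -
      have c: "c \<in> ch.Z1" "\<psi>\<^sub>0 c = \<one>\<^bsub>A\<^esub>" and d: "d \<in> ch.Z1" "\<psi>\<^sub>0 d = \<one>\<^bsub>A\<^esub>"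
        using that by blast+
      show ?thesis
        using \<psi>\<^sub>0_mult(2)[OF c(1) d(1)] c(2) d(2) subgroup.m_closed[OF ch.Z1_subgroup c(1) d(1)] by simp
    qed
  qed
  then have "ch.B1 \<subseteq> {c \<in> ch.Z1. \<psi>\<^sub>0 c = \<one>\<^bsub>A\<^esub>}"
  proof (rule ch.B1_subset)
    fix gh m assume gh: "gh \<in> carrier \<Gamma> \<times> carrier \<Gamma>" and m: "m \<in> carrier M"
    obtain g h where e: "gh = (g, h)"
      by (rule prod.exhaust)
    have "g \<in> carrier \<Gamma>" "h \<in> carrier \<Gamma>"
      using gh by (simp_all add: e)
    then obtain n w \<mu> where n: "1 \<le> n" and w: "w \<in> tuples (Suc n) \<Gamma>" and \<mu>: "\<mu> \<in> carrier (Mp n)"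
      and c1: "ch.cls (Suc n) w (ch.mg n w \<mu>) = ch.d2 (g, h) m" and c2: "ch.cls n (merge_last \<Gamma> n w) \<mu> = \<one>\<^bsub>ch.C1\<^esub>"
      using m by (rule ch.d2_merge)
    have z: "ch.d2 gh m \<in> ch.Z1"
      by (rule ch.d2_Z1[OF gh m])
    have cy2: "\<mu> \<in> cycles n (merge_last \<Gamma> n w)"
      by (rule cyclesI[OF \<mu>]) (simp only: c2 one_Z1)
    have cy1: "ch.mg n w \<mu> \<in> cycles (Suc n) w"
      by (rule cyclesI[OF hom_in_carrier[OF ch.mg_hom[OF w n] \<mu>]]) (use z in \<open>simp only: c1 e\<close>)
    have sn: "1 \<le> Suc n" by simp
    have "\<psi>\<^sub>0 (ch.d2 gh m) = \<psi>\<^sub>0 \<one>\<^bsub>ch.C1\<^esub>"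
      unfolding e c1[symmetric] \<psi>\<^sub>0_cls[OF sn w cy1] \<theta>_mg[OF n w cy2] \<psi>\<^sub>0_cls[OF n ch.merge_tuple[OF w n] cy2, symmetric] c2 ..
    then show "ch.d2 gh m \<in> {c \<in> ch.Z1. \<psi>\<^sub>0 c = \<one>\<^bsub>A\<^esub>}"
      using z \<psi>\<^sub>0_mult(3)[OF one_Z1 one_Z1] by simp
  qed
  then show ?thesis
    using c by blast
qed

text \<open>Since \<open>\<psi>\<^sub>0\<close> is trivial on boundaries, it descends to homology
  and the representative picked in each class is immaterial.\<close>

lemma PC_character: "\<exists>\<psi> \<in> characters ch.H1 A. \<forall>c \<in> ch.Z1. \<psi> (ch.B1 #>\<^bsub>ch.C1\<^esub> c) = \<psi>\<^sub>0 c"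
proof -
  interpret A: algebra R A by (rule AlgD[OF A])
  define \<psi> where "\<psi> = (\<lambda>x \<in> carrier ch.H1. \<psi>\<^sub>0 (SOME c. c \<in> ch.Z1 \<and> x = ch.B1 #>\<^bsub>ch.C1\<^esub> c))"
  have in_H1: "ch.B1 #>\<^bsub>ch.C1\<^esub> c \<in> carrier ch.H1" if "c \<in> ch.Z1" for c
    unfolding ch.carrier_H1 using that by blast
  have val: "\<psi> (ch.B1 #>\<^bsub>ch.C1\<^esub> c) = \<psi>\<^sub>0 c" if c: "c \<in> ch.Z1" for c
  proof -
    define d where "d = (SOME d. d \<in> ch.Z1 \<and> ch.B1 #>\<^bsub>ch.C1\<^esub> c = ch.B1 #>\<^bsub>ch.C1\<^esub> d)"
    have d: "d \<in> ch.Z1 \<and> ch.B1 #>\<^bsub>ch.C1\<^esub> c = ch.B1 #>\<^bsub>ch.C1\<^esub> d"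
      unfolding d_def by (rule someI[where x = c]) (use c in simp)
    have "c \<in> ch.B1 #>\<^bsub>ch.C1\<^esub> c"
      by (rule ch.C1.rcos_self[OF ch.Z1_C1[OF c] ch.B1_subgroup])
    then have "c \<in> ch.B1 #>\<^bsub>ch.C1\<^esub> d"
      using d by simp
    then obtain x where x: "x \<in> ch.B1" "c = x \<otimes>\<^bsub>ch.C1\<^esub> d"
      unfolding r_coset_def by blast
    have "\<psi>\<^sub>0 c = \<psi>\<^sub>0 d"
      using \<psi>\<^sub>0_mult(2)[OF subsetD[OF ch.B1_Z1 x(1)] conjunct1[OF d]] \<psi>\<^sub>0_B1[OF x(1)] x(2) \<psi>\<^sub>0_mult(1)[OF conjunct1[OF d] c] by simp
    then show ?thesis
      unfolding \<psi>_def restrict_apply'[OF in_H1[OF c]] d_def by (rule sym)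
  qed
  have "\<psi> \<in> characters ch.H1 A"
  proof (rule charactersI)
    show "\<psi> x \<in> Units A" if "x \<in> carrier ch.H1" for x
      using that \<psi>\<^sub>0_inverse(3) by (auto simp: ch.carrier_H1 val)
    fix x y assume "x \<in> carrier ch.H1" "y \<in> carrier ch.H1"
    then obtain c d where c: "c \<in> ch.Z1" "x = ch.B1 #>\<^bsub>ch.C1\<^esub> c" and d: "d \<in> ch.Z1" "y = ch.B1 #>\<^bsub>ch.C1\<^esub> d"
      unfolding ch.carrier_H1 by blast
    have "x \<otimes>\<^bsub>ch.H1\<^esub> y = ch.B1 #>\<^bsub>ch.C1\<^esub> (c \<otimes>\<^bsub>ch.C1\<^esub> d)"
      unfolding ch.H1_mult c(2) d(2) by (rule hom_mult[OF ch.quot_C1_hom ch.Z1_C1[OF c(1)] ch.Z1_C1[OF d(1)], symmetric])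
    then show "\<psi> (x \<otimes>\<^bsub>ch.H1\<^esub> y) = \<psi> x \<otimes>\<^bsub>A\<^esub> \<psi> y"
      using val[OF subgroup.m_closed[OF ch.Z1_subgroup c(1) d(1)]] \<psi>\<^sub>0_mult(2)[OF c(1) d(1)] val[OF c(1)] val[OF d(1)]
      by (simp add: c(2) d(2))
  qed (simp add: \<psi>_def)
  then show ?thesis
    using val by blast
qed

lemma PC_ext: "\<Theta> \<in> extensional {1..}" "1 \<le> n \<Longrightarrow> \<Theta> n \<in> extensional (carrier (IF n))"
  "1 \<le> n \<Longrightarrow> f \<in> carrier (IF n) \<Longrightarrow> \<Theta> n f \<in> extensional (tuples n \<Gamma>)"
proof -
  have "\<Theta> \<in> (\<Pi>\<^sub>E n \<in> {1..}. alg_hom R (IF n) (map_alg (tuples n \<Gamma>) A))"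
    using \<Theta> unfolding PC_def pseudocharacters_def by blast
  then show "\<Theta> \<in> extensional {1..}"
    unfolding PiE_iff by (rule conjunct2)
  show "1 \<le> n \<Longrightarrow> \<Theta> n \<in> extensional (carrier (IF n))"
    by (rule alg_hom_simps(5)[OF PC_hom])
  show "\<Theta> n f \<in> extensional (tuples n \<Gamma>)" if "1 \<le> n" "f \<in> carrier (IF n)"
    by (rule conjunct2[OF PiE_iff[THEN iffD1, OF alg_hom_closed[OF PC_hom[OF that(1)] that(2), unfolded map_alg_simps]]])
qed

end

section \<open>The bijection between characters of homology and pseudocharacters\<close>

lemma PC_eqI:
  assumes A: "A \<in> Alg R" and \<Theta>: "\<Theta> \<in> PCh A" and \<Theta>': "\<Theta>' \<in> PCh A"
    and eq: "\<And>n f w. 1 \<le> n \<Longrightarrow> f \<in> carrier (IF n) \<Longrightarrow> w \<in> tuples n \<Gamma> \<Longrightarrow> \<Theta> n f w = \<Theta>' n f w"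
  shows "\<Theta> = \<Theta>'"
proof (rule extensionalityI[OF PC_ext(1)[OF A \<Theta>] PC_ext(1)[OF A \<Theta>']])
  fix n :: nat assume "n \<in> {1..}"
  then have n: "1 \<le> n" by simp
  show "\<Theta> n = \<Theta>' n"
  proof (rule extensionalityI[OF PC_ext(2)[OF A \<Theta> n] PC_ext(2)[OF A \<Theta>' n]])
    fix f assume f: "f \<in> carrier (IF n)"
    show "\<Theta> n f = \<Theta>' n f"
      by (rule extensionalityI[OF PC_ext(3)[OF A \<Theta> n f] PC_ext(3)[OF A \<Theta>' n f]]) (rule eq[OF n f])
  qed
qed

text \<open>Monomials supported on one component recover \<open>\<psi>\<close>: the Laurent
  polynomial on that component is the monomial itself.\<close>

lemma pcm_\<theta>:
  assumes A: "A \<in> Alg R" and \<psi>: "\<psi> \<in> characters ch.H1 A" and n: "1 \<le> n" and w: "w \<in> tuples n \<Gamma>" and \<mu>: "\<mu> \<in> cycles n w"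
  shows "\<theta> (pcm A \<psi>) n w \<mu> = \<psi> (ch.qc n w \<mu>)"
proof -
  interpret Tg: monoid_alg_target R "Mp n" A by (rule target_Mp[OF A])
  show ?thesis
    unfolding \<theta>_def[OF A pcm_mem[OF A \<psi>]] pcm_apply[OF n Xf_monomial[OF w \<mu>] w] Th_def coef_Xf[OF w monomial_P[OF cyclesD(1)[OF \<mu>]]]
      Tg.lin_ext_monomial[OF cyclesD(1)[OF \<mu>] hx_closed[OF A \<psi>]] by (rule hx_cycles[OF w \<mu>])
qed

text \<open>For injectivity, every homology class is that of a chain over some tuple, and the value
  of \<open>\<psi>\<close> there is read off from a monomial. For surjectivity, the character
  extracted from \<open>\<Theta>\<close> reproduces \<open>\<Theta>\<close> on monomials, hence on
  all invariant functions.\<close>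

lemma pcm_bij:
  assumes A: "A \<in> Alg R"
  shows "bij_betw (pcm A) (characters ch.H1 A) (PCh A)"
  unfolding bij_betw_def
proof (intro conjI inj_onI subset_antisym subsetI)
  fix \<psi> \<psi>' assume \<psi>: "\<psi> \<in> characters ch.H1 A" and \<psi>': "\<psi>' \<in> characters ch.H1 A" and eq: "pcm A \<psi> = pcm A \<psi>'"
  show "\<psi> = \<psi>'"
  proof (rule extensionalityI[where A = "carrier ch.H1"])
    fix x assume "x \<in> carrier ch.H1"
    then obtain c where c: "c \<in> ch.Z1" "x = ch.B1 #>\<^bsub>ch.C1\<^esub> c"
      unfolding ch.carrier_H1 by blast
    obtain n w \<mu> \<nu> where n: "1 \<le> n" and w: "w \<in> tuples n \<Gamma>" and \<mu>: "\<mu> \<in> carrier (Mp n)" and e: "ch.cls n w \<mu> = c"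
      by (rule ch.common_tuple[OF ch.Z1_C1[OF c(1)] ch.Z1_C1[OF c(1)]])
    have cy: "\<mu> \<in> cycles n w"
      by (rule cyclesI[OF \<mu>]) (simp only: e c(1))
    have "\<psi> (ch.qc n w \<mu>) = \<psi>' (ch.qc n w \<mu>)"
      using pcm_\<theta>[OF A \<psi> n w cy] pcm_\<theta>[OF A \<psi>' n w cy] by (simp add: eq)
    then show "\<psi> x = \<psi>' x"
      by (simp add: ch.qc_def e c(2))
  qed (use \<psi> \<psi>' in blast)+
next
  fix \<Theta> assume "\<Theta> \<in> pcm A ` characters ch.H1 A"
  then show "\<Theta> \<in> PCh A"
    using pcm_mem[OF A] by blast
next
  fix \<Theta> assume \<Theta>: "\<Theta> \<in> PCh A"
  obtain \<psi> where \<psi>: "\<psi> \<in> characters ch.H1 A" and val: "\<forall>c \<in> ch.Z1. \<psi> (ch.B1 #>\<^bsub>ch.C1\<^esub> c) = \<psi>\<^sub>0 \<Theta> c"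
    using PC_character[OF A \<Theta>] by blast
  have "\<Theta> = pcm A \<psi>"
  proof (rule PC_eqI[OF A \<Theta> pcm_mem[OF A \<psi>]])
    fix n :: nat and f w assume n: "1 \<le> n" and f: "f \<in> carrier (IF n)" and w: "w \<in> tuples n \<Gamma>"
    show "\<Theta> n f w = pcm A \<psi> n f w"
      unfolding pcm_apply[OF n f w] Th_def
    proof (rule PC_lin_ext[OF A \<Theta> n w f hx_closed[OF A \<psi>]])
      fix \<mu> assume \<mu>: "\<mu> \<in> cycles n w"
      show "\<theta> \<Theta> n w \<mu> = hx A \<psi> n w \<mu>"
        unfolding hx_cycles[OF w \<mu>] ch.qc_def bspec[OF val cyclesD(2)[OF \<mu>]] by (rule \<psi>\<^sub>0_cls[OF A \<Theta> n w \<mu>, symmetric])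
    qed
  qed
  then show "\<Theta> \<in> pcm A ` characters ch.H1 A"
    using \<psi> by blast
qed

theorem PC_represented: "represented_by R (PC R G T Cf \<pi> \<Gamma> \<rho>\<^sub>0) (PC_map R G T \<Gamma>) (monoid_algebra R ch.H1)"
  by (rule represented_by_group_algebra[where \<Psi> = pcm, OF ch.H1.comm_group_axioms pcm_bij pcm_natural])

end

theorem theorem1p7:
  fixes R :: "'u ring"
    and H :: "('u, 'u) module"
    and G G\<^sub>0 :: "('u, 'u \<Rightarrow> 'u) group_functor"
    and C :: "'c monoid"
    and \<pi> :: "('u, 'u) module \<Rightarrow> ('u \<Rightarrow> 'u) \<Rightarrow> 'u set \<Rightarrow> 'c"
    and M :: "'m monoid"
    and \<chi> :: "('u, 'u) module \<Rightarrow> ('u \<Rightarrow> 'u) \<Rightarrow> 'm \<Rightarrow> 'u"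
    and \<Gamma>\<^sub>1 :: "'p monoid"
    and \<Gamma>\<^sub>2 :: "'p set"
    and \<Delta> :: "'p set monoid"
    and \<rho>\<^sub>0 :: "'p \<Rightarrow> 'u \<Rightarrow> 'u"
    and act :: "'p \<Rightarrow> 'm \<Rightarrow> 'm"
    and E :: "'e monoid"
    and a\<^sub>E :: "'p set \<Rightarrow> 'e \<Rightarrow> 'e"
    and \<iota> :: "'p set \<Rightarrow> 'e"
    and p :: "'e \<Rightarrow> 'p set \<Rightarrow>\<^sub>0 int"
  assumes universe: "infinite (UNIV :: 'u set)"
    and base: "cring R" "connected_spec R"
    and smooth_affine: "affine_group_scheme R H G" "smooth_alg R H"
    and G\<^sub>0: "G\<^sub>0 = neutral_component R H G"
    and split_torus: "lattice_group M" "group_functor_iso R G\<^sub>0 (diag_group M) \<chi>"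
    and component_group: "group C" "finite (carrier C)"
      "quotient_map_by R G G\<^sub>0 (constant_group C) \<pi>"
    and rep: "group \<Gamma>\<^sub>1" "\<rho>\<^sub>0 \<in> hom \<Gamma>\<^sub>1 (pts G (base_alg R))"
    and \<Gamma>\<^sub>2: "\<Gamma>\<^sub>2 = kernel \<Gamma>\<^sub>1 (pts (constant_group C) (base_alg R)) (\<pi> (base_alg R) \<circ> \<rho>\<^sub>0)"
    and \<Delta>: "\<Delta> = \<Gamma>\<^sub>1 Mod \<Gamma>\<^sub>2"
    and act: "act = (\<lambda>\<gamma>. character_action R G G\<^sub>0 M \<chi> (\<rho>\<^sub>0 \<gamma>))"
    and extension: "corresponding_extension \<Gamma>\<^sub>1 \<Gamma>\<^sub>2 E a\<^sub>E \<iota> p"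
  shows "represented_by R
           (Rep R G (constant_group C) \<pi> \<Gamma>\<^sub>1 \<rho>\<^sub>0) (Rep_map G \<Gamma>\<^sub>1)
           (monoid_algebra R
             (coinvariants \<Delta> (tensor E M) (tensor_action E M a\<^sub>E (coset_action act)))) \<and>
         represented_by R
           (PC R G G\<^sub>0 (constant_group C) \<pi> \<Gamma>\<^sub>1 \<rho>\<^sub>0) (PC_map R G G\<^sub>0 \<Gamma>\<^sub>1)
           (monoid_algebra R (homology1 \<Gamma>\<^sub>1 M act))"
proof -
  have quotient: "group_functor_hom R G (constant_group C) \<pi>"
    and ker: "\<And>A. A \<in> Alg R \<Longrightarrow> kernel (pts G A) (pts (constant_group C) A) (\<pi> A) = carrier (pts G\<^sub>0 A)"
    using component_group(3) unfolding quotient_map_by_def by blast+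
  have G: "is_group_functor R G"
    using smooth_affine(1) unfolding affine_group_scheme_def by blast
  have sub: "monoid.mult (pts G\<^sub>0 A) = monoid.mult (pts G A)" "transport G\<^sub>0 = transport G" for A
    by (simp_all add: G\<^sub>0 neutral_component_def)
  interpret split_extension R G G\<^sub>0 C M \<pi> \<chi> \<Gamma>\<^sub>1 \<rho>\<^sub>0
    by (intro split_extension.intro universe.intro split_extension_axioms.intro base universe G sub split_torus
        component_group(1) quotient ker rep)
  have act_eq: "act = split_extension.act R G G\<^sub>0 M \<chi> \<rho>\<^sub>0"
    unfolding act by (rule ext) (simp add: act_def)
  \<comment> \<open>Over the base ring a point lies in the torus exactly if its image under
    \<open>\<pi>\<close> is trivial, so the preimage of the torus is the kernel of the
    composite.\<close>
  have "N2 = \<Gamma>\<^sub>2"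
    using ker[OF base_alg_Alg] \<rho>\<^sub>0_closed unfolding N2_def \<Gamma>\<^sub>2 kernel_def by auto
  then interpret rep_extension R G G\<^sub>0 C M \<pi> \<chi> \<Gamma>\<^sub>1 \<rho>\<^sub>0 E a\<^sub>E \<iota> p
    by unfold_locales (use extension in simp)
  show ?thesis
    using Rep_represented PC_represented \<open>N2 = \<Gamma>\<^sub>2\<close> by (simp only: \<Delta> act_eq simp_thms)
qed
end
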